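(* Let $\alpha\in(0,1)$, $b_1,b_2\in(0,\infty)$, $d>2(b_1+b_2)$, and $\gamma_1,\gamma_2\in\mathbb{R}$ with $\gamma_1+\gamma_2\ne0$. Let $F=(F_1,F_2)$ be the functional defined in the context, and set $\Omega_0=\frac{\gamma_1+\gamma_2}{2d^2}$, $Z_0=\frac{d\gamma_2}{\gamma_1+\gamma_2}$. Then there exists $\varepsilon_0>0$ such that the following hold. (1) There is a unique $C^1$ function $g=(\Omega,Z,f_1,f_2):[-\varepsilon_0,\varepsilon_0]\to\mathbb{R}\times\mathbb{R}\times B_1$ such that $$F\big(\varepsilon,\Omega(\varepsilon),Z(\varepsilon),f_1(\varepsilon),f_2(\varepsilon)\big)=0\quad\text{for all }\varepsilon\in[-\varepsilon_0,\varepsilon_0],\qquad \big(\Omega(0),Z(0),f_1(0),f_2(0)\big)=(\Omega_0,Z_0,0,0).$$ (2) For all $\varepsilon\in[-\varepsilon_0,\varepsilon_0]\setminus\{0\}$ one has $(f_1(\varepsilon),f_2(\varepsilon))\neq(0,0)$. (3) If $(\varepsilon,f_1,f_2)$ is a solution (that is, $F(\varepsilon,\Omega,Z,f_1,f_2)=0$), then $(-\varepsilon,\tilde f_1,\tilde f_2)$ is also a solution (that is, $F(-\varepsilon,\Omega,Z,\tilde f_1,\tilde f_2)=0$, with the same $\Omega,Z$), where $\tilde f_j(w)=f_j(-w)$ for all $w\in\mathbb{T}$, $j=1,2$. (4) For all $\varepsilon\in[-\varepsilon_0,\varepsilon_0]\setminus\{0\}$, the domains $D_1^\varepsilon$ and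 $D_2^\varepsilon$ are strictly convex, where $D_j^\varepsilon$ is the bounded domain enclosed by the Jordan curve $\phi_j(\mathbb{T})$, $\phi_j(w)=w+\varepsilon b_jf_j(\varepsilon)(w)$.
   Context: $\mathbb{T}$ is the unit circle and $\fint_{\mathbb{T}}h(\tau)\,d\tau=\frac{1}{2i\pi}\int_{\mathbb{T}}h(\tau)\,d\tau$ (complex line integral). $C^{\alpha}(\mathbb{T})$ and $C^{1+\alpha}(\mathbb{T})$ are the usual Hölder spaces, with $\|f\|_{C^{1+\alpha}}=\|f\|_{L^\infty}+\|f'\|_{C^\alpha}$, where $f'=\frac{df}{dw}$. Let $$X=\Big\{f=(f_1,f_2)\in (C^{1+\alpha}(\mathbb{T}))^2:\ f(w)=\sum_{n\ge1}A_n\overline w^n,\ A_n\in\mathbb{R}^2\Big\},$$ $$Y=\Big\{g\in(C^\alpha(\mathbb{T}))^2:\ g(w)=\sum_{n\ge1}C_n\,\mathrm{Im}\{w^n\},\ C_n\in\mathbb{R}^2\Big\},$$ and let $B_1$ be the open unit ball of $X$ centered at zero. The functional $F=(F_1,F_2)$ takes values in $Y$. For $\varepsilon\in(-\frac12,\frac12)$, $\Omega,Z\in\mathbb{R}$, $(f_1,f_2)\in B_1$, $w\in\mathbb{T}$ and $j\in\{1,2\}$, set $A=\tau-w$, $B_j=f_j(\tau)-f_j(w)$ and $$F_j(\varepsilon,\Omega,Z,f_1,f_2)(w)=\mathrm{Im}\Big\{2\Omega\big[\varepsilon b_j(\overline w+\varepsilon b_j\overline{f_j(w)})+(-1)^jZ-(j-1)d\big]w(1+\varepsilon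 b_jf_j'(w))-\gamma_jf_j'(w)$$ $$+\varepsilon b_j\gamma_jw(1+\varepsilon b_jf_j'(w))\fint_{\mathbb{T}}\frac{A\overline{B_j}-\overline AB_j}{A(A+\varepsilon b_jB_j)}\Big[f_j'(\tau)-\frac{B_j}{A}\Big]d\tau$$ $$-\gamma_{3-j}w(1+\varepsilon b_jf_j'(w))\fint_{\mathbb{T}}\frac{(\overline\tau+\varepsilon b_{3-j}\overline{f_{3-j}(\tau)})(1+\varepsilon b_{3-j}f_{3-j}'(\tau))}{\varepsilon(b_{3-j}\tau+b_jw)+\varepsilon^2(b_{3-j}^2f_{3-j}(\tau)+b_j^2f_j(w))-d}\,d\tau\Big\}.$$ (The equation $F=0$ expresses that the vorticity $\frac{\gamma_1}{\varepsilon^2b_1^2}\chi_{\varepsilon b_1D_1^\varepsilon}+\frac{\gamma_2}{\varepsilon^2b_2^2}\chi_{-\varepsilon b_2D_2^\varepsilon+d}$ rotates rigidly for the 2D Euler equations with angular velocity $\Omega$ about the point $Z$ of the real axis.)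
   Formalization: The circulations are additionally assumed nonzero, γ₁≠0 and γ₂≠0; if one of them vanishes, no C¹ branch as in (1) exists, so the statement with only γ₁+γ₂≠0 is false. *)

theory Defs
  imports "HOL-Complex_Analysis.Complex_Analysis"
begin

text \<open>Functions on the unit circle are functions on the complex plane of which only the values on
  \<^term>\<open>sphere 0 1 :: complex set\<close> are used. A pair is a family indexed by natural numbers of which
  only the indices 1 and 2 are used.\<close>

abbreviation circ :: "complex set" where
  "circ \<equiv> sphere 0 1"

text \<open>The derivative df/dw along the circle; \<^const>\<open>deriv\<close> would need a neighbourhood in the plane.\<close>

definition circ_deriv :: "(complex \<Rightarrow> complex) \<Rightarrow> complex \<Rightarrow> complex" where
  "circ_deriv f w = (THE D. (f has_field_derivative D) (at w within circ))"

definition fint :: "(complex \<Rightarrow> complex) \<Rightarrow> complex" where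
  "fint h = 1 / (2 * \<i> * of_real pi) * contour_integral (circlepath 0 1) h"

definition holder :: "real \<Rightarrow> (complex \<Rightarrow> complex) set" where
  "holder \<alpha> = {h. \<exists>K. \<forall>w\<in>circ. \<forall>\<tau>\<in>circ. norm (h w - h \<tau>) \<le> K * norm (w - \<tau>) powr \<alpha>}"

text \<open>The suprema in the norms below are meaningful because they are only taken of functions in the
  corresponding spaces, where the sets involved are bounded.\<close>

definition sup_norm :: "(complex \<Rightarrow> complex) \<Rightarrow> real" where
  "sup_norm h = (SUP w\<in>circ. norm (h w))"

definition holder_seminorm :: "real \<Rightarrow> (complex \<Rightarrow> complex) \<Rightarrow> real" where
  "holder_seminorm \<alpha> h =
     (SUP (w, \<tau>)\<in>{(w, \<tau>). w \<in> circ \<and> \<tau> \<in> circ \<and> w \<noteq> \<tau>}. norm (h w - h \<tau>) / norm (w - \<tau>) powr \<alpha>)"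

definition holder_norm :: "real \<Rightarrow> (complex \<Rightarrow> complex) \<Rightarrow> real" where
  "holder_norm \<alpha> h = sup_norm h + holder_seminorm \<alpha> h"

definition holder1 :: "real \<Rightarrow> (complex \<Rightarrow> complex) set" where
  "holder1 \<alpha> = {f. (\<forall>w\<in>circ. \<exists>D. (f has_field_derivative D) (at w within circ)) \<and>
                    circ_deriv f \<in> holder \<alpha>}"

definition holder1_norm :: "real \<Rightarrow> (complex \<Rightarrow> complex) \<Rightarrow> real" where
  "holder1_norm \<alpha> f = sup_norm f + holder_norm \<alpha> (circ_deriv f)"

definition space_X :: "real \<Rightarrow> (nat \<Rightarrow> complex \<Rightarrow> complex) set" where
  "space_X \<alpha> = {f. \<forall>j\<in>{1, 2}. f j \<in> holder1 \<alpha> \<and>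
     (\<exists>A :: nat \<Rightarrow> real. \<forall>w\<in>circ. (\<lambda>n. of_real (A (Suc n)) * cnj w ^ Suc n) sums f j w)}"

definition norm_X :: "real \<Rightarrow> (nat \<Rightarrow> complex \<Rightarrow> complex) \<Rightarrow> real" where
  "norm_X \<alpha> f = max (holder1_norm \<alpha> (f 1)) (holder1_norm \<alpha> (f 2))"

definition ball_X :: "real \<Rightarrow> (nat \<Rightarrow> complex \<Rightarrow> complex) set" where
  "ball_X \<alpha> = {f \<in> space_X \<alpha>. norm_X \<alpha> f < 1}"

definition F :: "(nat \<Rightarrow> real) \<Rightarrow> real \<Rightarrow> (nat \<Rightarrow> real) \<Rightarrow> real \<Rightarrow> real \<Rightarrow> real \<Rightarrow>
    (nat \<Rightarrow> complex \<Rightarrow> complex) \<Rightarrow> nat \<Rightarrow> complex \<Rightarrow> real" where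
  "F b d \<gamma> \<epsilon> \<Omega> Z f j w =
    (let f' = (\<lambda>i. circ_deriv (f i));
         k = 3 - j;
         A = (\<lambda>\<tau>. \<tau> - w);
         B = (\<lambda>\<tau>. f j \<tau> - f j w)
     in Im (
       2 * complex_of_real \<Omega> * (\<epsilon> * b j * (cnj w + \<epsilon> * b j * cnj (f j w)) + (- 1) ^ j * complex_of_real Z
           - (of_nat j - 1) * complex_of_real d) * w * (1 + \<epsilon> * b j * f' j w)
       - \<gamma> j * f' j w
       + \<epsilon> * b j * \<gamma> j * w * (1 + \<epsilon> * b j * f' j w) *
           fint (\<lambda>\<tau>. (A \<tau> * cnj (B \<tau>) - cnj (A \<tau>) * B \<tau>) / (A \<tau> * (A \<tau> + \<epsilon> * b j * B \<tau>)) *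
                      (f' j \<tau> - B \<tau> / A \<tau>))
       - \<gamma> k * w * (1 + \<epsilon> * b j * f' j w) *
           fint (\<lambda>\<tau>. (cnj \<tau> + \<epsilon> * b k * cnj (f k \<tau>)) * (1 + \<epsilon> * b k * f' k \<tau>) /
                      (\<epsilon> * (b k * \<tau> + b j * w) + \<epsilon>\<^sup>2 * ((b k)\<^sup>2 * f k \<tau> + (b j)\<^sup>2 * f j w) - d))))"

definition F_zero :: "(nat \<Rightarrow> real) \<Rightarrow> real \<Rightarrow> (nat \<Rightarrow> real) \<Rightarrow> real \<Rightarrow> real \<Rightarrow> real \<Rightarrow>
    (nat \<Rightarrow> complex \<Rightarrow> complex) \<Rightarrow> bool" where
  "F_zero b d \<gamma> \<epsilon> \<Omega> Z f \<longleftrightarrow> (\<forall>j\<in>{1, 2}. \<forall>w\<in>circ. F b d \<gamma> \<epsilon> \<Omega> Z f j w = 0)"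

definition C1_real :: "real set \<Rightarrow> (real \<Rightarrow> real) \<Rightarrow> bool" where
  "C1_real I u \<longleftrightarrow>
     (\<exists>u'. (\<forall>t\<in>I. (u has_real_derivative u' t) (at t within I)) \<and> continuous_on I u')"

text \<open>Continuously differentiable curves in the Banach space X: the difference quotients converge to
  \<open>v'\<close>, and \<open>v'\<close> is continuous, with respect to the norm of X.\<close>

definition C1_X :: "real \<Rightarrow> real set \<Rightarrow> (real \<Rightarrow> nat \<Rightarrow> complex \<Rightarrow> complex) \<Rightarrow> bool" where
  "C1_X \<alpha> I v \<longleftrightarrow> (\<exists>v'. \<forall>t\<in>I. v t \<in> space_X \<alpha> \<and> v' t \<in> space_X \<alpha> \<and>
     ((\<lambda>s. norm_X \<alpha> (\<lambda>j w. (v s j w - v t j w) / of_real (s - t) - v' t j w)) \<longlongrightarrow> 0)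
       (at t within I) \<and>
     ((\<lambda>s. norm_X \<alpha> (\<lambda>j w. v' s j w - v' t j w)) \<longlongrightarrow> 0) (at t within I))"

definition solution_branch :: "real \<Rightarrow> (nat \<Rightarrow> real) \<Rightarrow> real \<Rightarrow> (nat \<Rightarrow> real) \<Rightarrow> real \<Rightarrow>
    (real \<Rightarrow> real) \<Rightarrow> (real \<Rightarrow> real) \<Rightarrow> (real \<Rightarrow> nat \<Rightarrow> complex \<Rightarrow> complex) \<Rightarrow> bool" where
  "solution_branch \<alpha> b d \<gamma> \<epsilon>\<^sub>0 \<Omega> Z f \<longleftrightarrow>
     C1_real {-\<epsilon>\<^sub>0..\<epsilon>\<^sub>0} \<Omega> \<and> C1_real {-\<epsilon>\<^sub>0..\<epsilon>\<^sub>0} Z \<and> C1_X \<alpha> {-\<epsilon>\<^sub>0..\<epsilon>\<^sub>0} f \<and>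
     (\<forall>\<epsilon>\<in>{-\<epsilon>\<^sub>0..\<epsilon>\<^sub>0}. f \<epsilon> \<in> ball_X \<alpha> \<and> F_zero b d \<gamma> \<epsilon> (\<Omega> \<epsilon>) (Z \<epsilon>) (f \<epsilon>)) \<and>
     \<Omega> 0 = (\<gamma> 1 + \<gamma> 2) / (2 * d\<^sup>2) \<and> Z 0 = d * \<gamma> 2 / (\<gamma> 1 + \<gamma> 2) \<and>
     (\<forall>j\<in>{1, 2}. \<forall>w\<in>circ. f 0 j w = 0)"

definition boundary_param :: "(nat \<Rightarrow> real) \<Rightarrow> real \<Rightarrow> (nat \<Rightarrow> complex \<Rightarrow> complex) \<Rightarrow> nat \<Rightarrow>
    complex \<Rightarrow> complex" where
  "boundary_param b \<epsilon> f j w = w + \<epsilon> * b j * f j w"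

text \<open>The closure matters: every open convex set satisfies the condition for x, y in D itself.\<close>

definition strictly_convex_domain :: "complex set \<Rightarrow> bool" where
  "strictly_convex_domain D \<longleftrightarrow> open D \<and> connected D \<and> D \<noteq> {} \<and>
     (\<forall>x\<in>closure D. \<forall>y\<in>closure D. x \<noteq> y \<longrightarrow> open_segment x y \<subseteq> D)"

end

theory Submission imports Defs begin

text \<open>Write \<open>P = 2 \<Omega> Z\<close>, \<open>Q = 2 \<Omega>\<close> and \<open>k = 3 - j\<close>. In these variables
  \<open>F\<^sub>j = ((-1)^j P - (j - 1) d Q + \<gamma>\<^sub>k / d) Im w - \<gamma>\<^sub>j Im f\<^sub>j' + \<epsilon> R\<^sub>j\<close>.
  Since \<open>f\<^sub>j\<close> has only the modes \<open>cnj w ^ n\<close> with \<open>n \<ge> 1\<close>, the function \<open>Im f\<^sub>j'\<close> has only the modes \<open>Im (w ^ n)\<close>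
  with \<open>n \<ge> 2\<close>. So the linear part is invertible: the mode \<open>Im w\<close> of the two equations determines \<open>(P, Q)\<close>,
  the higher modes determine \<open>f\<close>. At \<open>\<epsilon> = 0\<close> this gives \<open>P = \<gamma>\<^sub>2 / d\<close>, \<open>Q = (\<gamma>\<^sub>1 + \<gamma>\<^sub>2) / d\<^sup>2\<close> and \<open>f = 0\<close>, and
  \<open>Z = P / Q\<close> exists near \<open>\<epsilon> = 0\<close> because \<open>Q \<noteq> 0\<close> there. The implicit function theorem would conclude from here;
  existence and uniqueness are proved separately instead, by two more elementary arguments.

  Existence. The difference quotients of \<open>f\<^sub>j\<close> and of its conjugate are again Laurent series in \<open>\<tau>\<close> and \<open>w\<close>. With the
  auxiliary unknowns \<open>1 / (1 + \<epsilon> b\<^sub>j q\<^sub>j)\<close> (where \<open>q\<^sub>j\<close> is the difference quotient) and the reciprocal of the denominator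
  of the interaction integral, the whole system becomes polynomial: an equation \<open>x = x\<^sub>0 + r H(x)\<close> in a weighted
  l1 algebra of Laurent series in \<open>(e, \<tau>, w)\<close>, where \<open>\<epsilon> = r e\<close>. For small \<open>r\<close> it is solved by contraction
  (\<open>existence_in_algebra\<close>), and evaluation of the series at \<open>(e, \<tau>, w)\<close> turns the solution into zeros of \<open>F\<close>
  (\<open>F_zero_of_fixed_point\<close>). As \<open>e\<close> is one of the variables of the series, the zeros depend analytically on \<open>\<epsilon>\<close>, which
  gives the smooth branch. The weight gives each \<open>f\<^sub>j\<close> a Lipschitz derivative, so the boundary
  curves are small perturbations of the circle to second order and hence strictly convex (\<open>near_circle_convex\<close>).

  Uniqueness (\<open>unique_zero\<close>). Two zeros in the unit ball with the same small \<open>\<epsilon>\<close> have differences \<open>h\<^sub>j\<close> of the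
  functions and \<open>a\<^sub>j\<close> of the coefficients of \<open>Im w\<close> with
  \<open>|a\<^sub>j Im w - \<gamma>\<^sub>j Im h\<^sub>j'| \<le> |\<epsilon>| C (\<delta> + N + |h\<^sub>j'|)\<close>; here \<open>\<delta>\<close> measures the difference of \<open>(P, Q)\<close> and \<open>N\<close> is the L2
  norm of \<open>(h\<^sub>1', h\<^sub>2')\<close>. The L2 norm of the left side is computed exactly, because \<open>h\<^sub>j'\<close> is one-sided: all mixed terms
  integrate to zero (\<open>energy_identity\<close>). For small \<open>\<epsilon>\<close> this forces \<open>\<delta> = N = 0\<close>. The one point that needs
  care is that the series of a function in X is only assumed to converge pointwise; that it is nevertheless
  the Fourier series is Riemann's theory of trigonometric series: summation by the squares of \<open>sin x / x\<close>, and
  Schwarz's lemma on vanishing second symmetric derivatives.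

  Nontriviality (\<open>trivial_not_zero\<close>). For \<open>f = 0\<close> all integrals are explicit, and \<open>F\<^sub>1 = 0\<close> at the two points \<open>\<i>\<close> and
  \<open>(3 + 4 \<i>) / 5\<close> is contradictory for \<open>\<epsilon> \<noteq> 0\<close>.

  Symmetry (\<open>F_zero_reflect\<close>). The substitution of \<open>- \<tau>\<close> for \<open>\<tau>\<close> in the integrals shows that reflection of \<open>f\<close> and of
  \<open>\<epsilon>\<close> maps \<open>F\<^sub>j(w)\<close> to \<open>- F\<^sub>j(- w)\<close>.\<close>

section \<open>Weighted convolution algebras of summable families\<close>

text \<open>A submultiplicative weight on a commutative monoid of exponents; it makes the summable families of
  coefficients with this weight a Banach algebra under convolution.\<close>
class weighted = comm_monoid_add +
  fixes wt :: "'a \<Rightarrow> real"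
  assumes wt_zero [simp]: "wt 0 = 1"
    and wt_pos [simp]: "wt k > 0"
    and wt_add: "wt (i + j) \<le> wt i * wt j"

lemma wt_nonneg [simp]: "wt k \<ge> 0"
  by (simp add: less_imp_le)

text \<open>Over the reals unconditional summability is absolute summability, so this is weighted l1.\<close>
typedef (overloaded) 'a l1 = "{f :: 'a::weighted \<Rightarrow> real. (\<lambda>k. f k * wt k) summable_on UNIV}"
  morphisms coef Abs_l1
  by (rule exI[of _ "\<lambda>_. 0"]) simp

setup_lifting type_definition_l1

lemma coef_summable: "(\<lambda>k. coef x k * wt k) summable_on UNIV"
  using coef[of x] by simp

lemma coef_abs_summable: "(\<lambda>k. \<bar>coef x k\<bar> * wt k) summable_on UNIV"
proof -
  have "(\<lambda>k. norm (coef x k * wt k)) summable_on UNIV"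
    by (rule summable_on_iff_abs_summable_on_real[THEN iffD1, OF coef_summable])
  then show ?thesis by (simp add: abs_mult)
qed

lemma coef_Abs: 
  assumes "(\<lambda>k. \<bar>f k\<bar> * wt k) summable_on UNIV"
  shows "coef (Abs_l1 f) = f"
proof -
  have "(\<lambda>k. norm (f k * wt k)) summable_on UNIV"
    using assms by (simp add: abs_mult)
  then have "(\<lambda>k. f k * wt k) summable_on UNIV"
    by (rule summable_on_iff_abs_summable_on_real[THEN iffD2])
  then show ?thesis by (simp add: Abs_l1_inverse)
qed

instantiation l1 :: (weighted) real_vector
begin

lift_definition zero_l1 :: "'a l1" is "\<lambda>_. 0" by simp
lift_definition plus_l1 :: "'a l1 \<Rightarrow> 'a l1 \<Rightarrow> 'a l1" is "\<lambda>f g k. f k + g k"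
  by (simp add: distrib_right summable_on_add)
lift_definition minus_l1 :: "'a l1 \<Rightarrow> 'a l1 \<Rightarrow> 'a l1" is "\<lambda>f g k. f k - g k"
proof -
  fix f g :: "'a \<Rightarrow> real"
  assume f: "(\<lambda>k. f k * wt k) summable_on UNIV" and "(\<lambda>k. g k * wt k) summable_on UNIV"
  then have g: "(\<lambda>k. - (g k * wt k)) summable_on UNIV" by (simp add: summable_on_uminus)
  show "(\<lambda>k. (f k - g k) * wt k) summable_on UNIV"
    using summable_on_add[OF f g] by (simp add: left_diff_distrib)
qed
lift_definition uminus_l1 :: "'a l1 \<Rightarrow> 'a l1" is "\<lambda>f k. - f k"
  by (simp add: summable_on_uminus)
lift_definition scaleR_l1 :: "real \<Rightarrow> 'a l1 \<Rightarrow> 'a l1" is "\<lambda>c f k. c * f k"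
  by (simp add: mult.assoc summable_on_cmult_right)

lemma l1_eq_iff: "x = y \<longleftrightarrow> (\<forall>k. coef x k = coef y k)" for x y :: "'a l1"
  using coef_inject by blast

instance
proof
  fix x y z :: "'a l1" and a b :: real
  note ops = zero_l1.rep_eq plus_l1.rep_eq minus_l1.rep_eq uminus_l1.rep_eq scaleR_l1.rep_eq
  show "x + y + z = x + (y + z)" "x + y = y + x" "0 + x = x" "- x + x = 0" "x - y = x + - y"
    by (simp_all add: l1_eq_iff ops algebra_simps)
  show "a *\<^sub>R (x + y) = a *\<^sub>R x + a *\<^sub>R y" "(a + b) *\<^sub>R x = a *\<^sub>R x + b *\<^sub>R x"
    "a *\<^sub>R b *\<^sub>R x = (a * b) *\<^sub>R x" "1 *\<^sub>R x = x"
    by (simp_all add: l1_eq_iff ops algebra_simps)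
qed

end

instantiation l1 :: (weighted) real_normed_vector
begin

definition norm_l1 :: "'a l1 \<Rightarrow> real" where "norm_l1 x = (\<Sum>\<^sub>\<infinity>k. \<bar>coef x k\<bar> * wt k)"
definition dist_l1 :: "'a l1 \<Rightarrow> 'a l1 \<Rightarrow> real" where "dist_l1 x y = norm (x - y)"
definition sgn_l1 :: "'a l1 \<Rightarrow> 'a l1" where "sgn_l1 x = x /\<^sub>R norm x"
definition uniformity_l1 :: "('a l1 \<times> 'a l1) filter" where
  "uniformity_l1 = (INF e\<in>{0 <..}. principal {(x, y). dist x y < e})"
definition open_l1 :: "'a l1 set \<Rightarrow> bool" where
  "open_l1 U = (\<forall>x\<in>U. \<forall>\<^sub>F (x', y) in uniformity. x' = x \<longrightarrow> y \<in> U)"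

instance
proof
  fix x y z :: "'a l1" and a b :: real
  show "dist x y = norm (x - y)" by (simp add: dist_l1_def)
  show "sgn x = x /\<^sub>R norm x" by (simp add: sgn_l1_def)
  show "(uniformity :: ('a l1 \<times> 'a l1) filter) = (INF e\<in>{0 <..}. principal {(x, y). dist x y < e})"
    by (simp add: uniformity_l1_def)
  show "open U = (\<forall>x\<in>U. \<forall>\<^sub>F (x', y) in uniformity. x' = x \<longrightarrow> y \<in> U)" for U :: "'a l1 set"
    by (simp add: open_l1_def)
  show "(norm x = 0) = (x = 0)"
  proof
    assume "norm x = 0"
    then have *: "(\<Sum>\<^sub>\<infinity>k. \<bar>coef x k\<bar> * wt k) = 0" by (simp add: norm_l1_def)
    have "\<bar>coef x k\<bar> * wt k = 0" for k
      by (rule nonneg_infsum_le_0D[where A = UNIV]) (use * coef_abs_summable[of x] in auto)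
    then have "coef x k = 0" for k
      using wt_pos[of k] by (metis abs_eq_0 less_irrefl mult_eq_0_iff)
    then show "x = 0" by (simp add: l1_eq_iff zero_l1.rep_eq)
  next
    assume "x = 0" then show "norm x = 0" by (simp add: norm_l1_def zero_l1.rep_eq)
  qed
  show "norm (x + y) \<le> norm x + norm y"
  proof -
    have "norm (x + y) \<le> (\<Sum>\<^sub>\<infinity>k. \<bar>coef x k\<bar> * wt k + \<bar>coef y k\<bar> * wt k)"
      unfolding norm_l1_def plus_l1.rep_eq
    proof (rule infsum_mono)
      show "(\<lambda>k. \<bar>coef x k + coef y k\<bar> * wt k) summable_on UNIV"
        using coef_abs_summable[of "x + y"] by (simp add: plus_l1.rep_eq)
      show "(\<lambda>k. \<bar>coef x k\<bar> * wt k + \<bar>coef y k\<bar> * wt k) summable_on UNIV"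
        by (intro summable_on_add coef_abs_summable)
      show "\<bar>coef x k + coef y k\<bar> * wt k \<le> \<bar>coef x k\<bar> * wt k + \<bar>coef y k\<bar> * wt k" for k
        by (metis abs_triangle_ineq distrib_right mult_right_mono wt_nonneg)
    qed
    also have "\<dots> = norm x + norm y"
      unfolding norm_l1_def by (intro infsum_add coef_abs_summable)
    finally show ?thesis .
  qed
  show "norm (a *\<^sub>R x) = \<bar>a\<bar> * norm x"
    unfolding norm_l1_def scaleR_l1.rep_eq
    by (simp add: abs_mult mult.assoc infsum_cmult_right coef_abs_summable)
qed

end

lemma coef_bound: "\<bar>coef x k\<bar> * wt k \<le> norm x"
proof -
  have "(\<Sum>\<^sub>\<infinity>i\<in>{k}. \<bar>coef x i\<bar> * wt i) \<le> (\<Sum>\<^sub>\<infinity>i. \<bar>coef x i\<bar> * wt i)"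
    by (rule infsum_mono2) (auto simp: coef_abs_summable)
  then show ?thesis by (simp add: norm_l1_def)
qed

text \<open>For the completeness proof: only the finite partial sums of the pointwise limit of a Cauchy sequence are
  controlled directly.\<close>
lemma norm_l1_le:
  assumes "\<And>F. finite F \<Longrightarrow> (\<Sum>k\<in>F. \<bar>f k\<bar> * wt k) \<le> B"
  shows "coef (Abs_l1 f) = f" "norm (Abs_l1 f) \<le> B"
proof -
  have s: "(\<lambda>k. \<bar>f k\<bar> * wt k) summable_on UNIV"
    by (rule nonneg_bounded_partial_sums_imp_summable_on[of _ _ B])
       (use assms in \<open>auto intro: eventually_finite_subsets_at_top_weakI\<close>)
  then show c: "coef (Abs_l1 f) = f" by (rule coef_Abs)
  show "norm (Abs_l1 f) \<le> B"
    unfolding norm_l1_def c by (rule infsum_le_finite_sums[OF s]) (use assms in auto)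
qed

instance l1 :: (weighted) banach
proof
  fix X :: "nat \<Rightarrow> 'a l1"
  assume C: "Cauchy X"
  have Ck: "Cauchy (\<lambda>n. coef (X n) k)" for k
  proof (rule metric_CauchyI)
    fix e :: real assume "e > 0"
    then have "e * wt k > 0" by simp
    from metric_CauchyD[OF C this] obtain M where M: "\<And>m n. m \<ge> M \<Longrightarrow> n \<ge> M \<Longrightarrow> dist (X m) (X n) < e * wt k"
      by blast
    have "dist (coef (X m) k) (coef (X n) k) < e" if "m \<ge> M" "n \<ge> M" for m n
    proof -
      have "\<bar>coef (X m - X n) k\<bar> * wt k < e * wt k"
        using coef_bound[of "X m - X n" k] M[OF that] unfolding dist_norm by (rule le_less_trans)
      then have "\<bar>coef (X m - X n) k\<bar> < e" by (rule mult_right_less_imp_less) simp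
      then show ?thesis by (simp add: dist_norm minus_l1.rep_eq)
    qed
    then show "\<exists>M. \<forall>m\<ge>M. \<forall>n\<ge>M. dist (coef (X m) k) (coef (X n) k) < e" by blast
  qed
  then have "\<exists>l. (\<lambda>n. coef (X n) k) \<longlonglongrightarrow> l" for k
    using Cauchy_convergent convergent_def by blast
  then obtain c where c: "\<And>k. (\<lambda>n. coef (X n) k) \<longlonglongrightarrow> c k" by metis
  have tail: "(\<Sum>k\<in>F. \<bar>c k - coef (X n) k\<bar> * wt k) \<le> e"
    if F: "finite F" and n: "n \<ge> M" and M: "\<And>m n. m \<ge> M \<Longrightarrow> n \<ge> M \<Longrightarrow> dist (X m) (X n) < e" for F n M e
  proof (rule tendsto_upperbound)
    show "((\<lambda>m. \<Sum>k\<in>F. \<bar>coef (X m) k - coef (X n) k\<bar> * wt k) \<longlongrightarrow> (\<Sum>k\<in>F. \<bar>c k - coef (X n) k\<bar> * wt k)) sequentially"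
      by (intro tendsto_intros c)
    have "(\<Sum>k\<in>F. \<bar>coef (X m) k - coef (X n) k\<bar> * wt k) \<le> e" if "m \<ge> M" for m
    proof -
      have "(\<Sum>k\<in>F. \<bar>coef (X m - X n) k\<bar> * wt k) \<le> norm (X m - X n)"
        unfolding norm_l1_def
        by (rule finite_sum_le_infsum) (use F coef_abs_summable in auto)
      also have "\<dots> < e" using M[OF that n] by (simp add: dist_norm)
      finally show ?thesis by (simp add: minus_l1.rep_eq)
    qed
    then show "\<forall>\<^sub>F m in sequentially. (\<Sum>k\<in>F. \<bar>coef (X m) k - coef (X n) k\<bar> * wt k) \<le> e"
      using eventually_sequentially by blast
  qed simp
  obtain M1 where M1: "\<And>m n. m \<ge> M1 \<Longrightarrow> n \<ge> M1 \<Longrightarrow> dist (X m) (X n) < 1"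
    using metric_CauchyD[OF C, of 1] by auto
  define L where "L = X M1 + Abs_l1 (\<lambda>k. c k - coef (X M1) k)"
  have L: "coef L = c"
    using norm_l1_le(1)[of "\<lambda>k. c k - coef (X M1) k" 1] tail[OF _ order_refl M1]
    by (auto simp: L_def plus_l1.rep_eq)
  have "X \<longlonglongrightarrow> L"
  proof (rule metric_LIMSEQ_I)
    fix e :: real assume "e > 0"
    from metric_CauchyD[OF C, of "e/2"] obtain M where M: "\<And>m n. m \<ge> M \<Longrightarrow> n \<ge> M \<Longrightarrow> dist (X m) (X n) < e/2"
      using \<open>e > 0\<close> by auto
    have "dist (X n) L < e" if "n \<ge> M" for n
    proof -
      have "L - X n = Abs_l1 (\<lambda>k. c k - coef (X n) k)"
        using norm_l1_le(1)[of "\<lambda>k. c k - coef (X n) k" "e/2"] tail[OF _ that M]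
        by (auto simp: coef_inject[symmetric] minus_l1.rep_eq L)
      moreover have "norm (Abs_l1 (\<lambda>k. c k - coef (X n) k)) \<le> e/2"
        using tail[OF _ that M] by (intro norm_l1_le(2)) auto
      ultimately show ?thesis using \<open>e > 0\<close> by (simp add: dist_norm norm_minus_commute)
    qed
    then show "\<exists>no. \<forall>n\<ge>no. dist (X n) L < e" by blast
  qed
  then show "convergent X" by (auto simp: convergent_def)
qed

definition mono1 :: "'a::weighted \<Rightarrow> 'a l1" where
  "mono1 k = Abs_l1 (\<lambda>i. if i = k then 1 else 0)"

lemma coef_mono1: "coef (mono1 k) = (\<lambda>i. if i = k then 1 else 0)"
proof -
  have "(\<lambda>i. \<bar>if i = k then 1 else (0::real)\<bar> * wt i) summable_on UNIV"
    by (rule finite_nonzero_values_imp_summable_on) (rule finite_subset[of _ "{k}"], auto)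
  then show ?thesis unfolding mono1_def by (rule coef_Abs)
qed

lemma norm_mono1: "norm (mono1 k) = wt k"
proof -
  have "norm (mono1 k) = infsum (\<lambda>i. \<bar>coef (mono1 k) i\<bar> * wt i) {k}"
    unfolding norm_l1_def by (rule infsum_cong_neutral) (auto simp: coef_mono1)
  then show ?thesis by (simp add: coef_mono1)
qed

text \<open>The families that extend from the unit vectors to bounded linear maps.\<close>
definition wbdd :: "('a::weighted \<Rightarrow> 'b::real_normed_vector) \<Rightarrow> bool" where
  "wbdd g \<longleftrightarrow> (\<exists>C. \<forall>k. norm (g k) \<le> C * wt k)"

lemma wbddI: "(\<And>k. norm (g k) \<le> C * wt k) \<Longrightarrow> wbdd g"
  by (auto simp: wbdd_def)

text \<open>The universal property of weighted l1: the continuous linear extension of a map given on the unit vectors.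
  The product and all operators on series are defined by it.\<close>
definition lift :: "('a::weighted \<Rightarrow> 'b::banach) \<Rightarrow> 'a l1 \<Rightarrow> 'b" where
  "lift g x = (\<Sum>\<^sub>\<infinity>k. coef x k *\<^sub>R g k)"

lemma lift_aux:
  fixes g :: "'a::weighted \<Rightarrow> 'b::banach"
  assumes g: "\<And>k. norm (g k) \<le> C * wt k"
  shows "((\<lambda>k. coef x k *\<^sub>R g k) has_sum lift g x) UNIV" "norm (lift g x) \<le> C * norm x"
proof -
  have b: "norm (coef x k *\<^sub>R g k) \<le> C * (\<bar>coef x k\<bar> * wt k)" for k
    using mult_left_mono[OF g[of k], of "\<bar>coef x k\<bar>"] by (simp add: mult_ac)
  have s: "(\<lambda>k. C * (\<bar>coef x k\<bar> * wt k)) summable_on UNIV"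
    by (intro summable_on_cmult_right coef_abs_summable)
  have a: "(\<lambda>k. coef x k *\<^sub>R g k) abs_summable_on UNIV"
    by (rule summable_on_comparison_test[OF s]) (use b in auto)
  then have "(\<lambda>k. coef x k *\<^sub>R g k) summable_on UNIV" by (rule abs_summable_summable)
  then show "((\<lambda>k. coef x k *\<^sub>R g k) has_sum lift g x) UNIV"
    unfolding lift_def by (rule has_sum_infsum)
  have "norm (lift g x) \<le> (\<Sum>\<^sub>\<infinity>k. norm (coef x k *\<^sub>R g k))"
    unfolding lift_def by (rule norm_infsum_bound[OF a])
  also have "\<dots> \<le> (\<Sum>\<^sub>\<infinity>k. C * (\<bar>coef x k\<bar> * wt k))"
    by (rule infsum_mono[OF a s]) (use b in auto)
  also have "\<dots> = C * norm x"
    unfolding norm_l1_def by (intro infsum_cmult_right) (simp add: coef_abs_summable)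
  finally show "norm (lift g x) \<le> C * norm x" .
qed

lemma lift_bound: "(\<And>k. norm (g k) \<le> C * wt k) \<Longrightarrow> norm (lift g x) \<le> C * norm x"
  by (rule lift_aux(2))

lemma lift_has_sum:
  "wbdd g \<Longrightarrow> ((\<lambda>k. coef x k *\<^sub>R g k) has_sum lift g x) UNIV"
  unfolding wbdd_def using lift_aux(1) by blast

lemma bounded_linear_lift:
  fixes g :: "'a::weighted \<Rightarrow> 'b::banach"
  assumes "wbdd g" shows "bounded_linear (lift g)"
proof -
  from assms obtain C where C: "\<And>k. norm (g k) \<le> C * wt k" unfolding wbdd_def by blast
  show ?thesis
  proof (rule bounded_linear_intro[of _ C])
    fix x y :: "'a l1" and r :: real
    have "((\<lambda>k. coef x k *\<^sub>R g k + coef y k *\<^sub>R g k) has_sum lift g x + lift g y) UNIV"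
      by (intro has_sum_add lift_has_sum assms)
    then have "((\<lambda>k. coef (x + y) k *\<^sub>R g k) has_sum lift g x + lift g y) UNIV"
      by (simp add: plus_l1.rep_eq scaleR_left_distrib)
    then show "lift g (x + y) = lift g x + lift g y"
      using lift_has_sum[OF assms] has_sum_unique by blast
    have "((\<lambda>k. r *\<^sub>R (coef x k *\<^sub>R g k)) has_sum r *\<^sub>R lift g x) UNIV"
      by (intro has_sum_scaleR lift_has_sum assms)
    then have "((\<lambda>k. coef (r *\<^sub>R x) k *\<^sub>R g k) has_sum r *\<^sub>R lift g x) UNIV"
      by (simp add: scaleR_l1.rep_eq)
    then show "lift g (r *\<^sub>R x) = r *\<^sub>R lift g x"
      using lift_has_sum[OF assms] has_sum_unique by blast
    show "norm (lift g x) \<le> norm x * C"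
      using lift_aux(2)[OF C] by (simp add: mult.commute)
  qed
qed

lemma lift_mono1 [simp]: "lift g (mono1 k) = g k"
proof -
  have "lift g (mono1 k) = (\<Sum>\<^sub>\<infinity>i\<in>{k}. coef (mono1 k) i *\<^sub>R g i)"
    unfolding lift_def by (rule infsum_cong_neutral) (auto simp: coef_mono1)
  then show ?thesis by (simp add: coef_mono1)
qed

lemma wbdd_mono1: "wbdd mono1"
  by (rule wbddI[of _ 1]) (simp add: norm_mono1)

lemma lift_self: "lift mono1 x = x"
proof -
  have "coef (lift mono1 x) k = coef x k" for k
  proof -
    have bl: "bounded_linear (\<lambda>x. coef x k)"
    proof (rule bounded_linear_intro[of _ "1 / wt k"])
      show "norm (coef x k) \<le> norm x * (1 / wt k)" for x
        using coef_bound[of x k] by (simp add: field_simps)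
    qed (auto simp: plus_l1.rep_eq scaleR_l1.rep_eq)
    have "((\<lambda>i. coef x i *\<^sub>R mono1 i) has_sum lift mono1 x) UNIV"
      by (rule lift_has_sum[OF wbdd_mono1])
    then have "(((\<lambda>x. coef x k) \<circ> (\<lambda>i. coef x i *\<^sub>R mono1 i)) has_sum coef (lift mono1 x) k) UNIV"
      using has_sum_bounded_linear[OF bl] by (simp add: o_def)
    moreover have "(((\<lambda>x. coef x k) \<circ> (\<lambda>i. coef x i *\<^sub>R mono1 i)) has_sum coef x k) UNIV"
    proof -
      have "((\<lambda>i. coef x i) has_sum coef x k) {k}" by (rule has_sum_finiteI) auto
      then show ?thesis
        by (rule has_sum_cong_neutral[THEN iffD1, rotated -1]) (auto simp: scaleR_l1.rep_eq coef_mono1)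
    qed
    ultimately show ?thesis using has_sum_unique by blast
  qed
  then show ?thesis using coef_inject by blast
qed

lemma mono1_has_sum: "((\<lambda>k. coef x k *\<^sub>R mono1 k) has_sum x) UNIV"
  using lift_has_sum[OF wbdd_mono1, of x] by (simp add: lift_self)

text \<open>The unit vectors span a dense subspace. This reduces each identity between bounded linear maps, such as
  associativity of the product or the formulas for integrals of series, to one computation with monomials.\<close>
lemma l1_eqI:
  fixes f g :: "'a::weighted l1 \<Rightarrow> 'b::real_normed_vector"
  assumes f: "bounded_linear f" and g: "bounded_linear g" and eq: "\<And>k. f (mono1 k) = g (mono1 k)"
  shows "f x = g x"
proof -
  have *: "((\<lambda>k. coef x k *\<^sub>R h (mono1 k)) has_sum h x) UNIV" if h: "bounded_linear h" for h :: "'a l1 \<Rightarrow> 'b"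
    using has_sum_bounded_linear[OF h mono1_has_sum[of x]]
    by (simp add: linear_simps(5)[OF h] o_def)
  show ?thesis using *[OF f] *[OF g] eq has_sum_unique by force
qed

text \<open>The norm is a weighted l1 norm, so the worst case of a bound for a bounded linear map is a unit vector.\<close>
lemma l1_bound:
  fixes f :: "'a::weighted l1 \<Rightarrow> 'b::banach"
  assumes f: "bounded_linear f" and b: "\<And>k. norm (f (mono1 k)) \<le> C * wt k"
  shows "norm (f x) \<le> C * norm x"
proof -
  have "f x = lift (\<lambda>k. f (mono1 k)) x"
    by (rule l1_eqI[OF f bounded_linear_lift[OF wbddI[OF b]]]) simp
  then show ?thesis using lift_bound[OF b] by simp
qed

instantiation l1 :: (weighted) "{comm_ring_1, real_normed_algebra_1}"
begin

definition one_l1 :: "'a l1" where "one_l1 = mono1 0"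
definition times_l1 :: "'a l1 \<Rightarrow> 'a l1 \<Rightarrow> 'a l1" where
  "times_l1 x y = lift (\<lambda>i. lift (\<lambda>j. mono1 (i + j)) y) x"

lemma times_aux1: "norm (lift (\<lambda>j. mono1 (i + j)) y) \<le> norm y * wt (i::'a)"
proof -
  have "norm (lift (\<lambda>j. mono1 (i + j)) y) \<le> wt i * norm y"
    by (rule lift_bound) (simp add: norm_mono1 wt_add)
  then show ?thesis by (simp add: mult.commute)
qed

lemma wbdd_times: "wbdd (\<lambda>j. mono1 ((i::'a) + j))"
  by (rule wbddI[of _ "wt i"]) (simp add: norm_mono1 wt_add)

lemma times_norm: "norm (x * y) \<le> norm x * norm (y :: 'a l1)"
  using lift_bound[OF times_aux1, of y x] by (simp add: times_l1_def mult.commute)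

lemma times_left: "bounded_linear (\<lambda>x. x * (y :: 'a l1))"
  unfolding times_l1_def by (intro bounded_linear_lift wbddI[OF times_aux1])

lemma times_add_right: "x * (y + z) = x * y + x * (z :: 'a l1)"
proof (rule l1_eqI[OF times_left bounded_linear_add[OF times_left times_left]])
  fix k :: 'a
  show "mono1 k * (y + z) = mono1 k * y + mono1 k * z"
    using bounded_linear_lift[OF wbdd_times[of k]] by (simp add: times_l1_def linear_simps)
qed

lemma times_scaleR_right: "x * (r *\<^sub>R y) = r *\<^sub>R (x * (y :: 'a l1))"
proof (rule l1_eqI[OF times_left bounded_linear_scaleR_right[THEN bounded_linear_compose, OF times_left]])
  fix k :: 'a
  show "mono1 k * (r *\<^sub>R y) = r *\<^sub>R (mono1 k * y)"
    using bounded_linear_lift[OF wbdd_times[of k]] by (simp add: times_l1_def linear_simps)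
qed

lemma times_right: "bounded_linear (\<lambda>y. x * (y :: 'a l1))"
proof (rule bounded_linear_intro[of _ "norm x"])
  show "norm (x * y) \<le> norm y * norm x" for y using times_norm[of x y] by (simp add: mult.commute)
qed (simp_all add: times_add_right times_scaleR_right)

lemma times_mono1: "mono1 i * mono1 (j::'a) = mono1 (i + j)"
  by (simp add: times_l1_def)

lemma times_comm: "x * y = y * (x :: 'a l1)"
proof (rule l1_eqI[OF times_left times_right])
  fix k
  show "mono1 k * y = y * mono1 k"
    by (rule l1_eqI[OF times_right times_left]) (simp add: times_mono1 add.commute)
qed

lemma times_assoc: "x * y * z = x * (y * (z :: 'a l1))"
proof (rule l1_eqI[OF bounded_linear_compose[OF times_left times_left] times_left])
  fix i
  show "mono1 i * y * z = mono1 i * (y * z)"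
  proof (rule l1_eqI[OF bounded_linear_compose[OF times_left times_right] bounded_linear_compose[OF times_right times_left]])
    fix j
    show "mono1 i * mono1 j * z = mono1 i * (mono1 j * z)"
      by (rule l1_eqI[OF times_right bounded_linear_compose[OF times_right times_right]])
         (simp add: times_mono1 add.assoc)
  qed
qed

instance
proof
  fix x y z :: "'a l1" and r :: real
  show "x * y * z = x * (y * z)" by (rule times_assoc)
  show "x * y = y * x" by (rule times_comm)
  show "1 * x = x" by (simp add: one_l1_def times_l1_def lift_self)
  show "x * (y + z) = x * y + x * z" by (rule times_add_right)
  show "x * 1 = x" by (simp add: one_l1_def times_comm[of x] times_l1_def lift_self)
  show "(x + y) * z = x * z + y * z" by (rule linear_simps(1)[OF times_left])
  show "r *\<^sub>R x * y = r *\<^sub>R (x * y)" by (rule linear_simps(5)[OF times_left])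
  show "x * r *\<^sub>R y = r *\<^sub>R (x * y)" by (rule times_scaleR_right)
  show "norm (x * y) \<le> norm x * norm y" by (rule times_norm)
  show "norm (1 :: 'a l1) = 1" by (simp add: one_l1_def norm_mono1)
  show "(0 :: 'a l1) \<noteq> 1"
  proof
    assume "(0 :: 'a l1) = 1"
    then have "norm (mono1 (0::'a)) = 0" by (simp add: one_l1_def)
    then show False by (simp add: norm_mono1)
  qed
qed

end

section \<open>Functions on the unit circle\<close>

lemma at_circ_neq_bot: "w \<in> circ \<Longrightarrow> at w within circ \<noteq> bot"
proof -
  assume w: "w \<in> circ"
  have "connected circ" by (rule connected_sphere) simp
  moreover have "\<nexists>a. circ = {a}"
  proof
    assume "\<exists>a. circ = {a}"
    moreover have "1 \<in> circ" "-1 \<in> circ" by auto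
    ultimately have "(1::complex) = -1" by (metis singletonD)
    then show False by simp
  qed
  ultimately have "w islimpt circ" using connected_imp_perfect w by blast
  then show ?thesis by (simp add: trivial_limit_within)
qed

text \<open>The circle has no isolated points, so derivatives along it are unique.\<close>
lemma circ_deriv_eq:
  assumes "(f has_field_derivative D) (at w within circ)" "w \<in> circ"
  shows "circ_deriv f w = D"
  unfolding circ_deriv_def
proof (rule the_equality[where P = "\<lambda>D. (f has_field_derivative D) (at w within circ)", OF assms(1)])
  fix E assume "(f has_field_derivative E) (at w within circ)"
  then show "E = D"
    using assms at_circ_neq_bot[OF assms(2)] tendsto_unique
    unfolding has_field_derivative_iff by blast
qed

lemma has_field_derivative_cong_on:
  assumes "(f has_field_derivative D) (at w within S)" "w \<in> S" "\<And>x. x \<in> S \<Longrightarrow> g x = f x"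
  shows "(g has_field_derivative D) (at w within S)"
  using assms unfolding has_field_derivative_def by (rule has_derivative_transform[rotated 2]) auto

lemma circ_deriv_cong:
  assumes "\<And>w. w \<in> circ \<Longrightarrow> f w = g w" "w \<in> circ"
  shows "circ_deriv f w = circ_deriv g w"
proof -
  have "(f has_field_derivative D) (at w within circ) \<longleftrightarrow> (g has_field_derivative D) (at w within circ)" for D
    using assms has_field_derivative_cong_on by metis
  then show ?thesis by (simp add: circ_deriv_def)
qed

lemma holder1_deriv:
  "f \<in> holder1 \<alpha> \<Longrightarrow> w \<in> circ \<Longrightarrow> (f has_field_derivative circ_deriv f w) (at w within circ)"
  using circ_deriv_eq unfolding holder1_def by fastforce

lemma holder1_continuous: "f \<in> holder1 \<alpha> \<Longrightarrow> continuous_on circ f"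
  by (rule DERIV_continuous_on[OF holder1_deriv]) auto

lemma holder_continuous:
  assumes "h \<in> holder \<alpha>" "\<alpha> > 0" shows "continuous_on circ h"
proof -
  obtain K where K: "\<And>w \<tau>. w \<in> circ \<Longrightarrow> \<tau> \<in> circ \<Longrightarrow> norm (h w - h \<tau>) \<le> K * norm (w - \<tau>) powr \<alpha>"
    using assms(1) unfolding holder_def by blast
  show ?thesis
    unfolding continuous_on_def
  proof
    fix w assume w: "w \<in> circ"
    have "((\<lambda>\<tau>. norm (\<tau> - w) powr \<alpha>) \<longlongrightarrow> norm (w - w) powr \<alpha>) (at w within circ)"
      using assms(2) by (intro tendsto_powr' tendsto_intros) auto
    then have "((\<lambda>\<tau>. K * norm (\<tau> - w) powr \<alpha>) \<longlongrightarrow> K * 0) (at w within circ)"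
      by (intro tendsto_intros) simp
    then have "((\<lambda>\<tau>. K * norm (\<tau> - w) powr \<alpha>) \<longlongrightarrow> 0) (at w within circ)" by simp
    moreover have "\<forall>\<^sub>F \<tau> in at w within circ. norm (h \<tau> - h w) \<le> K * norm (\<tau> - w) powr \<alpha>"
      unfolding eventually_at_filter by (intro always_eventually allI impI K w)
    ultimately have "((\<lambda>\<tau>. h \<tau> - h w) \<longlongrightarrow> 0) (at w within circ)"
      by (rule Lim_null_comparison[rotated])
    then show "(h \<longlongrightarrow> h w) (at w within circ)" by (simp add: Lim_null[symmetric])
  qed
qed

lemma norm_le_sup_norm:
  assumes "continuous_on circ h" "w \<in> circ" shows "norm (h w) \<le> sup_norm h"
  unfolding sup_norm_def
proof (rule cSUP_upper[OF assms(2)])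
  have "compact ((\<lambda>w. norm (h w)) ` circ)"
    by (intro compact_continuous_image continuous_intros assms(1)) simp
  then show "bdd_above ((\<lambda>w. norm (h w)) ` circ)"
    by (rule bounded_imp_bdd_above[OF compact_imp_bounded])
qed

lemma sup_norm_nonneg: "continuous_on circ h \<Longrightarrow> 0 \<le> sup_norm h"
  by (rule order_trans[OF norm_ge_zero norm_le_sup_norm[of h 1]]) simp_all

text \<open>The supremum of quotients is only meaningful when they are bounded; this is what membership in the Hoelder
  space provides.\<close>
lemma holder_seminorm_nonneg:
  assumes "h \<in> holder \<alpha>" shows "0 \<le> holder_seminorm \<alpha> h"
proof -
  obtain K where K: "\<And>w \<tau>. w \<in> circ \<Longrightarrow> \<tau> \<in> circ \<Longrightarrow> norm (h w - h \<tau>) \<le> K * norm (w - \<tau>) powr \<alpha>"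
    using assms(1) unfolding holder_def by blast
  let ?S = "{(w, \<tau>). w \<in> circ \<and> \<tau> \<in> circ \<and> w \<noteq> \<tau>}"
  let ?q = "\<lambda>(w, \<tau>). norm (h w - h \<tau>) / norm (w - \<tau>) powr \<alpha>"
  have "?q p \<le> K" if p0: "p \<in> ?S" for p
  proof -
    obtain w \<tau> where p: "p = (w, \<tau>)" "w \<in> circ" "\<tau> \<in> circ" "w \<noteq> \<tau>" using p0 by blast
    then show ?thesis using K[OF p(2,3)] by (simp add: divide_le_eq)
  qed
  then have "bdd_above (?q ` ?S)" by (intro bdd_aboveI2) blast
  moreover have "(1, -1) \<in> ?S" by auto
  ultimately have "?q (1, -1) \<le> (SUP p\<in>?S. ?q p)" by (intro cSUP_upper)
  moreover have "0 \<le> ?q (1, -1)" by simp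
  ultimately show ?thesis unfolding holder_seminorm_def by linarith
qed

lemma norm_le_holder1_norm:
  assumes "f \<in> holder1 \<alpha>" "\<alpha> > 0" "w \<in> circ"
  shows "norm (f w) \<le> holder1_norm \<alpha> f" "norm (circ_deriv f w) \<le> holder1_norm \<alpha> f"
proof -
  have h: "circ_deriv f \<in> holder \<alpha>" using assms by (simp add: holder1_def)
  note c = holder1_continuous[OF assms(1)] holder_continuous[OF h assms(2)]
  note * = sup_norm_nonneg[OF c(1)] sup_norm_nonneg[OF c(2)] holder_seminorm_nonneg[OF h]
    norm_le_sup_norm[OF c(1) assms(3)] norm_le_sup_norm[OF c(2) assms(3)]
  show "norm (f w) \<le> holder1_norm \<alpha> f" "norm (circ_deriv f w) \<le> holder1_norm \<alpha> f"
    unfolding holder1_norm_def holder_norm_def using * by linarith+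
qed

lemma ball_X_bounds:
  assumes "f \<in> ball_X \<alpha>" "\<alpha> > 0" "j \<in> {1, 2}" "w \<in> circ"
  shows "norm (f j w) \<le> 1" "norm (circ_deriv (f j) w) \<le> 1"
proof -
  have "f j \<in> holder1 \<alpha>" "holder1_norm \<alpha> (f j) < 1"
    using assms by (auto simp: ball_X_def space_X_def norm_X_def)
  then show "norm (f j w) \<le> 1" "norm (circ_deriv (f j) w) \<le> 1"
    using norm_le_holder1_norm[of "f j" \<alpha> w] assms by linarith+
qed

lemma cis_circ [simp]: "cis t \<in> circ" by simp

lemma circE: assumes "w \<in> circ" obtains t where "0 \<le> t" "t \<le> 1" "w = cis (2 * pi * t)"
proof -
  have "w = cis (Arg2pi w)" using Arg2pi_eq[of w] assms by (simp add: cis_conv_exp)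
  moreover have "0 \<le> Arg2pi w / (2 * pi)" "Arg2pi w / (2 * pi) \<le> 1"
    using Arg2pi[of w] by (auto simp: divide_le_eq)
  ultimately show ?thesis using that[of "Arg2pi w / (2 * pi)"] by simp
qed

lemma circ_cnj:
  assumes "w \<in> circ" shows "cnj w * w = 1" "cnj w = 1 / w"
proof -
  have n: "norm w = 1" using assms by simp
  show *: "cnj w * w = 1" using complex_norm_square[of w] n by (simp add: mult.commute)
  have "w \<noteq> 0" using n by auto
  then show "cnj w = 1 / w" using * by (simp add: eq_divide_eq)
qed

text \<open>Starting the parametrization at \<open>w\<close> places the singularity of the integrands at the two
  endpoints of \<open>{0..1}\<close>.\<close>
lemma fint_rot:
  assumes "w \<in> circ"
  shows "fint h = integral {0..1} (\<lambda>t. h (w * cis (2 * pi * t)) * (w * cis (2 * pi * t)))"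
proof -
  obtain a where a: "0 \<le> a" "a \<le> 1" "w = cis (2 * pi * a)" using circE[OF assms] .
  have cp: "circlepath 0 1 t = cis (2 * pi * t)" for t
    by (simp add: circlepath cis_conv_exp mult_ac)
  have sp: "shiftpath a (circlepath 0 1) = (\<lambda>t. w * cis (2 * pi * t))"
  proof
    fix t
    have "circlepath 0 1 (a + t - 1) = circlepath 0 1 (a + t)"
      using circlepath_add1[of 0 1 "a + t - 1"] by simp
    then show "shiftpath a (circlepath 0 1) t = w * cis (2 * pi * t)"
      by (simp add: shiftpath_def cp a(3) cis_mult algebra_simps)
  qed
  have vd: "vector_derivative (\<lambda>t. w * cis (2 * pi * t)) (at t) = 2 * pi * \<i> * (w * cis (2 * pi * t))" for t
    by (rule vector_derivative_at)
       (auto intro!: derivative_eq_intros simp: has_vector_derivative_def has_derivative_cis scaleR_conv_of_real)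
  have "contour_integral (circlepath 0 1) h = contour_integral (shiftpath a (circlepath 0 1)) h"
    by (rule contour_integral_shiftpath[symmetric]) (use a in auto)
  also have "\<dots> = integral {0..1} (\<lambda>t. h (w * cis (2 * pi * t)) * (2 * pi * \<i> * (w * cis (2 * pi * t))))"
    unfolding contour_integral_integral sp vd ..
  also have "\<dots> = integral {0..1} (\<lambda>t. (2 * pi * \<i>) * (h (w * cis (2 * pi * t)) * (w * cis (2 * pi * t))))"
    by (simp add: mult_ac)
  also have "\<dots> = (2 * pi * \<i>) * integral {0..1} (\<lambda>t. h (w * cis (2 * pi * t)) * (w * cis (2 * pi * t)))"
    by (rule integral_mult_right)
  finally show ?thesis unfolding fint_def by simp
qed

lemma fint_cong: "(\<And>\<tau>. \<tau> \<in> circ \<Longrightarrow> h \<tau> = g \<tau>) \<Longrightarrow> fint h = fint g"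
  by (simp add: fint_rot[of 1])

lemma fint_minus: "fint h = - fint (\<lambda>\<tau>. h (- \<tau>))"
  using fint_rot[of "-1" h] fint_rot[of 1 "\<lambda>\<tau>. h (- \<tau>)"] by simp

section \<open>The reflection symmetry\<close>

lemma circ_deriv_reflect:
  assumes "f \<in> holder1 \<alpha>" "w \<in> circ"
  shows "((\<lambda>w. f (- w)) has_field_derivative - circ_deriv f (- w)) (at w within circ)"
    and "circ_deriv (\<lambda>w. f (- w)) w = - circ_deriv f (- w)"
proof -
  have "uminus ` circ = (circ :: complex set)"
  proof (intro equalityI subsetI)
    fix x :: complex assume "x \<in> circ"
    then show "x \<in> uminus ` circ" by (intro image_eqI[of _ _ "- x"]) auto
  qed auto
  then have "(f has_field_derivative circ_deriv f (- w)) (at (- w) within uminus ` circ)"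
    using holder1_deriv[OF assms(1), of "- w"] assms(2) by simp
  then have "((f \<circ> uminus) has_field_derivative circ_deriv f (- w) * (- 1)) (at w within circ)"
    by (rule DERIV_image_chain) (auto intro!: derivative_eq_intros)
  then show "((\<lambda>w. f (- w)) has_field_derivative - circ_deriv f (- w)) (at w within circ)"
    by (simp add: o_def)
  then show "circ_deriv (\<lambda>w. f (- w)) w = - circ_deriv f (- w)"
    using assms(2) by (rule circ_deriv_eq)
qed

lemma sup_norm_reflect: "sup_norm (\<lambda>w. h (- w)) = sup_norm h"
proof -
  have "(\<lambda>w. norm (h (- w))) ` circ = (\<lambda>w. norm (h w)) ` circ"
  proof (intro equalityI subsetI)
    fix x assume "x \<in> (\<lambda>w. norm (h w)) ` circ"
    then obtain w where "w \<in> circ" "x = norm (h w)" by auto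
    then show "x \<in> (\<lambda>w. norm (h (- w))) ` circ" by (intro image_eqI[of _ _ "- w"]) auto
  next
    fix x assume "x \<in> (\<lambda>w. norm (h (- w))) ` circ"
    then obtain w where "w \<in> circ" "x = norm (h (- w))" by auto
    then show "x \<in> (\<lambda>w. norm (h w)) ` circ" by (intro image_eqI[of _ _ "- w"]) auto
  qed
  then show ?thesis by (simp add: sup_norm_def)
qed

lemma holder_seminorm_reflect: "holder_seminorm \<alpha> (\<lambda>w. h (- w)) = holder_seminorm \<alpha> h"
proof -
  let ?S = "{(w, \<tau>). w \<in> circ \<and> \<tau> \<in> circ \<and> w \<noteq> (\<tau>::complex)}"
  let ?q = "\<lambda>h (w, \<tau>). norm (h w - h \<tau>) / norm (w - \<tau>) powr \<alpha>"
  have sub: "?q (\<lambda>w. g (- w)) ` ?S \<subseteq> ?q g ` ?S" for g :: "complex \<Rightarrow> complex"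
  proof clarify
    fix w \<tau> :: complex assume *: "w \<in> circ" "\<tau> \<in> circ" "w \<noteq> \<tau>"
    have "norm (- w + \<tau>) = norm (w - \<tau>)" by (metis minus_diff_eq norm_minus_cancel uminus_add_conv_diff)
    then show "norm (g (- w) - g (- \<tau>)) / norm (w - \<tau>) powr \<alpha> \<in> ?q g ` ?S"
      by (intro image_eqI[of _ _ "(- w, - \<tau>)"]) (use * in auto)
  qed
  have "?q (\<lambda>w. h (- w)) ` ?S = ?q h ` ?S"
    using sub[of h] sub[of "\<lambda>w. h (- w)"] by (intro equalityI) simp_all
  then show ?thesis unfolding holder_seminorm_def by simp
qed

lemma sup_norm_cong: "(\<And>w. w \<in> circ \<Longrightarrow> norm (h w) = norm (g w)) \<Longrightarrow> sup_norm h = sup_norm g"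
  unfolding sup_norm_def by (intro SUP_cong) auto

lemma holder_seminorm_cong:
  "(\<And>w \<tau>. w \<in> circ \<Longrightarrow> \<tau> \<in> circ \<Longrightarrow> norm (h w - h \<tau>) = norm (g w - g \<tau>)) \<Longrightarrow> holder_seminorm \<alpha> h = holder_seminorm \<alpha> g"
  unfolding holder_seminorm_def by (intro SUP_cong) auto

lemma holder1_reflect:
  assumes f: "f \<in> holder1 \<alpha>"
  shows "(\<lambda>w. f (- w)) \<in> holder1 \<alpha>" "holder1_norm \<alpha> (\<lambda>w. f (- w)) = holder1_norm \<alpha> f"
proof -
  let ?g = "\<lambda>w. f (- w)"
  have d: "circ_deriv ?g w = - circ_deriv f (- w)" if "w \<in> circ" for w
    using circ_deriv_reflect(2)[OF f that] .
  have n: "norm (- a - - b) = norm (a - b)" for a b :: complex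
    by (metis minus_diff_minus norm_minus_cancel)
  obtain K where K: "\<And>w \<tau>. w \<in> circ \<Longrightarrow> \<tau> \<in> circ \<Longrightarrow> norm (circ_deriv f w - circ_deriv f \<tau>) \<le> K * norm (w - \<tau>) powr \<alpha>"
    using f unfolding holder_def holder1_def by blast
  have "norm (circ_deriv ?g w - circ_deriv ?g \<tau>) \<le> K * norm (w - \<tau>) powr \<alpha>" if "w \<in> circ" "\<tau> \<in> circ" for w \<tau>
    using K[of "- w" "- \<tau>"] that d n by (simp add: norm_minus_commute)
  then have "circ_deriv ?g \<in> holder \<alpha>" unfolding holder_def by blast
  then show "?g \<in> holder1 \<alpha>"
    using circ_deriv_reflect(1)[OF f] unfolding holder1_def by blast
  have "sup_norm (circ_deriv ?g) = sup_norm (\<lambda>w. circ_deriv f (- w))"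
    by (rule sup_norm_cong) (simp add: d)
  moreover have "holder_seminorm \<alpha> (circ_deriv ?g) = holder_seminorm \<alpha> (\<lambda>w. circ_deriv f (- w))"
    by (rule holder_seminorm_cong) (simp add: d norm_minus_commute)
  ultimately show "holder1_norm \<alpha> ?g = holder1_norm \<alpha> f"
    unfolding holder1_norm_def holder_norm_def by (simp add: sup_norm_reflect holder_seminorm_reflect)
qed

text \<open>Reflection multiplies the coefficient of \<open>cnj w ^ n\<close> by \<open>(-1) ^ n\<close>.\<close>
lemma ball_X_reflect:
  assumes "f \<in> ball_X \<alpha>" shows "(\<lambda>j w. f j (- w)) \<in> ball_X \<alpha>"
proof -
  have h: "f j \<in> holder1 \<alpha>" if "j \<in> {1, 2}" for j using assms that by (auto simp: ball_X_def space_X_def)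
  have "\<exists>A :: nat \<Rightarrow> real. \<forall>w\<in>circ. (\<lambda>n. of_real (A (Suc n)) * cnj w ^ Suc n) sums f j (- w)" if j: "j \<in> {1, 2}" for j
  proof -
    obtain A :: "nat \<Rightarrow> real" where A: "\<And>w. w \<in> circ \<Longrightarrow> (\<lambda>n. of_real (A (Suc n)) * cnj w ^ Suc n) sums f j w"
      using assms j unfolding ball_X_def space_X_def by blast
    have "(\<lambda>n. of_real ((-1) ^ Suc n * A (Suc n)) * cnj w ^ Suc n) sums f j (- w)" if "w \<in> circ" for w
    proof -
      have "of_real (A (Suc n)) * cnj (- w) ^ Suc n = of_real ((-1) ^ Suc n * A (Suc n)) * cnj w ^ Suc n" for n
        using power_minus[of "cnj w" n] by simp
      moreover have "(\<lambda>n. of_real (A (Suc n)) * cnj (- w) ^ Suc n) sums f j (- w)"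
        using A[of "- w"] that by simp
      ultimately show ?thesis by (rule sums_cong[THEN iffD1])
    qed
    then show ?thesis by (intro exI[of _ "\<lambda>n. (-1) ^ n * A n"]) blast
  qed
  then show ?thesis
    using assms h holder1_reflect by (auto simp: ball_X_def space_X_def norm_X_def)
qed

text \<open>Substitute \<open>- \<tau>\<close> for \<open>\<tau>\<close>. For the reflected function the increment B between \<open>- \<tau>\<close> and \<open>w\<close> is that of \<open>f\<close> between \<open>\<tau>\<close> and
  \<open>- w\<close>, while A is the negative of \<open>\<tau> - (- w)\<close>; as \<open>\<epsilon>\<close> changes sign too, so does \<open>A + \<epsilon> b\<^sub>j B\<close>. Derivatives along the
  circle and the line element also change sign.\<close>
lemma F_reflect:
  assumes f: "f \<in> ball_X \<alpha>" and j: "j \<in> {1, 2}" and w: "w \<in> circ"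
  shows "F b d \<gamma> (- \<epsilon>) \<Omega> Z (\<lambda>j w. f j (- w)) j w = - F b d \<gamma> \<epsilon> \<Omega> Z f j (- w)"
proof -
  define k where "k = 3 - j"
  have k: "k \<in> {1, 2}" using j by (auto simp: k_def)
  have h: "f i \<in> holder1 \<alpha>" if "i \<in> {1, 2}" for i using f that by (auto simp: ball_X_def space_X_def)
  have d: "circ_deriv (\<lambda>w. f i (- w)) \<tau> = - circ_deriv (f i) (- \<tau>)" if "i \<in> {1, 2}" "\<tau> \<in> circ" for i \<tau>
    using circ_deriv_reflect(2)[OF h] that by blast
  let ?S1 = "\<lambda>\<tau>. ((\<tau> - w) * cnj (f j (- \<tau>) - f j (- w)) - cnj (\<tau> - w) * (f j (- \<tau>) - f j (- w))) /
       ((\<tau> - w) * (\<tau> - w + complex_of_real (- \<epsilon>) * of_real (b j) * (f j (- \<tau>) - f j (- w)))) *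
       (circ_deriv (\<lambda>w. f j (- w)) \<tau> - (f j (- \<tau>) - f j (- w)) / (\<tau> - w))"
  let ?S2 = "\<lambda>\<tau>. ((\<tau> - (- w)) * cnj (f j \<tau> - f j (- w)) - cnj (\<tau> - (- w)) * (f j \<tau> - f j (- w))) /
       ((\<tau> - (- w)) * (\<tau> - (- w) + complex_of_real \<epsilon> * of_real (b j) * (f j \<tau> - f j (- w)))) *
       (circ_deriv (f j) \<tau> - (f j \<tau> - f j (- w)) / (\<tau> - (- w)))"
  have S: "fint ?S1 = - fint ?S2"
  proof -
    have "?S1 (- \<tau>) = ?S2 \<tau>" if "\<tau> \<in> circ" for \<tau>
    proof -
      have e: "circ_deriv (\<lambda>w. f j (- w)) (- \<tau>) = - circ_deriv (f j) \<tau>" using d[OF j, of "- \<tau>"] that by simp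
      define A B D where "A = \<tau> + w" and "B = f j \<tau> - f j (- w)" and "D = circ_deriv (f j) \<tau>"
      have A: "- \<tau> - w = - A" "\<tau> - - w = A" by (simp_all add: A_def)
      have den: "(- A) * (- A + complex_of_real (- \<epsilon>) * of_real (b j) * B) = A * (A + complex_of_real \<epsilon> * of_real (b j) * B)"
        by (simp add: algebra_simps)
      show ?thesis
        unfolding e A minus_minus den B_def[symmetric] D_def[symmetric] unfolding den
        by (cases "A = 0 \<or> A + complex_of_real \<epsilon> * of_real (b j) * B = 0") (auto simp: field_simps)
    qed
    then have "fint (\<lambda>\<tau>. ?S1 (- \<tau>)) = fint ?S2" by (rule fint_cong)
    then show ?thesis using fint_minus[of ?S1] by simp
  qed
  let ?I1 = "\<lambda>\<tau>. (cnj \<tau> + complex_of_real (- \<epsilon>) * of_real (b k) * cnj (f k (- \<tau>))) * (1 + complex_of_real (- \<epsilon>) * of_real (b k) * circ_deriv (\<lambda>w. f k (- w)) \<tau>) /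
     (complex_of_real (- \<epsilon>) * (of_real (b k) * \<tau> + of_real (b j) * w) + (complex_of_real (- \<epsilon>))\<^sup>2 * ((of_real (b k))\<^sup>2 * f k (- \<tau>) + (of_real (b j))\<^sup>2 * f j (- w)) - of_real d)"
  let ?I2 = "\<lambda>\<tau>. (cnj \<tau> + complex_of_real \<epsilon> * of_real (b k) * cnj (f k \<tau>)) * (1 + complex_of_real \<epsilon> * of_real (b k) * circ_deriv (f k) \<tau>) /
     (complex_of_real \<epsilon> * (of_real (b k) * \<tau> + of_real (b j) * (- w)) + (complex_of_real \<epsilon>)\<^sup>2 * ((of_real (b k))\<^sup>2 * f k \<tau> + (of_real (b j))\<^sup>2 * f j (- w)) - of_real d)"
  have I: "fint ?I1 = fint ?I2"
  proof -
    have "?I1 (- \<tau>) = - ?I2 \<tau>" if "\<tau> \<in> circ" for \<tau>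
    proof -
      have e: "circ_deriv (\<lambda>w. f k (- w)) (- \<tau>) = - circ_deriv (f k) \<tau>" using d[OF k, of "- \<tau>"] that by simp
      have den: "complex_of_real (- \<epsilon>) * (of_real (b k) * (- \<tau>) + of_real (b j) * w) = complex_of_real \<epsilon> * (of_real (b k) * \<tau> + of_real (b j) * (- w))"
        "(complex_of_real (- \<epsilon>))\<^sup>2 = (complex_of_real \<epsilon>)\<^sup>2"
        by (simp_all add: algebra_simps)
      show ?thesis unfolding e den minus_minus minus_divide_left by (simp add: algebra_simps)
    qed
    then have "fint (\<lambda>\<tau>. ?I1 (- \<tau>)) = fint (\<lambda>\<tau>. - ?I2 \<tau>)" by (rule fint_cong)
    also have "\<dots> = - fint ?I2" by (simp add: fint_rot[of 1])
    finally show ?thesis using fint_minus[of ?I1] by simp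
  qed
  show ?thesis
    unfolding F_def Let_def k_def[symmetric] S I d[OF j w]
    by (simp add: algebra_simps)
qed

lemma F_zero_reflect:
  assumes "f \<in> ball_X \<alpha>" "F_zero b d \<gamma> \<epsilon> \<Omega> Z f"
  shows "F_zero b d \<gamma> (- \<epsilon>) \<Omega> Z (\<lambda>j w. f j (- w))"
  unfolding F_zero_def
proof (intro ballI)
  fix j :: nat and w assume "j \<in> {1, 2}" "w \<in> circ"
  then show "F b d \<gamma> (- \<epsilon>) \<Omega> Z (\<lambda>j w. f j (- w)) j w = 0"
    using F_reflect[OF assms(1), of j w] assms(2) by (auto simp: F_zero_def)
qed

section \<open>Riemann summation and Schwarz's lemma\<close>

text \<open>The multiplier that a symmetric second difference quotient of step \<open>2 h\<close> puts on a twice integrated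
  exponential: the second difference of \<open>cis (x t)\<close> is \<open>- 4 sin\<^sup>2(x h)\<close> times \<open>cis (x t)\<close>.\<close>
definition sinc2 :: "real \<Rightarrow> real" where "sinc2 x = (sin x / x)\<^sup>2"

lemma sinc2_le1: "x > 0 \<Longrightarrow> sinc2 x \<le> 1"
proof -
  assume "x > 0"
  then have "\<bar>sin x / x\<bar> \<le> 1" using abs_sin_x_le_abs_x[of x] by (simp add: abs_divide divide_le_eq)
  then show ?thesis unfolding sinc2_def by (simp add: power_le_one_iff abs_square_le_1)
qed

lemma sin_minus_xcos: "x \<ge> 0 \<Longrightarrow> \<bar>x * cos x - sin x\<bar> \<le> x\<^sup>2 / 2" for x :: real
proof -
  assume x: "x \<ge> 0"
  have "0\<^sup>2 / 2 + (0 * cos 0 - sin 0) \<le> x\<^sup>2 / 2 + (x * cos x - sin x)"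
  proof (rule DERIV_nonneg_imp_nondecreasing[OF x])
    fix y :: real assume y: "0 \<le> y" "y \<le> x"
    have "0 \<le> y - y * sin y" using y mult_left_mono[of "sin y" 1 y] by simp
    then show "\<exists>d. ((\<lambda>x. x\<^sup>2 / 2 + (x * cos x - sin x)) has_real_derivative d) (at y) \<and> 0 \<le> d"
      by (intro exI[of _ "y - y * sin y"]) (auto intro!: derivative_eq_intros)
  qed
  moreover have "0\<^sup>2 / 2 - (0 * cos 0 - sin 0) \<le> x\<^sup>2 / 2 - (x * cos x - sin x)"
  proof (rule DERIV_nonneg_imp_nondecreasing[OF x])
    fix y :: real assume y: "0 \<le> y" "y \<le> x"
    have "0 \<le> y + y * sin y" using y mult_left_mono[of "-1" "sin y" y] by simp
    then show "\<exists>d. ((\<lambda>x. x\<^sup>2 / 2 - (x * cos x - sin x)) has_real_derivative d) (at y) \<and> 0 \<le> d"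
      by (intro exI[of _ "y + y * sin y"]) (auto intro!: derivative_eq_intros)
  qed
  ultimately show ?thesis unfolding abs_le_iff by simp
qed

text \<open>A bound by the derivative of \<open>8 arctan\<close>, integrable on the half line, so that the total variation is finite.\<close>
lemma sinc2_deriv:
  assumes "x > 0"
  shows "(sinc2 has_real_derivative 2 * sin x * (x * cos x - sin x) / x ^ 3) (at x)"
    and "\<bar>2 * sin x * (x * cos x - sin x) / x ^ 3\<bar> \<le> 8 * inverse (1 + x\<^sup>2)"
proof -
  show "(sinc2 has_real_derivative 2 * sin x * (x * cos x - sin x) / x ^ 3) (at x)"
    unfolding sinc2_def using assms
    by (auto intro!: derivative_eq_intros simp: field_simps power2_eq_square power3_eq_cube)
  have e: "\<bar>2 * sin x * (x * cos x - sin x) / x ^ 3\<bar> = 2 * \<bar>sin x\<bar> * \<bar>x * cos x - sin x\<bar> / x ^ 3"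
    using assms by (simp add: abs_mult)
  show "\<bar>2 * sin x * (x * cos x - sin x) / x ^ 3\<bar> \<le> 8 * inverse (1 + x\<^sup>2)"
  proof (cases "x \<le> 1")
    case True
    have "\<bar>sin x\<bar> * \<bar>x * cos x - sin x\<bar> \<le> x * (x\<^sup>2 / 2)"
      using abs_sin_x_le_abs_x[of x] sin_minus_xcos[of x] assms by (intro mult_mono) auto
    then have "2 * \<bar>sin x\<bar> * \<bar>x * cos x - sin x\<bar> / x ^ 3 \<le> 1"
      using assms by (simp add: divide_le_eq power2_eq_square power3_eq_cube)
    moreover have "x\<^sup>2 \<le> 1" using True assms by (simp add: power_le_one)
    then have "1 \<le> 8 * inverse (1 + x\<^sup>2)" by (simp add: field_simps add_pos_nonneg)
    ultimately show ?thesis unfolding e by linarith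
  next
    case False
    have "\<bar>x * cos x\<bar> \<le> x * 1" using assms unfolding abs_mult by (intro mult_mono) auto
    then have b: "\<bar>x * cos x - sin x\<bar> \<le> 2 * x" using abs_sin_le_one[of x] False by linarith
    have "\<bar>sin x\<bar> * \<bar>x * cos x - sin x\<bar> \<le> 1 * (2 * x)"
      using b by (intro mult_mono) auto
    then have "2 * \<bar>sin x\<bar> * \<bar>x * cos x - sin x\<bar> / x ^ 3 \<le> 4 * x / x ^ 3"
      using assms by (intro divide_right_mono) auto
    also have "\<dots> = 4 / x\<^sup>2" using assms by (simp add: power2_eq_square power3_eq_cube)
    also have "\<dots> \<le> 8 * inverse (1 + x\<^sup>2)"
    proof -
      have "1 \<le> x\<^sup>2" using False by (simp add: one_le_power)
      then show ?thesis using assms by (simp add: field_simps add_pos_nonneg)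
    qed
    finally show ?thesis unfolding e .
  qed
qed

lemma sinc2_variation:
  assumes "0 < a" "a \<le> b" shows "\<bar>sinc2 a - sinc2 b\<bar> \<le> 8 * (arctan b - arctan a)"
proof -
  have D: "(sinc2 has_real_derivative 2 * sin y * (y * cos y - sin y) / y ^ 3) (at y)"
    "\<bar>2 * sin y * (y * cos y - sin y) / y ^ 3\<bar> \<le> 8 * inverse (1 + y\<^sup>2)" if "a \<le> y" for y
    using sinc2_deriv[of y] that assms by auto
  have ab: "0 \<le> v + u \<and> 0 \<le> v - u" if "\<bar>u\<bar> \<le> v" for u v :: real using that by linarith
  have "8 * arctan a + sinc2 a \<le> 8 * arctan b + sinc2 b"
  proof (rule DERIV_nonneg_imp_nondecreasing[OF assms(2)])
    fix y assume y: "a \<le> y" "y \<le> b"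
    have "((\<lambda>x. 8 * arctan x + sinc2 x) has_real_derivative (8 * inverse (1 + y\<^sup>2) + 2 * sin y * (y * cos y - sin y) / y ^ 3)) (at y)"
      by (intro DERIV_add DERIV_cmult DERIV_arctan D(1) y)
    moreover have "0 \<le> 8 * inverse (1 + y\<^sup>2) + 2 * sin y * (y * cos y - sin y) / y ^ 3"
      using ab[OF D(2)[OF y(1)]] by blast
    ultimately show "\<exists>d. ((\<lambda>x. 8 * arctan x + sinc2 x) has_real_derivative d) (at y) \<and> 0 \<le> d"
      by blast
  qed
  moreover have "8 * arctan a - sinc2 a \<le> 8 * arctan b - sinc2 b"
  proof (rule DERIV_nonneg_imp_nondecreasing[OF assms(2)])
    fix y assume y: "a \<le> y" "y \<le> b"
    have "((\<lambda>x. 8 * arctan x - sinc2 x) has_real_derivative (8 * inverse (1 + y\<^sup>2) - 2 * sin y * (y * cos y - sin y) / y ^ 3)) (at y)"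
      by (intro DERIV_diff DERIV_cmult DERIV_arctan D(1) y)
    moreover have "0 \<le> 8 * inverse (1 + y\<^sup>2) - 2 * sin y * (y * cos y - sin y) / y ^ 3"
      using ab[OF D(2)[OF y(1)]] by blast
    ultimately show "\<exists>d. ((\<lambda>x. 8 * arctan x - sinc2 x) has_real_derivative d) (at y) \<and> 0 \<le> d"
      by blast
  qed
  ultimately show ?thesis unfolding abs_le_iff right_diff_distrib by simp
qed

lemma sinc2_tendsto: "(sinc2 \<longlongrightarrow> 1) (at_right 0)"
proof -
  have "((\<lambda>x. sin x / x) \<longlongrightarrow> 1) (at (0::real))"
    using DERIV_sin[of "0::real"] by (simp add: has_field_derivative_iff)
  then have "((\<lambda>x. (sin x / x) ^ 2) \<longlongrightarrow> 1 ^ 2) (at_right (0::real))"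
    by (intro tendsto_power) (rule tendsto_within_subset, auto)
  then show ?thesis by (simp add: sinc2_def[abs_def])
qed

text \<open>The bound does not depend on the step \<open>h\<close>: this uniformity is what makes the summation method regular.\<close>
lemma sinc2_variation_sum:
  assumes "h > 0"
  shows "(\<Sum>n<N. \<bar>sinc2 (real (Suc n) * h) - sinc2 (real (Suc (Suc n)) * h)\<bar>) \<le> 4 * pi"
proof -
  have "(\<Sum>n<N. \<bar>sinc2 (real (Suc n) * h) - sinc2 (real (Suc (Suc n)) * h)\<bar>)
      \<le> (\<Sum>n<N. 8 * (arctan (real (Suc (Suc n)) * h) - arctan (real (Suc n) * h)))"
    using assms by (intro sum_mono sinc2_variation) (auto intro: mult_right_mono)
  also have "\<dots> = 8 * (arctan (real (Suc N) * h) - arctan (real (Suc 0) * h))"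
    by (simp only: sum_distrib_left[symmetric] sum_lessThan_telescope[of "\<lambda>n. arctan (real (Suc n) * h)"])
  also have "\<dots> \<le> 8 * (pi / 2 - 0)"
  proof -
    have "0 \<le> arctan (real (Suc 0) * h)" using assms by simp
    then show ?thesis using arctan_ubound[of "real (Suc N) * h"] by (intro mult_left_mono) linarith+
  qed
  finally show ?thesis by simp
qed

lemma abel_parts:
  fixes T \<phi> :: "nat \<Rightarrow> 'a::comm_ring"
  shows "(\<Sum>n<N. (T (Suc n) - T n) * \<phi> n) = T N * \<phi> N - T 0 * \<phi> 0 + (\<Sum>n<N. T (Suc n) * (\<phi> n - \<phi> (Suc n)))"
  by (induction N) (simp_all add: algebra_simps)

text \<open>Riemann's summation method assigns to a convergent series its sum. Abel summation turns the damped series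
  into the remainders \<open>T n\<close> times the increments of the multiplier. The multiplier has variation at most \<open>4 \<pi>\<close>
  uniformly in \<open>h\<close>, late remainders are small, and the finitely many early increments tend to 0.\<close>
lemma riemann_summation:
  fixes a :: "nat \<Rightarrow> complex" and D :: "real \<Rightarrow> complex"
  assumes a: "a sums s"
    and D: "\<And>h. h > 0 \<Longrightarrow> (\<lambda>n. a n * of_real (sinc2 (real (Suc n) * h))) sums D h"
  shows "(D \<longlongrightarrow> s) (at_right 0)"
proof (rule tendstoI)
  fix e :: real assume e: "e > 0"
  define T where "T n = (\<Sum>k<n. a k) - s" for n
  have T0: "T \<longlonglongrightarrow> 0" using a unfolding T_def[abs_def] sums_def by (rule LIM_zero)
  then have "Bseq T" by (simp add: convergentI convergent_imp_Bseq)
  then obtain K where K: "K > 0" "\<And>n. norm (T n) \<le> K" unfolding Bseq_def by blast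
  define \<delta> where "\<delta> = e / (4 * (4 * pi))"
  have \<delta>: "\<delta> > 0" "\<delta> * (4 * pi) = e / 4" using e by (auto simp: \<delta>_def)
  from LIMSEQ_D[OF T0 \<delta>(1)] obtain M where M: "\<And>n. n \<ge> M \<Longrightarrow> norm (T n) \<le> \<delta>"
    by (auto intro: less_imp_le)
  define \<phi> where "\<phi> h n = sinc2 (real (Suc n) * h)" for h n
  have \<phi>1: "((\<lambda>h. \<phi> h n) \<longlongrightarrow> 1) (at_right 0)" for n
  proof -
    have "filterlim (\<lambda>h. real (Suc n) * h) (at_right 0) (at_right 0)"
      unfolding filterlim_at
      by (auto simp: eventually_at_filter intro!: tendsto_eq_intros)
    then show ?thesis unfolding \<phi>_def by (rule filterlim_compose[OF sinc2_tendsto])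
  qed
  have "((\<lambda>h. norm s * \<bar>\<phi> h 0 - 1\<bar> + K * (\<Sum>n<M. \<bar>\<phi> h n - \<phi> h (Suc n)\<bar>)) \<longlongrightarrow> norm s * \<bar>1 - 1\<bar> + K * (\<Sum>n<M. \<bar>1 - 1\<bar>)) (at_right 0)"
    by (intro tendsto_intros \<phi>1)
  then have "\<forall>\<^sub>F h in at_right 0. norm s * \<bar>\<phi> h 0 - 1\<bar> + K * (\<Sum>n<M. \<bar>\<phi> h n - \<phi> h (Suc n)\<bar>) < e / 4"
    using e by (intro order_tendstoD(2)) auto
  moreover have "\<forall>\<^sub>F h in at_right (0::real). h > 0" by (simp add: eventually_at_filter)
  ultimately show "\<forall>\<^sub>F h in at_right 0. dist (D h) s < e"
  proof eventually_elim
    case (elim h)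
    have \<phi>b: "\<bar>\<phi> h n\<bar> \<le> 1" for n
      using sinc2_le1[of "real (Suc n) * h"] elim(2) by (simp add: \<phi>_def sinc2_def)
    define V where "V n = \<bar>\<phi> h n - \<phi> h (Suc n)\<bar>" for n
    have var: "(\<Sum>n<N. V n) \<le> 4 * pi" for N
      using sinc2_variation_sum[OF elim(2), of N] by (simp add: \<phi>_def V_def)
    have V0: "V n \<ge> 0" for n by (simp add: V_def)
    have bound: "norm ((\<Sum>n<N. a n * of_real (\<phi> h n)) - s) \<le> norm (T N) + (e / 4 + e / 4)" for N
    proof -
      have "(\<Sum>n<N. a n * of_real (\<phi> h n)) = (\<Sum>n<N. (T (Suc n) - T n) * of_real (\<phi> h n))"
        by (simp add: T_def)
      also have "\<dots> = T N * of_real (\<phi> h N) - T 0 * of_real (\<phi> h 0) + (\<Sum>n<N. T (Suc n) * (of_real (\<phi> h n) - of_real (\<phi> h (Suc n))))"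
        by (rule abel_parts)
      finally have eq: "(\<Sum>n<N. a n * of_real (\<phi> h n)) - s
         = T N * of_real (\<phi> h N) + s * of_real (\<phi> h 0 - 1) + (\<Sum>n<N. T (Suc n) * of_real (\<phi> h n - \<phi> h (Suc n)))"
        by (simp add: T_def algebra_simps)
      have 1: "norm (T N * of_real (\<phi> h N)) \<le> norm (T N)"
        using mult_left_mono[OF \<phi>b[of N], of "norm (T N)"] by (simp add: norm_mult)
      have 2: "norm (s * of_real (\<phi> h 0 - 1)) = norm s * \<bar>\<phi> h 0 - 1\<bar>" by (simp add: norm_mult del: of_real_diff)
      have tV: "norm (T (Suc n)) * V n \<le> (if n < M then K * V n else 0) + \<delta> * V n" for n
      proof -
        have "0 \<le> \<delta> * V n" using \<delta>(1) V0[of n] by simp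
        moreover have "norm (T (Suc n)) * V n \<le> K * V n" by (rule mult_right_mono[OF K(2) V0])
        moreover have "norm (T (Suc n)) * V n \<le> \<delta> * V n" if "\<not> n < M"
          by (rule mult_right_mono[OF M V0]) (use that in simp)
        ultimately show ?thesis by (cases "n < M") simp_all
      qed
      have "norm (\<Sum>n<N. T (Suc n) * of_real (\<phi> h n - \<phi> h (Suc n))) \<le> (\<Sum>n<N. norm (T (Suc n)) * V n)"
        by (rule sum_norm_le) (simp add: norm_mult V_def del: of_real_diff)
      also have "\<dots> \<le> (\<Sum>n<N. (if n < M then K * V n else 0) + \<delta> * V n)"
        by (intro sum_mono tV)
      also have "\<dots> = (\<Sum>n<N. if n < M then K * V n else 0) + \<delta> * (\<Sum>n<N. V n)"
        by (simp add: sum.distrib sum_distrib_left)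
      also have "(\<Sum>n<N. if n < M then K * V n else 0) = (\<Sum>n\<in>{..<N} \<inter> {..<M}. K * V n)"
        by (subst sum.inter_restrict) (auto intro!: sum.cong)
      also have "\<dots> \<le> (\<Sum>n<M. K * V n)"
        using K V0 by (intro sum_mono2) auto
      also have "\<dots> = K * (\<Sum>n<M. V n)" by (simp add: sum_distrib_left)
      also have "\<delta> * (\<Sum>n<N. V n) \<le> e / 4" using mult_left_mono[OF var[of N], of \<delta>] \<delta> by simp
      finally have 3: "norm (\<Sum>n<N. T (Suc n) * of_real (\<phi> h n - \<phi> h (Suc n))) \<le> K * (\<Sum>n<M. V n) + e / 4" by simp
      show ?thesis unfolding eq
        using norm_triangle_ineq[of "T N * of_real (\<phi> h N) + s * of_real (\<phi> h 0 - 1)" "\<Sum>n<N. T (Suc n) * of_real (\<phi> h n - \<phi> h (Suc n))"]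
          norm_triangle_ineq[of "T N * of_real (\<phi> h N)" "s * of_real (\<phi> h 0 - 1)"] 1 2 3 elim(1)
        by (simp add: V_def del: of_real_diff)
    qed
    have "norm (D h - s) \<le> 0 + (e / 4 + e / 4)"
    proof (rule tendsto_le[OF trivial_limit_sequentially])
      show "(\<lambda>N. norm ((\<Sum>n<N. a n * of_real (\<phi> h n)) - s)) \<longlonglongrightarrow> norm (D h - s)"
        using D[OF elim(2)] unfolding sums_def \<phi>_def by (intro tendsto_intros)
      show "(\<lambda>N. norm (T N) + (e / 4 + e / 4)) \<longlonglongrightarrow> 0 + (e / 4 + e / 4)"
        using T0 by (intro tendsto_intros tendsto_norm_zero)
    qed (use bound in auto)
    then show ?case using e by (simp add: dist_norm)
  qed
qed

text \<open>If the function exceeded the chord, then after adding a small parabola that is negative between the endpoints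
  and has second derivative \<open>2 \<eta> > 0\<close>, an interior maximum would remain. At a maximum symmetric second differences are
  nonpositive, but they behave like \<open>2 \<eta> h\<^sup>2\<close>.\<close>
lemma schwarz_below_chord:
  fixes E :: "real \<Rightarrow> real"
  assumes c: "\<And>t. isCont E t" and ab: "a < b" and t0: "a \<le> t0" "t0 \<le> b"
    and S: "\<And>t. ((\<lambda>h. (E (t + h) + E (t - h) - 2 * E t) / h\<^sup>2) \<longlongrightarrow> 0) (at_right 0)"
  shows "E t0 \<le> E a + (t0 - a) * ((E b - E a) / (b - a))"
proof (rule ccontr)
  define m where "m = (E b - E a) / (b - a)"
  define D where "D x = E x - (E a + (x - a) * m)" for x
  assume "\<not> ?thesis"
  then have D0: "D t0 > 0" by (simp add: D_def m_def)
  have Dab: "D a = 0" "D b = 0" using ab by (auto simp: D_def m_def field_simps)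
  \<comment> \<open>At \<open>t0\<close> the parabola takes away at most half of the excess.\<close>
  define \<eta> where "\<eta> = D t0 / (2 * (b - a)\<^sup>2)"
  have \<eta>: "\<eta> > 0" using D0 ab by (simp add: \<eta>_def)
  define G where "G x = D x + \<eta> * ((x - a) * (x - b))" for x
  have "(t0 - a) * (b - t0) \<le> (b - a) * (b - a)" using t0 by (intro mult_mono) auto
  then have "\<eta> * ((t0 - a) * (b - t0)) \<le> \<eta> * ((b - a) * (b - a))" using \<eta> by (intro mult_left_mono) auto
  also have "\<dots> = D t0 / 2" using ab by (simp add: \<eta>_def power2_eq_square)
  finally have G0: "G t0 > 0" using D0 by (simp add: G_def algebra_simps)
  have "continuous_on {a..b} G"
    unfolding G_def D_def by (intro continuous_intros continuous_at_imp_continuous_on ballI c)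
  then obtain x where x: "x \<in> {a..b}" and max: "\<And>y. y \<in> {a..b} \<Longrightarrow> G y \<le> G x"
    using continuous_attains_sup[of "{a..b}" G] ab by auto
  have Gx: "G x > 0" using max[of t0] t0 G0 by simp
  then have "x \<noteq> a" "x \<noteq> b" using Dab by (auto simp: G_def)
  then have xab: "a < x" "x < b" using x by auto
  define r where "r = min (x - a) (b - x)"
  have r: "r > 0" using xab by (simp add: r_def)
  have "\<forall>\<^sub>F h in at_right 0. (E (x + h) + E (x - h) - 2 * E x) / h\<^sup>2 > - \<eta>"
    using S[of x] \<eta> by (intro order_tendstoD(1)[of _ 0]) auto
  moreover have "\<forall>\<^sub>F h in at_right 0. h \<in> {0<..<r}"
    using r by (rule eventually_at_right_real)
  ultimately have "\<forall>\<^sub>F h in at_right (0::real). False"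
  proof eventually_elim
    case (elim h)
    have h: "0 < h" "h < r" using elim(2) by auto
    have "G (x + h) \<le> G x" "G (x - h) \<le> G x" using h xab by (auto intro!: max simp: r_def)
    moreover have "G (x + h) + G (x - h) - 2 * G x = (E (x + h) + E (x - h) - 2 * E x) + 2 * \<eta> * h\<^sup>2"
      by (simp add: G_def D_def algebra_simps power2_eq_square)
    moreover have "E (x + h) + E (x - h) - 2 * E x > - \<eta> * h\<^sup>2"
      using elim(1) h by (simp add: field_simps)
    moreover have "\<eta> * h\<^sup>2 > 0" using \<eta> h by simp
    ultimately show False by simp
  qed
  then show False by simp
qed

text \<open>Schwarz's lemma: the previous estimate for the function and for its negative makes each chord exact.\<close>
lemma schwarz_affine_real:
  fixes E :: "real \<Rightarrow> real"
  assumes c: "\<And>t. isCont E t"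
    and S: "\<And>t. ((\<lambda>h. (E (t + h) + E (t - h) - 2 * E t) / h\<^sup>2) \<longlongrightarrow> 0) (at_right 0)"
  shows "E t = E 0 + t * (E 1 - E 0)"
proof -
  have chord: "E x = E a + (x - a) * ((E b - E a) / (b - a))" if "a < b" "a \<le> x" "x \<le> b" for a b x
  proof (rule antisym)
    show "E x \<le> E a + (x - a) * ((E b - E a) / (b - a))" by (rule schwarz_below_chord[OF c that S])
    have S': "((\<lambda>h. (- E (t + h) + - E (t - h) - 2 * - E t) / h\<^sup>2) \<longlongrightarrow> 0) (at_right 0)" for t
    proof -
      have "((\<lambda>h. - ((E (t + h) + E (t - h) - 2 * E t) / h\<^sup>2)) \<longlongrightarrow> - 0) (at_right 0)"
        by (intro tendsto_intros S)
      moreover have "- ((E (t + h) + E (t - h) - 2 * E t) / h\<^sup>2) = (- E (t + h) + - E (t - h) - 2 * - E t) / h\<^sup>2" for h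
        by (simp add: minus_divide_left)
      ultimately show ?thesis by simp
    qed
    have "- E x \<le> - E a + (x - a) * ((- E b - - E a) / (b - a))"
      by (rule schwarz_below_chord[of "\<lambda>x. - E x", OF _ that S']) (intro continuous_intros c)
    moreover have "(- E b - - E a) / (b - a) = - ((E b - E a) / (b - a))"
      by (metis minus_diff_eq minus_diff_minus minus_divide_left)
    ultimately have "- E x \<le> - E a + - ((x - a) * ((E b - E a) / (b - a)))" by (simp only: mult_minus_right)
    then show "E a + (x - a) * ((E b - E a) / (b - a)) \<le> E x" by linarith
  qed
  consider "t < 0" | "0 \<le> t" "t \<le> 1" | "1 < t" by linarith
  then show ?thesis
  proof cases
    case 1
    have "E 0 = E t + (0 - t) * ((E 1 - E t) / (1 - t))" using 1 by (intro chord) auto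
    then have "E 0 * (1 - t) = E t * (1 - t) - t * (E 1 - E t)" using 1 by (simp add: field_simps)
    then show ?thesis by (simp add: algebra_simps)
  next
    case 2 then show ?thesis using chord[of 0 1 t] by simp
  next
    case 3
    have "E 1 = E 0 + (1 - 0) * ((E t - E 0) / (t - 0))" using 3 by (intro chord) auto
    then show ?thesis using 3 by (simp add: field_simps)
  qed
qed

lemma schwarz_affine:
  fixes E :: "real \<Rightarrow> complex"
  assumes c: "\<And>t. isCont E t"
    and S: "\<And>t. ((\<lambda>h. (E (t + h) + E (t - h) - 2 * E t) / of_real (h\<^sup>2)) \<longlongrightarrow> 0) (at_right 0)"
  shows "E t = E 0 + t * (E 1 - E 0)"
proof (rule complex_eqI)
  have "((\<lambda>h. (Re (E (t + h)) + Re (E (t - h)) - 2 * Re (E t)) / h\<^sup>2) \<longlongrightarrow> 0) (at_right 0)" for t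
    using tendsto_Re[OF S[of t]] by (simp add: Re_divide_of_real del: of_real_power)
  then show "Re (E t) = Re (E 0 + t * (E 1 - E 0))"
    using schwarz_affine_real[of "\<lambda>t. Re (E t)" t] c by (simp add: isCont_Re)
  have "((\<lambda>h. (Im (E (t + h)) + Im (E (t - h)) - 2 * Im (E t)) / h\<^sup>2) \<longlongrightarrow> 0) (at_right 0)" for t
    using tendsto_Im[OF S[of t]] by (simp add: Im_divide_of_real del: of_real_power)
  then show "Im (E t) = Im (E 0 + t * (E 1 - E 0))"
    using schwarz_affine_real[of "\<lambda>t. Im (E t)" t] c by (simp add: isCont_Im)
qed

lemma continuous_antiderivative:
  fixes g :: "real \<Rightarrow> complex"
  assumes "\<And>t. isCont g t"
  shows "\<exists>H. \<forall>t. (H has_vector_derivative g t) (at t)"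
proof (intro exI allI)
  fix t :: real
  define R where "R = \<bar>t\<bar> + 1"
  have "((\<lambda>u. interval_lebesgue_integral lborel (ereal 0) (ereal u) g) has_vector_derivative g t) (at t within {-R..R})"
    by (rule interval_integral_FTC2) (auto simp: R_def intro!: continuous_at_imp_continuous_on assms)
  moreover have "t \<in> interior {-R..R}" by (auto simp: R_def)
  ultimately show "((\<lambda>u. interval_lebesgue_integral lborel (ereal 0) (ereal u) g) has_vector_derivative g t) (at t)"
    by (simp only: at_within_interior)
qed

text \<open>The error term vanishes to first order at \<open>h = 0\<close> and its second derivative is small near 0, so two
  applications of the mean value inequality bound it by a small multiple of \<open>h\<^sup>2\<close>.\<close>
lemma second_difference_tendsto:
  fixes H H1 g :: "real \<Rightarrow> complex"
  assumes H: "\<And>t. (H has_vector_derivative H1 t) (at t)" and H1: "\<And>t. (H1 has_vector_derivative g t) (at t)"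
    and g: "isCont g t"
  shows "((\<lambda>h. (H (t + h) + H (t - h) - 2 * H t) / of_real (h\<^sup>2)) \<longlongrightarrow> g t) (at_right 0)"
proof (rule tendstoI)
  fix e :: real assume e: "e > 0"
  then obtain r where r: "r > 0" "\<And>x. dist x t < r \<Longrightarrow> dist (g x) (g t) < e / 4"
    using g unfolding continuous_at_eps_delta by (metis zero_less_divide_iff zero_less_numeral)
  define K where "K h = H (t + h) + H (t - h) - 2 * H t - (h\<^sup>2) *\<^sub>R g t" for h
  define K1 where "K1 h = H1 (t + h) - H1 (t - h) - (2 * h) *\<^sub>R g t" for h
  define K2 where "K2 h = g (t + h) + g (t - h) - 2 *\<^sub>R g t" for h
  have shift: "((\<lambda>h. f (t + h)) has_vector_derivative f' (t + x)) (at x)"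
    "((\<lambda>h. f (t - h)) has_vector_derivative - f' (t - x)) (at x)"
    if "\<And>t. (f has_vector_derivative f' t) (at t)" for f f' :: "real \<Rightarrow> complex" and x
  proof -
    have "((f \<circ> (\<lambda>h. t + h)) has_vector_derivative 1 *\<^sub>R f' (t + x)) (at x)"
      by (rule vector_diff_chain_at) (auto intro!: derivative_eq_intros that)
    then show "((\<lambda>h. f (t + h)) has_vector_derivative f' (t + x)) (at x)" by (simp add: o_def)
    have "((f \<circ> (\<lambda>h. t - h)) has_vector_derivative (-1) *\<^sub>R f' (t - x)) (at x)"
      by (rule vector_diff_chain_at) (auto intro!: derivative_eq_intros that)
    then show "((\<lambda>h. f (t - h)) has_vector_derivative - f' (t - x)) (at x)" by (simp add: o_def)
  qed
  have dK: "(K has_vector_derivative K1 x) (at x within S)" for x S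
  proof -
    have "(K has_vector_derivative (H1 (t + x) + - H1 (t - x) - 0 - (2 * x) *\<^sub>R g t)) (at x)"
      unfolding K_def
      by (intro has_vector_derivative_add has_vector_derivative_diff shift[OF H] has_vector_derivative_const)
         (auto intro!: derivative_eq_intros simp: has_vector_derivative_def)
    then show ?thesis by (simp add: K1_def has_vector_derivative_at_within)
  qed
  have dK1: "(K1 has_vector_derivative K2 x) (at x within S)" for x S
  proof -
    have "(K1 has_vector_derivative (g (t + x) - - g (t - x) - 2 *\<^sub>R g t)) (at x)"
      unfolding K1_def
      by (intro has_vector_derivative_diff shift[OF H1])
         (auto intro!: derivative_eq_intros simp: has_vector_derivative_def)
    then show ?thesis by (simp add: K2_def has_vector_derivative_at_within)
  qed
  have K2b: "norm (K2 x) \<le> e / 2" if "0 \<le> x" "x < r" for x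
  proof -
    have "K2 x = (g (t + x) - g t) + (g (t - x) - g t)" by (simp add: K2_def scaleR_2)
    then have "norm (K2 x) \<le> norm (g (t + x) - g t) + norm (g (t - x) - g t)" by (metis norm_triangle_ineq)
    moreover have "norm (g (t + x) - g t) < e / 4" "norm (g (t - x) - g t) < e / 4"
      using r(2)[of "t + x"] r(2)[of "t - x"] that by (auto simp: dist_norm)
    ultimately show ?thesis by linarith
  qed
  have K1b: "norm (K1 x) \<le> x * (e / 2)" if x: "0 \<le> x" "x < r" for x
  proof -
    have "norm (K1 x - K1 0 - (x - 0) *\<^sub>R K2 0) \<le> norm (x - 0) * (e / 2)"
      by (rule vector_differentiable_bound_linearization[of "{0..x}" K1 K2])
         (use x dK1 K2b in \<open>auto simp: closed_segment_eq_real_ivl K2_def scaleR_2\<close>)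
    then show ?thesis using x by (simp add: K1_def K2_def scaleR_2)
  qed
  have Kb: "norm (K x) \<le> x * (x * (e / 2))" if x: "0 \<le> x" "x < r" for x
  proof -
    have b: "norm (K1 y - K1 0) \<le> x * (e / 2)" if "y \<in> {0..x}" for y
    proof -
      have "norm (K1 y) \<le> y * (e / 2)" using that x by (intro K1b) auto
      also have "\<dots> \<le> x * (e / 2)" using that e by (intro mult_right_mono) auto
      finally show ?thesis by (simp add: K1_def)
    qed
    have "norm (K x - K 0 - (x - 0) *\<^sub>R K1 0) \<le> norm (x - 0) * (x * (e / 2))"
      by (rule vector_differentiable_bound_linearization[of "{0..x}" K K1])
         (use x dK b in \<open>auto simp: closed_segment_eq_real_ivl\<close>)
    then show ?thesis using x by (simp add: K1_def K_def)
  qed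
  have "\<forall>\<^sub>F h in at_right 0. h \<in> {0<..<r}"
    using r(1) by (rule eventually_at_right_real)
  then show "\<forall>\<^sub>F h in at_right 0. dist ((H (t + h) + H (t - h) - 2 * H t) / of_real (h\<^sup>2)) (g t) < e"
  proof eventually_elim
    case (elim h)
    then have h: "0 < h" "h < r" by auto
    have "(H (t + h) + H (t - h) - 2 * H t) / of_real (h\<^sup>2) - g t = K h / of_real (h\<^sup>2)"
      using h by (simp add: K_def field_simps scaleR_conv_of_real)
    moreover have n: "norm (K h / of_real (h\<^sup>2)) = norm (K h) / (h * h)"
      using h by (simp add: norm_divide power2_eq_square norm_mult)
    have "norm (K h) / (h * h) \<le> e / 2"
      using Kb[of h] h by (simp add: divide_le_eq mult_ac)
    then have "norm (K h) / (h * h) < e" using e by linarith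
    ultimately show ?case unfolding dist_norm by (metis n)
  qed
qed

section \<open>Orthogonality relations for one-sided trigonometric series\<close>

text \<open>Orthogonality to all translates is preserved by differentiation in the translation parameter.\<close>
lemma orthogonal_deriv:
  fixes k q q' :: "real \<Rightarrow> complex"
  assumes k: "continuous_on UNIV k" and q: "\<And>t. (q has_vector_derivative q' t) (at t)"
    and q': "continuous_on UNIV q'" and z: "\<And>s. integral {0..1} (\<lambda>t. k t * q (t + s)) = 0"
  shows "integral {0..1} (\<lambda>t. k t * q' (t + s)) = 0"
proof -
  have qc: "continuous_on UNIV q"
    by (rule continuous_at_imp_continuous_on) (use q has_vector_derivative_continuous in blast)
  have "((\<lambda>s. integral (cbox 0 1) (\<lambda>t. k t * q (t + s))) has_vector_derivative
      integral (cbox 0 1) (\<lambda>t. k t * q' (t + s))) (at s within UNIV)"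
  proof (rule leibniz_rule_vector_derivative)
    fix x t :: real
    have "((q \<circ> (\<lambda>s. t + s)) has_vector_derivative 1 *\<^sub>R q' (t + x)) (at x)"
      by (rule vector_diff_chain_at) (auto intro!: derivative_eq_intros q)
    then have "((\<lambda>s. q (t + s)) has_vector_derivative q' (t + x)) (at x)" by (simp add: o_def)
    from has_vector_derivative_mult_right[OF this, of "k t"]
    show "((\<lambda>s. k t * q (t + s)) has_vector_derivative k t * q' (t + x)) (at x within UNIV)" .
  next
    fix x :: real
    show "(\<lambda>t. k t * q (t + x)) integrable_on cbox 0 1"
      by (intro integrable_continuous continuous_intros continuous_on_subset[OF k]
          continuous_on_compose2[OF qc]) auto
  next
    have "continuous_on (UNIV \<times> cbox 0 1) (\<lambda>p. k (snd p) * q' (snd p + fst p))"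
      by (intro continuous_intros continuous_on_compose2[OF k] continuous_on_compose2[OF q']) auto
    then show "continuous_on (UNIV \<times> cbox 0 1) (\<lambda>(x, t). k t * q' (t + x))"
      by (simp add: case_prod_unfold)
  qed auto
  then have "((\<lambda>s. 0) has_vector_derivative integral {0..1} (\<lambda>t. k t * q' (t + s))) (at s)"
    by (simp add: z)
  then show ?thesis using vector_derivative_unique_at has_vector_derivative_const by blast
qed

lemma cis_series_second_difference:
  fixes x t :: real
  shows "cis (x * (t + h)) + cis (x * (t - h)) - 2 * cis (x * t) = - (of_real ((2 * sin (x * h / 2))\<^sup>2) * cis (x * t))"
proof -
  have "cis (x * (t + h)) + cis (x * (t - h)) = cis (x * t) * (cis (x * h) + cis (- (x * h)))"
    by (simp add: cis_mult ring_distribs)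
  also have "cis (x * h) + cis (- (x * h)) = of_real (2 * cos (x * h))"
    by (simp add: complex_eq_iff)
  also have "2 * cos (x * h) = 2 - (2 * sin (x * h / 2))\<^sup>2"
    using cos_double_sin[of "x * h / 2"] by (simp add: power2_eq_square)
  finally show ?thesis by (simp add: algebra_simps)
qed

text \<open>A pointwise convergent trigonometric series with continuous sum \<open>g\<close> has bounded coefficients, so the series
  integrated twice converges uniformly to a continuous G. Its second symmetric derivative is the Riemann sum of the
  original series, that is \<open>g\<close>; so G differs from a second antiderivative of \<open>g\<close> by a function to which Schwarz's
  lemma applies.\<close>
lemma second_antiderivative_of_series:
  fixes A :: "nat \<Rightarrow> complex" and g :: "real \<Rightarrow> complex"
  defines "x \<equiv> \<lambda>n. 2 * pi * real (Suc n)"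
  defines "G \<equiv> \<lambda>t. \<Sum>n. - (A n / of_real ((x n)\<^sup>2)) * cis (- (x n * t))"
  assumes s: "\<And>t. (\<lambda>n. A n * cis (- (x n * t))) sums g t" and g: "\<And>t. isCont g t"
  shows "uniform_limit UNIV (\<lambda>N t. \<Sum>n<N. - (A n / of_real ((x n)\<^sup>2)) * cis (- (x n * t))) G sequentially"
    and "\<exists>G1. \<forall>t. (G has_vector_derivative G1 t) (at t) \<and> (G1 has_vector_derivative g t) (at t)"
proof -
  have x: "x n > 0" "x n \<ge> real (Suc n)" for n
    using pi_gt3 mult_right_mono[of 1 "2 * pi" "real (Suc n)"] by (auto simp: x_def)
  have "A \<longlonglongrightarrow> 0" using summable_LIMSEQ_zero[OF sums_summable[OF s[of 0]]] by simp
  then have "Bseq A" by (simp add: convergentI convergent_imp_Bseq)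
  then obtain K where K: "K > 0" "\<And>n. norm (A n) \<le> K" unfolding Bseq_def by blast
  define c where "c n t = - (A n / of_real ((x n)\<^sup>2)) * cis (- (x n * t))" for n t
  have cb: "norm (c n t) \<le> K * inverse (real (Suc n) ^ 2)" for n t
  proof -
    have "norm (c n t) = norm (A n) / (x n)\<^sup>2" using x[of n] by (simp add: c_def norm_mult norm_divide norm_power)
    also have "\<dots> \<le> K / (real (Suc n))\<^sup>2"
      using K x[of n] by (intro frac_le power_mono) auto
    finally show ?thesis by (simp add: divide_inverse)
  qed
  have sm: "summable (\<lambda>n. K * inverse (real (Suc n) ^ 2))"
    using inverse_power_summable[of 2, where 'a = real] by (intro summable_mult) (subst summable_Suc_iff, simp)
  have u: "uniform_limit UNIV (\<lambda>N t. \<Sum>n<N. c n t) (\<lambda>t. \<Sum>n. c n t) sequentially"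
    by (rule Weierstrass_m_test[OF _ sm]) (rule cb)
  have Gc: "G = (\<lambda>t. \<Sum>n. c n t)" by (simp add: G_def c_def)
  show "uniform_limit UNIV (\<lambda>N t. \<Sum>n<N. - (A n / of_real ((x n)\<^sup>2)) * cis (- (x n * t))) G sequentially"
    using u unfolding Gc c_def .
  have cG: "continuous_on UNIV G"
    unfolding Gc by (rule uniform_limit_theorem[OF _ u]) (auto intro!: always_eventually continuous_intros simp: c_def less_imp_neq[OF x(1), symmetric])
  have sG: "(\<lambda>n. c n t) sums G t" for t
    unfolding Gc by (intro summable_sums summable_comparison_test[OF _ sm]) (use cb in blast)
  have G2: "((\<lambda>h. (G (t + h) + G (t - h) - 2 * G t) / of_real (h\<^sup>2)) \<longlongrightarrow> g t) (at_right 0)" for t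
  proof -
    \<comment> \<open>The step \<open>h / pi\<close> turns the half phase \<open>x n * (h / pi) / 2\<close> into \<open>(n + 1) * h\<close>.\<close>
    define D where "D h = (G (t + h / pi) + G (t - h / pi) - 2 * G t) / of_real ((h / pi)\<^sup>2)" for h
    have "(D \<longlongrightarrow> g t) (at_right 0)"
    proof (rule riemann_summation[OF s])
      fix h :: real assume h: "h > 0"
      have "(\<lambda>n. (c n (t + h / pi) + c n (t - h / pi) - 2 * c n t) / of_real ((h / pi)\<^sup>2)) sums D h"
        unfolding D_def by (intro sums_divide sums_diff sums_add sums_mult sG)
      moreover have "(c n (t + h / pi) + c n (t - h / pi) - 2 * c n t) / of_real ((h / pi)\<^sup>2)
          = A n * cis (- (x n * t)) * of_real (sinc2 (real (Suc n) * h))" for n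
      proof -
        have "c n (t + h / pi) + c n (t - h / pi) - 2 * c n t
          = - (A n / of_real ((x n)\<^sup>2)) * (cis (- x n * (t + h / pi)) + cis (- x n * (t - h / pi)) - 2 * cis (- x n * t))"
          by (simp add: c_def algebra_simps)
        also have "\<dots> = A n / of_real ((x n)\<^sup>2) * (of_real ((2 * sin (- x n * (h / pi) / 2))\<^sup>2) * cis (- x n * t))"
          unfolding cis_series_second_difference by simp
        also have "- x n * (h / pi) / 2 = - (real (Suc n) * h)" by (simp add: x_def)
        also have "A n / of_real ((x n)\<^sup>2) * (of_real ((2 * sin (- (real (Suc n) * h)))\<^sup>2) * cis (- x n * t)) / of_real ((h / pi)\<^sup>2)
           = A n * cis (- (x n * t)) * of_real ((2 * sin (real (Suc n) * h))\<^sup>2 / ((x n)\<^sup>2 * (h / pi)\<^sup>2))"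
          by simp
        also have "(2 * sin (real (Suc n) * h))\<^sup>2 / ((x n)\<^sup>2 * (h / pi)\<^sup>2) = sinc2 (real (Suc n) * h)"
          unfolding sinc2_def x_def using h by (simp add: power_divide power_mult_distrib field_simps del: of_nat_Suc)
        finally show ?thesis .
      qed
      ultimately show "(\<lambda>n. A n * cis (- (x n * t)) * of_real (sinc2 (real (Suc n) * h))) sums D h" by simp
    qed
    moreover have "filterlim (\<lambda>h. pi * h) (at_right 0) (at_right (0::real))"
      unfolding filterlim_at by (auto simp: eventually_at_filter intro!: tendsto_eq_intros)
    ultimately have "((\<lambda>h. D (pi * h)) \<longlongrightarrow> g t) (at_right 0)" by (rule filterlim_compose)
    then show ?thesis by (simp add: D_def)
  qed
  obtain H1 where H1: "\<And>t. (H1 has_vector_derivative g t) (at t)"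
    using continuous_antiderivative[of g] g by blast
  have "isCont H1 t" for t using H1 has_vector_derivative_continuous by blast
  then obtain H where H: "\<And>t. (H has_vector_derivative H1 t) (at t)"
    using continuous_antiderivative[of H1] by blast
  have cH: "isCont H t" for t using H has_vector_derivative_continuous by blast
  define E where "E t = G t - H t" for t
  have "E t = E 0 + t * (E 1 - E 0)" for t
  proof (rule schwarz_affine)
    show "isCont E t" for t
      unfolding E_def using cG cH by (intro continuous_intros) (auto simp: continuous_on_eq_continuous_at)
    fix t
    have "((\<lambda>h. (G (t + h) + G (t - h) - 2 * G t) / of_real (h\<^sup>2) - (H (t + h) + H (t - h) - 2 * H t) / of_real (h\<^sup>2)) \<longlongrightarrow> g t - g t) (at_right 0)"
      by (intro tendsto_diff G2 second_difference_tendsto[OF H H1 g])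
    moreover have "(G (t + h) + G (t - h) - 2 * G t) / of_real (h\<^sup>2) - (H (t + h) + H (t - h) - 2 * H t) / of_real (h\<^sup>2)
       = (E (t + h) + E (t - h) - 2 * E t) / of_real (h\<^sup>2)" for h :: real
      by (simp add: E_def diff_divide_distrib[symmetric] algebra_simps del: of_real_power)
    ultimately show "((\<lambda>h. (E (t + h) + E (t - h) - 2 * E t) / of_real (h\<^sup>2)) \<longlongrightarrow> 0) (at_right 0)" by simp
  qed
  then have Geq: "G = (\<lambda>t. H t + (E 0 + t *\<^sub>R (E 1 - E 0)))" by (auto simp: E_def scaleR_conv_of_real fun_eq_iff algebra_simps)
  show "\<exists>G1. \<forall>t. (G has_vector_derivative G1 t) (at t) \<and> (G1 has_vector_derivative g t) (at t)"
  proof (intro exI allI conjI)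
    fix t :: real
    have "((\<lambda>t. H t + (E 0 + t *\<^sub>R (E 1 - E 0))) has_vector_derivative H1 t + (0 + 1 *\<^sub>R (E 1 - E 0))) (at t)"
      by (intro has_vector_derivative_add H has_vector_derivative_const)
         (auto intro!: derivative_eq_intros simp: has_vector_derivative_def)
    then show "(G has_vector_derivative H1 t + (E 1 - E 0)) (at t)" unfolding Geq by simp
    have "((\<lambda>t. H1 t + (E 1 - E 0)) has_vector_derivative g t + 0) (at t)"
      by (intro has_vector_derivative_add H1 has_vector_derivative_const)
    then show "((\<lambda>t. H1 t + (E 1 - E 0)) has_vector_derivative g t) (at t)" by simp
  qed
qed

text \<open>A kernel orthogonal to every exponential of the series is orthogonal to all translates of the twice integrated
  series, by uniform convergence; differentiating in the translation returns to \<open>g\<close> and then to \<open>g'\<close>.\<close>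
lemma series_orthogonal:
  fixes A :: "nat \<Rightarrow> complex" and g g' k :: "real \<Rightarrow> complex"
  assumes g: "\<And>t. (g has_vector_derivative g' t) (at t)" and g': "continuous_on UNIV g'"
    and s: "\<And>t. (\<lambda>n. A n * cis (- (2 * pi * real (Suc n) * t))) sums g t"
    and k: "continuous_on UNIV k"
    and orth: "\<And>n. integral {0..1} (\<lambda>t. k t * cis (- (2 * pi * real (Suc n) * t))) = 0"
  shows "integral {0..1} (\<lambda>t. k t * g t) = 0" and "integral {0..1} (\<lambda>t. k t * g' t) = 0"
proof -
  define x where "x n = 2 * pi * real (Suc n)" for n
  define c where "c n = - (A n / of_real ((x n)\<^sup>2))" for n
  define G where "G t = (\<Sum>n. c n * cis (- (x n * t)))" for t
  have gc: "isCont g t" for t using g has_vector_derivative_continuous by blast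
  note P = second_antiderivative_of_series[of A g, folded x_def, OF s[folded x_def] gc, folded c_def, folded G_def]
  have u: "uniform_limit UNIV (\<lambda>N t. \<Sum>n<N. c n * cis (- (x n * t))) G sequentially"
    using P(1) by (simp add: G_def[abs_def])
  obtain G1 where G1: "\<And>t. (G has_vector_derivative G1 t) (at t)" "\<And>t. (G1 has_vector_derivative g t) (at t)"
    using P(2) by (auto simp: G_def[abs_def])
  have z: "integral {0..1} (\<lambda>t. k t * G (t + s)) = 0" for s
  proof -
    define P where "P N t = (\<Sum>n<N. c n * cis (- (x n * (t + s))))" for N t
    have "uniform_limit UNIV (\<lambda>N t. P N t) (\<lambda>t. G (t + s)) sequentially"
      unfolding P_def using uniform_limit_compose'[OF u, of "\<lambda>t. t + s" UNIV] by simp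
    then have uP: "uniform_limit {0..1} P (\<lambda>t. G (t + s)) sequentially"
      by (rule uniform_limit_on_subset) simp
    have Gs: "continuous_on UNIV G"
      by (rule continuous_at_imp_continuous_on) (use G1(1) has_vector_derivative_continuous in blast)
    have b1: "bounded (k ` {0..1})"
      by (intro compact_imp_bounded compact_continuous_image continuous_on_subset[OF k]) auto
    have b2: "bounded ((\<lambda>t. G (t + s)) ` {0..1})"
      by (intro compact_imp_bounded compact_continuous_image continuous_on_compose2[OF Gs] continuous_intros) auto
    have "uniform_limit {0..1} (\<lambda>N t. k t * P N t) (\<lambda>t. k t * G (t + s)) sequentially"
      by (rule bounded_bilinear.bounded_uniform_limit[OF bounded_bilinear_mult uniform_limit_const[where c = k] uP b2 b1])
    moreover have cP: "continuous_on {0..1} (\<lambda>t. k t * P N t)" for N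
      unfolding P_def by (intro continuous_intros continuous_on_subset[OF k]) auto
    ultimately obtain I J where I: "\<And>N. ((\<lambda>t. k t * P N t) has_integral I N) {0..1}"
      and J: "((\<lambda>t. k t * G (t + s)) has_integral J) {0..1}" and IJ: "I \<longlonglongrightarrow> J"
      by (rule uniform_limit_integral) auto
    have "I N = 0" for N
    proof -
      have "((\<lambda>t. k t * cis (- (x n * t))) has_integral 0) {0..1}" for n
      proof -
        have "(\<lambda>t. k t * cis (- (x n * t))) integrable_on {0..1}"
          by (intro integrable_continuous_real continuous_intros continuous_on_subset[OF k]) auto
        then show ?thesis using orth[of n] by (simp add: x_def has_integral_iff)
      qed
      then have "((\<lambda>t. (c n * cis (- (x n * s))) * (k t * cis (- (x n * t)))) has_integral (c n * cis (- (x n * s))) * 0) {0..1}" for n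
        by (intro has_integral_mult_right)
      then have "((\<lambda>t. \<Sum>n<N. (c n * cis (- (x n * s))) * (k t * cis (- (x n * t)))) has_integral (\<Sum>n<N. (c n * cis (- (x n * s))) * 0)) {0..1}"
        by (intro has_integral_sum) auto
      moreover have "(\<Sum>n<N. (c n * cis (- (x n * s))) * (k t * cis (- (x n * t)))) = k t * P N t" for t
      proof -
        have "cis (- (x n * (t + s))) = cis (- (x n * s)) * cis (- (x n * t))" for n
          by (simp add: cis_mult algebra_simps)
        then show ?thesis unfolding P_def sum_distrib_left by (simp add: mult_ac)
      qed
      ultimately have "((\<lambda>t. k t * P N t) has_integral 0) {0..1}" by simp
      then show ?thesis using I has_integral_unique by blast
    qed
    then have "I = (\<lambda>_. 0)" by auto
    then have "J = 0" using IJ LIMSEQ_unique[of I J 0] by simp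
    then show ?thesis using J by (simp add: has_integral_iff)
  qed
  have cG1: "continuous_on UNIV G1"
    by (rule continuous_at_imp_continuous_on) (use G1(2) has_vector_derivative_continuous in blast)
  have cg: "continuous_on UNIV g" using gc by (simp add: continuous_at_imp_continuous_on)
  have "integral {0..1} (\<lambda>t. k t * G1 (t + s)) = 0" for s
    by (rule orthogonal_deriv[OF k G1(1) cG1 z])
  then have *: "integral {0..1} (\<lambda>t. k t * g (t + s)) = 0" for s
    by (rule orthogonal_deriv[OF k G1(2) cg])
  show "integral {0..1} (\<lambda>t. k t * g t) = 0" using *[of 0] by simp
  from * have "integral {0..1} (\<lambda>t. k t * g' (t + 0)) = 0"
    by (rule orthogonal_deriv[OF k g g'])
  then show "integral {0..1} (\<lambda>t. k t * g' t) = 0" by simp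
qed

lemma integral_cis_multiple:
  assumes "m \<noteq> 0" shows "integral {0..1} (\<lambda>t. cis (2 * pi * of_int m * t)) = 0"
proof -
  let ?c = "2 * pi * of_int m * \<i> :: complex"
  have c: "?c \<noteq> 0" using assms by simp
  have "((\<lambda>t. cis (2 * pi * of_int m * t)) has_integral cis (2 * pi * of_int m * 1) / ?c - cis (2 * pi * of_int m * 0) / ?c) {0..1}"
  proof (rule fundamental_theorem_of_calculus)
    fix t :: real
    have "((\<lambda>t. cis (2 * pi * of_int m * t) / ?c) has_vector_derivative (?c * cis (2 * pi * of_int m * t)) / ?c) (at t within {0..1})"
    proof (rule has_vector_derivative_divide)
      show "((\<lambda>t. cis (2 * pi * of_int m * t)) has_vector_derivative ?c * cis (2 * pi * of_int m * t)) (at t within {0..1})"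
        unfolding has_vector_derivative_def
        by (auto intro!: derivative_eq_intros has_derivative_cis simp: scaleR_conv_of_real mult_ac)
    qed
    then show "((\<lambda>t. cis (2 * pi * of_int m * t) / ?c) has_vector_derivative cis (2 * pi * of_int m * t)) (at t within {0..1})"
      using c by simp
  qed simp
  moreover have "cis (2 * pi * of_int m) = 1"
    using cis_multiple_2pi[of "of_int m"] by (simp add: Ints_of_int)
  ultimately show ?thesis by (simp add: has_integral_iff)
qed

text \<open>The modes of \<open>h'\<close> are \<open>cnj w ^ n\<close> with \<open>n \<ge> 2\<close>. Products with \<open>w\<close>, with \<open>cnj w\<close> and with \<open>h'\<close> itself therefore
  still have only negative modes, and their means vanish.\<close>
lemma space_X_diff_orthogonal:
  fixes h h' :: "complex \<Rightarrow> complex"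
  assumes d: "\<And>w. w \<in> circ \<Longrightarrow> (h has_field_derivative h' w) (at w within circ)"
    and c: "continuous_on circ h'"
    and A: "\<And>w. w \<in> circ \<Longrightarrow> (\<lambda>n. of_real (A n) * cnj w ^ Suc n) sums h w"
  defines "c \<equiv> \<lambda>t. cis (2 * pi * t)"
  shows "integral {0..1} (\<lambda>t. h' (c t) * c t) = 0" "integral {0..1} (\<lambda>t. h' (c t) * cnj (c t)) = 0"
    and "integral {0..1} (\<lambda>t. h' (c t) ^ 2) = 0" and "integral {0..1} (\<lambda>t. h (c t)) = 0"
proof -
  define g where "g t = h (c t)" for t
  define g' where "g' t = (2 * pi * \<i> * c t) * h' (c t)" for t
  have cc: "c t \<in> circ" for t by (simp add: c_def)
  have ccont: "continuous_on UNIV c" unfolding c_def by (intro continuous_intros)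
  have hc: "continuous_on UNIV (\<lambda>t. h' (c t))"
    by (rule continuous_on_compose2[OF assms(2) ccont]) (auto simp: c_def)
  have dg: "(g has_vector_derivative g' t) (at t)" for t
  proof -
    have "(c has_vector_derivative 2 * pi * \<i> * c t) (at t)"
      unfolding c_def by (auto intro!: derivative_eq_intros simp: has_vector_derivative_def has_derivative_cis scaleR_conv_of_real)
    moreover have "(h has_field_derivative h' (c t)) (at (c t) within range c)"
      by (rule DERIV_subset[OF d[OF cc]]) (use cc in blast)
    ultimately have "((h \<circ> c) has_vector_derivative g' t) (at t)"
      unfolding g'_def by (intro field_vector_diff_chain_within) auto
    then show ?thesis unfolding g_def o_def .
  qed
  have g'c: "continuous_on UNIV g'" unfolding g'_def by (intro continuous_intros ccont hc)
  have ser: "(\<lambda>n. of_real (A n) * cis (- (2 * pi * real (Suc n) * t))) sums g t" for t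
  proof -
    have "cnj (c t) ^ Suc n = cis (- (2 * pi * real (Suc n) * t))" for n
      unfolding c_def cis_cnj by (simp only: Complex.DeMoivre) (simp add: mult_ac)
    then show ?thesis using A[OF cc, of t] by (simp add: g_def)
  qed
  have cm: "c t * cis (- (2 * pi * real (Suc n) * t)) = cis (2 * pi * of_int (1 - int (Suc n)) * t)" for n t
    by (simp add: c_def cis_mult algebra_simps)
  define e where "e m t = cis (2 * pi * of_int m * t)" for m and t :: real
  have ec: "continuous_on UNIV (e m)" for m unfolding e_def by (intro continuous_intros)
  have eprod: "e m t * cis (- (2 * pi * real (Suc n) * t)) = cis (2 * pi * of_int (m - int (Suc n)) * t)" for n m t
    by (simp add: e_def cis_mult algebra_simps)
  have O: "integral {0..1} (\<lambda>t. e m t * g' t) = 0" if "m \<le> 0" for m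
    by (rule series_orthogonal(2)[OF dg g'c ser ec]) (use that in \<open>simp only: eprod, intro integral_cis_multiple, simp\<close>)
  have "integral {0..1} (\<lambda>t. e 0 t * g t) = 0"
    by (rule series_orthogonal(1)[OF dg g'c ser ec]) (simp only: eprod, intro integral_cis_multiple, simp)
  then show "integral {0..1} (\<lambda>t. h (c t)) = 0" by (simp add: e_def g_def)
  have "(\<lambda>t. e 0 t * g' t) = (\<lambda>t. (2 * pi * \<i>) * (h' (c t) * c t))"
    by (auto simp: e_def g'_def)
  then show "integral {0..1} (\<lambda>t. h' (c t) * c t) = 0"
    using O[of 0] by simp
  have e2: "e (-2) t * c t = cnj (c t)" for t by (simp add: e_def c_def cis_mult cis_cnj mult.assoc)
  have "(\<lambda>t. e (-2) t * g' t) = (\<lambda>t. (2 * pi * \<i>) * (h' (c t) * cnj (c t)))"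
    by (auto simp: e2[symmetric] g'_def)
  then show "integral {0..1} (\<lambda>t. h' (c t) * cnj (c t)) = 0"
    using O[of "-2"] by simp
  define k where "k t = e (-2) t * g' t" for t
  have kc: "continuous_on UNIV k" unfolding k_def by (intro continuous_intros ec g'c)
  have "integral {0..1} (\<lambda>t. k t * g' t) = 0"
  proof (rule series_orthogonal(2)[OF dg g'c ser kc])
    fix n
    have "k t * cis (- (2 * pi * real (Suc n) * t)) = e (-2 - int (Suc n)) t * g' t" for t
      using eprod[of "-2" t n] by (simp add: k_def e_def mult_ac)
    then show "integral {0..1} (\<lambda>t. k t * cis (- (2 * pi * real (Suc n) * t))) = 0"
      using O[of "-2 - int (Suc n)"] by simp
  qed
  moreover have "k t * g' t = (2 * pi * \<i>)\<^sup>2 * h' (c t) ^ 2" for t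
  proof -
    have eps: "e (-2) t * c t * c t = 1" unfolding e2 by (simp add: c_def cis_cnj cis_mult)
    have "k t * g' t = (2 * pi * \<i>)\<^sup>2 * h' (c t) ^ 2 * (e (-2) t * c t * c t)"
      unfolding k_def g'_def by (simp add: power2_eq_square)
    then show ?thesis unfolding eps by (simp only: mult_1_right)
  qed
  ultimately show "integral {0..1} (\<lambda>t. h' (c t) ^ 2) = 0" by simp
qed

section \<open>Increments of functions on the circle and the energy of the derivative\<close>

definition C1circ :: "(complex \<Rightarrow> complex) \<Rightarrow> (complex \<Rightarrow> complex) \<Rightarrow> bool" where
  "C1circ h h' \<longleftrightarrow> (\<forall>w\<in>circ. (h has_field_derivative h' w) (at w within circ)) \<and> continuous_on circ h'"

lemma C1circD:
  assumes "C1circ h h'"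
  shows "w \<in> circ \<Longrightarrow> (h has_field_derivative h' w) (at w within circ)" "continuous_on circ h'" "continuous_on circ h"
  using assms by (auto simp: C1circ_def intro!: DERIV_continuous_on)

lemma C1circ_diff:
  assumes "C1circ f f'" "C1circ g g'" shows "C1circ (\<lambda>w. f w - g w) (\<lambda>w. f' w - g' w)"
  unfolding C1circ_def
proof (intro conjI ballI)
  show "continuous_on circ (\<lambda>w. f' w - g' w)"
    using C1circD(2)[OF assms(1)] C1circD(2)[OF assms(2)] by (rule continuous_on_diff)
  show "((\<lambda>w. f w - g w) has_field_derivative f' w - g' w) (at w within circ)" if "w \<in> circ" for w
    using C1circD(1)[OF assms(1) that] C1circD(1)[OF assms(2) that] by (rule DERIV_diff)
qed

lemma rot_circ: "w \<in> circ \<Longrightarrow> w * cis x \<in> circ" by (simp add: norm_mult)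

lemma continuous_on_rot:
  assumes "continuous_on circ h" "w \<in> circ" shows "continuous_on S (\<lambda>t. h (w * cis (2 * pi * t)))"
  by (rule continuous_on_compose2[OF assms(1)]) (use rot_circ[OF assms(2)] in \<open>auto intro!: continuous_intros\<close>)

text \<open>By concavity of the sine, chords are comparable to arcs.\<close>
lemma chord_lower:
  assumes "0 \<le> t" "t \<le> 1" shows "4 * min t (1 - t) \<le> norm (cis (2 * pi * t) - 1)"
proof -
  have s: "2 * t \<le> sin (pi * t)" if "0 \<le> t" "t \<le> 1/2" for t
  proof -
    have "concave_on {0..pi} sin"
    proof (rule f''_le0_imp_concave)
      show "((\<lambda>x. - sin x) x) \<le> 0" if "x \<in> {0..pi}" for x using that by (simp add: sin_ge_zero)
    qed (auto intro!: derivative_eq_intros)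
    then have "(1 - 2 * t) * sin 0 + 2 * t * sin (pi / 2) \<le> sin ((1 - 2 * t) *\<^sub>R 0 + (2 * t) *\<^sub>R (pi / 2))"
      using that by (intro concave_onD) auto
    then show ?thesis by (simp add: mult.commute)
  qed
  have "2 * min t (1 - t) \<le> \<bar>sin (pi * t)\<bar>"
  proof (cases "t \<le> 1/2")
    case True then show ?thesis using s[of t] assms by simp
  next
    case False
    have "sin (pi * (1 - t)) = sin (pi * t)" by (simp add: right_diff_distrib)
    then show ?thesis using s[of "1 - t"] assms False by (simp add: min_def)
  qed
  moreover have "norm (cis (2 * pi * t) - 1) = 2 * \<bar>sin (pi * t)\<bar>"
  proof (rule power2_eq_imp_eq)
    have "(norm (cis (2 * pi * t) - 1))\<^sup>2 = (cos (2 * pi * t) - 1)\<^sup>2 + (sin (2 * pi * t))\<^sup>2"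
      by (simp add: cmod_power2)
    also have "\<dots> = 2 - 2 * cos (2 * pi * t)"
      using sin_cos_squared_add[of "2 * pi * t"] by (simp add: power2_eq_square algebra_simps)
    also have "\<dots> = (2 * \<bar>sin (pi * t)\<bar>)\<^sup>2"
      using cos_double_sin[of "pi * t"] by (simp add: mult_ac power_mult_distrib)
    finally show "(norm (cis (2 * pi * t) - 1))\<^sup>2 = (2 * \<bar>sin (pi * t)\<bar>)\<^sup>2" .
  qed auto
  ultimately show ?thesis by linarith
qed

lemma path_deriv:
  assumes h: "C1circ h h'" and w: "w \<in> circ"
  shows "((\<lambda>t. h (w * cis (2 * pi * t))) has_vector_derivative
          (2 * pi * \<i> * (w * cis (2 * pi * t))) * h' (w * cis (2 * pi * t))) (at t within S)"
proof -
  let ?c = "\<lambda>t. w * cis (2 * pi * t)"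
  have "(?c has_vector_derivative 2 * pi * \<i> * ?c t) (at t)"
    by (auto intro!: derivative_eq_intros simp: has_vector_derivative_def has_derivative_cis scaleR_conv_of_real)
  moreover have "(h has_field_derivative h' (?c t)) (at (?c t) within range ?c)"
    by (rule DERIV_subset[OF C1circD(1)[OF h rot_circ[OF w]]]) (use rot_circ[OF w] in blast)
  ultimately have "((h \<circ> ?c) has_vector_derivative (2 * pi * \<i> * ?c t) * h' (?c t)) (at t)"
    by (intro field_vector_diff_chain_within) auto
  then show ?thesis by (simp add: o_def has_vector_derivative_at_within)
qed

lemma path_increment:
  assumes h: "C1circ h h'" and w: "w \<in> circ" and ab: "a \<le> b"
  shows "norm (h (w * cis (2 * pi * b)) - h (w * cis (2 * pi * a))) \<le> 2 * pi * integral {a..b} (\<lambda>x. norm (h' (w * cis (2 * pi * x))))"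
proof -
  let ?c = "\<lambda>t. w * cis (2 * pi * t)"
  have "((\<lambda>t. (2 * pi * \<i> * ?c t) * h' (?c t)) has_integral h (?c b) - h (?c a)) {a..b}"
    by (rule fundamental_theorem_of_calculus[OF ab]) (rule path_deriv[OF h w])
  then have e: "h (?c b) - h (?c a) = integral {a..b} (\<lambda>t. (2 * pi * \<i> * ?c t) * h' (?c t))"
    and i: "(\<lambda>t. (2 * pi * \<i> * ?c t) * h' (?c t)) integrable_on {a..b}"
    by (simp_all add: has_integral_iff)
  have "norm (h (?c b) - h (?c a)) \<le> integral {a..b} (\<lambda>x. 2 * pi * norm (h' (?c x)))"
    unfolding e
  proof (rule integral_norm_bound_integral[OF i])
    show "(\<lambda>x. 2 * pi * norm (h' (?c x))) integrable_on {a..b}"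
      by (intro integrable_continuous_real continuous_intros continuous_on_rot[OF C1circD(2)[OF h] w])
    show "norm ((2 * pi * \<i> * ?c t) * h' (?c t)) \<le> 2 * pi * norm (h' (?c t))" for t
      using w by (simp add: norm_mult)
  qed
  then show ?thesis by simp
qed

text \<open>The Cauchy-Schwarz inequality with the constant function 1: the variance of \<open>g\<close> is nonnegative.\<close>
lemma integral_square_le:
  fixes g :: "real \<Rightarrow> real"
  assumes g: "continuous_on {a..b} g" and ab: "a \<le> b"
  shows "(integral {a..b} g)\<^sup>2 \<le> (b - a) * integral {a..b} (\<lambda>x. (g x)\<^sup>2)"
proof (cases "a = b")
  case False
  then have L: "b - a > 0" using ab by simp
  define m where "m = integral {a..b} g / (b - a)"
  have ig: "g integrable_on {a..b}" "(\<lambda>x. (g x)\<^sup>2) integrable_on {a..b}"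
    by (intro integrable_continuous_real continuous_intros g)+
  have "0 \<le> integral {a..b} (\<lambda>x. (g x - m)\<^sup>2)"
    by (intro integral_nonneg integrable_continuous_real continuous_intros g) auto
  also have "((\<lambda>x. (g x)\<^sup>2 - (2 * m) * g x + m\<^sup>2) has_integral
      integral {a..b} (\<lambda>x. (g x)\<^sup>2) - (2 * m) * integral {a..b} g + (b - a) *\<^sub>R m\<^sup>2) {a..b}"
    using ab by (intro has_integral_add has_integral_diff has_integral_mult_right integrable_integral ig has_integral_const_real)
      (metis has_integral_const_real content_real)
  then have "integral {a..b} (\<lambda>x. (g x - m)\<^sup>2) = integral {a..b} (\<lambda>x. (g x)\<^sup>2) - (2 * m) * integral {a..b} g + (b - a) * m\<^sup>2"
    by (simp add: power2_diff algebra_simps has_integral_iff)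
  also have "\<dots> = integral {a..b} (\<lambda>x. (g x)\<^sup>2) - (integral {a..b} g)\<^sup>2 / (b - a)"
    using L by (simp add: m_def power2_eq_square)
  finally have "(integral {a..b} g)\<^sup>2 / (b - a) \<le> integral {a..b} (\<lambda>x. (g x)\<^sup>2)" by simp
  then show ?thesis using L by (simp add: pos_divide_le_eq mult.commute)
qed simp

definition energy :: "(complex \<Rightarrow> complex) \<Rightarrow> real" where
  "energy h' = integral {0..1} (\<lambda>t. (norm (h' (cis (2 * pi * t))))\<^sup>2)"

lemma integral_rot:
  assumes "w \<in> circ"
  shows "integral {0..1} (\<lambda>t. q (w * cis (2 * pi * t)) :: complex) = integral {0..1} (\<lambda>t. q (cis (2 * pi * t)))"
proof -
  have "integral {0..1} (\<lambda>t. q (v * cis (2 * pi * t))) = fint (\<lambda>\<tau>. q \<tau> / \<tau>)" if "v \<in> circ" for v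
  proof -
    have "v * cis x \<noteq> 0" for x using rot_circ[OF that, of x] by auto
    then show ?thesis unfolding fint_rot[OF that] by simp
  qed
  from this[OF assms] this[of 1] show ?thesis by simp
qed

lemma integral_rot_real:
  assumes "w \<in> circ" "continuous_on circ q"
  shows "integral {0..1} (\<lambda>t. q (w * cis (2 * pi * t)) :: real) = integral {0..1} (\<lambda>t. q (cis (2 * pi * t)))"
proof -
  have i: "(\<lambda>t. q (v * cis (2 * pi * t))) integrable_on {0..1}" if "v \<in> circ" for v
    by (intro integrable_continuous_real continuous_on_compose2[OF assms(2)])
      (use rot_circ[OF that] in \<open>auto intro!: continuous_intros\<close>)
  have e: "integral {0..1} (\<lambda>t. complex_of_real (q (v * cis (2 * pi * t)))) = of_real (integral {0..1} (\<lambda>t. q (v * cis (2 * pi * t))))" if "v \<in> circ" for v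
    using integral_linear[OF i[OF that] bounded_linear_of_real] by (simp add: o_def)
  show ?thesis
    using integral_rot[OF assms(1), of "\<lambda>v. of_real (q v)"] e[OF assms(1)] e[of 1] by simp
qed

lemma energy_rot:
  assumes "continuous_on circ h'" "w \<in> circ"
  shows "integral {0..1} (\<lambda>t. (norm (h' (w * cis (2 * pi * t))))\<^sup>2) = energy h'"
  unfolding energy_def by (rule integral_rot_real[OF assms(2)]) (intro continuous_intros assms(1))

lemma path_increment_energy:
  assumes h: "C1circ h h'" and w: "w \<in> circ" and ab: "0 \<le> a" "a \<le> b" "b \<le> 1"
    and N: "energy h' \<le> N\<^sup>2" "0 \<le> N"
  shows "integral {a..b} (\<lambda>x. norm (h' (w * cis (2 * pi * x)))) \<le> sqrt (b - a) * N"
    and "norm (h (w * cis (2 * pi * b)) - h (w * cis (2 * pi * a))) \<le> 7 * (sqrt (b - a) * N)"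
proof -
  have c: "continuous_on S (\<lambda>x. norm (h' (w * cis (2 * pi * x))))" for S
    by (intro continuous_intros continuous_on_rot[OF C1circD(2)[OF h] w])
  let ?I = "integral {a..b} (\<lambda>x. norm (h' (w * cis (2 * pi * x))))"
  have "?I\<^sup>2 \<le> (b - a) * integral {a..b} (\<lambda>x. (norm (h' (w * cis (2 * pi * x))))\<^sup>2)"
    by (rule integral_square_le[OF c ab(2)])
  also have "integral {a..b} (\<lambda>x. (norm (h' (w * cis (2 * pi * x))))\<^sup>2) \<le> integral {0..1} (\<lambda>x. (norm (h' (w * cis (2 * pi * x))))\<^sup>2)"
    by (rule integral_subset_le) (use ab in \<open>auto intro!: integrable_continuous_real continuous_intros c\<close>)
  also have "\<dots> = energy h'" by (rule energy_rot[OF C1circD(2)[OF h] w])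
  also have "\<dots> \<le> N\<^sup>2" by (rule N)
  finally have "?I\<^sup>2 \<le> (b - a) * N\<^sup>2" using ab by (simp add: mult_left_mono)
  then have "?I\<^sup>2 \<le> (sqrt (b - a) * N)\<^sup>2" using ab by (simp add: power_mult_distrib)
  then show I: "?I \<le> sqrt (b - a) * N" by (rule power2_le_imp_le) (use N(2) ab in simp)
  have "norm (h (w * cis (2 * pi * b)) - h (w * cis (2 * pi * a))) \<le> 2 * pi * ?I"
    by (rule path_increment[OF h w ab(2)])
  also have "\<dots> \<le> 2 * pi * (sqrt (b - a) * N)" using I by (intro mult_left_mono) auto
  also have "\<dots> \<le> 7 * (sqrt (b - a) * N)" using N ab pi_approx by (intro mult_right_mono) auto
  finally show "norm (h (w * cis (2 * pi * b)) - h (w * cis (2 * pi * a))) \<le> 7 * (sqrt (b - a) * N)" .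
qed

text \<open>The shorter of the two arcs from \<open>w\<close> to the second point gives the minimum.\<close>
lemma increment_energy:
  assumes h: "C1circ h h'" and w: "w \<in> circ" and t: "0 \<le> t" "t \<le> 1" and N: "energy h' \<le> N\<^sup>2" "0 \<le> N"
  shows "norm (h (w * cis (2 * pi * t)) - h w) \<le> 7 * (sqrt (min t (1 - t)) * N)"
proof (cases "t \<le> 1 - t")
  case True
  then show ?thesis using path_increment_energy(2)[OF h w _ t(1) t(2) N] by (simp add: min_def)
next
  case False
  then show ?thesis
    using path_increment_energy(2)[OF h w t(1) t(2) _ N] by (simp add: min_def norm_minus_commute)
qed

text \<open>The value at \<open>w\<close> is the mean of the increments from \<open>w\<close>, since the function has mean zero.\<close>
lemma sup_le_energy:
  assumes h: "C1circ h h'" and w: "w \<in> circ" and N: "energy h' \<le> N\<^sup>2" "0 \<le> N"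
    and z: "integral {0..1} (\<lambda>t. h (cis (2 * pi * t))) = 0"
  shows "norm (h w) \<le> 7 * N"
proof -
  let ?q = "\<lambda>t. h (w * cis (2 * pi * t))"
  have i: "?q integrable_on {0..1}"
    by (intro integrable_continuous_real continuous_on_rot[OF C1circD(3)[OF h] w])
  have "((\<lambda>t. h w - ?q t) has_integral (1 - 0) *\<^sub>R h w - integral {0..1} ?q) {0..1}"
    using has_integral_const_real[of "h w" 0 1] by (intro has_integral_diff integrable_integral i) simp
  then have hi: "((\<lambda>t. h w - ?q t) has_integral h w) {0..1}" using z by (simp add: integral_rot[OF w])
  have "norm (integral {0..1} (\<lambda>t. h w - ?q t)) \<le> integral {0..1} (\<lambda>t::real. 7 * N)"
  proof (rule integral_norm_bound_integral)
    show "(\<lambda>t. h w - ?q t) integrable_on {0..1}" using hi by blast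
    fix t :: real assume t: "t \<in> {0..1}"
    have "norm (h w - ?q t) \<le> 7 * (sqrt (min t (1 - t)) * N)"
      using increment_energy[OF h w _ _ N, of t] t by (simp add: norm_minus_commute)
    also have "\<dots> \<le> 7 * (1 * N)" using t N by (intro mult_left_mono mult_right_mono) auto
    finally show "norm (h w - ?q t) \<le> 7 * N" by simp
  qed (simp add: integrable_const_ivl)
  then show ?thesis using hi by (simp add: has_integral_iff)
qed

lemma increment_lipschitz:
  assumes h: "C1circ f f'" and w: "w \<in> circ" and t: "0 \<le> t" "t \<le> 1" and b: "\<And>v. v \<in> circ \<Longrightarrow> norm (f' v) \<le> 1"
  shows "norm (f (w * cis (2 * pi * t)) - f w) \<le> 2 * norm (w * cis (2 * pi * t) - w)"
proof -
  have *: "norm (f (w * cis (2 * pi * b)) - f (w * cis (2 * pi * a))) \<le> 8 * (b - a)" if "a \<le> b" for a b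
  proof -
    have "integral {a..b} (\<lambda>x. norm (f' (w * cis (2 * pi * x)))) \<le> integral {a..b} (\<lambda>x. 1)"
      by (intro integral_le integrable_continuous_real continuous_intros continuous_on_rot[OF C1circD(2)[OF h] w] b rot_circ[OF w])
    then have "integral {a..b} (\<lambda>x. norm (f' (w * cis (2 * pi * x)))) \<le> b - a" using that by simp
    then have "2 * pi * integral {a..b} (\<lambda>x. norm (f' (w * cis (2 * pi * x)))) \<le> 2 * pi * (b - a)" by (intro mult_left_mono) auto
    also have "\<dots> \<le> 8 * (b - a)" using that pi_approx by (intro mult_right_mono) auto
    finally show ?thesis using path_increment[OF h w that] by linarith
  qed
  have "norm (f (w * cis (2 * pi * t)) - f w) \<le> 8 * min t (1 - t)"
    using *[OF t(1)] *[OF t(2)] by (simp add: min_def norm_minus_commute)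
  also have "\<dots> \<le> 2 * norm (cis (2 * pi * t) - 1)" using chord_lower[OF t] by simp
  also have "norm (cis (2 * pi * t) - 1) = norm (w * (cis (2 * pi * t) - 1))" using w by (simp add: norm_mult)
  also have "w * (cis (2 * pi * t) - 1) = w * cis (2 * pi * t) - w" by (simp add: algebra_simps)
  finally show ?thesis .
qed

text \<open>An integrable weight with inverse square root singularities at both endpoints.\<close>
definition singw :: "real \<Rightarrow> real" where "singw t = t powr (- (1/2)) + (1 - t) powr (- (1/2))"

lemma singw_integral: "(singw has_integral 4) {0..1}"
proof -
  have 1: "((\<lambda>t. t powr (- (1/2))) has_integral 2) {0..1::real}"
    using has_integral_powr_from_0[of "- (1/2)" 1] by simp
  have "((\<lambda>t. (- t) powr (- (1/2))) has_integral 2) {- 1..- 0::real}"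
    using 1 by (subst has_integral_reflect_real)
  then have "((\<lambda>t. (- (t - 1)) powr (- (1/2))) has_integral 2) {0..1::real}"
    using has_integral_shift_real_ivl[of "\<lambda>t. (- t) powr (- (1/2))" 2 "-1" 0 "-1"] by simp
  then have 2: "((\<lambda>t. (1 - t) powr (- (1/2))) has_integral 2) {0..1::real}" by simp
  show ?thesis unfolding singw_def using has_integral_add[OF 1 2] by simp
qed

lemma sqrt_min_le_singw:
  assumes "0 < t" "t < 1" shows "sqrt (min t (1 - t)) \<le> min t (1 - t) * singw t"
proof -
  define m where "m = min t (1 - t)"
  have m: "m > 0" using assms by (simp add: m_def)
  have "m * m powr (- (1/2)) = m powr (1 + - (1/2))" using m by (simp only: powr_add) simp
  then have "sqrt m = m * m powr (- (1/2))" using m by (simp add: powr_half_sqrt)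
  also have "m powr (- (1/2)) \<le> singw t" unfolding m_def singw_def min_def by simp
  finally show ?thesis using m unfolding m_def by (simp add: mult_left_mono)
qed

text \<open>Increments are of the order of the square root of the arc length, so the difference quotient has an integrable
  singularity.\<close>
lemma increment_energy_ratio:
  assumes h: "C1circ h h'" and w: "w \<in> circ" and t: "0 < t" "t < 1" and N: "energy h' \<le> N\<^sup>2" "0 \<le> N"
  shows "norm (h (w * cis (2 * pi * t)) - h w) \<le> 2 * N * singw t * norm (w * cis (2 * pi * t) - w)"
proof -
  have "norm (h (w * cis (2 * pi * t)) - h w) \<le> 7 * (sqrt (min t (1 - t)) * N)"
    using increment_energy[OF h w _ _ N, of t] t by simp
  also have "\<dots> \<le> 7 * ((min t (1 - t) * singw t) * N)"
    using sqrt_min_le_singw[OF t] N by (intro mult_left_mono mult_right_mono) auto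
  also have "\<dots> = (7 * min t (1 - t)) * (N * singw t)" by simp
  also have "\<dots> \<le> (2 * norm (cis (2 * pi * t) - 1)) * (N * singw t)"
  proof (rule mult_right_mono)
    have "min t (1 - t) > 0" using t by simp
    moreover have "4 * min t (1 - t) \<le> norm (cis (2 * pi * t) - 1)" using t by (intro chord_lower) auto
    moreover have "7 * m \<le> 2 * c" if "0 < m" "4 * m \<le> c" for m c :: real using that by linarith
    ultimately show "7 * min t (1 - t) \<le> 2 * norm (cis (2 * pi * t) - 1)" by blast
    show "0 \<le> N * singw t" using N by (simp add: singw_def)
  qed
  also have "norm (cis (2 * pi * t) - 1) = norm (w * (cis (2 * pi * t) - 1))" using w by (simp add: norm_mult)
  also have "w * (cis (2 * pi * t) - 1) = w * cis (2 * pi * t) - w" by (simp add: algebra_simps)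
  finally show ?thesis by (simp add: mult_ac)
qed

section \<open>The singular self-interaction integral\<close>

text \<open>The integrand of the self-interaction with \<open>A = \<tau> - w\<close>, \<open>B = f \<tau> - f w\<close> and \<open>D = f' \<tau>\<close>.\<close>
definition singular_kernel :: "complex \<Rightarrow> complex \<Rightarrow> complex \<Rightarrow> complex \<Rightarrow> complex" where
  "singular_kernel e A B D = (A * cnj B - cnj A * B) / (A * (A + e * B)) * (D - B / A)"

lemma singular_kernel_aux:
  assumes A: "A \<noteq> 0" and B: "norm B \<le> 2 * norm A" and e: "norm e \<le> 1/4"
  shows "norm A / 2 \<le> norm (A + e * B)" "norm (A * cnj B - cnj A * B) \<le> 4 * (norm A)\<^sup>2"
    and "norm ((A * cnj B - cnj A * B) / (A * (A + e * B))) \<le> 8" "norm (B / A) \<le> 2"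
proof -
  have "norm (e * B) \<le> 1/4 * (2 * norm A)" unfolding norm_mult using B e by (intro mult_mono) auto
  then show 1: "norm A / 2 \<le> norm (A + e * B)" using norm_diff_ineq[of A "e * B"] by linarith
  have "norm (A * cnj B - cnj A * B) \<le> norm (A * cnj B) + norm (cnj A * B)" by (rule norm_triangle_ineq4)
  also have "\<dots> = 2 * (norm A * norm B)" by (simp add: norm_mult)
  also have "\<dots> \<le> 2 * (norm A * (2 * norm A))" using B by (intro mult_left_mono) auto
  finally show 2: "norm (A * cnj B - cnj A * B) \<le> 4 * (norm A)\<^sup>2" by (simp add: power2_eq_square)
  have "norm ((A * cnj B - cnj A * B) / (A * (A + e * B))) \<le> 4 * (norm A)\<^sup>2 / (norm A * (norm A / 2))"
    unfolding norm_divide norm_mult using 1 2 A by (intro frac_le mult_left_mono) auto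
  also have "\<dots> = 8" using A by (simp add: power2_eq_square)
  finally show "norm ((A * cnj B - cnj A * B) / (A * (A + e * B))) \<le> 8" .
  show "norm (B / A) \<le> 2" using A B by (simp add: norm_divide divide_le_eq)
qed

lemma norm_mult_diff_le:
  fixes x y x' y' :: "'a::real_normed_algebra"
  assumes "norm (x - x') \<le> p" "norm y \<le> q" "norm x' \<le> r" "norm (y - y') \<le> s"
  shows "norm (x * y - x' * y') \<le> p * q + r * s"
proof -
  have "x * y - x' * y' = (x - x') * y + x' * (y - y')" by (simp add: algebra_simps)
  then have "norm (x * y - x' * y') \<le> norm ((x - x') * y) + norm (x' * (y - y'))" by (metis norm_triangle_ineq)
  also have "\<dots> \<le> norm (x - x') * norm y + norm x' * norm (y - y')" by (intro add_mono norm_mult_ineq)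
  also have "\<dots> \<le> p * q + r * s"
    using assms by (intro add_mono mult_mono) (auto intro: order_trans[OF norm_ge_zero])
  finally show ?thesis .
qed

lemma singular_kernel_bound:
  assumes "A \<noteq> 0" "norm B \<le> 2 * norm A" "norm e \<le> 1/4" "norm D \<le> 1"
  shows "norm (singular_kernel e A B D) \<le> 24"
proof -
  have "norm (D - B / A) \<le> 1 + 2" using norm_triangle_ineq4[of D "B / A"] singular_kernel_aux(4)[OF assms(1-3)] assms(4) by linarith
  then have "norm (singular_kernel e A B D) \<le> 8 * 3"
    unfolding singular_kernel_def norm_mult using singular_kernel_aux(3)[OF assms(1-3)] by (intro mult_mono) auto
  then show ?thesis by simp
qed

text \<open>The kernel depends on B only through \<open>B / A\<close>, up to unimodular factors, so what counts is the relative difference \<open>\<beta>\<close>. For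
  functions close in energy this \<open>\<beta>\<close> is unbounded but integrable, and it enters linearly.\<close>
lemma singular_kernel_diff:
  assumes A: "A \<noteq> 0" and B: "norm B \<le> 2 * norm A" "norm B' \<le> 2 * norm A" and e: "norm e \<le> 1/4" and D: "norm D \<le> 1"
    and \<beta>: "norm (B - B') \<le> \<beta> * norm A"
  shows "norm (singular_kernel e A B D - singular_kernel e A B' D') \<le> 68 * \<beta> + 8 * norm (D - D')"
proof -
  define a where "a = norm A"
  have a: "a > 0" using A by (simp add: a_def)
  define X X' Y Y' where "X = A * cnj B - cnj A * B" and "X' = A * cnj B' - cnj A * B'" and "Y = A + e * B" and "Y' = A + e * B'"
  note k = singular_kernel_aux[OF A B(1) e, folded a_def X_def Y_def]
  note k' = singular_kernel_aux[OF A B(2) e, folded a_def X'_def Y'_def]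
  have Y0: "Y \<noteq> 0" "Y' \<noteq> 0" using k(1) k'(1) a by auto
  have \<beta>0: "\<beta> \<ge> 0"
  proof -
    have "0 \<le> \<beta> * a" using \<beta> norm_ge_zero[of "B - B'"] unfolding a_def by linarith
    then show ?thesis using a by (simp add: zero_le_mult_iff)
  qed
  have "X - X' = A * cnj (B - B') - cnj A * (B - B')" by (simp add: X_def X'_def algebra_simps)
  then have "norm (X - X') \<le> norm (A * cnj (B - B')) + norm (cnj A * (B - B'))" by (metis norm_triangle_ineq4)
  also have "\<dots> = 2 * a * norm (B - B')" by (simp add: norm_mult a_def complex_cnj_diff[symmetric] del: complex_cnj_diff)
  also have "\<dots> \<le> 2 * a * (\<beta> * a)" using \<beta> a unfolding a_def by (intro mult_left_mono) auto
  finally have XX: "norm (X - X') \<le> 2 * \<beta> * a\<^sup>2" by (simp add: power2_eq_square mult_ac)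
  have "norm (Y' - Y) = norm e * norm (B - B')"
    by (simp add: Y_def Y'_def norm_mult[symmetric] algebra_simps norm_minus_commute)
  also have "\<dots> \<le> 1 * (\<beta> * a)" using e \<beta> unfolding a_def by (intro mult_mono) auto
  finally have YY: "norm (Y' - Y) \<le> \<beta> * a" by simp
  have eq: "X / (A * Y) - X' / (A * Y') = (X - X') / (A * Y) + X' * (Y' - Y) / (A * Y * Y')"
    using A Y0 by (simp add: field_simps)
  have "norm ((X - X') / (A * Y)) \<le> 2 * \<beta> * a\<^sup>2 / (a * (a / 2))"
    unfolding norm_divide norm_mult a_def[symmetric] using XX k(1) a \<beta>0 by (intro frac_le mult_left_mono) auto
  also have "\<dots> = 4 * \<beta>" using a by (simp add: power2_eq_square)
  finally have 1: "norm ((X - X') / (A * Y)) \<le> 4 * \<beta>" .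
  have "norm (X' * (Y' - Y) / (A * Y * Y')) \<le> 4 * a\<^sup>2 * (\<beta> * a) / (a * (a / 2) * (a / 2))"
    unfolding norm_divide norm_mult a_def[symmetric] using k'(1,2) k(1) YY a \<beta>0 by (intro frac_le mult_mono) auto
  also have "\<dots> = 16 * \<beta>" using a by (simp add: power2_eq_square)
  finally have 2: "norm (X' * (Y' - Y) / (A * Y * Y')) \<le> 16 * \<beta>" .
  have kk: "norm (X / (A * Y) - X' / (A * Y')) \<le> 20 * \<beta>"
    unfolding eq using norm_triangle_ineq[of "(X - X') / (A * Y)" "X' * (Y' - Y) / (A * Y * Y')"] 1 2 by linarith
  have g: "norm (D - B / A) \<le> 3" using norm_triangle_ineq4[of D "B / A"] k(4) D by linarith
  have "norm ((B - B') / A) \<le> \<beta>" using \<beta> A by (simp add: norm_divide divide_le_eq)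
  then have "norm ((D - D') - (B - B') / A) \<le> norm (D - D') + \<beta>"
    using norm_triangle_ineq4[of "D - D'" "(B - B') / A"] by linarith
  moreover have "D - B / A - (D' - B' / A) = (D - D') - (B - B') / A" by (simp add: diff_divide_distrib)
  ultimately have gg: "norm (D - B / A - (D' - B' / A)) \<le> norm (D - D') + \<beta>" by (simp only:)
  have "norm (X / (A * Y) * (D - B / A) - X' / (A * Y') * (D' - B' / A)) \<le> 20 * \<beta> * 3 + 8 * (norm (D - D') + \<beta>)"
    by (rule norm_mult_diff_le[OF kk g k'(3) gg])
  then show ?thesis unfolding singular_kernel_def X_def X'_def Y_def Y'_def by simp
qed

lemma integrable_bounded_continuous:
  fixes F :: "real \<Rightarrow> complex"
  assumes c: "continuous_on {0<..<1} F" and b: "\<And>t. 0 < t \<Longrightarrow> t < 1 \<Longrightarrow> norm (F t) \<le> B"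
  shows "F integrable_on {0..1}"
proof -
  have "F integrable_on {0<..<1}"
  proof (rule measurable_bounded_by_integrable_imp_integrable)
    show "F \<in> borel_measurable (lebesgue_on {0<..<1})"
      by (rule continuous_imp_measurable_on_sets_lebesgue[OF c]) simp
    show "(\<lambda>_. B) integrable_on {0<..<1::real}"
      by (subst integrable_on_Icc_iff_Ioo[symmetric]) (rule integrable_const_ivl)
  qed (use b in auto)
  then show ?thesis by (subst integrable_on_Icc_iff_Ioo)
qed

definition singular_int :: "complex \<Rightarrow> (complex \<Rightarrow> complex) \<Rightarrow> (complex \<Rightarrow> complex) \<Rightarrow> complex \<Rightarrow> complex" where
  "singular_int e f f' w = fint (\<lambda>\<tau>. singular_kernel e (\<tau> - w) (f \<tau> - f w) (f' \<tau>))"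

lemma rot_neq: assumes "w \<in> circ" "0 < t" "t < 1" shows "w * cis (2 * pi * t) - w \<noteq> 0"
proof -
  have "norm (w * cis (2 * pi * t) - w) = norm (w * (cis (2 * pi * t) - 1))" by (simp add: algebra_simps)
  also have "\<dots> = norm (cis (2 * pi * t) - 1)" using assms by (simp add: norm_mult)
  also have "\<dots> \<ge> 4 * min t (1 - t)" using chord_lower[of t] assms by simp
  moreover have "min t (1 - t) > 0" using assms by simp
  ultimately show ?thesis by force
qed

lemma singular_int_integrable:
  assumes f: "C1circ f f'" and b: "\<And>v. v \<in> circ \<Longrightarrow> norm (f' v) \<le> 1" and e: "norm e \<le> 1/4" and w: "w \<in> circ"
  defines "v \<equiv> \<lambda>t. w * cis (2 * pi * t)"
  shows "(\<lambda>t. singular_kernel e (v t - w) (f (v t) - f w) (f' (v t)) * v t) integrable_on {0..1}"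
    and "0 < t \<Longrightarrow> t < 1 \<Longrightarrow> norm (singular_kernel e (v t - w) (f (v t) - f w) (f' (v t)) * v t) \<le> 24"
proof -
  have bd: "norm (singular_kernel e (v t - w) (f (v t) - f w) (f' (v t)) * v t) \<le> 24" if "0 < t" "t < 1" for t
  proof -
    have vc: "v t \<in> circ" unfolding v_def by (rule rot_circ[OF w])
    have "norm (singular_kernel e (v t - w) (f (v t) - f w) (f' (v t))) \<le> 24"
    proof (rule singular_kernel_bound)
      show "v t - w \<noteq> 0" unfolding v_def by (rule rot_neq[OF w that])
      show "norm (f (v t) - f w) \<le> 2 * norm (v t - w)"
        unfolding v_def using that by (intro increment_lipschitz[OF f w _ _ b]) auto
    qed (use e b vc in auto)
    then show ?thesis using vc by (simp add: norm_mult)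
  qed
  then show "0 < t \<Longrightarrow> t < 1 \<Longrightarrow> norm (singular_kernel e (v t - w) (f (v t) - f w) (f' (v t)) * v t) \<le> 24" .
  show "(\<lambda>t. singular_kernel e (v t - w) (f (v t) - f w) (f' (v t)) * v t) integrable_on {0..1}"
  proof (rule integrable_bounded_continuous[OF _ bd])
    have nz: "v t - w \<noteq> 0" "v t - w + e * (f (v t) - f w) \<noteq> 0" if "t \<in> {0<..<1}" for t
    proof -
      show 1: "v t - w \<noteq> 0" unfolding v_def by (rule rot_neq[OF w]) (use that in auto)
      have "norm (f (v t) - f w) \<le> 2 * norm (v t - w)"
        unfolding v_def using that by (intro increment_lipschitz[OF f w _ _ b]) auto
      from singular_kernel_aux(1)[OF 1 this e] show "v t - w + e * (f (v t) - f w) \<noteq> 0" using 1 by force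
    qed
    have cv: "continuous_on {0<..<1} v" unfolding v_def by (intro continuous_intros)
    have cf: "continuous_on {0<..<1} (\<lambda>t. f (v t))" "continuous_on {0<..<1} (\<lambda>t. f' (v t))"
      unfolding v_def by (intro continuous_on_rot[OF C1circD(3)[OF f] w] continuous_on_rot[OF C1circD(2)[OF f] w])+
    show "continuous_on {0<..<1} (\<lambda>t. singular_kernel e (v t - w) (f (v t) - f w) (f' (v t)) * v t)"
      unfolding singular_kernel_def by (intro continuous_intros cv cf) (use nz in auto)
  qed
qed

lemma norm_integral_le:
  fixes F :: "real \<Rightarrow> complex"
  assumes "F integrable_on {0..1}" "(g has_integral I) {0..1}" "\<And>t. 0 < t \<Longrightarrow> t < 1 \<Longrightarrow> norm (F t) \<le> g t"
  shows "norm (integral {0..1} F) \<le> I"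
proof -
  have "norm (integral {0<..<1} F) \<le> integral {0<..<1} g"
    by (rule integral_norm_bound_integral)
      (use assms in \<open>auto simp: integrable_on_Icc_iff_Ioo[symmetric] has_integral_iff\<close>)
  then show ?thesis using assms(2) by (simp add: integral_open_interval_real has_integral_iff)
qed

lemma singular_int_bound:
  assumes "C1circ f f'" "\<And>v. v \<in> circ \<Longrightarrow> norm (f' v) \<le> 1" "norm e \<le> 1/4" "w \<in> circ"
  shows "norm (singular_int e f f' w) \<le> 24"
  unfolding singular_int_def fint_rot[OF assms(4)]
  by (rule norm_integral_le[OF singular_int_integrable(1)[OF assms] _ singular_int_integrable(2)[OF assms]])
    (use has_integral_const_real[of "24::real" 0 1] in auto)

text \<open>Lipschitz dependence on the derivative in L2, uniformly in \<open>w\<close>: the kernel bound is integrated with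
  \<open>\<beta> = 2 N singw\<close>, whose integral is \<open>8 N\<close>.\<close>
lemma singular_int_diff:
  assumes f: "C1circ f f'" "\<And>v. v \<in> circ \<Longrightarrow> norm (f' v) \<le> 1"
    and g: "C1circ g g'" "\<And>v. v \<in> circ \<Longrightarrow> norm (g' v) \<le> 1"
    and e: "norm e \<le> 1/4" and w: "w \<in> circ"
    and N: "energy (\<lambda>w. f' w - g' w) \<le> N\<^sup>2" "0 \<le> N"
  shows "norm (singular_int e f f' w - singular_int e g g' w) \<le> 552 * N"
proof -
  define v where "v t = w * cis (2 * pi * t)" for t
  define h h' where "h = (\<lambda>w. f w - g w)" and "h' = (\<lambda>w. f' w - g' w)"
  have h: "C1circ h h'" unfolding h_def h'_def by (rule C1circ_diff[OF f(1) g(1)])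
  have vc: "v t \<in> circ" for t unfolding v_def by (rule rot_circ[OF w])
  let ?F = "\<lambda>t. singular_kernel e (v t - w) (f (v t) - f w) (f' (v t)) * v t"
  let ?G = "\<lambda>t. singular_kernel e (v t - w) (g (v t) - g w) (g' (v t)) * v t"
  note i = singular_int_integrable(1)[OF f e w, folded v_def] singular_int_integrable(1)[OF g e w, folded v_def]
  have hn: "((\<lambda>t. norm (h' (v t))) has_integral integral {0..1} (\<lambda>t. norm (h' (v t)))) {0..1}"
    unfolding v_def by (intro integrable_integral integrable_continuous_real continuous_intros continuous_on_rot[OF C1circD(2)[OF h] w])
  have N': "energy h' \<le> N\<^sup>2" using N by (simp add: h'_def)
  have "norm (integral {0..1} (\<lambda>t. ?F t - ?G t)) \<le> 68 * (2 * N) * 4 + 8 * integral {0..1} (\<lambda>t. norm (h' (v t)))"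
  proof (rule norm_integral_le)
    show "(\<lambda>t. ?F t - ?G t) integrable_on {0..1}" by (rule integrable_diff[OF i])
    show "((\<lambda>t. 68 * (2 * N) * singw t + 8 * norm (h' (v t))) has_integral 68 * (2 * N) * 4 + 8 * integral {0..1} (\<lambda>t. norm (h' (v t)))) {0..1}"
      by (intro has_integral_add has_integral_mult_right singw_integral hn)
    fix t :: real assume t: "0 < t" "t < 1"
    have "norm (singular_kernel e (v t - w) (f (v t) - f w) (f' (v t)) - singular_kernel e (v t - w) (g (v t) - g w) (g' (v t)))
        \<le> 68 * (2 * N * singw t) + 8 * norm (f' (v t) - g' (v t))"
    proof (rule singular_kernel_diff)
      show "v t - w \<noteq> 0" unfolding v_def by (rule rot_neq[OF w t])
      show "norm (f (v t) - f w) \<le> 2 * norm (v t - w)" "norm (g (v t) - g w) \<le> 2 * norm (v t - w)"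
        unfolding v_def using t by (auto intro!: increment_lipschitz[OF f(1) w _ _ f(2)] increment_lipschitz[OF g(1) w _ _ g(2)])
      have "f (v t) - f w - (g (v t) - g w) = h (v t) - h w" by (simp add: h_def)
      then show "norm (f (v t) - f w - (g (v t) - g w)) \<le> 2 * N * singw t * norm (v t - w)"
        using increment_energy_ratio[OF h w t N' N(2)] unfolding v_def by simp
    qed (use e f(2) vc in auto)
    then show "norm (?F t - ?G t) \<le> 68 * (2 * N) * singw t + 8 * norm (h' (v t))"
      using vc[of t] by (simp add: left_diff_distrib[symmetric] norm_mult h'_def)
  qed
  moreover have "integral {0..1} (\<lambda>t. norm (h' (v t))) \<le> N"
    using path_increment_energy(1)[OF h w _ _ _ N' N(2), of 0 1] by (simp add: v_def)
  moreover have "singular_int e f f' w - singular_int e g g' w = integral {0..1} (\<lambda>t. ?F t - ?G t)"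
    unfolding singular_int_def fint_rot[OF w] v_def[symmetric] by (rule integral_diff[OF i, symmetric])
  ultimately show ?thesis by simp
qed

section \<open>The complex expression behind the functional\<close>

definition interaction_kernel :: "complex \<Rightarrow> complex \<Rightarrow> complex \<Rightarrow> complex \<Rightarrow> complex \<Rightarrow> complex \<Rightarrow> complex \<Rightarrow> complex \<Rightarrow> complex" where
  "interaction_kernel d ej ek w y \<tau> x x' = (cnj \<tau> + ek * cnj x) * (1 + ek * x') / (ek * \<tau> + ej * w + (ek\<^sup>2 * x + ej\<^sup>2 * y) - d)"

definition interaction_int :: "complex \<Rightarrow> complex \<Rightarrow> complex \<Rightarrow> complex \<Rightarrow> (complex \<Rightarrow> complex) \<Rightarrow> (complex \<Rightarrow> complex) \<Rightarrow> complex \<Rightarrow> complex" where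
  "interaction_int d ej ek y fk fk' w = fint (\<lambda>\<tau>. interaction_kernel d ej ek w y \<tau> (fk \<tau>) (fk' \<tau>))"

text \<open>The expression whose imaginary part is the functional. The numbers \<open>Q = 2 \<Omega>\<close> and the coefficient L of \<open>w\<close> replace
  \<open>(\<Omega>, Z)\<close>, since the equation is linear in them; \<open>ej\<close> and \<open>ek\<close> stand for \<open>\<epsilon> b\<^sub>j\<close> and \<open>\<epsilon> b\<^sub>k\<close>.\<close>
definition full_expr where
  "full_expr \<gamma>j \<gamma>k d ej ek Q L fj fj' fk fk' w =
     (Q * ej * (cnj w + ej * cnj (fj w)) + L) * w * (1 + ej * fj' w) - \<gamma>j * fj' w
     + ej * \<gamma>j * w * (1 + ej * fj' w) * singular_int ej fj fj' w
     - \<gamma>k * w * (1 + ej * fj' w) * interaction_int d ej ek (fj w) fk fk' w"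

lemma F_eq_Im_full_expr:
  fixes \<Omega> Z \<epsilon> d :: real
  assumes j: "j \<in> {1, 2}" "k = 3 - j"
  shows "F b d \<gamma> \<epsilon> \<Omega> Z f j w = Im (full_expr (\<gamma> j) (\<gamma> k) d (of_real \<epsilon> * of_real (b j)) (of_real \<epsilon> * of_real (b k)) (of_real (2 * \<Omega>))
     (of_real ((-1) ^ j * (2 * \<Omega> * Z) - (of_nat j - 1) * d * (2 * \<Omega>))) (f j) (circ_deriv (f j)) (f k) (circ_deriv (f k)) w)"
proof -
  have I: "(\<lambda>\<tau>. (cnj \<tau> + of_real \<epsilon> * b k * cnj (f k \<tau>)) * (1 + of_real \<epsilon> * b k * circ_deriv (f k) \<tau>) /
                      (of_real \<epsilon> * (b k * \<tau> + b j * w) + (of_real \<epsilon>)\<^sup>2 * ((b k)\<^sup>2 * f k \<tau> + (b j)\<^sup>2 * f j w) - d))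
     = (\<lambda>\<tau>. (cnj \<tau> + (of_real \<epsilon> * of_real (b k)) * cnj (f k \<tau>)) * (1 + (of_real \<epsilon> * of_real (b k)) * circ_deriv (f k) \<tau>) /
       ((of_real \<epsilon> * of_real (b k)) * \<tau> + (of_real \<epsilon> * of_real (b j)) * w + ((of_real \<epsilon> * of_real (b k))\<^sup>2 * f k \<tau> + (of_real \<epsilon> * of_real (b j))\<^sup>2 * f j w) - complex_of_real d))"
    by (simp add: algebra_simps power2_eq_square)
  show ?thesis
    unfolding F_def Let_def j(2)[symmetric] I full_expr_def interaction_int_def interaction_kernel_def singular_int_def singular_kernel_def
    by (simp add: algebra_simps)
qed

context
  fixes E d :: real
  assumes E: "0 \<le> E" "E \<le> 1/4" "E \<le> d / 8" and d: "0 < d"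
begin

text \<open>The two vortices stay apart: the distance \<open>d\<close> dominates the small displacements of the points.\<close>
lemma interaction_int_den:
  fixes ej ek w \<tau> x y :: complex
  assumes "norm ej \<le> E" "norm ek \<le> E" "norm w = 1" "norm \<tau> = 1" "norm x \<le> 1" "norm y \<le> 1"
  shows "d / 2 \<le> norm (ek * \<tau> + ej * w + (ek\<^sup>2 * x + ej\<^sup>2 * y) - of_real d)"
proof -
  have sq: "norm (e\<^sup>2 * z) \<le> 1/4 * E" if "norm e \<le> E" "norm z \<le> 1" for e z :: complex
  proof -
    have "norm (e\<^sup>2 * z) = norm e * norm e * norm z" by (simp add: norm_mult power2_eq_square)
    also have "\<dots> \<le> 1/4 * E * 1" using that E by (intro mult_mono) auto
    finally show ?thesis by simp
  qed
  let ?s = "ek * \<tau> + ej * w + (ek\<^sup>2 * x + ej\<^sup>2 * y)"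
  have "norm ?s \<le> E + E + (1/4 * E + 1/4 * E)"
    using assms by (intro norm_triangle_mono sq) (auto simp: norm_mult)
  also have "\<dots> \<le> d / 2" using E d by simp
  finally have "norm ?s \<le> d / 2" .
  moreover have "norm (of_real d :: complex) \<le> norm ?s + norm (?s - of_real d)"
    using norm_triangle_sub[of "of_real d :: complex" ?s] by (simp add: norm_minus_commute)
  ultimately show ?thesis using d by simp
qed

lemma interaction_kernel_bound:
  assumes e: "norm ej \<le> E" "norm ek \<le> E" and "norm w = 1" "norm \<tau> = 1" "norm x \<le> 1" "norm x' \<le> 1" "norm y \<le> 1"
  shows "norm (interaction_kernel d ej ek w y \<tau> x x') \<le> 4 / d"
proof -
  have n: "norm (ek * z) \<le> 1/4" if "norm z \<le> 1" for z
  proof -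
    have "norm (ek * z) \<le> 1/4 * 1" unfolding norm_mult using that e E by (intro mult_mono) auto
    then show ?thesis by simp
  qed
  have "norm (cnj \<tau> + ek * cnj x) \<le> 5/4"
    using norm_triangle_ineq[of "cnj \<tau>" "ek * cnj x"] n[of "cnj x"] assms by simp
  moreover have "norm (1 + ek * x') \<le> 5/4"
    using norm_triangle_ineq[of 1 "ek * x'"] n[of x'] assms by simp
  ultimately have "norm (interaction_kernel d ej ek w y \<tau> x x') \<le> (5/4 * (5/4)) / (d / 2)"
    unfolding interaction_kernel_def norm_divide norm_mult using interaction_int_den[of ej ek w \<tau> x y] assms d by (intro frac_le mult_mono) auto
  also have "\<dots> \<le> 4 / d" using d by (simp add: field_simps)
  finally show ?thesis .
qed

lemma interaction_int_integrable:
  assumes e: "norm ej \<le> E" "norm ek \<le> E" and f: "C1circ fk fk'" and w: "w \<in> circ"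
    and b: "\<And>v. v \<in> circ \<Longrightarrow> norm (fk v) \<le> 1" "\<And>v. v \<in> circ \<Longrightarrow> norm (fk' v) \<le> 1" "norm y \<le> 1"
  defines "v \<equiv> \<lambda>t. w * cis (2 * pi * t)"
  shows "(\<lambda>t. interaction_kernel d ej ek w y (v t) (fk (v t)) (fk' (v t)) * v t) integrable_on {0..1}"
proof -
  have nz: "ek * v t + ej * w + (ek\<^sup>2 * fk (v t) + ej\<^sup>2 * y) - of_real d \<noteq> 0" for t
  proof -
    have "v t \<in> circ" unfolding v_def by (rule rot_circ[OF w])
    then have "d / 2 \<le> norm (ek * v t + ej * w + (ek\<^sup>2 * fk (v t) + ej\<^sup>2 * y) - of_real d)"
      using w b e by (intro interaction_int_den) auto
    then show ?thesis using d by force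
  qed
  have cv: "continuous_on {0..1} v" unfolding v_def by (intro continuous_intros)
  have cf: "continuous_on {0..1} (\<lambda>t. fk (v t))" "continuous_on {0..1} (\<lambda>t. fk' (v t))"
    unfolding v_def by (intro continuous_on_rot[OF C1circD(3)[OF f] w] continuous_on_rot[OF C1circD(2)[OF f] w])+
  show ?thesis
    unfolding interaction_kernel_def by (intro integrable_continuous_real continuous_intros cv cf) (use nz in auto)
qed

lemma interaction_int_bound:
  assumes e: "norm ej \<le> E" "norm ek \<le> E" and f: "C1circ fk fk'" and w: "w \<in> circ"
    and b: "\<And>v. v \<in> circ \<Longrightarrow> norm (fk v) \<le> 1" "\<And>v. v \<in> circ \<Longrightarrow> norm (fk' v) \<le> 1" "norm y \<le> 1"
  shows "norm (interaction_int d ej ek y fk fk' w) \<le> 4 / d"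
  unfolding interaction_int_def fint_rot[OF w]
proof (rule norm_integral_le[OF interaction_int_integrable[OF assms]])
  show "((\<lambda>t::real. 4 / d) has_integral 4 / d) {0..1}" using has_integral_const_real[of "4 / d" 0 1] by simp
  fix t
  define v where "v = w * cis (2 * pi * t)"
  have v: "v \<in> circ" unfolding v_def by (rule rot_circ[OF w])
  then show "norm (interaction_kernel d ej ek w y v (fk v) (fk' v) * v) \<le> 4 / d"
    using interaction_kernel_bound[OF e _ _ b(1)[OF v] b(2)[OF v] b(3), of w v] w by (simp add: norm_mult)
qed

lemma interaction_int_diff:
  assumes e: "norm ej \<le> E" "norm ek \<le> E" and w: "w \<in> circ"
    and f: "C1circ fk fk'" "\<And>v. v \<in> circ \<Longrightarrow> norm (fk v) \<le> 1" "\<And>v. v \<in> circ \<Longrightarrow> norm (fk' v) \<le> 1" "norm x \<le> 1"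
    and g: "C1circ gk gk'" "\<And>v. v \<in> circ \<Longrightarrow> norm (gk v) \<le> 1" "\<And>v. v \<in> circ \<Longrightarrow> norm (gk' v) \<le> 1" "norm x' \<le> 1"
    and N: "energy (\<lambda>w. fk' w - gk' w) \<le> N\<^sup>2" "0 \<le> N"
    and h: "\<And>v. v \<in> circ \<Longrightarrow> norm (fk v - gk v) \<le> 7 * N" "norm (x - x') \<le> 7 * N"
  shows "norm (interaction_int d ej ek x fk fk' w - interaction_int d ej ek x' gk gk' w) \<le> E * (20 / d + 28 / d\<^sup>2) * N"
proof -
  define v where "v t = w * cis (2 * pi * t)" for t
  have vc: "v t \<in> circ" for t unfolding v_def by (rule rot_circ[OF w])
  define h' where "h' = (\<lambda>w. fk' w - gk' w)"
  have hC: "C1circ (\<lambda>w. fk w - gk w) h'" unfolding h'_def by (rule C1circ_diff[OF f(1) g(1)])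
  have i: "(\<lambda>t. interaction_kernel d ej ek w x (v t) (fk (v t)) (fk' (v t)) * v t) integrable_on {0..1}"
    "(\<lambda>t. interaction_kernel d ej ek w x' (v t) (gk (v t)) (gk' (v t)) * v t) integrable_on {0..1}"
    using interaction_int_integrable[OF e f(1) w f(2-4)] interaction_int_integrable[OF e g(1) w g(2-4)] by (auto simp only: v_def)
  let ?G = "\<lambda>\<tau>. interaction_kernel d ej ek w x \<tau> (fk \<tau>) (fk' \<tau>) - interaction_kernel d ej ek w x' \<tau> (gk \<tau>) (gk' \<tau>)"
  have pt: "norm (?G \<tau>) \<le> E * ((5 / (2 * d)) * (7 * N + norm (h' \<tau>)) + 28 / d\<^sup>2 * N)" if \<tau>: "\<tau> \<in> circ" for \<tau>
  proof -
    define D D' where "D = ek * \<tau> + ej * w + (ek\<^sup>2 * fk \<tau> + ej\<^sup>2 * x) - of_real d"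
      and "D' = ek * \<tau> + ej * w + (ek\<^sup>2 * gk \<tau> + ej\<^sup>2 * x') - of_real d"
    have n: "norm w = 1" "norm \<tau> = 1" using w \<tau> by auto
    have den: "d / 2 \<le> norm D" "d / 2 \<le> norm D'"
      using interaction_int_den[OF e n f(2)[OF \<tau>] f(4)] interaction_int_den[OF e n g(2)[OF \<tau>] g(4)] by (simp_all only: D_def D'_def)
    have D0: "D \<noteq> 0" "D' \<noteq> 0" using den d by auto
    have n: "norm (ek * z) \<le> E * c" if "norm z \<le> c" for z c
      unfolding norm_mult using that e E by (intro mult_mono) auto
    have n1: "norm (1 + ek * z) \<le> 5/4" "norm (cnj \<tau> + ek * z) \<le> 5/4" if "norm z \<le> 1" for z
      using n[OF that] norm_triangle_ineq[of 1 "ek * z"] norm_triangle_ineq[of "cnj \<tau>" "ek * z"] \<tau> E by auto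
    have xx: "norm ((cnj \<tau> + ek * cnj (fk \<tau>)) - (cnj \<tau> + ek * cnj (gk \<tau>))) \<le> E * (7 * N)"
    proof -
      have "(cnj \<tau> + ek * cnj (fk \<tau>)) - (cnj \<tau> + ek * cnj (gk \<tau>)) = ek * cnj (fk \<tau> - gk \<tau>)" by (simp add: algebra_simps)
      then show ?thesis using n[of "cnj (fk \<tau> - gk \<tau>)"] h(1)[OF \<tau>] by (simp only: complex_mod_cnj)
    qed
    have y: "norm ((1 + ek * fk' \<tau>) - (1 + ek * gk' \<tau>)) \<le> E * norm (h' \<tau>)"
    proof -
      have "(1 + ek * fk' \<tau>) - (1 + ek * gk' \<tau>) = ek * h' \<tau>" by (simp add: h'_def algebra_simps)
      then show ?thesis using n[of "h' \<tau>" "norm (h' \<tau>)"] by simp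
    qed
    have num: "norm ((cnj \<tau> + ek * cnj (fk \<tau>)) * (1 + ek * fk' \<tau>) - (cnj \<tau> + ek * cnj (gk \<tau>)) * (1 + ek * gk' \<tau>))
       \<le> E * (7 * N) * (5/4) + 5/4 * (E * norm (h' \<tau>))"
      by (rule norm_mult_diff_le[OF xx n1(1) n1(2) y]) (use f(3) g(2) \<tau> in auto)
    have sq: "norm (e\<^sup>2 * z) \<le> E * (1/4) * (7 * N)" if "norm e \<le> E" "norm z \<le> 7 * N" for e z :: complex
    proof -
      have "norm (e\<^sup>2 * z) = norm e * norm e * norm z" by (simp add: norm_mult power2_eq_square)
      also have "\<dots> \<le> E * (1/4) * (7 * N)" using that E N by (intro mult_mono) auto
      finally show ?thesis .
    qed
    have "D' - D = ek\<^sup>2 * (gk \<tau> - fk \<tau>) + ej\<^sup>2 * (x' - x)" by (simp add: D_def D'_def algebra_simps)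
    then have DD: "norm (D' - D) \<le> E * (1/4) * (7 * N) + E * (1/4) * (7 * N)"
      using sq[OF e(2)] sq[OF e(1)] h(1)[OF \<tau>] h(2) by (metis norm_triangle_mono norm_minus_commute)
    have "inverse (D) - inverse (D') = (D' - D) / (D * D')"
      using D0 by (simp add: field_simps)
    also have "norm \<dots> \<le> (E * (1/4) * (7 * N) + E * (1/4) * (7 * N)) / (d / 2 * (d / 2))"
      unfolding norm_divide norm_mult using DD den d E N by (intro frac_le mult_mono) auto
    also have "\<dots> = E * N * (14 / d\<^sup>2)" by (simp add: power2_eq_square)
    finally have inv: "norm (inverse (D) - inverse (D')) \<le> E * N * (14 / d\<^sup>2)" .
    have invb: "norm (inverse (D)) \<le> 2 / d"
      using le_imp_inverse_le[OF den(1)] d by (simp add: norm_inverse)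
    have nb: "norm ((cnj \<tau> + ek * cnj (gk \<tau>)) * (1 + ek * gk' \<tau>)) \<le> 2"
    proof -
      have "norm ((cnj \<tau> + ek * cnj (gk \<tau>)) * (1 + ek * gk' \<tau>)) \<le> 5/4 * (5/4)"
        unfolding norm_mult using n1(1)[OF g(3)[OF \<tau>]] n1(2)[of "cnj (gk \<tau>)"] g(2)[OF \<tau>] by (intro mult_mono) auto
      then show ?thesis by simp
    qed
    have "norm (?G \<tau>) \<le> (E * (7 * N) * (5/4) + 5/4 * (E * norm (h' \<tau>))) * (2 / d) + 2 * (E * N * (14 / d\<^sup>2))"
      unfolding interaction_kernel_def D_def[symmetric] D'_def[symmetric] divide_inverse[of _ D] divide_inverse[of _ D']
      by (rule norm_mult_diff_le[OF num invb nb inv])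
    also have "\<dots> = E * ((5 / (2 * d)) * (7 * N + norm (h' \<tau>)) + 28 / d\<^sup>2 * N)" by (simp add: algebra_simps add_divide_distrib)
    finally show ?thesis .
  qed
  have hi: "((\<lambda>t. norm (h' (v t))) has_integral integral {0..1} (\<lambda>t. norm (h' (v t)))) {0..1}"
    unfolding v_def by (intro integrable_integral integrable_continuous_real continuous_intros continuous_on_rot[OF C1circD(2)[OF hC] w])
  have c7: "((\<lambda>t::real. c) has_integral c) {0..1}" for c :: real using has_integral_const_real[of c 0 1] by simp
  have "norm (integral {0..1} (\<lambda>t. interaction_kernel d ej ek w x (v t) (fk (v t)) (fk' (v t)) * v t - interaction_kernel d ej ek w x' (v t) (gk (v t)) (gk' (v t)) * v t))
     \<le> E * ((5 / (2 * d)) * (7 * N + integral {0..1} (\<lambda>t. norm (h' (v t)))) + 28 / d\<^sup>2 * N)"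
  proof (rule norm_integral_le[OF integrable_diff[OF i]])
    show "((\<lambda>t. E * ((5 / (2 * d)) * (7 * N + norm (h' (v t))) + 28 / d\<^sup>2 * N)) has_integral
       E * ((5 / (2 * d)) * (7 * N + integral {0..1} (\<lambda>t. norm (h' (v t)))) + 28 / d\<^sup>2 * N)) {0..1}"
      by (intro has_integral_mult_right has_integral_add c7 hi)
    show "norm (interaction_kernel d ej ek w x (v t) (fk (v t)) (fk' (v t)) * v t - interaction_kernel d ej ek w x' (v t) (gk (v t)) (gk' (v t)) * v t) \<le> E * ((5 / (2 * d)) * (7 * N + norm (h' (v t))) + 28 / d\<^sup>2 * N)" for t
      using pt[OF vc[of t]] vc[of t] by (simp add: left_diff_distrib[symmetric] norm_mult)
  qed
  also have "\<dots> \<le> E * ((5 / (2 * d)) * (7 * N + N) + 28 / d\<^sup>2 * N)"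
  proof -
    have "integral {0..1} (\<lambda>t. norm (h' (v t))) \<le> N"
      using path_increment_energy(1)[OF hC w, of 0 1 N] N by (simp add: v_def h'_def)
    then show ?thesis using E d by (intro mult_left_mono add_mono) auto
  qed
  also have "\<dots> = E * (20 / d + 28 / d\<^sup>2) * N" by (simp add: algebra_simps)
  also have "integral {0..1} (\<lambda>t. interaction_kernel d ej ek w x (v t) (fk (v t)) (fk' (v t)) * v t - interaction_kernel d ej ek w x' (v t) (gk (v t)) (gk' (v t)) * v t)
     = interaction_int d ej ek x fk fk' w - interaction_int d ej ek x' gk gk' w"
    unfolding interaction_int_def fint_rot[OF w] integral_diff[OF i] by (simp add: v_def)
  finally show ?thesis .
qed

text \<open>The difference of two values is the linear part up to an error with the factor E, a bound for
  \<open>|\<epsilon>| b\<^sub>j\<close>. The estimate is pointwise in \<open>w\<close> because the expression contains \<open>f\<^sub>j' w\<close> outside of the integrals; this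
  contributes the pointwise term on the right, which becomes the energy after squaring and integrating.\<close>
lemma full_expr_diff:
  fixes M :: real
  assumes e: "norm ej \<le> E" "norm ek \<le> E" and w: "w \<in> circ"
    and fj: "C1circ fj fj'" "\<And>v. v \<in> circ \<Longrightarrow> norm (fj v) \<le> 1" "\<And>v. v \<in> circ \<Longrightarrow> norm (fj' v) \<le> 1"
    and gj: "C1circ gj gj'" "\<And>v. v \<in> circ \<Longrightarrow> norm (gj v) \<le> 1" "\<And>v. v \<in> circ \<Longrightarrow> norm (gj' v) \<le> 1"
    and fk: "C1circ fk fk'" "\<And>v. v \<in> circ \<Longrightarrow> norm (fk v) \<le> 1" "\<And>v. v \<in> circ \<Longrightarrow> norm (fk' v) \<le> 1"
    and gk: "C1circ gk gk'" "\<And>v. v \<in> circ \<Longrightarrow> norm (gk v) \<le> 1" "\<And>v. v \<in> circ \<Longrightarrow> norm (gk' v) \<le> 1"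
    and N: "energy (\<lambda>w. fk' w - gk' w) \<le> N\<^sup>2" "energy (\<lambda>w. fj' w - gj' w) \<le> N\<^sup>2" "0 \<le> N"
    and h: "\<And>v. v \<in> circ \<Longrightarrow> norm (fk v - gk v) \<le> 7 * N" "\<And>v. v \<in> circ \<Longrightarrow> norm (fj v - gj v) \<le> 7 * N"
    and M: "norm Q' \<le> M" "norm L' \<le> M"
    and \<delta>: "norm (Q - Q') \<le> \<delta>" "norm (L - L') \<le> D * \<delta>"
    and C: "C \<ge> 2 + D + 5 * M + 690 * norm \<gamma>j + norm \<gamma>k * (4 / d + 2 * (20 / d + 28 / d\<^sup>2))" and D: "0 \<le> D"
  shows "norm (full_expr \<gamma>j \<gamma>k d ej ek Q L fj fj' fk fk' w - full_expr \<gamma>j \<gamma>k d ej ek Q' L' gj gj' gk gk' w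
            - ((L - L') * w - \<gamma>j * (fj' w - gj' w))) \<le> E * C * (\<delta> + N + norm (fj' w - gj' w))"
proof -
  define y where "y = norm (fj' w - gj' w)"
  have w1: "norm w = 1" using w by simp
  have \<delta>0: "0 \<le> \<delta>" using \<delta>(1) norm_ge_zero order_trans by blast
  have M0: "0 \<le> M" using M(1) norm_ge_zero order_trans by blast
  have y0: "0 \<le> y" by (simp add: y_def)
  define A A' where "A = 1 + ej * fj' w" and "A' = 1 + ej * gj' w"
  have n: "norm (ej * z) \<le> E * c" if "norm z \<le> c" for z c
    unfolding norm_mult using that e E by (intro mult_mono) auto
  have n1: "norm (1 + ej * z) \<le> 5/4" "norm (cnj w + ej * z) \<le> 5/4" if "norm z \<le> 1" for z
    using n[OF that] norm_triangle_ineq[of 1 "ej * z"] norm_triangle_ineq[of "cnj w" "ej * z"] w1 E by auto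
  have A: "norm A \<le> 5/4" "norm A' \<le> 5/4" using n1(1) fj(3)[OF w] gj(3)[OF w] by (auto simp: A_def A'_def)
  have "A - A' = ej * (fj' w - gj' w)" by (simp add: A_def A'_def algebra_simps)
  then have AA: "norm (A - A') \<le> E * y" using n[of "fj' w - gj' w" y] by (simp add: y_def)
  have A1: "norm (A - 1) \<le> E * 1" unfolding A_def using n[OF fj(3)[OF w]] by simp
  have X: "norm (Q * (cnj w + ej * cnj (fj w)) - Q' * (cnj w + ej * cnj (gj w))) \<le> \<delta> * (5/4) + M * (E * (7 * N))"
  proof (rule norm_mult_diff_le[OF \<delta>(1) _ M(1)])
    show "norm (cnj w + ej * cnj (fj w)) \<le> 5/4" using n1(2) fj(2)[OF w] by simp
    have "cnj w + ej * cnj (fj w) - (cnj w + ej * cnj (gj w)) = ej * cnj (fj w - gj w)" by (simp add: algebra_simps)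
    then show "norm (cnj w + ej * cnj (fj w) - (cnj w + ej * cnj (gj w))) \<le> E * (7 * N)"
      using n[of "cnj (fj w - gj w)"] h(2)[OF w] by (simp only: complex_mod_cnj)
  qed
  define X X' where "X = Q * ej * (cnj w + ej * cnj (fj w))" and "X' = Q' * ej * (cnj w + ej * cnj (gj w))"
  have "X - X' = ej * (Q * (cnj w + ej * cnj (fj w)) - Q' * (cnj w + ej * cnj (gj w)))" by (simp add: X_def X'_def algebra_simps)
  then have XX: "norm (X - X') \<le> E * (\<delta> * (5/4) + M * (E * (7 * N)))" using n[OF X] by simp
  have "norm (Q' * (cnj w + ej * cnj (gj w))) \<le> M * (5/4)"
    unfolding norm_mult using M n1(2)[of "cnj (gj w)"] gj(2)[OF w] M0 by (intro mult_mono) auto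
  from n[OF this] have "norm X' \<le> E * (M * (5/4))" by (simp add: X'_def mult_ac)
  also have "\<dots> \<le> 1/4 * (M * (5/4))" using E M0 by (intro mult_right_mono) auto
  finally have X'b: "norm (X' + L') \<le> 2 * M" using norm_triangle_ineq[of X' L'] M M0 by linarith
  \<comment> \<open>At order 0 in E only \<open>L - L'\<close> remains of the rotation term.\<close>
  have eq1: "(X + L) * A - (X' + L') * A' - (L - L') = (X - X') * A + (L - L') * (A - 1) + (X' + L') * (A - A')"
    by (simp add: algebra_simps)
  have "norm ((X + L) * A - (X' + L') * A' - (L - L')) \<le> norm ((X - X') * A) + norm ((L - L') * (A - 1)) + norm ((X' + L') * (A - A'))"
    unfolding eq1 by (intro norm_triangle_mono order_refl)
  also have "\<dots> \<le> E * (\<delta> * (5/4) + M * (E * (7 * N))) * (5/4) + D * \<delta> * (E * 1) + 2 * M * (E * y)"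
    unfolding norm_mult using XX A \<delta>(2) A1 X'b AA M0 \<delta>0 E N D by (intro add_mono mult_mono) auto
  also have "\<dots> \<le> E * ((2 + D + 5 * M) * (\<delta> + N + y))"
  proof -
    have "E * N * M \<le> 1/4 * (N * M)" using mult_right_mono[OF E(2), of "N * M"] N M0 by (simp add: mult_ac)
    moreover have "0 \<le> N * M" "0 \<le> N * D" "0 \<le> \<delta> * M" "0 \<le> y * D" "0 \<le> y * M" using N M0 D \<delta>0 y0 by simp_all
    ultimately have "(\<delta> * (5/4) + M * (E * (7 * N))) * (5/4) + D * \<delta> + 2 * M * y \<le> (2 + D + 5 * M) * (\<delta> + N + y)"
      using \<delta>0 N y0 by (simp add: algebra_simps)
    from mult_left_mono[OF this E(1)] show ?thesis by (simp add: algebra_simps)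
  qed
  finally have T1: "norm ((X + L) * A - (X' + L') * A' - (L - L')) \<le> E * ((2 + D + 5 * M) * (\<delta> + N + y))" .
  have e4: "norm ej \<le> 1/4" using e E by simp
  define S S' where "S = singular_int ej fj fj' w" and "S' = singular_int ej gj gj' w"
  have "norm (A * S - A' * S') \<le> E * y * 24 + 5/4 * (552 * N)"
    by (rule norm_mult_diff_le[OF AA _ A(2)])
      (auto simp: S_def S'_def intro!: singular_int_bound singular_int_diff fj gj e4 w[simplified] N w)
  also have "\<dots> \<le> 690 * (\<delta> + N + y)"
    using mult_right_mono[OF E(2) y0] \<delta>0 N y0 by simp
  finally have "norm (A * S - A' * S') \<le> 690 * (\<delta> + N + y)" .
  then have "norm (\<gamma>j * (A * S - A' * S')) \<le> norm \<gamma>j * (690 * (\<delta> + N + y))"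
    unfolding norm_mult by (intro mult_left_mono) auto
  from n[OF this] have T2: "norm (ej * (\<gamma>j * (A * S - A' * S'))) \<le> E * (norm \<gamma>j * (690 * (\<delta> + N + y)))" .
  \<comment> \<open>The interaction term has no factor \<open>ej\<close> in front; the factor E comes from the difference of the integrals.\<close>
  define I I' where "I = interaction_int d ej ek (fj w) fk fk' w" and "I' = interaction_int d ej ek (gj w) gk gk' w"
  have Ib: "norm I \<le> 4 / d" unfolding I_def by (rule interaction_int_bound[OF e fk(1) w fk(2,3) fj(2)[OF w]])
  have II: "norm (I - I') \<le> E * (20 / d + 28 / d\<^sup>2) * N"
    unfolding I_def I'_def by (rule interaction_int_diff[OF e w fk(1-3) fj(2)[OF w] gk(1-3) gj(2)[OF w] N(1,3) h(1) h(2)[OF w]])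
  have "norm (A * I - A' * I') \<le> E * y * (4 / d) + 5/4 * (E * (20 / d + 28 / d\<^sup>2) * N)"
    by (rule norm_mult_diff_le[OF AA Ib A(2) II])
  also have "\<dots> \<le> E * ((4 / d + 2 * (20 / d + 28 / d\<^sup>2)) * (\<delta> + N + y))"
  proof -
    define p q where "p = 4 / d" and "q = 20 / d + 28 / d\<^sup>2"
    have "0 \<le> p" "0 \<le> q" using d by (simp_all add: p_def q_def)
    then have "0 \<le> p * \<delta>" "0 \<le> p * N" "0 \<le> q * \<delta>" "0 \<le> q * N" "0 \<le> q * y" using \<delta>0 N y0 by simp_all
    then have "y * p + 5/4 * (q * N) \<le> (p + 2 * q) * (\<delta> + N + y)" by (simp add: algebra_simps)
    from mult_left_mono[OF this E(1)] show ?thesis unfolding p_def[symmetric] q_def[symmetric] by (simp add: algebra_simps)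
  qed
  finally have "norm (\<gamma>k * (A * I - A' * I')) \<le> norm \<gamma>k * (E * ((4 / d + 2 * (20 / d + 28 / d\<^sup>2)) * (\<delta> + N + y)))"
    unfolding norm_mult by (intro mult_left_mono) auto
  then have T3: "norm (\<gamma>k * (A * I - A' * I')) \<le> E * (norm \<gamma>k * (4 / d + 2 * (20 / d + 28 / d\<^sup>2)) * (\<delta> + N + y))"
    by (simp only: mult_ac)
  have eq: "full_expr \<gamma>j \<gamma>k d ej ek Q L fj fj' fk fk' w - full_expr \<gamma>j \<gamma>k d ej ek Q' L' gj gj' gk gk' w - ((L - L') * w - \<gamma>j * (fj' w - gj' w))
     = w * (((X + L) * A - (X' + L') * A' - (L - L')) + ej * (\<gamma>j * (A * S - A' * S')) - \<gamma>k * (A * I - A' * I'))"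
    unfolding full_expr_def A_def[symmetric] A'_def[symmetric] X_def[symmetric] X'_def[symmetric] S_def[symmetric] S'_def[symmetric] I_def[symmetric] I'_def[symmetric]
    by (simp add: algebra_simps)
  have "norm (((X + L) * A - (X' + L') * A' - (L - L')) + ej * (\<gamma>j * (A * S - A' * S')) - \<gamma>k * (A * I - A' * I'))
    \<le> E * ((2 + D + 5 * M) * (\<delta> + N + y)) + E * (norm \<gamma>j * (690 * (\<delta> + N + y))) + E * (norm \<gamma>k * (4 / d + 2 * (20 / d + 28 / d\<^sup>2)) * (\<delta> + N + y))"
    using norm_triangle_ineq4[of "((X + L) * A - (X' + L') * A' - (L - L')) + ej * (\<gamma>j * (A * S - A' * S'))" "\<gamma>k * (A * I - A' * I')"]
      norm_triangle_ineq[of "(X + L) * A - (X' + L') * A' - (L - L')" "ej * (\<gamma>j * (A * S - A' * S'))"] T1 T2 T3 by linarith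
  also have "\<dots> = E * (2 + D + 5 * M + 690 * norm \<gamma>j + norm \<gamma>k * (4 / d + 2 * (20 / d + 28 / d\<^sup>2))) * (\<delta> + N + y)"
    by (simp only: algebra_simps)
  also have "\<dots> \<le> E * C * (\<delta> + N + y)"
    using C E \<delta>0 N y0 by (intro mult_right_mono mult_left_mono) auto
  finally show ?thesis unfolding eq norm_mult w1 y_def by simp
qed

end

section \<open>Uniqueness of zeros\<close>

text \<open>With \<open>2 (Im z)\<^sup>2 = |z|\<^sup>2 - Re z\<^sup>2\<close> and its polarization, the square expands into terms that vanish by
  one-sidedness, the energy, and a constant. In particular \<open>Im h'\<close> carries half of the energy of \<open>h'\<close>.\<close>
lemma energy_identity:
  fixes h' :: "complex \<Rightarrow> complex" and a g :: real
  assumes c: "continuous_on circ h'"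
    and o: "integral {0..1} (\<lambda>t. h' (cis (2 * pi * t)) * cis (2 * pi * t)) = 0"
      "integral {0..1} (\<lambda>t. h' (cis (2 * pi * t)) * cnj (cis (2 * pi * t))) = 0"
      "integral {0..1} (\<lambda>t. h' (cis (2 * pi * t)) ^ 2) = 0"
  shows "((\<lambda>t. (a * Im (cis (2 * pi * t)) - g * Im (h' (cis (2 * pi * t))))\<^sup>2) has_integral a\<^sup>2 / 2 + g\<^sup>2 / 2 * energy h') {0..1}"
proof -
  define z where "z t = cis (2 * pi * t)" for t
  define q where "q t = h' (z t)" for t
  have qc: "continuous_on {0..1} q"
    unfolding q_def z_def using continuous_on_rot[OF c, of 1] by simp
  have zc: "continuous_on {0..1} z" unfolding z_def by (intro continuous_intros)
  have hi: "(F has_integral integral {0..1} F) {0..1}" if "continuous_on {0..1} F" for F :: "real \<Rightarrow> complex"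
    using that by (intro integrable_integral integrable_continuous_real)
  have Re0: "((\<lambda>t. Re (F t)) has_integral 0) {0..1}" if "continuous_on {0..1} F" "integral {0..1} F = 0" for F :: "real \<Rightarrow> complex"
    using has_integral_linear[OF hi[OF that(1)] bounded_linear_Re] that(2) by (simp add: o_def)
  have 1: "((\<lambda>t. Re (q t * z t)) has_integral 0) {0..1}"
    using o(1) by (intro Re0 continuous_intros qc zc) (simp add: q_def z_def)
  have 2: "((\<lambda>t. Re (q t * cnj (z t))) has_integral 0) {0..1}"
    using o(2) by (intro Re0 continuous_intros qc zc) (simp add: q_def z_def)
  have 3: "((\<lambda>t. Re (q t ^ 2)) has_integral 0) {0..1}"
    using o(3) by (intro Re0 continuous_intros qc zc) (simp add: q_def z_def)
  have "integral {0..1} (\<lambda>t. z t ^ 2) = 0"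
  proof -
    have "z t ^ 2 = cis (2 * pi * of_int 2 * t)" for t by (simp add: z_def cis_mult power2_eq_square mult.assoc)
    then show ?thesis using integral_cis_multiple[of 2] by simp
  qed
  then have 4: "((\<lambda>t. Re (z t ^ 2)) has_integral 0) {0..1}" by (intro Re0 continuous_intros zc)
  have 5: "((\<lambda>t. (norm (q t))\<^sup>2) has_integral energy h') {0..1}"
    unfolding energy_def q_def z_def[symmetric]
    by (intro integrable_integral integrable_continuous_real continuous_intros qc[unfolded q_def])
  have 6: "((\<lambda>t. 1 :: real) has_integral 1) {0..1::real}" using has_integral_const_real[of "1::real" 0 1] by simp
  have "((\<lambda>t. a\<^sup>2 / 2 * (1 - Re (z t ^ 2)) - a * g * (Re (q t * cnj (z t)) - Re (q t * z t)) + g\<^sup>2 / 2 * ((norm (q t))\<^sup>2 - Re (q t ^ 2)))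
      has_integral a\<^sup>2 / 2 * (1 - 0) - a * g * (0 - 0) + g\<^sup>2 / 2 * (energy h' - 0)) {0..1}"
    by (intro has_integral_add has_integral_diff has_integral_mult_right 1 2 3 4 5 6)
  moreover have "a\<^sup>2 / 2 * (1 - Re (z t ^ 2)) - a * g * (Re (q t * cnj (z t)) - Re (q t * z t)) + g\<^sup>2 / 2 * ((norm (q t))\<^sup>2 - Re (q t ^ 2))
     = (a * Im (z t) - g * Im (q t))\<^sup>2" for t
  proof -
    have "(Re (z t))\<^sup>2 + (Im (z t))\<^sup>2 = 1" by (simp add: z_def)
    then have z2: "1 - Re (z t ^ 2) = 2 * (Im (z t))\<^sup>2" by (simp add: power2_eq_square)
    have q2: "(norm (q t))\<^sup>2 - Re (q t ^ 2) = 2 * (Im (q t))\<^sup>2" unfolding cmod_power2 by (simp add: power2_eq_square)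
    have qz: "Re (q t * cnj (z t)) - Re (q t * z t) = 2 * (Im (q t) * Im (z t))" by simp
    show ?thesis unfolding z2 q2 qz by (simp add: power2_eq_square algebra_simps)
  qed
  ultimately show ?thesis by (simp add: z_def q_def)
qed

lemma sum3_square_le: "(x + y + z)\<^sup>2 \<le> 3 * (x\<^sup>2 + y\<^sup>2 + z\<^sup>2)" for x y z :: real
proof -
  have "0 \<le> (x - y)\<^sup>2 + (y - z)\<^sup>2 + (x - z)\<^sup>2" by simp
  then show ?thesis by (simp add: power2_eq_square algebra_simps)
qed

lemma energy_estimate:
  fixes h' :: "complex \<Rightarrow> complex" and a g c \<delta> N :: real
  assumes co: "continuous_on circ h'"
    and o: "integral {0..1} (\<lambda>t. h' (cis (2 * pi * t)) * cis (2 * pi * t)) = 0"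
      "integral {0..1} (\<lambda>t. h' (cis (2 * pi * t)) * cnj (cis (2 * pi * t))) = 0"
      "integral {0..1} (\<lambda>t. h' (cis (2 * pi * t)) ^ 2) = 0"
    and b: "\<And>w. w \<in> circ \<Longrightarrow> \<bar>a * Im w - g * Im (h' w)\<bar> \<le> c * (\<delta> + N + norm (h' w))"
  shows "a\<^sup>2 / 2 + g\<^sup>2 / 2 * energy h' \<le> 3 * c\<^sup>2 * (\<delta>\<^sup>2 + N\<^sup>2 + energy h')"
proof (rule has_integral_le[OF energy_identity[OF co o]])
  have qc: "continuous_on {0..1} (\<lambda>t. h' (cis (2 * pi * t)))" using continuous_on_rot[OF co, of 1] by simp
  have c1: "((\<lambda>t::real. u) has_integral u) {0..1}" for u :: real using has_integral_const_real[of u 0 1] by simp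
  have "((\<lambda>t. (norm (h' (cis (2 * pi * t))))\<^sup>2) has_integral energy h') {0..1}"
    unfolding energy_def by (intro integrable_integral integrable_continuous_real continuous_intros qc)
  then show "((\<lambda>t. 3 * c\<^sup>2 * (\<delta>\<^sup>2 + N\<^sup>2 + (norm (h' (cis (2 * pi * t))))\<^sup>2)) has_integral 3 * c\<^sup>2 * (\<delta>\<^sup>2 + N\<^sup>2 + energy h')) {0..1}"
    by (intro has_integral_mult_right has_integral_add c1)
  fix t :: real
  let ?w = "cis (2 * pi * t)"
  have "(a * Im ?w - g * Im (h' ?w))\<^sup>2 \<le> (c * (\<delta> + N + norm (h' ?w)))\<^sup>2"
    using b[OF cis_circ] by (rule power2_le_iff_abs_le[THEN iffD2, rotated]) (rule order_trans[OF abs_ge_zero b[OF cis_circ]])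
  also have "\<dots> \<le> c\<^sup>2 * (3 * (\<delta>\<^sup>2 + N\<^sup>2 + (norm (h' ?w))\<^sup>2))"
    unfolding power_mult_distrib by (intro mult_left_mono sum3_square_le) simp
  finally show "(a * Im ?w - g * Im (h' ?w))\<^sup>2 \<le> 3 * c\<^sup>2 * (\<delta>\<^sup>2 + N\<^sup>2 + (norm (h' ?w))\<^sup>2)" by (simp only: mult_ac)
qed

lemma energy_nonneg: "continuous_on circ h' \<Longrightarrow> 0 \<le> energy h'"
  unfolding energy_def
  by (intro integral_nonneg integrable_continuous_real continuous_intros continuous_on_rot[where w = 1, simplified]) auto

lemma space_X_C1circ:
  assumes "f \<in> space_X \<alpha>" "0 < \<alpha>" "j \<in> {1, 2}"
  shows "C1circ (f j) (circ_deriv (f j))"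
proof -
  have f: "f j \<in> holder1 \<alpha>" using assms by (auto simp: space_X_def)
  then have "circ_deriv (f j) \<in> holder \<alpha>" by (simp add: holder1_def)
  then show ?thesis
    using holder1_deriv[OF f] holder_continuous[OF _ assms(2)] by (auto simp: C1circ_def)
qed

lemma space_X_difference:
  assumes f: "f \<in> space_X \<alpha>" "g \<in> space_X \<alpha>" and \<alpha>: "0 < \<alpha>" and j: "j \<in> {1, 2}"
  defines "h' \<equiv> \<lambda>w. circ_deriv (f j) w - circ_deriv (g j) w"
  shows "integral {0..1} (\<lambda>t. h' (cis (2 * pi * t)) * cis (2 * pi * t)) = 0"
      "integral {0..1} (\<lambda>t. h' (cis (2 * pi * t)) * cnj (cis (2 * pi * t))) = 0"
      "integral {0..1} (\<lambda>t. h' (cis (2 * pi * t)) ^ 2) = 0"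
      "integral {0..1} (\<lambda>t. f j (cis (2 * pi * t)) - g j (cis (2 * pi * t))) = 0"
proof -
  obtain A :: "nat \<Rightarrow> real" where A: "\<And>w. w \<in> circ \<Longrightarrow> (\<lambda>n. of_real (A (Suc n)) * cnj w ^ Suc n) sums f j w"
    using f(1) j unfolding space_X_def by blast
  obtain B :: "nat \<Rightarrow> real" where B: "\<And>w. w \<in> circ \<Longrightarrow> (\<lambda>n. of_real (B (Suc n)) * cnj w ^ Suc n) sums g j w"
    using f(2) j unfolding space_X_def by blast
  have S: "(\<lambda>n. of_real (A (Suc n) - B (Suc n)) * cnj w ^ Suc n) sums (f j w - g j w)" if "w \<in> circ" for w
    using sums_diff[OF A[OF that] B[OF that]] by (simp add: left_diff_distrib)
  have C: "C1circ (\<lambda>w. f j w - g j w) h'"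
    unfolding h'_def using f \<alpha> j by (intro C1circ_diff space_X_C1circ)
  note * = space_X_diff_orthogonal[OF C1circD(1)[OF C] C1circD(2)[OF C] S]
  show "integral {0..1} (\<lambda>t. h' (cis (2 * pi * t)) * cis (2 * pi * t)) = 0"
      "integral {0..1} (\<lambda>t. h' (cis (2 * pi * t)) * cnj (cis (2 * pi * t))) = 0"
      "integral {0..1} (\<lambda>t. h' (cis (2 * pi * t)) ^ 2) = 0"
      "integral {0..1} (\<lambda>t. f j (cis (2 * pi * t)) - g j (cis (2 * pi * t))) = 0"
    using * by blast+
qed

text \<open>The linear part of the difference of the equations is bounded below in L2 by the energy identity, and the rest is
  bounded by a multiple of \<open>\<epsilon>\<close> times the same quantities. So for small \<open>\<epsilon>\<close> the difference is absorbed.\<close>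
lemma unique_zero:
  fixes \<alpha> d M :: real and b \<gamma> :: "nat \<Rightarrow> real"
  assumes \<alpha>: "0 < \<alpha>" and b: "0 < b 1" "0 < b 2" and d: "0 < d" and \<gamma>: "\<gamma> 1 \<noteq> 0" "\<gamma> 2 \<noteq> 0" and M: "0 \<le> M"
  shows "\<exists>\<epsilon>1>0. \<forall>\<epsilon> \<Omega> Z f \<Omega>' Z' f'. \<bar>\<epsilon>\<bar> \<le> \<epsilon>1 \<longrightarrow> f \<in> ball_X \<alpha> \<longrightarrow> f' \<in> ball_X \<alpha> \<longrightarrow> F_zero b d \<gamma> \<epsilon> \<Omega> Z f \<longrightarrow>
      F_zero b d \<gamma> \<epsilon> \<Omega>' Z' f' \<longrightarrow> \<bar>2 * \<Omega>'\<bar> \<le> M \<longrightarrow> \<bar>2 * \<Omega>' * Z'\<bar> \<le> M \<longrightarrow>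
      2 * \<Omega> = 2 * \<Omega>' \<and> 2 * \<Omega> * Z = 2 * \<Omega>' * Z' \<and> (\<forall>j\<in>{1, 2}. \<forall>w\<in>circ. f j w = f' j w)"
proof -
  define D where "D = 1 + d"
  define M1 where "M1 = D * (M + M)"
  define G where "G = \<bar>\<gamma> 1\<bar> + \<bar>\<gamma> 2\<bar>"
  define C where "C = 2 + D + 5 * M1 + 690 * G + G * (4 / d + 2 * (20 / d + 28 / d\<^sup>2))"
  \<comment> \<open>The coercivity constant of the linear part: \<open>\<kappa> * (\<delta>\<^sup>2 + N\<^sup>2)\<close> is at most the sum of the two left sides of the
    energy estimate. The right sides sum to at most \<open>9 * (E * C)\<^sup>2 * (\<delta>\<^sup>2 + N\<^sup>2)\<close>, so \<open>(E * C)\<^sup>2 \<le> \<kappa> / 16\<close> suffices.\<close>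
  define \<kappa> where "\<kappa> = min (1 / (4 * (1 + 1 / d)\<^sup>2)) (min ((\<gamma> 1)\<^sup>2) ((\<gamma> 2)\<^sup>2) / 2)"
  have D: "1 \<le> D" "0 \<le> D" using d by (auto simp: D_def)
  have M1: "0 \<le> M1" "M \<le> M1" using M D by (auto simp: M1_def intro: order_trans[OF _ mult_right_mono[of 1]])
  have G: "0 \<le> G" "\<bar>\<gamma> 1\<bar> \<le> G" "\<bar>\<gamma> 2\<bar> \<le> G" by (auto simp: G_def)
  have p: "0 \<le> 4 / d + 2 * (20 / d + 28 / d\<^sup>2)" using d by simp
  have C0: "C > 0"
    using D M1 G mult_nonneg_nonneg[OF G(1) p] unfolding C_def by linarith
  have Cj: "2 + D + 5 * M1 + 690 * norm (complex_of_real (\<gamma> j)) + norm (complex_of_real (\<gamma> k)) * (4 / d + 2 * (20 / d + 28 / d\<^sup>2)) \<le> C"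
    if "j \<in> {1, 2}" "k \<in> {1, 2}" for j k
  proof -
    have "\<bar>\<gamma> j\<bar> \<le> G" "\<bar>\<gamma> k\<bar> \<le> G" using that G by auto
    then have "690 * \<bar>\<gamma> j\<bar> \<le> 690 * G" "\<bar>\<gamma> k\<bar> * (4 / d + 2 * (20 / d + 28 / d\<^sup>2)) \<le> G * (4 / d + 2 * (20 / d + 28 / d\<^sup>2))"
      using p by (simp, intro mult_right_mono)
    then show ?thesis unfolding C_def norm_of_real by linarith
  qed
  have d1: "0 < 1 + 1 / d" using d by (simp add: add_pos_pos)
  have \<kappa>: "\<kappa> > 0" using \<gamma> d1 unfolding \<kappa>_def min_less_iff_conj by simp
  define Emax where "Emax = min (min (1/4) (d / 8)) (sqrt \<kappa> / (4 * C))"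
  have Em: "Emax > 0" using d \<kappa> C0 by (simp add: Emax_def)
  define B where "B = b 1 + b 2"
  have B: "B > 0" using b by (simp add: B_def)
  show ?thesis
  proof (intro exI[of _ "Emax / B"] conjI allI impI)
    show "0 < Emax / B" using Em B by simp
    fix \<epsilon> \<Omega> Z f \<Omega>' Z' f'
    assume \<epsilon>: "\<bar>\<epsilon>\<bar> \<le> Emax / B" and f: "f \<in> ball_X \<alpha>" and f': "f' \<in> ball_X \<alpha>"
      and z: "F_zero b d \<gamma> \<epsilon> \<Omega> Z f" and z': "F_zero b d \<gamma> \<epsilon> \<Omega>' Z' f'"
      and b1: "\<bar>2 * \<Omega>'\<bar> \<le> M" and b2: "\<bar>2 * \<Omega>' * Z'\<bar> \<le> M"
    define E where "E = \<bar>\<epsilon>\<bar> * B"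
    have E: "0 \<le> E" "E \<le> 1/4" "E \<le> d / 8" "E \<le> sqrt \<kappa> / (4 * C)"
      using \<epsilon> B by (auto simp: E_def Emax_def pos_le_divide_eq)
    have eb: "norm (complex_of_real \<epsilon> * of_real (b j)) \<le> E" if "j \<in> {1, 2}" for j
      unfolding norm_mult norm_of_real E_def B_def using that b by (intro mult_left_mono) auto
    have X: "f \<in> space_X \<alpha>" "f' \<in> space_X \<alpha>" using f f' by (auto simp: ball_X_def)
    define h' where "h' j w = circ_deriv (f j) w - circ_deriv (f' j) w" for j w
    define N where "N = sqrt (energy (h' 1) + energy (h' 2))"
    have cd: "C1circ (f j) (circ_deriv (f j))" "C1circ (f' j) (circ_deriv (f' j))" if "j \<in> {1, 2}" for j
      using space_X_C1circ X \<alpha> that by blast+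
    have dC: "C1circ (\<lambda>w. f j w - f' j w) (h' j)" if "j \<in> {1, 2}" for j
      unfolding h'_def using cd[OF that] by (rule C1circ_diff)
    have en: "0 \<le> energy (h' j)" if "j \<in> {1, 2}" for j by (rule energy_nonneg[OF C1circD(2)[OF dC[OF that]]])
    have N2: "N\<^sup>2 = energy (h' 1) + energy (h' 2)" using en[of 1] en[of 2] by (simp add: N_def)
    have N: "0 \<le> N" "energy (h' j) \<le> N\<^sup>2" if "j \<in> {1, 2}" for j
      using en[of 1] en[of 2] that by (auto simp: N_def)
    have N0: "0 \<le> N" using N(1)[of 1] by simp
    have sup: "norm (f j w - f' j w) \<le> 7 * N" if "j \<in> {1, 2}" "w \<in> circ" for j w
      using sup_le_energy[OF dC[OF that(1)] that(2) N(2)[OF that(1)] N0] space_X_difference(4)[OF X \<alpha> that(1)] by simp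
    define dQ where "dQ = 2 * \<Omega> - 2 * \<Omega>'"
    define dP where "dP = 2 * \<Omega> * Z - 2 * \<Omega>' * Z'"
    define \<delta> where "\<delta> = \<bar>dQ\<bar> + \<bar>dP\<bar>"
    define L where "L j Q P = (-1) ^ j * P - (of_nat j - 1) * d * Q" for j and Q P :: real
    define a where "a j = L j dQ dP" for j
    have ad: "L j (2 * \<Omega>) (2 * \<Omega> * Z) - L j (2 * \<Omega>') (2 * \<Omega>' * Z') = a j" for j
      by (simp add: L_def a_def dQ_def dP_def algebra_simps)
    have Lb: "\<bar>L j Q P\<bar> \<le> D * (\<bar>Q\<bar> + \<bar>P\<bar>)" if "j \<in> {1, 2}" for j Q P
    proof -
      have "\<bar>L j Q P\<bar> \<le> \<bar>P\<bar> + d * \<bar>Q\<bar>" using that d by (auto simp: L_def abs_mult intro: order_trans[OF abs_triangle_ineq4])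
      also have "\<dots> \<le> D * (\<bar>Q\<bar> + \<bar>P\<bar>)" using d by (simp add: D_def algebra_simps)
      finally show ?thesis .
    qed
    have pt: "\<bar>a j * Im w - \<gamma> j * Im (h' j w)\<bar> \<le> E * C * (\<delta> + N + norm (h' j w))" if j: "j \<in> {1, 2}" and w: "w \<in> circ" for j w
    proof -
      define k where "k = 3 - j"
      have k: "k \<in> {1, 2}" using j by (auto simp: k_def)
      let ?K = "full_expr (of_real (\<gamma> j)) (of_real (\<gamma> k)) (of_real d) (of_real \<epsilon> * of_real (b j)) (of_real \<epsilon> * of_real (b k))"
      let ?K1 = "?K (of_real (2 * \<Omega>)) (of_real (L j (2 * \<Omega>) (2 * \<Omega> * Z))) (f j) (circ_deriv (f j)) (f k) (circ_deriv (f k)) w"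
      let ?K2 = "?K (of_real (2 * \<Omega>')) (of_real (L j (2 * \<Omega>') (2 * \<Omega>' * Z'))) (f' j) (circ_deriv (f' j)) (f' k) (circ_deriv (f' k)) w"
      have "norm (?K1 - ?K2 - ((of_real (L j (2 * \<Omega>) (2 * \<Omega> * Z)) - of_real (L j (2 * \<Omega>') (2 * \<Omega>' * Z'))) * w - of_real (\<gamma> j) * (circ_deriv (f j) w - circ_deriv (f' j) w)))
         \<le> E * C * (\<delta> + N + norm (circ_deriv (f j) w - circ_deriv (f' j) w))"
      proof (rule full_expr_diff[OF E(1-3) d eb[OF j] eb[OF k] w])
        show "norm (of_real (2 * \<Omega>') :: complex) \<le> M1" unfolding norm_of_real using b1 M1 by linarith
        show "norm (of_real (L j (2 * \<Omega>') (2 * \<Omega>' * Z')) :: complex) \<le> M1"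
        proof -
          have "D * (\<bar>2 * \<Omega>'\<bar> + \<bar>2 * \<Omega>' * Z'\<bar>) \<le> M1"
            unfolding M1_def using b1 b2 D by (intro mult_left_mono) auto
          then show ?thesis unfolding norm_of_real using Lb[OF j, of "2 * \<Omega>'" "2 * \<Omega>' * Z'"] by linarith
        qed
        show "norm (of_real (2 * \<Omega>) - of_real (2 * \<Omega>') :: complex) \<le> \<delta>"
          unfolding of_real_diff[symmetric] norm_of_real \<delta>_def dQ_def by simp
        show "norm (of_real (L j (2 * \<Omega>) (2 * \<Omega> * Z)) - of_real (L j (2 * \<Omega>') (2 * \<Omega>' * Z')) :: complex) \<le> D * \<delta>"
          unfolding of_real_diff[symmetric] norm_of_real ad unfolding a_def \<delta>_def by (rule Lb[OF j])
        show "energy (\<lambda>w. circ_deriv (f k) w - circ_deriv (f' k) w) \<le> N\<^sup>2" using N(2)[OF k] unfolding h'_def .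
        show "energy (\<lambda>w. circ_deriv (f j) w - circ_deriv (f' j) w) \<le> N\<^sup>2" using N(2)[OF j] unfolding h'_def .
      qed (use Cj[OF j k] D in \<open>auto intro!: cd j k N0 sup ball_X_bounds[OF f \<alpha>] ball_X_bounds[OF f' \<alpha>] simp del: mem_sphere_0\<close>)
      then have n: "norm (?K1 - ?K2 - (of_real (a j) * w - of_real (\<gamma> j) * h' j w)) \<le> E * C * (\<delta> + N + norm (h' j w))"
        unfolding of_real_diff[symmetric] ad h'_def .
      have "Im ?K1 = 0"
        using z j w F_eq_Im_full_expr[OF j k_def, of b d \<gamma> \<epsilon> \<Omega> Z f w] unfolding F_zero_def L_def by force
      moreover have "Im ?K2 = 0"
        using z' j w F_eq_Im_full_expr[OF j k_def, of b d \<gamma> \<epsilon> \<Omega>' Z' f' w] unfolding F_zero_def L_def by force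
      ultimately have "Im (?K1 - ?K2 - (of_real (a j) * w - of_real (\<gamma> j) * h' j w)) = - (a j * Im w - \<gamma> j * Im (h' j w))"
        by simp
      then show ?thesis using order_trans[OF abs_Im_le_cmod n] by simp
    qed
    have est: "(a j)\<^sup>2 / 2 + (\<gamma> j)\<^sup>2 / 2 * energy (h' j) \<le> 3 * (E * C)\<^sup>2 * (\<delta>\<^sup>2 + N\<^sup>2 + energy (h' j))" if j: "j \<in> {1, 2}" for j
      by (rule energy_estimate[OF C1circD(2)[OF dC[OF j]] _ _ _ pt[OF j]])
        (use space_X_difference[OF X \<alpha> j] in \<open>simp_all add: h'_def\<close>)
    have EC: "(E * C)\<^sup>2 \<le> \<kappa> / 16"
    proof -
      have "E * C \<le> sqrt \<kappa> / 4" using E(4) C0 by (simp add: field_simps)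
      then have "(E * C)\<^sup>2 \<le> (sqrt \<kappa> / 4)\<^sup>2" using E(1) C0 by (intro power_mono) auto
      then show ?thesis using \<kappa> by (simp add: power_divide)
    qed
    have "\<kappa> * \<delta>\<^sup>2 \<le> (a 1)\<^sup>2 / 2 + (a 2)\<^sup>2 / 2"
    proof -
      have a12: "a 1 = - dP" "a 2 = dP - d * dQ" by (simp_all add: a_def L_def)
      have "\<delta> \<le> (1 + 1 / d) * (\<bar>a 1\<bar> + \<bar>a 2\<bar>)"
      proof -
        have "d * \<bar>dQ\<bar> = \<bar>d * dQ\<bar>" using d by (simp add: abs_mult)
        also have "\<dots> \<le> \<bar>a 1\<bar> + \<bar>a 2\<bar>" unfolding a12 by linarith
        finally have "\<bar>dQ\<bar> \<le> 1 / d * (\<bar>a 1\<bar> + \<bar>a 2\<bar>)" using d by (simp add: field_simps)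
        moreover have "\<bar>dP\<bar> \<le> \<bar>a 1\<bar> + \<bar>a 2\<bar>" unfolding a12 by linarith
        ultimately have "\<bar>dP\<bar> + \<bar>dQ\<bar> \<le> (\<bar>a 1\<bar> + \<bar>a 2\<bar>) + 1 / d * (\<bar>a 1\<bar> + \<bar>a 2\<bar>)"
          by (intro add_mono)
        then show ?thesis unfolding \<delta>_def distrib_right[of 1] by (simp only: mult_1 add.commute)
      qed
      then have "\<delta>\<^sup>2 \<le> ((1 + 1 / d) * (\<bar>a 1\<bar> + \<bar>a 2\<bar>))\<^sup>2" by (intro power_mono) (auto simp: \<delta>_def)
      also have "\<dots> = (1 + 1 / d)\<^sup>2 * (\<bar>a 1\<bar> + \<bar>a 2\<bar>)\<^sup>2" by (rule power_mult_distrib)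
      also have "(\<bar>a 1\<bar> + \<bar>a 2\<bar>)\<^sup>2 \<le> 2 * ((a 1)\<^sup>2 + (a 2)\<^sup>2)"
        using zero_le_power2[of "\<bar>a 1\<bar> - \<bar>a 2\<bar>"] by (simp add: power2_sum power2_diff)
      finally have *: "\<delta>\<^sup>2 \<le> (1 + 1 / d)\<^sup>2 * (2 * ((a 1)\<^sup>2 + (a 2)\<^sup>2))" by (simp add: mult_left_mono)
      have "\<kappa> * \<delta>\<^sup>2 \<le> 1 / (4 * (1 + 1 / d)\<^sup>2) * ((1 + 1 / d)\<^sup>2 * (2 * ((a 1)\<^sup>2 + (a 2)\<^sup>2)))"
        by (rule mult_mono[OF _ *]) (simp_all add: \<kappa>_def)
      also have "\<dots> = ((a 1)\<^sup>2 + (a 2)\<^sup>2) / 2"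
      proof -
        have "(1 + 1 / d)\<^sup>2 \<noteq> 0" using d1 by simp
        then show ?thesis by simp
      qed
      finally show ?thesis by (simp add: add_divide_distrib)
    qed
    moreover have "\<kappa> * energy (h' j) \<le> (\<gamma> j)\<^sup>2 / 2 * energy (h' j)" if "j \<in> {1, 2}" for j
      using that by (intro mult_right_mono en) (auto simp: \<kappa>_def min_le_iff_disj)
    from this[of 1] this[of 2] have "\<kappa> * N\<^sup>2 \<le> (\<gamma> 1)\<^sup>2 / 2 * energy (h' 1) + (\<gamma> 2)\<^sup>2 / 2 * energy (h' 2)"
      unfolding N2 by (simp add: distrib_left)
    ultimately have "\<kappa> * (\<delta>\<^sup>2 + N\<^sup>2) \<le> 3 * (E * C)\<^sup>2 * (\<delta>\<^sup>2 + N\<^sup>2 + energy (h' 1)) + 3 * (E * C)\<^sup>2 * (\<delta>\<^sup>2 + N\<^sup>2 + energy (h' 2))"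
      using est[of 1, simplified] est[of 2, simplified] unfolding distrib_left[of \<kappa>] One_nat_def by linarith
    also have "\<dots> = (E * C)\<^sup>2 * (6 * \<delta>\<^sup>2 + 9 * N\<^sup>2)" unfolding N2 by (simp add: algebra_simps)
    also have "\<dots> \<le> \<kappa> / 16 * (6 * \<delta>\<^sup>2 + 9 * N\<^sup>2)" by (rule mult_right_mono[OF EC]) simp
    finally have "\<kappa> * (10 * \<delta>\<^sup>2 + 7 * N\<^sup>2) \<le> 0" by (simp add: algebra_simps)
    then have "10 * \<delta>\<^sup>2 + 7 * N\<^sup>2 \<le> 0" using \<kappa> by (simp add: mult_le_0_iff)
    moreover have "0 \<le> \<delta>\<^sup>2" "0 \<le> N\<^sup>2" by simp_all
    ultimately have "\<delta>\<^sup>2 = 0" "N\<^sup>2 = 0" by linarith+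
    then have "\<delta> = 0" "N = 0" by simp_all
    then have "dQ = 0" "dP = 0" unfolding \<delta>_def by linarith+
    then show "2 * \<Omega> = 2 * \<Omega>'" "2 * \<Omega> * Z = 2 * \<Omega>' * Z'" by (simp_all add: dQ_def dP_def)
    show "\<forall>j\<in>{1, 2}. \<forall>w\<in>circ. f j w = f' j w"
    proof (intro ballI)
      fix j :: nat and w assume "j \<in> {1, 2}" "w \<in> circ"
      then show "f j w = f' j w" using sup[of j w] \<open>N = 0\<close> by simp
    qed
  qed
qed

section \<open>Strict convexity of curves close to the circle\<close>

text \<open>An open half-space together with one point of its boundary is convex. Supporting lines that touch a
  set in one point only are expressed by it.\<close>
lemma convex_open_halfspace_insert:
  fixes n p :: "'a::real_inner"
  shows "convex ({z. n \<bullet> (z - p) < 0} \<union> {p})"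
proof (rule convexI)
  fix x y :: 'a and u v :: real
  assume x: "x \<in> {z. n \<bullet> (z - p) < 0} \<union> {p}" and y: "y \<in> {z. n \<bullet> (z - p) < 0} \<union> {p}"
    and u: "0 \<le> u" "0 \<le> v" "u + v = 1"
  have "u *\<^sub>R x + v *\<^sub>R y - p = u *\<^sub>R (x - p) + v *\<^sub>R (y - p)"
    using u(3) by (simp add: algebra_simps scaleR_left_distrib[symmetric])
  then have e: "n \<bullet> (u *\<^sub>R x + v *\<^sub>R y - p) = u * (n \<bullet> (x - p)) + v * (n \<bullet> (y - p))"
    by (simp add: inner_add_right)
  consider "u = 0" | "v = 0" | "x = p" "y = p" | "u > 0" "v > 0" "x \<noteq> p" | "u > 0" "v > 0" "y \<noteq> p"
    using u(1,2) less_le by metis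
  then show "u *\<^sub>R x + v *\<^sub>R y \<in> {z. n \<bullet> (z - p) < 0} \<union> {p}"
  proof cases
    case 1 then show ?thesis using y u by simp
  next
    case 2 then show ?thesis using x u by simp
  next
    case 3 then show ?thesis using u by (simp add: scaleR_left_distrib[symmetric])
  next
    case 4
    then have "u * (n \<bullet> (x - p)) < 0" using x by (simp add: mult_pos_neg)
    moreover have "v * (n \<bullet> (y - p)) \<le> 0" using y 4 by (auto simp: mult_nonneg_nonpos)
    ultimately show ?thesis using e by simp
  next
    case 5
    then have "v * (n \<bullet> (y - p)) < 0" using y by (simp add: mult_pos_neg)
    moreover have "u * (n \<bullet> (x - p)) \<le> 0" using x 5 by (auto simp: mult_nonneg_nonpos)
    ultimately show ?thesis using e by simp
  qed
qed

text \<open>Each point of the curve has a supporting line that touches the curve in this point only, hence also the convex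
  hull K of the curve. So the curve avoids the interior of K. That interior is connected and meets the inside of
  the curve, so by the Jordan curve theorem it equals the inside. A segment through a
  boundary point of K would lie on the supporting line there, and hence consist of that point only.\<close>
lemma strictly_convex_inside:
  fixes c :: "real \<Rightarrow> complex" and n :: "complex \<Rightarrow> complex"
  assumes c: "simple_path c" "pathfinish c = pathstart c"
    and n: "\<And>p q. p \<in> path_image c \<Longrightarrow> q \<in> path_image c \<Longrightarrow> q \<noteq> p \<Longrightarrow> n p \<bullet> (q - p) < 0"
    and n0: "\<And>p. p \<in> path_image c \<Longrightarrow> n p \<noteq> 0"
  shows "strictly_convex_domain (inside (path_image c))"
proof -
  let ?C = "path_image c"
  define K where "K = convex hull ?C"
  note J = Jordan_inside_outside[OF c]
  have CK: "?C \<subseteq> K" unfolding K_def by (rule hull_subset)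
  have cK: "compact K" unfolding K_def using c by (intro compact_convex_hull compact_path_image simple_path_imp_path)
  have vK: "convex K" unfolding K_def by (rule convex_convex_hull)
  have Kn: "K \<subseteq> {z. n p \<bullet> (z - p) < 0} \<union> {p}" if "p \<in> ?C" for p
    unfolding K_def using n[OF that] by (intro hull_minimal convex_open_halfspace_insert) auto
  have dis: "?C \<inter> interior K = {}"
  proof (rule ccontr)
    assume "?C \<inter> interior K \<noteq> {}"
    then obtain p where p: "p \<in> ?C" "p \<in> interior K" by blast
    then obtain e where e: "e > 0" "ball p e \<subseteq> K" by (meson mem_interior)
    define s where "s = e / (2 * norm (n p))"
    have s: "s > 0" using e n0[OF p(1)] by (simp add: s_def)
    have "p + s *\<^sub>R n p \<in> ball p e" using e n0[OF p(1)] by (simp add: dist_norm s_def)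
    then have "p + s *\<^sub>R n p \<in> {z. n p \<bullet> (z - p) < 0} \<union> {p}" using e Kn[OF p(1)] by blast
    then have "s * (n p \<bullet> n p) < 0" using s n0[OF p(1)] by simp
    then show False using s inner_ge_zero[of "n p"] by (simp add: mult_less_0_iff)
  qed
  have "inside ?C \<subseteq> K" using inside_mono[OF CK] inside_convex[OF vK] by blast
  then have sub: "inside ?C \<subseteq> interior K" using J by (simp add: interior_maximal)
  have "interior K - inside ?C = {}"
  proof (rule ccontr)
    assume "interior K - inside ?C \<noteq> {}"
    moreover have "interior K \<inter> inside ?C \<noteq> {}" using sub J by blast
    ultimately have "interior K \<inter> frontier (inside ?C) \<noteq> {}"
      using convex_connected[OF convex_interior[OF vK]] by (intro connected_Int_frontier)
    then show False using J dis by auto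
  qed
  then have D: "inside ?C = interior K" using sub by blast
  have ne: "interior K \<noteq> {}" using J D by simp
  have cl: "closure (interior K) = K"
    using convex_closure_interior[OF vK ne] cK by (simp add: compact_imp_closed)
  have fr: "K - interior K = ?C"
    using J cl unfolding D by (simp add: frontier_def)
  show ?thesis
    unfolding strictly_convex_domain_def D cl
  proof (intro conjI ballI impI subsetI)
    show "connected (interior K)" by (intro convex_connected convex_interior vK)
    fix x y p assume x: "x \<in> K" and y: "y \<in> K" and xy: "x \<noteq> y" and p: "p \<in> open_segment x y"
    have pK: "p \<in> K" using p x y vK by (meson convex_contains_open_segment subsetD)
    show "p \<in> interior K"
    proof (rule ccontr)
      assume "p \<notin> interior K"
      then have pC: "p \<in> ?C" using pK fr by blast
      obtain u where u: "0 < u" "u < 1" "p = (1 - u) *\<^sub>R x + u *\<^sub>R y" using p by (auto simp: in_segment)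
      have "p - p = (1 - u) *\<^sub>R (x - p) + u *\<^sub>R (y - p)"
        using u(3) by (simp add: algebra_simps)
      then have "0 = (1 - u) * (n p \<bullet> (x - p)) + u * (n p \<bullet> (y - p))"
        by (metis diff_self inner_add_right inner_scaleR_right inner_zero_right)
      then have sum0: "(1 - u) * (n p \<bullet> (x - p)) + u * (n p \<bullet> (y - p)) = 0" by simp
      have or: "n p \<bullet> (x - p) < 0 \<or> x = p" "n p \<bullet> (y - p) < 0 \<or> y = p" using Kn[OF pC] x y by auto
      then have le: "n p \<bullet> (x - p) \<le> 0" "n p \<bullet> (y - p) \<le> 0" by auto
      have le': "(1 - u) * (n p \<bullet> (x - p)) \<le> 0" "u * (n p \<bullet> (y - p)) \<le> 0"
        using u le by (auto intro: mult_nonneg_nonpos)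
      then have "(1 - u) * (n p \<bullet> (x - p)) = 0" "u * (n p \<bullet> (y - p)) = 0" using sum0 by linarith+
      then have "x = p" "y = p" using u or by auto
      then show False using xy by simp
    qed
  qed (use ne in auto)
qed

text \<open>The vector \<open>w * \<Phi>' w\<close> is an outer normal at \<open>\<Phi> w\<close>. For the circle its product with the chord is
  \<open>- |\<tau> - w|\<^sup>2 / 2\<close>, and the second order error of the perturbation is too small to change the sign. Injectivity
  follows, since that product is then nonzero for distinct points.\<close>
lemma near_circle_convex:
  fixes \<Phi> \<Phi>' :: "complex \<Rightarrow> complex"
  assumes c: "continuous_on circ \<Phi>"
    and d: "\<And>w. w \<in> circ \<Longrightarrow> norm (\<Phi>' w - 1) \<le> 1/8"
    and t: "\<And>w \<tau>. w \<in> circ \<Longrightarrow> \<tau> \<in> circ \<Longrightarrow> norm (\<Phi> \<tau> - \<Phi> w - \<Phi>' w * (\<tau> - w)) \<le> 1/8 * (norm (\<tau> - w))\<^sup>2"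
  shows "simple_path (\<Phi> \<circ> circlepath 0 1)" "strictly_convex_domain (inside (\<Phi> ` circ))"
proof -
  have key: "(w * \<Phi>' w) \<bullet> (\<Phi> \<tau> - \<Phi> w) < 0" if w: "w \<in> circ" and \<tau>: "\<tau> \<in> circ" and ne: "\<tau> \<noteq> w" for w \<tau>
  proof -
    define a where "a = norm (\<Phi>' w)"
    have a: "a \<ge> 7/8" using d[OF w] norm_triangle_ineq2[of 1 "1 - \<Phi>' w"] by (simp add: a_def norm_minus_commute)
    define R where "R = \<Phi> \<tau> - \<Phi> w - \<Phi>' w * (\<tau> - w)"
    have w1: "norm w = 1" "norm \<tau> = 1" using w \<tau> by auto
    have sq: "(norm (\<tau> - w))\<^sup>2 = 2 - 2 * (w \<bullet> \<tau>)"
      using w1 by (simp add: power2_norm_eq_inner inner_diff_left inner_diff_right inner_commute norm_eq_1)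
    have "(w * \<Phi>' w) \<bullet> (\<Phi>' w * (\<tau> - w)) = a\<^sup>2 * (w \<bullet> (\<tau> - w))"
      unfolding a_def cmod_power2 by (simp add: inner_complex_def power2_eq_square algebra_simps)
    also have "w \<bullet> (\<tau> - w) = - (norm (\<tau> - w))\<^sup>2 / 2"
      using sq w1 by (simp add: inner_diff_right norm_eq_1)
    finally have 1: "(w * \<Phi>' w) \<bullet> (\<Phi>' w * (\<tau> - w)) = - (a * (a * (norm (\<tau> - w))\<^sup>2)) / 2" by (simp add: power2_eq_square)
    have "(w * \<Phi>' w) \<bullet> R \<le> norm (w * \<Phi>' w) * norm R" by (rule norm_cauchy_schwarz)
    also have "\<dots> \<le> a * (1/8 * (norm (\<tau> - w))\<^sup>2)"
      unfolding a_def R_def norm_mult w1 using mult_left_mono[OF t[OF w \<tau>] norm_ge_zero[of "\<Phi>' w"]] by simp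
    finally have 2: "(w * \<Phi>' w) \<bullet> R \<le> a * (1/8 * (norm (\<tau> - w))\<^sup>2)" .
    have pos: "0 < (norm (\<tau> - w))\<^sup>2" using ne by simp
    have "1/8 * (norm (\<tau> - w))\<^sup>2 < a * (norm (\<tau> - w))\<^sup>2 / 2"
      using mult_right_mono[OF a, of "(norm (\<tau> - w))\<^sup>2"] pos by simp
    then have "a * (1/8 * (norm (\<tau> - w))\<^sup>2) < a * (a * (norm (\<tau> - w))\<^sup>2 / 2)"
      using a by (intro mult_strict_left_mono) auto
    moreover have "\<Phi> \<tau> - \<Phi> w = \<Phi>' w * (\<tau> - w) + R" by (simp add: R_def)
    ultimately show ?thesis using 1 2 by (simp add: inner_add_right)
  qed
  have inj: "inj_on \<Phi> circ"
  proof (rule inj_onI, rule ccontr)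
    fix w \<tau> assume "w \<in> circ" "\<tau> \<in> circ" "\<Phi> w = \<Phi> \<tau>" "w \<noteq> \<tau>"
    then show False using key[of w \<tau>] by simp
  qed
  have pi: "path_image (circlepath 0 1) = circ" by simp
  show sp: "simple_path (\<Phi> \<circ> circlepath 0 1)"
    by (rule simple_path_continuous_image) (use c inj in \<open>simp_all add: simple_path_circlepath\<close>)
  define n where "n p = (let w = inv_into circ \<Phi> p in w * \<Phi>' w)" for p
  have nw: "n (\<Phi> w) = w * \<Phi>' w" if "w \<in> circ" for w
    using inv_into_f_f[OF inj that] by (simp add: n_def)
  have im: "path_image (\<Phi> \<circ> circlepath 0 1) = \<Phi> ` circ" unfolding path_image_compose pi ..
  have "strictly_convex_domain (inside (path_image (\<Phi> \<circ> circlepath 0 1)))"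
  proof (rule strictly_convex_inside[OF sp, of n])
    show "pathfinish (\<Phi> \<circ> circlepath 0 1) = pathstart (\<Phi> \<circ> circlepath 0 1)"
      by (simp add: pathfinish_compose pathstart_compose)
    fix p assume "p \<in> path_image (\<Phi> \<circ> circlepath 0 1)"
    then obtain w where w: "w \<in> circ" "p = \<Phi> w" unfolding im by blast
    have "\<Phi>' w \<noteq> 0" using d[OF w(1)] by force
    then show "n p \<noteq> 0" using nw[OF w(1)] w by auto
    fix q assume "q \<in> path_image (\<Phi> \<circ> circlepath 0 1)" "q \<noteq> p"
    then obtain \<tau> where \<tau>: "\<tau> \<in> circ" "q = \<Phi> \<tau>" unfolding im by blast
    then show "n p \<bullet> (q - p) < 0" using key[OF w(1) \<tau>(1)] nw[OF w(1)] w \<tau> \<open>q \<noteq> p\<close> by auto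
  qed
  then show "strictly_convex_domain (inside (\<Phi> ` circ))" unfolding im .
qed

section \<open>The algebra of Laurent series in the parameter and two circle variables\<close>

text \<open>\<open>Ix m i k\<close> is the exponent of the monomial \<open>e ^ m * \<tau> ^ i * w ^ k\<close>. The weight \<open>1 + |k|\<close> controls one derivative in \<open>w\<close>.
  Powers of \<open>e\<close> and \<open>\<tau>\<close> are bounded by 1 for \<open>|e| \<le> 1\<close> and \<open>|\<tau>| = 1\<close>, so the other exponents have weight 1.\<close>
datatype idx = Ix nat int int

instantiation idx :: weighted
begin
definition zero_idx :: idx where "zero_idx = Ix 0 0 0"
fun plus_idx :: "idx \<Rightarrow> idx \<Rightarrow> idx" where "plus_idx (Ix m i k) (Ix m' i' k') = Ix (m + m') (i + i') (k + k')"
fun wt_idx :: "idx \<Rightarrow> real" where "wt_idx (Ix m i k) = 1 + \<bar>real_of_int k\<bar>"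
instance
proof
  fix a b c :: idx
  show "a + b + c = a + (b + c)" by (cases a; cases b; cases c) simp
  show "a + b = b + a" by (cases a; cases b) simp
  show "0 + a = a" by (cases a) (simp add: zero_idx_def)
  show "wt (0 :: idx) = 1" by (simp add: zero_idx_def)
  show "0 < wt a" by (cases a) simp
  show "wt (a + b) \<le> wt a * wt b"
  proof (cases a; cases b)
    fix m i k m' i' k' assume ab: "a = Ix m i k" "b = Ix m' i' k'"
    have "\<bar>real_of_int k + real_of_int k'\<bar> \<le> \<bar>real_of_int k\<bar> + \<bar>real_of_int k'\<bar>" by (rule abs_triangle_ineq)
    moreover have "0 \<le> \<bar>real_of_int k\<bar> * \<bar>real_of_int k'\<bar>" by simp
    ultimately have "1 + \<bar>real_of_int k + real_of_int k'\<bar> \<le> (1 + \<bar>real_of_int k\<bar>) * (1 + \<bar>real_of_int k'\<bar>)"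
      unfolding distrib_left distrib_right by linarith
    then show ?thesis unfolding ab by simp
  qed
qed
end

instantiation nat :: weighted
begin
definition wt_nat :: "nat \<Rightarrow> real" where "wt_nat n = 1 + real n"
instance by standard (auto simp: wt_nat_def algebra_simps)
end

type_synonym laurent = "idx l1"

abbreviation mon :: "nat \<Rightarrow> int \<Rightarrow> int \<Rightarrow> laurent" where "mon m i k \<equiv> mono1 (Ix m i k)"

definition lift_idx :: "(nat \<Rightarrow> int \<Rightarrow> int \<Rightarrow> 'b::banach) \<Rightarrow> laurent \<Rightarrow> 'b" where
  "lift_idx g = lift (\<lambda>x. case x of Ix m i k \<Rightarrow> g m i k)"

lemma lift_idx_mon [simp]: "lift_idx g (mon m i k) = g m i k"
  by (simp add: lift_idx_def)

lemma lift_idx_wbdd: "(\<And>m i k. norm (g m i k) \<le> C * (1 + \<bar>real_of_int k\<bar>)) \<Longrightarrow> wbdd (\<lambda>x. case x of Ix m i k \<Rightarrow> g m i k)"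
  by (rule wbddI[of _ C]) (simp split: idx.split)

lemma lift_idx_linear: "(\<And>m i k. norm (g m i k) \<le> C * (1 + \<bar>real_of_int k\<bar>)) \<Longrightarrow> bounded_linear (lift_idx g)"
  unfolding lift_idx_def by (rule bounded_linear_lift[OF lift_idx_wbdd])

lemma lift_idx_bound: "(\<And>m i k. norm (g m i k) \<le> C * (1 + \<bar>real_of_int k\<bar>)) \<Longrightarrow> norm (lift_idx g x) \<le> C * norm x"
  unfolding lift_idx_def by (rule lift_bound) (simp split: idx.split)

lemma laurent_eqI:
  fixes f g :: "laurent \<Rightarrow> 'b::real_normed_vector"
  assumes "bounded_linear f" "bounded_linear g" "\<And>m i k. f (mon m i k) = g (mon m i k)"
  shows "f x = g x"
  by (rule l1_eqI[OF assms(1,2)]) (metis assms(3) idx.exhaust)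

lemma norm_mon: "norm (mon m i k) = 1 + \<bar>real_of_int k\<bar>"
  by (simp add: norm_mono1)

lemma mon_mult: "mon m i k * mon m' i' k' = mon (m + m') (i + i') (k + k')"
  by (simp add: times_mono1)

lemma mon_one: "mon 0 0 0 = 1"
  by (simp add: one_l1_def zero_idx_def)

definition admissible :: "real \<Rightarrow> complex \<Rightarrow> complex \<Rightarrow> bool" where
  "admissible e \<tau> w \<longleftrightarrow> \<bar>e\<bar> \<le> 1 \<and> \<tau> \<in> circ \<and> w \<in> circ"

definition ev :: "real \<Rightarrow> complex \<Rightarrow> complex \<Rightarrow> laurent \<Rightarrow> complex" where
  "ev e \<tau> w = lift_idx (\<lambda>m i k. of_real e ^ m * \<tau> powi i * w powi k)"

lemma norm_ev_mon:
  assumes "admissible e \<tau> w"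
  shows "norm (of_real e ^ m * \<tau> powi i * w powi k :: complex) \<le> 1 * (1 + \<bar>real_of_int k\<bar>)"
proof -
  have "norm (of_real e ^ m * \<tau> powi i * w powi k :: complex) = \<bar>e\<bar> ^ m"
    using assms by (simp add: admissible_def norm_mult norm_power norm_power_int)
  also have "\<dots> \<le> 1" using assms by (simp add: admissible_def power_le_one)
  finally show ?thesis by simp
qed

lemma ev_linear: "admissible e \<tau> w \<Longrightarrow> bounded_linear (ev e \<tau> w)"
  unfolding ev_def by (rule lift_idx_linear[OF norm_ev_mon])

lemma ev_bound: "admissible e \<tau> w \<Longrightarrow> norm (ev e \<tau> w x) \<le> norm x"
  unfolding ev_def using lift_idx_bound[OF norm_ev_mon] by fastforce

lemma ev_mon: "ev e \<tau> w (mon m i k) = of_real e ^ m * \<tau> powi i * w powi k"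
  by (simp add: ev_def)

lemma ev_one: "ev e \<tau> w 1 = 1"
  unfolding mon_one[symmetric] by (simp only: ev_mon) simp

text \<open>Evaluation is multiplicative on monomials, hence on the algebra.\<close>
lemma ev_mult:
  assumes a: "admissible e \<tau> w" shows "ev e \<tau> w (x * y) = ev e \<tau> w x * ev e \<tau> w y"
proof -
  note L = ev_linear[OF a]
  have nz: "\<tau> \<noteq> 0" "w \<noteq> 0" using a by (auto simp: admissible_def)
  show ?thesis
  proof (rule laurent_eqI[of "\<lambda>x. ev e \<tau> w (x * y)" "\<lambda>x. ev e \<tau> w x * ev e \<tau> w y"])
    show "bounded_linear (\<lambda>x. ev e \<tau> w (x * y))" by (rule bounded_linear_compose[OF L bounded_linear_mult_left])
    show "bounded_linear (\<lambda>x. ev e \<tau> w x * ev e \<tau> w y)" by (rule bounded_linear_compose[OF bounded_linear_mult_left L])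
    fix m i k
    show "ev e \<tau> w (mon m i k * y) = ev e \<tau> w (mon m i k) * ev e \<tau> w y"
    proof (rule laurent_eqI[of "\<lambda>y. ev e \<tau> w (mon m i k * y)" "\<lambda>y. ev e \<tau> w (mon m i k) * ev e \<tau> w y"])
      show "bounded_linear (\<lambda>y. ev e \<tau> w (mon m i k * y))" by (rule bounded_linear_compose[OF L bounded_linear_mult_right])
      show "bounded_linear (\<lambda>y. ev e \<tau> w (mon m i k) * ev e \<tau> w y)" by (rule bounded_linear_compose[OF bounded_linear_mult_right L])
    qed (simp add: mon_mult ev_mon power_add power_int_add nz)
  qed
qed

lemma ev_simps:
  assumes "admissible e \<tau> w"
  shows "ev e \<tau> w (x + y) = ev e \<tau> w x + ev e \<tau> w y" "ev e \<tau> w (x - y) = ev e \<tau> w x - ev e \<tau> w y"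
    "ev e \<tau> w (- x) = - ev e \<tau> w x" "ev e \<tau> w (c *\<^sub>R x) = of_real c * ev e \<tau> w x" "ev e \<tau> w 1 = 1"
    "ev e \<tau> w (x * y) = ev e \<tau> w x * ev e \<tau> w y" "ev e \<tau> w (mon 1 0 0) = of_real e"
    "ev e \<tau> w (mon 0 1 0) = \<tau>" "ev e \<tau> w (mon 0 (-1) 0) = cnj \<tau>" "ev e \<tau> w (mon 0 0 1) = w" "ev e \<tau> w (mon 0 0 (-1)) = cnj w"
proof -
  note L = ev_linear[OF assms]
  have c: "inverse \<tau> = cnj \<tau>" "inverse w = cnj w"
    using assms by (simp_all add: admissible_def complex_eq_iff inverse_complex.simps cmod_power2[symmetric])
  show "ev e \<tau> w (x + y) = ev e \<tau> w x + ev e \<tau> w y" "ev e \<tau> w (x - y) = ev e \<tau> w x - ev e \<tau> w y"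
    "ev e \<tau> w (- x) = - ev e \<tau> w x" "ev e \<tau> w (c *\<^sub>R x) = of_real c * ev e \<tau> w x"
    using linear_simps[OF L] by (simp_all add: scaleR_conv_of_real)
  show "ev e \<tau> w 1 = 1" by (rule ev_one)
  show "ev e \<tau> w (x * y) = ev e \<tau> w x * ev e \<tau> w y" by (rule ev_mult[OF assms])
  show "ev e \<tau> w (mon 1 0 0) = of_real e"
    "ev e \<tau> w (mon 0 1 0) = \<tau>" "ev e \<tau> w (mon 0 (-1) 0) = cnj \<tau>" "ev e \<tau> w (mon 0 0 1) = w" "ev e \<tau> w (mon 0 0 (-1)) = cnj w"
    by (simp_all add: ev_mon power_int_minus c)
qed

lemma ev_continuous:
  assumes e: "\<bar>e\<bar> \<le> 1" and w: "w \<in> circ"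
  shows "continuous_on circ (\<lambda>\<tau>. ev e \<tau> w x)"
proof -
  let ?g = "\<lambda>k \<tau>. case k of Ix m i k \<Rightarrow> (of_real e ^ m * \<tau> powi i * w powi k :: complex)"
  have b: "norm (?g k \<tau>) \<le> 1 * wt k" if "\<tau> \<in> circ" for k \<tau>
    using norm_ev_mon[of e \<tau> w] e w that by (simp add: admissible_def split: idx.split)
  have "uniform_limit circ (\<lambda>X \<tau>. \<Sum>k\<in>X. coef x k *\<^sub>R ?g k \<tau>) (\<lambda>\<tau>. ev e \<tau> w x) (finite_subsets_at_top UNIV)"
  proof (rule Weierstrass_m_test_general'[of _ _ _ "\<lambda>k. \<bar>coef x k\<bar> * wt k"])
    show "norm (coef x k *\<^sub>R ?g k \<tau>) \<le> \<bar>coef x k\<bar> * wt k" if "\<tau> \<in> circ" for k \<tau>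
      using mult_left_mono[OF b[OF that, of k], of "\<bar>coef x k\<bar>"] by simp
    show "((\<lambda>k. coef x k *\<^sub>R ?g k \<tau>) has_sum ev e \<tau> w x) UNIV" if "\<tau> \<in> circ" for \<tau>
      unfolding ev_def lift_idx_def by (rule lift_has_sum[OF wbddI[OF b[OF that]]])
  qed (rule coef_abs_summable)
  then show ?thesis
  proof (rule uniform_limit_theorem[rotated])
    have "continuous_on circ (?g k)" for k
    proof (cases k)
      case (Ix m i k)
      then show ?thesis by (auto intro!: continuous_intros)
    qed
    then show "\<forall>\<^sub>F X in finite_subsets_at_top UNIV. continuous_on circ (\<lambda>\<tau>. \<Sum>k\<in>X. coef x k *\<^sub>R ?g k \<tau>)"
      by (intro always_eventually allI continuous_intros)
  qed simp
qed

text \<open>The coefficient of \<open>\<tau> ^ (-1)\<close>, as a series without \<open>\<tau>\<close>: the algebraic form of the mean line integral.\<close>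
definition tau_residue :: "laurent \<Rightarrow> laurent" where "tau_residue = lift_idx (\<lambda>m i k. if i = -1 then mon m 0 k else 0)"

lemma tau_residue_linear: "bounded_linear tau_residue"
  unfolding tau_residue_def by (rule lift_idx_linear[of _ 1]) (simp add: norm_mon)

lemma fint_ev:
  assumes e: "\<bar>e\<bar> \<le> 1" and w: "w \<in> circ"
  shows "fint (\<lambda>\<tau>. ev e \<tau> w x) = ev e 1 w (tau_residue x)"
proof -
  have ad: "admissible e \<tau> w" if "\<tau> \<in> circ" for \<tau> using e w that by (simp add: admissible_def)
  let ?c = "\<lambda>t. cis (2 * pi * t)"
  have i: "(\<lambda>t. ev e (?c t) w x * ?c t) integrable_on {0..1}" for x
    using continuous_on_rot[OF ev_continuous[OF e w], of 1]
    by (intro integrable_continuous_real continuous_intros) simp_all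
  have f: "fint (\<lambda>\<tau>. ev e \<tau> w x) = integral {0..1} (\<lambda>t. ev e (?c t) w x * ?c t)" for x
    using fint_rot[of 1] by simp
  show ?thesis
  proof (rule laurent_eqI[of "\<lambda>x. fint (\<lambda>\<tau>. ev e \<tau> w x)" "\<lambda>x. ev e 1 w (tau_residue x)"])
    show "bounded_linear (\<lambda>x. ev e 1 w (tau_residue x))"
      by (rule bounded_linear_compose[OF ev_linear[OF ad] tau_residue_linear]) simp
    show "bounded_linear (\<lambda>x. fint (\<lambda>\<tau>. ev e \<tau> w x))"
    proof (rule bounded_linear_intro[of _ 1])
      fix x y :: laurent and r :: real
      have "ev e (?c t) w (x + y) * ?c t = ev e (?c t) w x * ?c t + ev e (?c t) w y * ?c t" for t
        by (simp add: ev_simps(1)[OF ad[OF cis_circ]] distrib_right)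
      then show "fint (\<lambda>\<tau>. ev e \<tau> w (x + y)) = fint (\<lambda>\<tau>. ev e \<tau> w x) + fint (\<lambda>\<tau>. ev e \<tau> w y)"
        unfolding f by (simp add: integral_add[OF i i])
      have sc: "ev e (?c t) w (r *\<^sub>R x) * ?c t = of_real r * (ev e (?c t) w x * ?c t)" for t
        by (simp add: ev_simps(4)[OF ad[OF cis_circ]])
      show "fint (\<lambda>\<tau>. ev e \<tau> w (r *\<^sub>R x)) = r *\<^sub>R fint (\<lambda>\<tau>. ev e \<tau> w x)"
        unfolding f sc by (simp add: scaleR_conv_of_real)
      show "norm (fint (\<lambda>\<tau>. ev e \<tau> w x)) \<le> norm x * 1"
        unfolding f
      proof (rule norm_integral_le[OF i])
        show "((\<lambda>t::real. norm x) has_integral norm x * 1) {0..1}" using has_integral_const_real[of "norm x" 0 1] by simp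
        show "norm (ev e (?c t) w x * ?c t) \<le> norm x" for t using ev_bound[OF ad[OF cis_circ]] by (simp add: norm_mult)
      qed
    qed
    fix m i k
    have "ev e (?c t) w (mon m i k) * ?c t = (of_real e ^ m * w powi k) * cis (2 * pi * of_int (i + 1) * t)" for t
    proof -
      have "?c t powi i * ?c t = ?c t powi (i + 1)" by (simp add: power_int_add)
      also have "\<dots> = cis (2 * pi * of_int (i + 1) * t)" by (simp only: cis_power_int) (simp add: mult_ac)
      finally show ?thesis by (simp add: ev_mon mult_ac)
    qed
    then have F: "fint (\<lambda>\<tau>. ev e \<tau> w (mon m i k)) = (of_real e ^ m * w powi k) * integral {0..1} (\<lambda>t. cis (2 * pi * of_int (i + 1) * t))"
      unfolding f by simp
    show "fint (\<lambda>\<tau>. ev e \<tau> w (mon m i k)) = ev e 1 w (tau_residue (mon m i k))"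
    proof (cases "i = -1")
      case True
      then show ?thesis unfolding F by (simp add: tau_residue_def ev_mon)
    next
      case False
      then have "i + 1 \<noteq> 0" by simp
      from integral_cis_multiple[OF this] False show ?thesis unfolding F
        using linear_simps(3)[OF ev_linear[OF ad[of 1]]] by (simp add: tau_residue_def)
    qed
  qed
qed

lemma tau_residue_mult_e: "tau_residue (mon m 0 0 * x) = mon m 0 0 * tau_residue x"
proof (rule laurent_eqI[of "\<lambda>x. tau_residue (mon m 0 0 * x)" "\<lambda>x. mon m 0 0 * tau_residue x"])
  show "bounded_linear (\<lambda>x. tau_residue (mon m 0 0 * x))" by (rule bounded_linear_compose[OF tau_residue_linear bounded_linear_mult_right])
  show "bounded_linear (\<lambda>x. mon m 0 0 * tau_residue x)" by (rule bounded_linear_compose[OF bounded_linear_mult_right tau_residue_linear])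
qed (simp add: mon_mult tau_residue_def)

text \<open>Since \<open>Im (w powi (- k)) = - Im (w powi k)\<close> on the circle, the imaginary part of a series with real coefficients
  is a sine series. This operator and the next one extract its modes of order at least 2, written with positive
  exponents, and its mode 1. The exponent of \<open>\<tau>\<close> is dropped, as they are used only at \<open>\<tau> = 1\<close>.\<close>
definition high_modes :: "laurent \<Rightarrow> laurent" where
  "high_modes = lift_idx (\<lambda>m i k. if 2 \<le> k then mon m 0 k else if k \<le> -2 then - mon m 0 (-k) else 0)"

definition first_mode :: "laurent \<Rightarrow> laurent" where
  "first_mode = lift_idx (\<lambda>m i k. if k = 1 then mon m 0 0 else if k = -1 then - mon m 0 0 else 0)"

text \<open>Substitutes a number for the variable \<open>e\<close> and leaves a value in a Banach space attached to the other exponents;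
  \<open>deriv_eps\<close> below is its derivative in \<open>e\<close>.\<close>
definition eval_eps :: "(int \<Rightarrow> int \<Rightarrow> 'b::banach) \<Rightarrow> real \<Rightarrow> laurent \<Rightarrow> 'b" where
  "eval_eps g e = lift_idx (\<lambda>m i k. e ^ m *\<^sub>R g i k)"

definition deriv_eps :: "(int \<Rightarrow> int \<Rightarrow> 'b::banach) \<Rightarrow> real \<Rightarrow> laurent \<Rightarrow> 'b" where
  "deriv_eps g e = lift_idx (\<lambda>m i k. (real m * e ^ (m - 1)) *\<^sub>R g i k)"

lemma eval_eps_norm:
  assumes "\<And>i k. norm (g i k) \<le> 1 + \<bar>real_of_int k\<bar>" "\<bar>e\<bar> \<le> 1"
  shows "norm (e ^ m *\<^sub>R g i k) \<le> 1 * (1 + \<bar>real_of_int k\<bar>)"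
  using mult_mono[OF power_le_one[OF abs_ge_zero assms(2)] assms(1)] by (simp add: power_abs)

lemma eval_eps_linear:
  "(\<And>i k. norm (g i k) \<le> 1 + \<bar>real_of_int k\<bar>) \<Longrightarrow> \<bar>e\<bar> \<le> 1 \<Longrightarrow> bounded_linear (eval_eps g e)"
  unfolding eval_eps_def by (rule lift_idx_linear[OF eval_eps_norm])

lemma eval_eps_bound:
  assumes "\<And>i k. norm (g i k) \<le> 1 + \<bar>real_of_int k\<bar>" "\<bar>e\<bar> \<le> 1"
  shows "norm (eval_eps g e x) \<le> norm x"
proof -
  have "norm (eval_eps g e x) \<le> 1 * norm x"
    unfolding eval_eps_def by (rule lift_idx_bound) (rule eval_eps_norm[OF assms])
  then show ?thesis by simp
qed

lemma dpower_bound: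
  fixes b :: real assumes "\<bar>b\<bar> \<le> 1/2" shows "\<bar>real m * b ^ (m - 1)\<bar> \<le> 2"
proof (cases m)
  case (Suc n)
  have "\<bar>b\<bar> ^ n \<le> (1/2) ^ n" using assms by (intro power_mono) auto
  then have "\<bar>real m * b ^ (m - 1)\<bar> \<le> real (Suc n) * (1/2) ^ n"
    using Suc by (simp add: abs_mult power_abs mult_left_mono)
  also have "\<dots> \<le> 2" using of_nat_less_two_power[of "Suc n", where 'a = real] by (simp add: power_one_over field_simps)
  finally show ?thesis .
qed simp

text \<open>Powers on \<open>[-1/2, 1/2]\<close> have second derivatives bounded uniformly in the exponent, because \<open>m\<^sup>2 / 2 ^ m\<close> is bounded.
  This is what makes series without any weight on the exponent of \<open>e\<close> twice differentiable there.\<close>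
lemma power_taylor_bound:
  fixes a b :: real assumes "\<bar>a\<bar> \<le> 1/2" "\<bar>b\<bar> \<le> 1/2"
  shows "\<bar>a ^ m - b ^ m - real m * b ^ (m - 1) * (a - b)\<bar> \<le> 4 * (a - b)\<^sup>2"
proof (induction m)
  case (Suc m)
  define D where "D = a ^ m - b ^ m - real m * b ^ (m - 1) * (a - b)"
  have e: "a ^ Suc m - b ^ Suc m - real (Suc m) * b ^ (Suc m - 1) * (a - b) = a * D + real m * b ^ (m - 1) * (a - b)\<^sup>2"
    by (cases m) (simp_all add: D_def algebra_simps power2_eq_square)
  note mb = dpower_bound[OF assms(2), of m]
  have "\<bar>a * D\<bar> \<le> 1/2 * (4 * (a - b)\<^sup>2)" unfolding abs_mult using assms Suc by (intro mult_mono) (auto simp: D_def)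
  moreover have "\<bar>real m * b ^ (m - 1) * (a - b)\<^sup>2\<bar> \<le> 2 * (a - b)\<^sup>2"
    unfolding abs_mult[of _ "(a - b)\<^sup>2"] using mult_right_mono[OF mb, of "(a - b)\<^sup>2"] by simp
  ultimately show ?case unfolding e using abs_triangle_ineq[of "a * D" "real m * b ^ (m - 1) * (a - b)\<^sup>2"] by linarith
qed simp

lemma dpower_diff_bound:
  fixes a b :: real assumes "\<bar>a\<bar> \<le> 1/2" "\<bar>b\<bar> \<le> 1/2"
  shows "\<bar>real m * a ^ (m - 1) - real m * b ^ (m - 1)\<bar> \<le> 8 * \<bar>a - b\<bar>"
proof (cases "a = b")
  case False
  define p q where "p = real m * a ^ (m - 1)" and "q = real m * b ^ (m - 1)"
  have "\<bar>(p - q) * (a - b)\<bar> = \<bar>(b ^ m - a ^ m - p * (b - a)) + (a ^ m - b ^ m - q * (a - b))\<bar>"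
    by (simp add: algebra_simps)
  also have "\<dots> \<le> 4 * (b - a)\<^sup>2 + 4 * (a - b)\<^sup>2"
    using power_taylor_bound[OF assms, of m] power_taylor_bound[OF assms(2,1), of m]
    unfolding p_def q_def by (intro order_trans[OF abs_triangle_ineq] add_mono)
  also have "\<dots> = 8 * (\<bar>a - b\<bar> * \<bar>a - b\<bar>)" unfolding power2_commute[of b a] by (simp add: power2_eq_square)
  finally have "\<bar>p - q\<bar> * \<bar>a - b\<bar> \<le> 8 * \<bar>a - b\<bar> * \<bar>a - b\<bar>" by (simp add: abs_mult)
  then show ?thesis using False by (simp add: p_def q_def)
qed simp

context
  fixes g :: "int \<Rightarrow> int \<Rightarrow> 'b::banach"
  assumes g: "\<And>i k. norm (g i k) \<le> 1 + \<bar>real_of_int k\<bar>"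
begin

lemma deriv_eps_linear:
  assumes "\<bar>e\<bar> \<le> 1/2" shows "bounded_linear (deriv_eps g e)"
  unfolding deriv_eps_def
proof (rule lift_idx_linear[of _ 2])
  show "norm ((real m * e ^ (m - 1)) *\<^sub>R g i k) \<le> 2 * (1 + \<bar>real_of_int k\<bar>)" for m i k
    using mult_mono[OF dpower_bound[OF assms, of m] g[of i k]] by simp
qed

lemma eval_eps_taylor:
  assumes "\<bar>a\<bar> \<le> 1/2" "\<bar>b\<bar> \<le> 1/2"
  shows "norm (eval_eps g a x - eval_eps g b x - (a - b) *\<^sub>R deriv_eps g b x) \<le> 4 * (a - b)\<^sup>2 * norm x"
proof (rule l1_bound[of "\<lambda>x. eval_eps g a x - eval_eps g b x - (a - b) *\<^sub>R deriv_eps g b x"])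
  show "bounded_linear (\<lambda>x. eval_eps g a x - eval_eps g b x - (a - b) *\<^sub>R deriv_eps g b x)"
    using assms by (intro bounded_linear_sub bounded_linear_scaleR_right[THEN bounded_linear_compose] eval_eps_linear deriv_eps_linear g) auto
  fix x :: idx
  obtain m i k where x: "x = Ix m i k" by (cases x)
  have "norm (eval_eps g a (mono1 x) - eval_eps g b (mono1 x) - (a - b) *\<^sub>R deriv_eps g b (mono1 x))
     = norm ((a ^ m - b ^ m - real m * b ^ (m - 1) * (a - b)) *\<^sub>R g i k)"
    unfolding x by (simp add: eval_eps_def deriv_eps_def scaleR_diff_left[symmetric] mult.commute)
  also have "\<dots> \<le> 4 * (a - b)\<^sup>2 * (1 + \<bar>real_of_int k\<bar>)"
    unfolding norm_scaleR using power_taylor_bound[OF assms] g by (intro mult_mono) auto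
  finally show "norm (eval_eps g a (mono1 x) - eval_eps g b (mono1 x) - (a - b) *\<^sub>R deriv_eps g b (mono1 x)) \<le> 4 * (a - b)\<^sup>2 * wt x"
    by (simp add: x)
qed

lemma deriv_eps_diff:
  assumes "\<bar>a\<bar> \<le> 1/2" "\<bar>b\<bar> \<le> 1/2"
  shows "norm (deriv_eps g a x - deriv_eps g b x) \<le> 8 * \<bar>a - b\<bar> * norm x"
proof (rule l1_bound[of "\<lambda>x. deriv_eps g a x - deriv_eps g b x"])
  show "bounded_linear (\<lambda>x. deriv_eps g a x - deriv_eps g b x)"
    using assms by (intro bounded_linear_sub deriv_eps_linear)
  fix x :: idx
  obtain m i k where x: "x = Ix m i k" by (cases x)
  have "norm (deriv_eps g a (mono1 x) - deriv_eps g b (mono1 x)) = norm ((real m * a ^ (m - 1) - real m * b ^ (m - 1)) *\<^sub>R g i k)"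
    unfolding x by (simp add: deriv_eps_def scaleR_diff_left[symmetric])
  also have "\<dots> \<le> 8 * \<bar>a - b\<bar> * (1 + \<bar>real_of_int k\<bar>)"
    unfolding norm_scaleR using dpower_diff_bound[OF assms] g by (intro mult_mono) auto
  finally show "norm (deriv_eps g a (mono1 x) - deriv_eps g b (mono1 x)) \<le> 8 * \<bar>a - b\<bar> * wt x" by (simp add: x)
qed

end

section \<open>Functions in X from summable coefficient sequences\<close>

text \<open>The coefficients \<open>a n\<close> belong to the derivative \<open>tail_deriv a\<close>, of which \<open>tail_fun a\<close> is the primitive along the
  circle. Together with the weight \<open>1 + n\<close> this means that \<open>tail_deriv a\<close> is Lipschitz. Outside
  the circle the functions are 0, so that boundedness holds everywhere.\<close>
definition tail_fun :: "nat l1 \<Rightarrow> complex \<Rightarrow> complex" where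
  "tail_fun a w = lift (\<lambda>n. if w \<in> circ then (1 / real (Suc n)) *\<^sub>R cnj w ^ Suc n else 0) a"

definition tail_deriv :: "nat l1 \<Rightarrow> complex \<Rightarrow> complex" where
  "tail_deriv a w = lift (\<lambda>n. if w \<in> circ then - (cnj w ^ Suc (Suc n)) else 0) a"

lemma tail_fun_norms:
  "norm (if w \<in> circ then (1 / real (Suc n)) *\<^sub>R cnj w ^ Suc n else 0) \<le> 1 * wt n"
  "norm (if w \<in> circ then - (cnj w ^ Suc (Suc n)) else 0) \<le> 1 * wt n"
proof -
  have "1 / real (Suc n) \<le> 1" "1 \<le> wt n" by (simp_all add: wt_nat_def)
  then have "1 / real (Suc n) \<le> wt n" by linarith
  then show "norm (if w \<in> circ then (1 / real (Suc n)) *\<^sub>R cnj w ^ Suc n else 0) \<le> 1 * wt n"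
    by (simp add: norm_power norm_mult)
  show "norm (if w \<in> circ then - (cnj w ^ Suc (Suc n)) else 0) \<le> 1 * wt n"
    using \<open>1 \<le> wt n\<close> by (simp add: norm_power norm_mult)
qed

lemma tail_fun_linear: "bounded_linear (\<lambda>a. tail_fun a w)" "bounded_linear (\<lambda>a. tail_deriv a w)"
  unfolding tail_fun_def tail_deriv_def by (rule bounded_linear_lift[OF wbddI], rule tail_fun_norms)+

lemma tail_fun_bound: "norm (tail_fun a w) \<le> norm a" "norm (tail_deriv a w) \<le> norm a"
proof -
  have "norm (tail_fun a w) \<le> 1 * norm a" unfolding tail_fun_def by (rule lift_bound[OF tail_fun_norms(1)])
  then show "norm (tail_fun a w) \<le> norm a" by simp
  have "norm (tail_deriv a w) \<le> 1 * norm a" unfolding tail_deriv_def by (rule lift_bound[OF tail_fun_norms(2)])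
  then show "norm (tail_deriv a w) \<le> norm a" by simp
qed

lemma tail_fun_mono1:
  "w \<in> circ \<Longrightarrow> tail_fun (mono1 n) w = (1 / real (Suc n)) *\<^sub>R cnj w ^ Suc n"
  "w \<in> circ \<Longrightarrow> tail_deriv (mono1 n) w = - (cnj w ^ Suc (Suc n))"
  by (simp_all add: tail_fun_def tail_deriv_def)

text \<open>On the circle \<open>cnj \<tau>\<close> and \<open>cnj w\<close> are the inverses \<open>a\<close> and \<open>b\<close>, and \<open>b * (\<tau> - w) = - (a - b) * \<tau>\<close>; so the first order
  term has the factor \<open>a - b\<close>, like \<open>a ^ N - b ^ N\<close>, and the cofactors are compared term by term.\<close>
lemma power_taylor_circle:
  fixes w \<tau> :: complex assumes "w \<in> circ" "\<tau> \<in> circ"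
  shows "norm (cnj \<tau> ^ N - cnj w ^ N + of_nat N * cnj w ^ Suc N * (\<tau> - w)) \<le> real N * real N * (norm (\<tau> - w))\<^sup>2"
proof -
  define a b where "a = cnj \<tau>" and "b = cnj w"
  have n: "norm a = 1" "norm b = 1" using assms by (auto simp: a_def b_def)
  have ab: "norm (a - b) = norm (\<tau> - w)"
    unfolding a_def b_def by (metis complex_cnj_diff complex_mod_cnj)
  have u: "a * \<tau> = 1" "b * w = 1" using assms by (simp_all add: a_def b_def complex_norm_square[symmetric] mult.commute)
  have "b * (\<tau> - w) = b * \<tau> - a * \<tau>" using u by (simp add: algebra_simps)
  then have bw: "b * (\<tau> - w) = - ((a - b) * \<tau>)" by (simp add: algebra_simps)
  have "a ^ N - b ^ N = (a - b) * (\<Sum>i<N. a ^ i * b ^ (N - Suc i))"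
    by (simp add: power_diff_sumr2 mult.commute)
  moreover have "of_nat N * b ^ Suc N * (\<tau> - w) = - ((a - b) * (\<Sum>i<N. \<tau> * b ^ N))"
  proof -
    have "of_nat N * b ^ Suc N * (\<tau> - w) = of_nat N * b ^ N * (b * (\<tau> - w))" by simp
    then show ?thesis unfolding bw by simp
  qed
  ultimately have "a ^ N - b ^ N + of_nat N * b ^ Suc N * (\<tau> - w) = (a - b) * (\<Sum>i<N. a ^ i * b ^ (N - Suc i) - \<tau> * b ^ N)"
    by (simp add: sum_subtractf right_diff_distrib)
  also have "norm \<dots> \<le> norm (a - b) * (\<Sum>i<N. real N * norm (a - b))"
    unfolding norm_mult
  proof (intro mult_left_mono sum_norm_le)
    fix i assume "i \<in> {..<N}"
    then have i: "i < N" by simp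
    have "a ^ i * b ^ (N - Suc i) - \<tau> * b ^ N = \<tau> * b ^ (N - Suc i) * (a ^ Suc i - b ^ Suc i)"
    proof -
      have "b ^ N = b ^ ((N - Suc i) + Suc i)" using i by simp
      then have "b ^ N = b ^ (N - Suc i) * b ^ Suc i" by (simp only: power_add)
      moreover have "\<tau> * b ^ (N - Suc i) * a ^ Suc i = (a * \<tau>) * (a ^ i * b ^ (N - Suc i))" by simp
      ultimately show ?thesis using u by (simp add: algebra_simps)
    qed
    then have "norm (a ^ i * b ^ (N - Suc i) - \<tau> * b ^ N) = norm (a ^ Suc i - b ^ Suc i)"
      using n assms by (simp add: norm_mult norm_power)
    also have "\<dots> \<le> real (Suc i) * norm (a - b)" by (rule norm_power_diff) (simp_all add: n)
    also have "\<dots> \<le> real N * norm (a - b)" using i by (intro mult_right_mono) auto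
    finally show "norm (a ^ i * b ^ (N - Suc i) - \<tau> * b ^ N) \<le> real N * norm (a - b)" .
  qed simp
  finally show ?thesis by (simp add: a_def[symmetric] b_def[symmetric] ab power2_eq_square mult_ac)
qed

lemma tail_fun_taylor:
  assumes w: "w \<in> circ" and \<tau>: "\<tau> \<in> circ"
  shows "norm (tail_fun a \<tau> - tail_fun a w - tail_deriv a w * (\<tau> - w)) \<le> norm a * (norm (\<tau> - w))\<^sup>2"
    and "norm (tail_deriv a \<tau> - tail_deriv a w) \<le> 2 * norm a * norm (\<tau> - w)"
proof -
  have "norm (tail_fun a \<tau> - tail_fun a w - tail_deriv a w * (\<tau> - w)) \<le> (norm (\<tau> - w))\<^sup>2 * norm a"
  proof (rule l1_bound[of "\<lambda>a. tail_fun a \<tau> - tail_fun a w - tail_deriv a w * (\<tau> - w)"])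
    show "bounded_linear (\<lambda>a. tail_fun a \<tau> - tail_fun a w - tail_deriv a w * (\<tau> - w))"
      by (intro bounded_linear_sub tail_fun_linear bounded_linear_mult_left[THEN bounded_linear_compose])
    fix n
    let ?N = "Suc n"
    have "tail_fun (mono1 n) \<tau> - tail_fun (mono1 n) w - tail_deriv (mono1 n) w * (\<tau> - w)
      = (1 / real ?N) *\<^sub>R (cnj \<tau> ^ ?N - cnj w ^ ?N + of_nat ?N * cnj w ^ Suc ?N * (\<tau> - w))"
      using w \<tau> by (simp add: tail_fun_mono1 scaleR_diff_right scaleR_add_right scaleR_conv_of_real field_simps del: of_nat_Suc)
    also have "norm \<dots> \<le> (1 / real ?N) * (real ?N * real ?N * (norm (\<tau> - w))\<^sup>2)"
      unfolding norm_scaleR using mult_left_mono[OF power_taylor_circle[OF w \<tau>, of ?N], of "1 / real ?N"]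
      by (simp del: of_nat_Suc power_Suc)
    also have "\<dots> = (norm (\<tau> - w))\<^sup>2 * wt n" by (simp add: wt_nat_def)
    finally show "norm (tail_fun (mono1 n) \<tau> - tail_fun (mono1 n) w - tail_deriv (mono1 n) w * (\<tau> - w)) \<le> (norm (\<tau> - w))\<^sup>2 * wt n" .
  qed
  then show "norm (tail_fun a \<tau> - tail_fun a w - tail_deriv a w * (\<tau> - w)) \<le> norm a * (norm (\<tau> - w))\<^sup>2" by (simp add: mult.commute)
  have "norm (tail_deriv a \<tau> - tail_deriv a w) \<le> (2 * norm (\<tau> - w)) * norm a"
  proof (rule l1_bound[of "\<lambda>a. tail_deriv a \<tau> - tail_deriv a w"])
    show "bounded_linear (\<lambda>a. tail_deriv a \<tau> - tail_deriv a w)" by (intro bounded_linear_sub tail_fun_linear)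
    fix n
    have "norm (tail_deriv (mono1 n) \<tau> - tail_deriv (mono1 n) w) = norm (cnj \<tau> ^ Suc (Suc n) - cnj w ^ Suc (Suc n))"
      unfolding tail_fun_mono1(2)[OF w] tail_fun_mono1(2)[OF \<tau>] by (metis minus_diff_minus norm_minus_cancel)
    also have "\<dots> \<le> real (Suc (Suc n)) * norm (cnj \<tau> - cnj w)"
      by (rule norm_power_diff) (use w \<tau> in auto)
    also have "norm (cnj \<tau> - cnj w) = norm (\<tau> - w)" by (metis complex_cnj_diff complex_mod_cnj)
    also have "real (Suc (Suc n)) * norm (\<tau> - w) \<le> (2 * wt n) * norm (\<tau> - w)"
      by (intro mult_right_mono) (simp_all add: wt_nat_def)
    finally show "norm (tail_deriv (mono1 n) \<tau> - tail_deriv (mono1 n) w) \<le> 2 * norm (\<tau> - w) * wt n" by (simp add: mult_ac)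
  qed
  then show "norm (tail_deriv a \<tau> - tail_deriv a w) \<le> 2 * norm a * norm (\<tau> - w)" by (simp add: mult_ac)
qed

lemma tail_fun_deriv:
  assumes w: "w \<in> circ" shows "(tail_fun a has_field_derivative tail_deriv a w) (at w within circ)" "circ_deriv (tail_fun a) w = tail_deriv a w"
proof -
  have "((\<lambda>\<tau>. (tail_fun a \<tau> - tail_fun a w) / (\<tau> - w) - tail_deriv a w) \<longlongrightarrow> 0) (at w within circ)"
  proof (rule Lim_null_comparison)
    have "((\<lambda>\<tau>. norm a * norm (\<tau> - w)) \<longlongrightarrow> norm a * norm (w - w)) (at w within circ)"
      by (intro tendsto_intros)
    then show "((\<lambda>\<tau>. norm a * norm (\<tau> - w)) \<longlongrightarrow> 0) (at w within circ)" by simp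
    have "norm ((tail_fun a \<tau> - tail_fun a w) / (\<tau> - w) - tail_deriv a w) \<le> norm a * norm (\<tau> - w)" if "\<tau> \<noteq> w" "\<tau> \<in> circ" for \<tau>
    proof -
      have "(tail_fun a \<tau> - tail_fun a w) / (\<tau> - w) - tail_deriv a w = (tail_fun a \<tau> - tail_fun a w - tail_deriv a w * (\<tau> - w)) / (\<tau> - w)"
        using that by (simp add: field_simps)
      then show ?thesis
        using tail_fun_taylor(1)[OF w that(2), of a] that(1) by (simp add: norm_divide divide_le_eq power2_eq_square)
    qed
    then show "\<forall>\<^sub>F \<tau> in at w within circ. norm ((tail_fun a \<tau> - tail_fun a w) / (\<tau> - w) - tail_deriv a w) \<le> norm a * norm (\<tau> - w)"
      unfolding eventually_at_filter by (intro always_eventually allI impI)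
  qed
  then show "(tail_fun a has_field_derivative tail_deriv a w) (at w within circ)"
    unfolding has_field_derivative_iff by (simp add: Lim_null[symmetric])
  then show "circ_deriv (tail_fun a) w = tail_deriv a w" using w by (rule circ_deriv_eq)
qed

text \<open>A Lipschitz function on the circle is Hoelder continuous, as distances are at most 2.\<close>
lemma tail_fun_holder1:
  assumes \<alpha>: "0 < \<alpha>" "\<alpha> < 1"
  shows "tail_fun a \<in> holder1 \<alpha>" "holder1_norm \<alpha> (tail_fun a) \<le> 6 * norm a"
proof -
  have d: "circ_deriv (tail_fun a) w = tail_deriv a w" if "w \<in> circ" for w by (rule tail_fun_deriv(2)[OF that])
  have H: "norm (circ_deriv (tail_fun a) w - circ_deriv (tail_fun a) \<tau>) \<le> (4 * norm a) * norm (w - \<tau>) powr \<alpha>"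
    if "w \<in> circ" "\<tau> \<in> circ" for w \<tau>
  proof (cases "w = \<tau>")
    case False
    define x where "x = norm (w - \<tau>)"
    have x: "x > 0" "x \<le> 2" using False norm_triangle_ineq4[of w \<tau>] that by (auto simp: x_def)
    have "x / 2 \<le> (x / 2) powr \<alpha>" using x \<alpha> powr_mono'[of \<alpha> 1 "x / 2"] by simp
    also have "\<dots> = x powr \<alpha> / 2 powr \<alpha>" using x by (simp add: powr_divide)
    also have "\<dots> \<le> x powr \<alpha> / 1"
      using \<alpha> ge_one_powr_ge_zero[of 2 \<alpha>] by (intro divide_left_mono) auto
    finally have "x \<le> 2 * x powr \<alpha>" by simp
    then have "2 * norm a * x \<le> 2 * norm a * (2 * x powr \<alpha>)" by (intro mult_left_mono) auto
    then show ?thesis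
      using tail_fun_taylor(2)[OF that(2,1), of a] that by (simp add: d x_def)
  qed simp
  then have h: "circ_deriv (tail_fun a) \<in> holder \<alpha>" unfolding holder_def by blast
  then show h1: "tail_fun a \<in> holder1 \<alpha>" using tail_fun_deriv(1) unfolding holder1_def by blast
  have s: "sup_norm g \<le> norm a" if "\<And>w. w \<in> circ \<Longrightarrow> norm (g w) \<le> norm a" for g
    unfolding sup_norm_def by (rule cSUP_least) (use that in \<open>auto intro: exI[of _ 1]\<close>)
  have "holder_seminorm \<alpha> (circ_deriv (tail_fun a)) \<le> 4 * norm a"
    unfolding holder_seminorm_def
  proof (rule cSUP_least)
    have "(1, -1) \<in> {(w, \<tau>). w \<in> circ \<and> \<tau> \<in> circ \<and> w \<noteq> (\<tau> :: complex)}" by auto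
    then show "{(w, \<tau>). w \<in> circ \<and> \<tau> \<in> circ \<and> w \<noteq> (\<tau> :: complex)} \<noteq> {}" by blast
    fix p assume "p \<in> {(w, \<tau>). w \<in> circ \<and> \<tau> \<in> circ \<and> w \<noteq> (\<tau> :: complex)}"
    then obtain w \<tau> where p: "p = (w, \<tau>)" "w \<in> circ" "\<tau> \<in> circ" "w \<noteq> \<tau>" by blast
    then show "(case p of (w, \<tau>) \<Rightarrow> norm (circ_deriv (tail_fun a) w - circ_deriv (tail_fun a) \<tau>) / norm (w - \<tau>) powr \<alpha>) \<le> 4 * norm a"
      using H[OF p(2,3)] by (simp add: divide_le_eq)
  qed
  moreover have "sup_norm (tail_fun a) \<le> norm a" by (rule s[OF tail_fun_bound(1)])
  moreover have "sup_norm (circ_deriv (tail_fun a)) \<le> norm a" by (rule s) (simp only: d tail_fun_bound(2))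
  ultimately show "holder1_norm \<alpha> (tail_fun a) \<le> 6 * norm a"
    unfolding holder1_norm_def holder_norm_def by linarith
qed

lemma tail_fun_sums:
  assumes "w \<in> circ"
  shows "(\<lambda>n. of_real (coef a n / real (Suc n)) * cnj w ^ Suc n) sums tail_fun a w"
proof -
  have "((\<lambda>n. coef a n *\<^sub>R (if w \<in> circ then (1 / real (Suc n)) *\<^sub>R cnj w ^ Suc n else 0)) has_sum tail_fun a w) UNIV"
    unfolding tail_fun_def by (rule lift_has_sum[OF wbddI[OF tail_fun_norms(1)]])
  then show ?thesis
    using assms has_sum_imp_sums by (fastforce simp: scaleR_conv_of_real simp del: of_nat_Suc)
qed

lemma tail_fun_space_X:
  assumes "0 < \<alpha>" "\<alpha> < 1" shows "(\<lambda>j. tail_fun (a j)) \<in> space_X \<alpha>"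
  unfolding space_X_def
proof (intro CollectI ballI conjI)
  fix j
  show "tail_fun (a j) \<in> holder1 \<alpha>" by (rule tail_fun_holder1[OF assms])
  show "\<exists>A :: nat \<Rightarrow> real. \<forall>w\<in>circ. (\<lambda>n. of_real (A (Suc n)) * cnj w ^ Suc n) sums tail_fun (a j) w"
  proof (intro exI ballI)
    fix w assume "w \<in> circ"
    from tail_fun_sums[OF this]
    show "(\<lambda>n. of_real ((\<lambda>n. coef (a j) (n - 1) / real n) (Suc n)) * cnj w ^ Suc n) sums tail_fun (a j) w" by simp
  qed
qed

lemma norm_X_tail_fun:
  assumes "0 < \<alpha>" "\<alpha> < 1" "norm (a 1) \<le> B" "norm (a 2) \<le> B"
  shows "norm_X \<alpha> (\<lambda>j. tail_fun (a j)) \<le> 6 * B" "0 \<le> norm_X \<alpha> (\<lambda>j. tail_fun (a j))"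
proof -
  show "norm_X \<alpha> (\<lambda>j. tail_fun (a j)) \<le> 6 * B"
    using tail_fun_holder1(2)[OF assms(1,2), of "a 1"] tail_fun_holder1(2)[OF assms(1,2), of "a 2"] assms(3,4)
    unfolding norm_X_def by simp
  have "0 \<le> holder1_norm \<alpha> (tail_fun (a 1))"
    by (rule order_trans[OF norm_ge_zero norm_le_holder1_norm(1)[OF tail_fun_holder1(1)[OF assms(1,2)] assms(1)]]) (rule cis_circ)
  then show "0 \<le> norm_X \<alpha> (\<lambda>j. tail_fun (a j))" unfolding norm_X_def by simp
qed

text \<open>The part of a series with exponents \<open>k \<ge> 2\<close> in \<open>w\<close> is taken as the coefficients of \<open>- cnj (f')\<close>, where \<open>f'\<close> has the
  modes \<open>cnj w ^ k\<close>. This matches the output of \<open>high_modes\<close>.\<close>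
definition tail_slot :: "int \<Rightarrow> int \<Rightarrow> nat l1" where "tail_slot i k = (if 2 \<le> k then mono1 (nat (k - 2)) else 0)"

lemma tail_slot_norm: "norm (tail_slot i k) \<le> 1 + \<bar>real_of_int k\<bar>"
  by (auto simp: tail_slot_def norm_mono1 wt_nat_def)

abbreviation tail_coeffs where "tail_coeffs \<equiv> eval_eps tail_slot"

text \<open>Only the constant term in \<open>\<tau>\<close> and \<open>w\<close> is kept: such series represent real functions of \<open>e\<close> such as P and Q.\<close>
definition const_slot :: "int \<Rightarrow> int \<Rightarrow> real" where "const_slot i k = (if i = 0 \<and> k = 0 then 1 else 0)"

lemma const_slot_norm: "norm (const_slot i k) \<le> 1 + \<bar>real_of_int k\<bar>" by (simp add: const_slot_def)

abbreviation const_at where "const_at \<equiv> eval_eps const_slot"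

section \<open>Laurent series of the functions and of their difference quotients\<close>

text \<open>Operators that only read the slots \<open>k = n + 1 \<ge> 2\<close>, where slot \<open>n + 1\<close> stands for the function \<open>cnj w ^ n / n\<close>.\<close>
definition lift_high :: "(nat \<Rightarrow> nat \<Rightarrow> 'b::banach) \<Rightarrow> laurent \<Rightarrow> 'b" where
  "lift_high h = lift_idx (\<lambda>m i k. if 2 \<le> k then h m (nat (k - 1)) else 0)"

lemma lift_high_linear: assumes "\<And>m n. 1 \<le> n \<Longrightarrow> norm (h m n) \<le> real n + 2" shows "bounded_linear (lift_high h)"
  unfolding lift_high_def
proof (rule lift_idx_linear[of _ 1])
  show "norm (if 2 \<le> k then h m (nat (k - 1)) else 0) \<le> 1 * (1 + \<bar>real_of_int k\<bar>)" for m i k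
    using assms[of "nat (k - 1)" m] by auto
qed

lemma lift_high_mono: "k < 2 \<Longrightarrow> lift_high h (mon m i k) = 0" "1 \<le> n \<Longrightarrow> lift_high h (mon m i (int n + 1)) = h m n"
  by (simp_all add: lift_high_def)

lemma lift_high_eqI:
  assumes "bounded_linear f" "bounded_linear g" "\<And>m i k. k < 2 \<Longrightarrow> f (mon m i k) = g (mon m i k)"
    "\<And>m i n. 1 \<le> n \<Longrightarrow> f (mon m i (int n + 1)) = g (mon m i (int n + 1))"
  shows "f x = g x"
proof (rule laurent_eqI[OF assms(1,2)])
  fix m i k
  show "f (mon m i k) = g (mon m i k)"
  proof (cases "k < 2")
    case False
    then have "k = int (nat (k - 1)) + 1" "1 \<le> nat (k - 1)" by auto
    then show ?thesis using assms(4)[of "nat (k - 1)" m i] by simp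
  qed (rule assms(3))
qed

text \<open>For a series \<open>x\<close> that encodes a function \<open>f\<close>, these are the series of \<open>f w\<close>, \<open>cnj (f w)\<close>, \<open>f' w\<close>, \<open>f \<tau>\<close>, \<open>cnj (f \<tau>)\<close>, \<open>f' \<tau>\<close>
  and of the difference quotients of \<open>f\<close> and of \<open>cnj f\<close> between \<open>\<tau>\<close> and \<open>w\<close>; the quotients are polynomials for each
  mode. They are bounded as the factor \<open>1 / n\<close> compensates for the number of terms.\<close>
definition at_w :: "laurent \<Rightarrow> laurent" where "at_w = lift_high (\<lambda>m n. (1 / real n) *\<^sub>R mon m 0 (- int n))"
definition cnj_at_w :: "laurent \<Rightarrow> laurent" where "cnj_at_w = lift_high (\<lambda>m n. (1 / real n) *\<^sub>R mon m 0 (int n))"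
definition deriv_at_w :: "laurent \<Rightarrow> laurent" where "deriv_at_w = lift_high (\<lambda>m n. - mon m 0 (- int n - 1))"
definition at_tau :: "laurent \<Rightarrow> laurent" where "at_tau = lift_high (\<lambda>m n. (1 / real n) *\<^sub>R mon m (- int n) 0)"
definition cnj_at_tau :: "laurent \<Rightarrow> laurent" where "cnj_at_tau = lift_high (\<lambda>m n. (1 / real n) *\<^sub>R mon m (int n) 0)"
definition deriv_at_tau :: "laurent \<Rightarrow> laurent" where "deriv_at_tau = lift_high (\<lambda>m n. - mon m (- int n - 1) 0)"
definition quot :: "laurent \<Rightarrow> laurent" where "quot = lift_high (\<lambda>m n. - ((1 / real n) *\<^sub>R (\<Sum>i<n. mon m (- int i - 1) (- int (n - i)))))"
definition cnj_quot :: "laurent \<Rightarrow> laurent" where "cnj_quot = lift_high (\<lambda>m n. (1 / real n) *\<^sub>R (\<Sum>i<n. mon m (int i) (int (n - Suc i))))"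

lemma ops_linear:
  "bounded_linear at_w" "bounded_linear cnj_at_w" "bounded_linear deriv_at_w" "bounded_linear at_tau" "bounded_linear cnj_at_tau" "bounded_linear deriv_at_tau"
  "bounded_linear quot" "bounded_linear cnj_quot"
proof -
  have s: "norm ((1 / real n) *\<^sub>R (\<Sum>i<n. h i)) \<le> real n + 2" if "\<And>i. i < n \<Longrightarrow> norm (h i) \<le> real n + 2" "1 \<le> n"
    for h :: "nat \<Rightarrow> laurent" and n
  proof -
    have "norm (\<Sum>i<n. h i) \<le> (\<Sum>i<n. real n + 2)" using that by (intro sum_norm_le) auto
    then have "(1 / real n) * norm (\<Sum>i<n. h i) \<le> (1 / real n) * (real n * (real n + 2))" by (intro mult_left_mono) auto
    then show ?thesis using that by simp
  qed
  have b: "norm ((1 / real n) *\<^sub>R x) \<le> real n + 2" if "1 \<le> n" "norm x \<le> real n + 2" for n and x :: laurent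
  proof -
    have "(1 / real n) * norm x \<le> 1 * norm x" using that by (intro mult_right_mono) auto
    then show ?thesis using that by simp
  qed
  show "bounded_linear at_w" "bounded_linear cnj_at_w" "bounded_linear at_tau" "bounded_linear cnj_at_tau"
    unfolding at_w_def cnj_at_w_def at_tau_def cnj_at_tau_def
    by (rule lift_high_linear, rule b, assumption, simp add: norm_mon)+
  show "bounded_linear deriv_at_w" "bounded_linear deriv_at_tau"
    unfolding deriv_at_w_def deriv_at_tau_def by (rule lift_high_linear, simp add: norm_mon)+
  show "bounded_linear quot" unfolding quot_def norm_minus_cancel
    by (rule lift_high_linear) (unfold norm_minus_cancel, rule s, auto simp: norm_mon)
  show "bounded_linear cnj_quot" unfolding cnj_quot_def
    by (rule lift_high_linear, rule s) (auto simp: norm_mon)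
qed

lemma powi_neg_circ: assumes "w \<in> circ" shows "w powi (- int n) = cnj w ^ n"
proof -
  have "inverse w = cnj w"
    using assms by (simp add: complex_eq_iff inverse_complex.simps cmod_power2[symmetric])
  then show ?thesis by (simp add: power_int_minus power_inverse[symmetric])
qed

lemma tail_coeffs_mon: "k < 2 \<Longrightarrow> tail_coeffs e (mon m i k) = 0" "1 \<le> n \<Longrightarrow> tail_coeffs e (mon m i (int n + 1)) = e ^ m *\<^sub>R mono1 (n - 1)"
  by (simp_all add: eval_eps_def tail_slot_def nat_diff_distrib')

lemma tail_coeffs_linear: "\<bar>e\<bar> \<le> 1 \<Longrightarrow> bounded_linear (tail_coeffs e)" by (rule eval_eps_linear[OF tail_slot_norm])

lemma tail_fun_mon:
  assumes "1 \<le> n" "w \<in> circ"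
  shows "tail_fun (tail_coeffs e (mon m i (int n + 1))) w = of_real (e ^ m / real n) * cnj w ^ n"
    "tail_deriv (tail_coeffs e (mon m i (int n + 1))) w = - (of_real (e ^ m) * cnj w ^ Suc n)"
proof -
  obtain n' where n: "n = Suc n'" using assms by (cases n) auto
  note sm = tail_coeffs_mon(2)[OF assms(1)]
  show "tail_fun (tail_coeffs e (mon m i (int n + 1))) w = of_real (e ^ m / real n) * cnj w ^ n"
    unfolding sm linear_simps(5)[OF tail_fun_linear(1)] using assms(2)
    by (simp add: n tail_fun_mono1 scaleR_conv_of_real del: of_nat_Suc)
  show "tail_deriv (tail_coeffs e (mon m i (int n + 1))) w = - (of_real (e ^ m) * cnj w ^ Suc n)"
    unfolding sm linear_simps(5)[OF tail_fun_linear(2)] using assms(2)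
    by (simp add: n tail_fun_mono1 scaleR_conv_of_real)
qed

lemma tail_fun_mon_low: "k < 2 \<Longrightarrow> tail_fun (tail_coeffs e (mon m i k)) w = 0" "k < 2 \<Longrightarrow> tail_deriv (tail_coeffs e (mon m i k)) w = 0"
  by (simp_all add: tail_coeffs_mon linear_simps(3)[OF tail_fun_linear(1)] linear_simps(3)[OF tail_fun_linear(2)])

lemma ev_ops:
  assumes a: "admissible e \<tau> w"
  shows "ev e \<tau> w (at_w x) = tail_fun (tail_coeffs e x) w" "ev e \<tau> w (cnj_at_w x) = cnj (tail_fun (tail_coeffs e x) w)"
    "ev e \<tau> w (deriv_at_w x) = tail_deriv (tail_coeffs e x) w" "ev e \<tau> w (at_tau x) = tail_fun (tail_coeffs e x) \<tau>"
    "ev e \<tau> w (cnj_at_tau x) = cnj (tail_fun (tail_coeffs e x) \<tau>)" "ev e \<tau> w (deriv_at_tau x) = tail_deriv (tail_coeffs e x) \<tau>"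
proof -
  have e: "\<bar>e\<bar> \<le> 1" and w: "w \<in> circ" "\<tau> \<in> circ" using a by (auto simp: admissible_def)
  note L = ops_linear[THEN bounded_linear_compose[OF ev_linear[OF a]]]
  have R: "bounded_linear (\<lambda>x. tail_fun (tail_coeffs e x) v)" "bounded_linear (\<lambda>x. tail_deriv (tail_coeffs e x) v)" for v
    by (rule bounded_linear_compose[OF tail_fun_linear(1) tail_coeffs_linear[OF e]], rule bounded_linear_compose[OF tail_fun_linear(2) tail_coeffs_linear[OF e]])
  have Rc: "bounded_linear (\<lambda>x. cnj (tail_fun (tail_coeffs e x) v))" for v
    by (rule bounded_linear_compose[OF bounded_linear_cnj R(1)])
  have p1: "v powi (- int n - 1) = cnj v ^ Suc n" if "v \<in> circ" for v n
  proof -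
    have "- int n - 1 = - int (Suc n)" by simp
    then show ?thesis using powi_neg_circ[OF that, of "Suc n"] by (simp only:)
  qed
  have wn: "norm w = 1" "norm \<tau> = 1" using w by auto
  note S = wn lift_high_mono ev_simps[OF a] linear_simps(3)[OF ev_linear[OF a]] tail_fun_mon_low tail_fun_mon w ev_mon powi_neg_circ p1
  note D = at_w_def cnj_at_w_def deriv_at_w_def at_tau_def cnj_at_tau_def deriv_at_tau_def
  show "ev e \<tau> w (at_w x) = tail_fun (tail_coeffs e x) w"
    by (rule lift_high_eqI[OF L(1) R(1)]) (simp_all add: D S)
  show "ev e \<tau> w (cnj_at_w x) = cnj (tail_fun (tail_coeffs e x) w)"
    by (rule lift_high_eqI[OF L(2) Rc]) (simp_all add: D S)
  show "ev e \<tau> w (deriv_at_w x) = tail_deriv (tail_coeffs e x) w"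
    by (rule lift_high_eqI[OF L(3) R(2)]) (simp_all add: D S del: power_Suc)
  show "ev e \<tau> w (at_tau x) = tail_fun (tail_coeffs e x) \<tau>"
    by (rule lift_high_eqI[OF L(4) R(1)]) (simp_all add: D S)
  show "ev e \<tau> w (cnj_at_tau x) = cnj (tail_fun (tail_coeffs e x) \<tau>)"
    by (rule lift_high_eqI[OF L(5) Rc]) (simp_all add: D S)
  show "ev e \<tau> w (deriv_at_tau x) = tail_deriv (tail_coeffs e x) \<tau>"
    by (rule lift_high_eqI[OF L(6) R(2)]) (simp_all add: D S del: power_Suc)
qed

lemma ev_sum: "admissible e \<tau> w \<Longrightarrow> ev e \<tau> w (\<Sum>i\<in>I. h i) = (\<Sum>i\<in>I. ev e \<tau> w (h i))"
  by (rule linear_sum[OF bounded_linear.linear[OF ev_linear]])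

text \<open>The geometric sum \<open>p ^ n - q ^ n = (p - q) * (\<Sum>i<n. p ^ i * q ^ (n - 1 - i))\<close>, with \<open>p = cnj \<tau>\<close>, \<open>q = cnj w\<close> and
  \<open>p * q * (\<tau> - w) = q - p\<close> for \<open>f\<close>, and with \<open>\<tau>\<close> and \<open>w\<close> for its conjugate.\<close>
lemma ev_quotients:
  assumes a: "admissible e \<tau> w"
  shows "ev e \<tau> w (quot x) * (\<tau> - w) = tail_fun (tail_coeffs e x) \<tau> - tail_fun (tail_coeffs e x) w"
    "ev e \<tau> w (cnj_quot x) * (\<tau> - w) = cnj (tail_fun (tail_coeffs e x) \<tau>) - cnj (tail_fun (tail_coeffs e x) w)"
proof -
  have e: "\<bar>e\<bar> \<le> 1" and w: "w \<in> circ" "\<tau> \<in> circ" using a by (auto simp: admissible_def)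
  note L = ops_linear[THEN bounded_linear_compose[OF bounded_linear_compose[OF bounded_linear_mult_left ev_linear[OF a]]]]
  have R: "bounded_linear (\<lambda>x. tail_fun (tail_coeffs e x) v)" for v
    by (rule bounded_linear_compose[OF tail_fun_linear(1) tail_coeffs_linear[OF e]])
  have Rc: "bounded_linear (\<lambda>x. cnj (tail_fun (tail_coeffs e x) v))" for v
    by (rule bounded_linear_compose[OF bounded_linear_cnj R])
  have u: "cnj \<tau> * \<tau> = 1" "cnj w * w = 1" using w by (simp_all add: complex_norm_square[symmetric] mult.commute)
  have p1: "v powi (- int n - 1) = cnj v ^ Suc n" if "v \<in> circ" for v n
  proof -
    have "- int n - 1 = - int (Suc n)" by simp
    then show ?thesis using powi_neg_circ[OF that, of "Suc n"] by (simp only:)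
  qed
  show "ev e \<tau> w (quot x) * (\<tau> - w) = tail_fun (tail_coeffs e x) \<tau> - tail_fun (tail_coeffs e x) w"
  proof (rule lift_high_eqI[OF L(7) bounded_linear_sub[OF R R]])
    fix m i and n :: nat assume n: "1 \<le> n"
    define p q where "p = cnj \<tau>" and "q = cnj w"
    have "(\<Sum>i<n. of_real e ^ m * \<tau> powi (- int i - 1) * w powi (- int (n - i))) = of_real (e ^ m) * (p * q * (\<Sum>i<n. p ^ i * q ^ (n - Suc i)))"
      unfolding sum_distrib_left
    proof (rule sum.cong[OF refl])
      fix i assume "i \<in> {..<n}"
      then have "q ^ (n - i) = q * q ^ (n - Suc i)" by (simp add: Suc_diff_Suc[symmetric] flip: power_Suc)
      then show "of_real e ^ m * \<tau> powi (- int i - 1) * w powi (- int (n - i)) = of_real (e ^ m) * (p * q * (p ^ i * q ^ (n - Suc i)))"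
        unfolding p1[OF w(2)] powi_neg_circ[OF w(1)] p_def[symmetric] q_def[symmetric] by simp
    qed
    then have E: "ev e \<tau> w (quot (mon m i (int n + 1))) = - (of_real (e ^ m / real n) * (p * q * (\<Sum>i<n. p ^ i * q ^ (n - Suc i))))"
      using n by (simp add: quot_def lift_high_mono ev_simps[OF a] ev_sum[OF a] ev_mon)
    have pq: "p * q * (\<tau> - w) = q - p" using u by (simp add: p_def q_def algebra_simps)
    have pn: "p ^ n - q ^ n = (p - q) * (\<Sum>i<n. p ^ i * q ^ (n - Suc i))"
      by (simp add: power_diff_sumr2 mult.commute)
    have "- (c * (p * q * S)) * (\<tau> - w) = c * ((p - q) * S)" for c S
    proof -
      have "- (c * (p * q * S)) * (\<tau> - w) = - (c * S) * (p * q * (\<tau> - w))" by (simp add: algebra_simps)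
      then show ?thesis unfolding pq by (simp add: algebra_simps)
    qed
    then have "ev e \<tau> w (quot (mon m i (int n + 1))) * (\<tau> - w) = of_real (e ^ m / real n) * (p ^ n - q ^ n)"
      unfolding E pn .
    then show "ev e \<tau> w (quot (mon m i (int n + 1))) * (\<tau> - w) = tail_fun (tail_coeffs e (mon m i (int n + 1))) \<tau> - tail_fun (tail_coeffs e (mon m i (int n + 1))) w"
      using n w by (simp add: tail_fun_mon p_def q_def right_diff_distrib)
  qed (simp add: quot_def lift_high_mono linear_simps(3)[OF ev_linear[OF a]] tail_fun_mon_low)
  show "ev e \<tau> w (cnj_quot x) * (\<tau> - w) = cnj (tail_fun (tail_coeffs e x) \<tau>) - cnj (tail_fun (tail_coeffs e x) w)"
  proof (rule lift_high_eqI[OF L(8) bounded_linear_sub[OF Rc Rc]])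
    fix m i and n :: nat assume n: "1 \<le> n"
    have "\<tau> ^ n - w ^ n = (\<tau> - w) * (\<Sum>i<n. \<tau> ^ i * w ^ (n - Suc i))"
      by (simp add: power_diff_sumr2 mult.commute)
    moreover have "ev e \<tau> w (cnj_quot (mon m i (int n + 1))) = of_real (e ^ m / real n) * (\<Sum>i<n. \<tau> ^ i * w ^ (n - Suc i))"
      using n by (simp add: cnj_quot_def lift_high_mono ev_simps[OF a] ev_sum[OF a] ev_mon sum_distrib_left mult.assoc del: of_nat_diff)
    ultimately have "ev e \<tau> w (cnj_quot (mon m i (int n + 1))) * (\<tau> - w) = of_real (e ^ m / real n) * (\<tau> ^ n - w ^ n)"
      by (simp add: mult_ac)
    then show "ev e \<tau> w (cnj_quot (mon m i (int n + 1))) * (\<tau> - w) = cnj (tail_fun (tail_coeffs e (mon m i (int n + 1))) \<tau>) - cnj (tail_fun (tail_coeffs e (mon m i (int n + 1))) w)"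
      using n w by (simp add: tail_fun_mon right_diff_distrib)
  qed (simp add: cnj_quot_def lift_high_mono linear_simps(3)[OF ev_linear[OF a]] tail_fun_mon_low)
qed

lemma high_modes_linear: "bounded_linear high_modes"
  unfolding high_modes_def by (rule lift_idx_linear[of _ 1]) (simp add: norm_mon)

lemma first_mode_linear: "bounded_linear first_mode"
  unfolding first_mode_def by (rule lift_idx_linear[of _ 1]) (simp add: norm_mon)

lemma const_at_linear: "\<bar>e\<bar> \<le> 1 \<Longrightarrow> bounded_linear (const_at e)" by (rule eval_eps_linear[OF const_slot_norm])

lemma const_at_mon: "const_at e (mon m i k) = (if i = 0 \<and> k = 0 then e ^ m else 0)"
  by (simp add: eval_eps_def const_slot_def)

lemma ev_first_mode:
  assumes a: "admissible e \<tau> w" shows "ev e \<tau> w (first_mode x) = of_real (const_at e (first_mode x))"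
proof -
  have e: "\<bar>e\<bar> \<le> 1" using a by (simp add: admissible_def)
  note l3 = linear_simps(3)[OF ev_linear[OF a]] linear_simps(3)[OF const_at_linear[OF e]] linear_simps(4)[OF const_at_linear[OF e]]
  show ?thesis
    by (rule laurent_eqI[OF bounded_linear_compose[OF ev_linear[OF a] first_mode_linear]
        bounded_linear_compose[OF bounded_linear_of_real bounded_linear_compose[OF const_at_linear[OF e] first_mode_linear]]])
      (simp add: first_mode_def l3 ev_simps(3)[OF a] ev_mon const_at_mon)
qed

text \<open>The high modes of the imaginary part are those of \<open>Im f'\<close> for a function \<open>f\<close> of X, by the choice of \<open>tail_slot\<close>.\<close>
lemma Im_split:
  assumes a: "admissible e 1 w"
  shows "Im (ev e 1 w x) = Im (ev e 1 w (high_modes x)) + const_at e (first_mode x) * Im w"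
    and "Im (tail_deriv (tail_coeffs e (high_modes x)) w) = Im (ev e 1 w (high_modes x))"
proof -
  have e: "\<bar>e\<bar> \<le> 1" and w: "w \<in> circ" using a by (auto simp: admissible_def)
  note l3 = linear_simps(3)[OF ev_linear[OF a]] linear_simps(3)[OF const_at_linear[OF e]] linear_simps(4)[OF const_at_linear[OF e]]
  note IL = bounded_linear_compose[OF bounded_linear_Im ev_linear[OF a]]
  have inv: "Im (w powi (- k)) = - Im (w powi k)" for k
  proof -
    have "w powi (- k) = cnj (w powi k)"
    proof (cases k rule: int_cases2)
      case (nonneg n) then show ?thesis using powi_neg_circ[OF w, of n] by simp
    next
      case (nonpos n) then show ?thesis using powi_neg_circ[OF w, of n] by simp
    qed
    then show ?thesis by (simp only: cnj.simps)
  qed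
  show "Im (ev e 1 w x) = Im (ev e 1 w (high_modes x)) + const_at e (first_mode x) * Im w"
  proof (rule laurent_eqI[OF IL bounded_linear_add[OF bounded_linear_compose[OF IL high_modes_linear]
        bounded_linear_compose[OF bounded_linear_mult_left bounded_linear_compose[OF const_at_linear[OF e] first_mode_linear]]]])
    fix m :: nat and i k :: int
    consider "2 \<le> k" | "k \<le> -2" | "k = 1" | "k = -1" | "k = 0" by linarith
    then show "Im (ev e 1 w (mon m i k)) = Im (ev e 1 w (high_modes (mon m i k))) + const_at e (first_mode (mon m i k)) * Im w"
      using inv[of k] inv[of 1]
      by cases (simp_all add: high_modes_def first_mode_def l3 ev_simps(3)[OF a] ev_mon const_at_mon flip: of_real_power)
  qed
  have FL: "bounded_linear (\<lambda>x. Im (tail_deriv (tail_coeffs e (high_modes x)) w))"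
    by (intro bounded_linear_compose[OF bounded_linear_Im bounded_linear_compose[OF tail_fun_linear(2) bounded_linear_compose[OF tail_coeffs_linear[OF e] high_modes_linear]]])
  show "Im (tail_deriv (tail_coeffs e (high_modes x)) w) = Im (ev e 1 w (high_modes x))"
  proof (rule laurent_eqI[OF FL bounded_linear_compose[OF IL high_modes_linear]])
    fix m i k
    have key: "Im (tail_deriv (tail_coeffs e (mon m 0 k)) w) = Im (ev e 1 w (mon m 0 k))" if "2 \<le> k" for k
    proof -
      define n where "n = nat (k - 1)"
      have k: "k = int n + 1" "1 \<le> n" using that by (auto simp: n_def)
      have "k = int (Suc n)" using k by simp
      then have "w powi k = w ^ Suc n" by (simp only: power_int_of_nat)
      then show ?thesis
        unfolding ev_mon unfolding k(1) tail_fun_mon(2)[OF k(2) w]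
        by (simp add: complex_cnj_power[symmetric] del: complex_cnj_power power_Suc flip: of_real_power)
    qed
    note l = linear_simps(4)[OF tail_coeffs_linear[OF e]] linear_simps(4)[OF tail_fun_linear(2)] linear_simps(3)[OF tail_coeffs_linear[OF e]] linear_simps(3)[OF tail_fun_linear(2)]
    show "Im (tail_deriv (tail_coeffs e (high_modes (mon m i k))) w) = Im (ev e 1 w (high_modes (mon m i k)))"
      using key[of k] key[of "- k"] by (simp add: high_modes_def l l3 ev_simps(3)[OF a])
  qed
qed

section \<open>Fixed points of a small Lipschitz perturbation of a constant\<close>

text \<open>Bounded and Lipschitz on the ball of radius R, with one constant for all \<open>r\<close> in \<open>{0..1}\<close>. The property
  is closed under sums, products and bounded linear maps, so it holds for polynomial maps by composition.\<close>
definition ulip :: "real \<Rightarrow> (real \<Rightarrow> 'a::real_normed_vector \<Rightarrow> 'b::real_normed_vector) \<Rightarrow> bool" where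
  "ulip R G \<longleftrightarrow> (\<exists>K\<ge>0. \<forall>r\<in>{0..1}. \<forall>x\<in>cball 0 R. norm (G r x) \<le> K \<and> (\<forall>y\<in>cball 0 R. norm (G r x - G r y) \<le> K * norm (x - y)))"

lemma ulipI:
  fixes G :: "real \<Rightarrow> 'a::real_normed_vector \<Rightarrow> 'b::real_normed_vector"
  assumes "\<And>r x. 0 \<le> r \<Longrightarrow> r \<le> 1 \<Longrightarrow> norm x \<le> R \<Longrightarrow> norm (G r x) \<le> K"
    "\<And>r x y. 0 \<le> r \<Longrightarrow> r \<le> 1 \<Longrightarrow> norm x \<le> R \<Longrightarrow> norm y \<le> R \<Longrightarrow> norm (G r x - G r y) \<le> L * norm (x - y)"
  shows "ulip R G"
  unfolding ulip_def
proof (intro exI[of _ "max 0 (max K L)"] conjI ballI)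
  fix r :: real and x y :: 'a assume r: "r \<in> {0..1}" and x: "x \<in> cball 0 R" and y: "y \<in> cball 0 R"
  have "norm (G r x - G r y) \<le> L * norm (x - y)" using assms(2) r x y by simp
  also have "\<dots> \<le> max 0 (max K L) * norm (x - y)" by (intro mult_right_mono) auto
  finally show "norm (G r x - G r y) \<le> max 0 (max K L) * norm (x - y)" .
next
  fix r :: real and x :: 'a assume r: "r \<in> {0..1}" and x: "x \<in> cball 0 R"
  have "norm (G r x) \<le> K" using assms(1) r x by simp
  then show "norm (G r x) \<le> max 0 (max K L)" by simp
qed simp

lemma ulipE:
  assumes "ulip R G"
  obtains K where "0 \<le> K" "\<And>r x. 0 \<le> r \<Longrightarrow> r \<le> 1 \<Longrightarrow> norm x \<le> R \<Longrightarrow> norm (G r x) \<le> K"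
    "\<And>r x y. 0 \<le> r \<Longrightarrow> r \<le> 1 \<Longrightarrow> norm x \<le> R \<Longrightarrow> norm y \<le> R \<Longrightarrow> norm (G r x - G r y) \<le> K * norm (x - y)"
  using assms that unfolding ulip_def by (auto simp: dist_norm)

lemma ulip_const: "ulip R (\<lambda>r x. c)"
  by (rule ulipI[of _ _ "norm c" 0]) auto

lemma ulip_id: "ulip R (\<lambda>r x. x)"
  by (rule ulipI[of _ _ R 1]) auto

lemma ulip_blin:
  fixes G :: "real \<Rightarrow> 'a::real_normed_vector \<Rightarrow> 'b::real_normed_vector"
  assumes "bounded_linear f" "ulip R G" shows "ulip R (\<lambda>r x. f (G r x))"
proof -
  interpret bounded_linear f by (rule assms(1))
  obtain B where B: "0 \<le> B" "\<And>x. norm (f x) \<le> norm x * B" using nonneg_bounded by blast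
  obtain K where K: "0 \<le> K" "\<And>r x. 0 \<le> r \<Longrightarrow> r \<le> 1 \<Longrightarrow> norm x \<le> R \<Longrightarrow> norm (G r x) \<le> K"
    "\<And>r x y. 0 \<le> r \<Longrightarrow> r \<le> 1 \<Longrightarrow> norm x \<le> R \<Longrightarrow> norm y \<le> R \<Longrightarrow> norm (G r x - G r y) \<le> K * norm (x - y)"
    using assms(2) by (rule ulipE) blast
  show ?thesis
  proof (rule ulipI[of _ _ "K * B" "K * B"])
    fix r :: real and x y :: 'a assume r: "0 \<le> r" "r \<le> 1" and x: "norm x \<le> R"
    show "norm (f (G r x)) \<le> K * B"
      using B(2)[of "G r x"] mult_right_mono[OF K(2)[OF r x] B(1)] by linarith
    assume y: "norm y \<le> R"
    have "norm (f (G r x) - f (G r y)) \<le> norm (G r x - G r y) * B" using B(2)[of "G r x - G r y"] by (simp add: diff)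
    also have "\<dots> \<le> K * norm (x - y) * B" by (rule mult_right_mono[OF K(3)[OF r x y] B(1)])
    finally show "norm (f (G r x) - f (G r y)) \<le> K * B * norm (x - y)" by (simp add: mult_ac)
  qed
qed

lemma ulip_add:
  fixes G H :: "real \<Rightarrow> 'a::real_normed_vector \<Rightarrow> 'b::real_normed_vector"
  assumes "ulip R G" "ulip R H" shows "ulip R (\<lambda>r x. G r x + H r x)"
proof -
  obtain K where K: "0 \<le> K" "\<And>r x. 0 \<le> r \<Longrightarrow> r \<le> 1 \<Longrightarrow> norm x \<le> R \<Longrightarrow> norm (G r x) \<le> K"
    "\<And>r x y. 0 \<le> r \<Longrightarrow> r \<le> 1 \<Longrightarrow> norm x \<le> R \<Longrightarrow> norm y \<le> R \<Longrightarrow> norm (G r x - G r y) \<le> K * norm (x - y)"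
    using assms(1) by (rule ulipE) blast
  obtain L where L: "0 \<le> L" "\<And>r x. 0 \<le> r \<Longrightarrow> r \<le> 1 \<Longrightarrow> norm x \<le> R \<Longrightarrow> norm (H r x) \<le> L"
    "\<And>r x y. 0 \<le> r \<Longrightarrow> r \<le> 1 \<Longrightarrow> norm x \<le> R \<Longrightarrow> norm y \<le> R \<Longrightarrow> norm (H r x - H r y) \<le> L * norm (x - y)"
    using assms(2) by (rule ulipE) blast
  show ?thesis
  proof (rule ulipI[of _ _ "K + L" "K + L"])
    fix r :: real and x y :: 'a assume r: "0 \<le> r" "r \<le> 1" and x: "norm x \<le> R"
    show "norm (G r x + H r x) \<le> K + L" by (rule norm_triangle_mono[OF K(2)[OF r x] L(2)[OF r x]])
    assume y: "norm y \<le> R"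
    have "norm ((G r x - G r y) + (H r x - H r y)) \<le> K * norm (x - y) + L * norm (x - y)"
      by (rule norm_triangle_mono[OF K(3)[OF r x y] L(3)[OF r x y]])
    then show "norm (G r x + H r x - (G r y + H r y)) \<le> (K + L) * norm (x - y)" by (simp add: algebra_simps)
  qed
qed

lemma ulip_uminus: "ulip R G \<Longrightarrow> ulip R (\<lambda>r x. - G r x)"
  by (rule ulip_blin[OF bounded_linear_minus[OF bounded_linear_ident]])

lemma ulip_diff:
  assumes "ulip R G" "ulip R H" shows "ulip R (\<lambda>r x. G r x - H r x)"
  using ulip_add[OF assms(1) ulip_uminus[OF assms(2)]] by simp

lemma ulip_mult:
  fixes G H :: "real \<Rightarrow> 'a::real_normed_vector \<Rightarrow> 'b::real_normed_algebra"
  assumes "ulip R G" "ulip R H" shows "ulip R (\<lambda>r x. G r x * H r x)"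
proof -
  obtain K where K: "0 \<le> K" "\<And>r x. 0 \<le> r \<Longrightarrow> r \<le> 1 \<Longrightarrow> norm x \<le> R \<Longrightarrow> norm (G r x) \<le> K"
    "\<And>r x y. 0 \<le> r \<Longrightarrow> r \<le> 1 \<Longrightarrow> norm x \<le> R \<Longrightarrow> norm y \<le> R \<Longrightarrow> norm (G r x - G r y) \<le> K * norm (x - y)"
    using assms(1) by (rule ulipE) blast
  obtain L where L: "0 \<le> L" "\<And>r x. 0 \<le> r \<Longrightarrow> r \<le> 1 \<Longrightarrow> norm x \<le> R \<Longrightarrow> norm (H r x) \<le> L"
    "\<And>r x y. 0 \<le> r \<Longrightarrow> r \<le> 1 \<Longrightarrow> norm x \<le> R \<Longrightarrow> norm y \<le> R \<Longrightarrow> norm (H r x - H r y) \<le> L * norm (x - y)"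
    using assms(2) by (rule ulipE) blast
  show ?thesis
  proof (rule ulipI[of _ _ "K * L" "K * L + K * L"])
    fix r :: real and x y :: 'a assume r: "0 \<le> r" "r \<le> 1" and x: "norm x \<le> R"
    show "norm (G r x * H r x) \<le> K * L"
      by (rule order_trans[OF norm_mult_ineq mult_mono[OF K(2)[OF r x] L(2)[OF r x] K(1) norm_ge_zero]])
    assume y: "norm y \<le> R"
    have "norm (G r x * H r x - G r y * H r y) \<le> K * norm (x - y) * L + K * (L * norm (x - y))"
      by (rule norm_mult_diff_le[OF K(3)[OF r x y] L(2)[OF r x] K(2)[OF r y] L(3)[OF r x y]])
    then show "norm (G r x * H r x - G r y * H r y) \<le> (K * L + K * L) * norm (x - y)" by (simp add: algebra_simps)
  qed
qed

lemma ulip_radius: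
  fixes G :: "real \<Rightarrow> 'a::real_normed_vector \<Rightarrow> 'b::real_normed_vector"
  assumes "ulip R G" shows "ulip R (\<lambda>r x. r *\<^sub>R G r x)"
proof -
  obtain K where K: "0 \<le> K" "\<And>r x. 0 \<le> r \<Longrightarrow> r \<le> 1 \<Longrightarrow> norm x \<le> R \<Longrightarrow> norm (G r x) \<le> K"
    "\<And>r x y. 0 \<le> r \<Longrightarrow> r \<le> 1 \<Longrightarrow> norm x \<le> R \<Longrightarrow> norm y \<le> R \<Longrightarrow> norm (G r x - G r y) \<le> K * norm (x - y)"
    using assms(1) by (rule ulipE) blast
  show ?thesis
  proof (rule ulipI[of _ _ K K])
    fix r :: real and x y :: 'a assume r: "0 \<le> r" "r \<le> 1" and x: "norm x \<le> R"
    show "norm (r *\<^sub>R G r x) \<le> K"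
      using mult_mono[OF r(2) K(2)[OF r x]] r K(1) by simp
    assume y: "norm y \<le> R"
    have "norm (r *\<^sub>R G r x - r *\<^sub>R G r y) = r * norm (G r x - G r y)"
      using r by (simp add: scaleR_diff_right[symmetric])
    also have "\<dots> \<le> 1 * (K * norm (x - y))" using r K(1) K(3)[OF r x y] by (intro mult_mono) auto
    finally show "norm (r *\<^sub>R G r x - r *\<^sub>R G r y) \<le> K * norm (x - y)" by simp
  qed
qed

lemma ulip_Pair:
  assumes "ulip R G" "ulip R H" shows "ulip R (\<lambda>r x. (G r x, H r x))"
proof -
  have "ulip R (\<lambda>r x. (G r x, 0))" "ulip R (\<lambda>r x. (0, H r x))"
    by (rule ulip_blin[OF bounded_linear_Pair[OF bounded_linear_ident bounded_linear_zero] assms(1)],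
        rule ulip_blin[OF bounded_linear_Pair[OF bounded_linear_zero bounded_linear_ident] assms(2)])
  from ulip_add[OF this] show ?thesis by simp
qed

text \<open>For small \<open>r\<close> the map is a contraction of a ball around \<open>x0\<close>.\<close>
lemma ulip_fixed_point:
  fixes H :: "real \<Rightarrow> 'a::banach \<Rightarrow> 'a"
  assumes H: "ulip (norm x0 + 1) H" and \<rho>: "0 < \<rho>" "\<rho> \<le> 1"
  shows "\<exists>r x. 0 < r \<and> r \<le> 1 \<and> x = x0 + r *\<^sub>R H r x \<and> norm (x - x0) \<le> \<rho>"
proof -
  obtain K where K: "0 \<le> K" "\<And>r x. 0 \<le> r \<Longrightarrow> r \<le> 1 \<Longrightarrow> norm x \<le> norm x0 + 1 \<Longrightarrow> norm (H r x) \<le> K"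
    "\<And>r x y. 0 \<le> r \<Longrightarrow> r \<le> 1 \<Longrightarrow> norm x \<le> norm x0 + 1 \<Longrightarrow> norm y \<le> norm x0 + 1 \<Longrightarrow> norm (H r x - H r y) \<le> K * norm (x - y)"
    using H by (rule ulipE) blast
  define r where "r = \<rho> / (2 * (K + 1))"
  have r: "0 < r" "r \<le> 1" "r * K \<le> \<rho> / 2"
    using \<rho> K(1) by (auto simp: r_def divide_le_eq field_simps)
  have nb: "norm x \<le> norm x0 + 1" if "x \<in> cball x0 \<rho>" for x
    using that \<rho> norm_triangle_sub[of x x0] by (simp add: dist_norm norm_minus_commute)
  have "\<exists>!x\<in>cball x0 \<rho>. x0 + r *\<^sub>R H r x = x"
  proof (rule Banach_fix[of _ "1/2"])
    show "complete (cball x0 \<rho>)" by (simp add: complete_eq_closed)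
    show "cball x0 \<rho> \<noteq> {}" using \<rho> by simp
    show "(\<lambda>x. x0 + r *\<^sub>R H r x) ` cball x0 \<rho> \<subseteq> cball x0 \<rho>"
    proof clarify
      fix x assume x: "x \<in> cball x0 \<rho>"
      have "r * norm (H r x) \<le> r * K" using r K(2)[OF _ _ nb[OF x]] by (intro mult_left_mono) auto
      also have "\<dots> \<le> \<rho>" using r(3) \<rho> by simp
      finally show "x0 + r *\<^sub>R H r x \<in> cball x0 \<rho>" using r by (simp add: dist_norm)
    qed
    show "dist (x0 + r *\<^sub>R H r x) (x0 + r *\<^sub>R H r y) \<le> 1/2 * dist x y" if "x \<in> cball x0 \<rho>" "y \<in> cball x0 \<rho>" for x y
    proof -
      have "dist (x0 + r *\<^sub>R H r x) (x0 + r *\<^sub>R H r y) = r * norm (H r x - H r y)"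
        using r by (simp add: dist_norm scaleR_diff_right[symmetric])
      also have "\<dots> \<le> r * (K * norm (x - y))"
        using r K(3)[OF _ _ nb[OF that(1)] nb[OF that(2)]] by (intro mult_left_mono) auto
      also have "\<dots> = (r * K) * norm (x - y)" by simp
      also have "\<dots> \<le> 1/2 * norm (x - y)" using r(3) \<rho> by (intro mult_right_mono) auto
      finally show ?thesis by (simp add: dist_norm)
    qed
  qed auto
  then obtain x where "x \<in> cball x0 \<rho>" "x0 + r *\<^sub>R H r x = x" by blast
  then show ?thesis using r by (intro exI[of _ r] exI[of _ x]) (simp add: dist_norm norm_minus_commute)
qed

section \<open>The functional as a polynomial fixed-point equation\<close>

definition nth_pair :: "nat \<Rightarrow> 'a \<times> 'a \<Rightarrow> 'a" where "nth_pair j p = (if j = 1 then fst p else snd p)"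

lemma nth_pair_simps [simp]: "nth_pair 1 p = fst p" "nth_pair (Suc 0) p = fst p" "nth_pair 2 p = snd p"
  by (simp_all add: nth_pair_def)

lemma nth_pair_linear: "bounded_linear (nth_pair j :: 'a::real_normed_vector \<times> 'a \<Rightarrow> 'a)"
  by (cases "j = 1") (simp_all add: nth_pair_def[abs_def] bounded_linear_fst bounded_linear_snd)

abbreviation eps :: laurent where "eps \<equiv> mon 1 0 0"

lemmas ulip_ops =
  ulip_blin[OF ops_linear(1)] ulip_blin[OF ops_linear(2)] ulip_blin[OF ops_linear(3)] ulip_blin[OF ops_linear(4)]
  ulip_blin[OF ops_linear(5)] ulip_blin[OF ops_linear(6)] ulip_blin[OF ops_linear(7)] ulip_blin[OF ops_linear(8)]
  ulip_blin[OF nth_pair_linear] ulip_blin[OF tau_residue_linear] ulip_blin[OF high_modes_linear] ulip_blin[OF first_mode_linear]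
  ulip_blin[OF bounded_linear_fst] ulip_blin[OF bounded_linear_snd]

lemma ulip_scaleR: "ulip R G \<Longrightarrow> ulip R (\<lambda>r x. c *\<^sub>R G r x)"
  by (rule ulip_blin[OF bounded_linear_scaleR_right])

type_synonym laurent_pair = "laurent \<times> laurent"

context
  fixes b \<gamma> :: "nat \<Rightarrow> real" and d :: real
begin

text \<open>The next definitions are the series of the parts of the functional for \<open>\<epsilon> = r e\<close>. Here \<open>u\<close> encodes the two functions, \<open>v\<close>
  stands for \<open>1 / (1 + \<epsilon> b\<^sub>j q\<^sub>j)\<close> with the difference quotients \<open>q\<^sub>j\<close>, and Y for the reciprocals of
  \<open>d - \<epsilon> D\<close> with \<open>D = denom_ser\<close>. This one is \<open>1 + \<epsilon> b\<^sub>j f\<^sub>j' w\<close>.\<close>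
definition tangent_ser :: "real \<Rightarrow> nat \<Rightarrow> laurent_pair \<Rightarrow> laurent" where
  "tangent_ser r j u = 1 + r *\<^sub>R (eps * (b j *\<^sub>R deriv_at_w (nth_pair j u)))"

text \<open>On the circle \<open>cnj (\<tau> - w) = - cnj \<tau> * cnj w * (\<tau> - w)\<close>, so \<open>(\<tau> - w)\<^sup>2\<close> cancels in the singular kernel.\<close>
definition singular_ser :: "nat \<Rightarrow> laurent_pair \<Rightarrow> laurent_pair \<Rightarrow> laurent" where
  "singular_ser j u v = tau_residue ((cnj_quot (nth_pair j u) + mon 0 (-1) 0 * mon 0 0 (-1) * quot (nth_pair j u)) * nth_pair j v * (deriv_at_tau (nth_pair j u) - quot (nth_pair j u)))"

definition denom_ser :: "real \<Rightarrow> nat \<Rightarrow> laurent_pair \<Rightarrow> laurent" where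
  "denom_ser r j u = b (3 - j) *\<^sub>R mon 0 1 0 + b j *\<^sub>R mon 0 0 1
     + r *\<^sub>R (eps * ((b (3 - j))\<^sup>2 *\<^sub>R at_tau (nth_pair (3 - j) u) + (b j)\<^sup>2 *\<^sub>R at_w (nth_pair j u)))"

text \<open>The interaction integral is \<open>- 1 / d\<close> at \<open>\<epsilon> = 0\<close>; this is the rest, divided by \<open>- \<epsilon>\<close>. Each of its three
  summands collects what one factor of the integrand contributes beyond its value at \<open>\<epsilon> = 0\<close>.\<close>
definition interaction_ser :: "real \<Rightarrow> nat \<Rightarrow> laurent_pair \<Rightarrow> laurent_pair \<Rightarrow> laurent" where
  "interaction_ser r j u Y = tau_residue (b (3 - j) *\<^sub>R (cnj_at_tau (nth_pair (3 - j) u) * (1 + r *\<^sub>R (eps * (b (3 - j) *\<^sub>R deriv_at_tau (nth_pair (3 - j) u)))) * nth_pair j Y)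
     + mon 0 (-1) 0 * (b (3 - j) *\<^sub>R deriv_at_tau (nth_pair (3 - j) u)) * nth_pair j Y
     + (1 / d) *\<^sub>R (mon 0 (-1) 0 * denom_ser r j u * nth_pair j Y))"

definition linear_ser :: "nat \<Rightarrow> laurent \<Rightarrow> laurent \<Rightarrow> laurent" where
  "linear_ser j P Q = (-1) ^ j *\<^sub>R P - ((real j - 1) * d) *\<^sub>R Q"

text \<open>The complex expression of the functional minus its value to order 0 in \<open>\<epsilon>\<close> at fixed \<open>(P, Q, f)\<close>, divided by \<open>\<epsilon>\<close>.\<close>
definition remainder_ser :: "real \<Rightarrow> nat \<Rightarrow> laurent \<Rightarrow> laurent \<Rightarrow> laurent_pair \<Rightarrow> laurent_pair \<Rightarrow> laurent_pair \<Rightarrow> laurent" where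
  "remainder_ser r j P Q u v Y = linear_ser j P Q * mon 0 0 1 * (b j *\<^sub>R deriv_at_w (nth_pair j u))
     + b j *\<^sub>R (Q * (mon 0 0 (-1) + r *\<^sub>R (eps * (b j *\<^sub>R cnj_at_w (nth_pair j u)))) * mon 0 0 1 * tangent_ser r j u)
     + (b j * \<gamma> j) *\<^sub>R (mon 0 0 1 * tangent_ser r j u * singular_ser j u v)
     + \<gamma> (3 - j) *\<^sub>R (mon 0 0 1 * (b j *\<^sub>R deriv_at_w (nth_pair j u) * ((1 / d) *\<^sub>R 1 + r *\<^sub>R (eps * interaction_ser r j u Y)) + interaction_ser r j u Y))"

text \<open>The equations solved for their linear parts: mode 1 gives P and Q, the higher modes give \<open>u\<close>, and the last two
  lines say that \<open>v\<close> and Y are the reciprocals they stand for.\<close>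
definition fix_map :: "real \<Rightarrow> laurent_pair \<times> laurent_pair \<times> laurent_pair \<times> laurent_pair \<Rightarrow> laurent_pair \<times> laurent_pair \<times> laurent_pair \<times> laurent_pair" where
  "fix_map r x = (let P = fst (fst x); Q = snd (fst x); u = fst (snd x); v = fst (snd (snd x)); Y = snd (snd (snd x));
        G = (\<lambda>j. eps * remainder_ser r j P Q u v Y)
     in ((first_mode (G 1), (1 / d) *\<^sub>R (first_mode (G 1) + first_mode (G 2))),
         ((1 / \<gamma> 1) *\<^sub>R high_modes (G 1), (1 / \<gamma> 2) *\<^sub>R high_modes (G 2)),
         (- (b 1 *\<^sub>R (eps * (quot (nth_pair 1 u) * nth_pair 1 v))), - (b 2 *\<^sub>R (eps * (quot (nth_pair 2 u) * nth_pair 2 v)))),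
         ((1 / d) *\<^sub>R (eps * (denom_ser r 1 u * nth_pair 1 Y)), (1 / d) *\<^sub>R (eps * (denom_ser r 2 u * nth_pair 2 Y)))))"

text \<open>Every component is a polynomial expression in bounded linear maps of the unknowns.\<close>
lemma ulip_fix_map: "ulip R fix_map"
proof -
  note I = ulip_const ulip_add ulip_diff ulip_uminus ulip_mult ulip_radius ulip_scaleR ulip_Pair ulip_ops ulip_id
  have "ulip R (\<lambda>r x. fix_map r x)"
    unfolding fix_map_def Let_def remainder_ser_def linear_ser_def interaction_ser_def denom_ser_def singular_ser_def tangent_ser_def by (intro I)
  then show ?thesis by simp
qed

lemma pair_norms: "norm (fst z) \<le> norm z" "norm (snd z) \<le> norm z"
  for z :: "'a::real_normed_vector \<times> 'b::real_normed_vector"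
  by (cases z; simp add: norm_fst_le norm_snd_le)+

lemma existence_in_algebra:
  assumes "0 < \<rho>" "\<rho> \<le> 1"
  shows "\<exists>r P Q u v Y. 0 < r \<and> r \<le> 1 \<and>
     P = (\<gamma> 2 / d) *\<^sub>R 1 + r *\<^sub>R first_mode (eps * remainder_ser r 1 P Q u v Y) \<and>
     Q = ((\<gamma> 1 + \<gamma> 2) / d\<^sup>2) *\<^sub>R 1 + r *\<^sub>R ((1 / d) *\<^sub>R (first_mode (eps * remainder_ser r 1 P Q u v Y) + first_mode (eps * remainder_ser r 2 P Q u v Y))) \<and>
     (\<forall>j\<in>{1, 2}. nth_pair j u = r *\<^sub>R ((1 / \<gamma> j) *\<^sub>R high_modes (eps * remainder_ser r j P Q u v Y)) \<and>
        nth_pair j v = 1 - r *\<^sub>R (b j *\<^sub>R (eps * (quot (nth_pair j u) * nth_pair j v))) \<and>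
        nth_pair j Y = (1 / d) *\<^sub>R 1 + r *\<^sub>R ((1 / d) *\<^sub>R (eps * (denom_ser r j u * nth_pair j Y)))) \<and>
     norm (Q - ((\<gamma> 1 + \<gamma> 2) / d\<^sup>2) *\<^sub>R 1) \<le> \<rho> \<and> (\<forall>j\<in>{1, 2}. norm (nth_pair j u) \<le> \<rho>)"
proof -
  \<comment> \<open>The values of all unknowns at \<open>\<epsilon> = 0\<close>.\<close>
  define x0 :: "laurent_pair \<times> laurent_pair \<times> laurent_pair \<times> laurent_pair" where
    "x0 = (((\<gamma> 2 / d) *\<^sub>R 1, ((\<gamma> 1 + \<gamma> 2) / d\<^sup>2) *\<^sub>R 1), (0, 0), (1, 1), ((1 / d) *\<^sub>R 1, (1 / d) *\<^sub>R 1))"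
  obtain r x where r: "0 < r" "r \<le> 1" and x: "x = x0 + r *\<^sub>R fix_map r x" "norm (x - x0) \<le> \<rho>"
    using ulip_fixed_point[OF ulip_fix_map assms, of x0] by blast
  obtain P Q u1 u2 v1 v2 Y1 Y2 where xe: "x = ((P, Q), (u1, u2), (v1, v2), (Y1, Y2))" by (metis surj_pair)
  have "norm (snd (fst (x - x0))) \<le> \<rho>" "norm (fst (snd (x - x0))) \<le> \<rho>"
    using pair_norms[of "x - x0"] pair_norms[of "fst (x - x0)"] pair_norms[of "snd (x - x0)"] x(2) by linarith+
  then have n: "norm (Q - ((\<gamma> 1 + \<gamma> 2) / d\<^sup>2) *\<^sub>R 1) \<le> \<rho>" "norm (u1, u2) \<le> \<rho>" by (simp_all add: xe x0_def)
  then have n2: "norm u1 \<le> \<rho>" "norm u2 \<le> \<rho>" using norm_fst_le[of u1 u2] norm_snd_le[of u2 u1] by linarith+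
  show ?thesis
    by (rule exI[of _ r], rule exI[of _ P], rule exI[of _ Q], rule exI[of _ "(u1, u2)"], rule exI[of _ "(v1, v2)"], rule exI[of _ "(Y1, Y2)"])
      (use r n n2 x(1) in \<open>simp add: xe x0_def fix_map_def Let_def\<close>)
qed

text \<open>In the simplifier's normal form the exponent 1 is \<open>Suc 0\<close>.\<close>
lemma ev_eps [simp]: "ev e \<tau> w (mon (Suc 0) 0 0) = of_real e"
  by (simp add: ev_mon)

lemma fint_cong_except:
  assumes "w \<in> circ" "\<And>\<tau>. \<tau> \<in> circ \<Longrightarrow> \<tau> \<noteq> w \<Longrightarrow> h \<tau> = g \<tau>"
  shows "fint h = fint g"
  unfolding fint_rot[OF assms(1)]
proof (rule integral_spike[of "{0, 1}"])
  fix t :: real assume "t \<in> {0..1} - {0, 1}"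
  then have "w * cis (2 * pi * t) \<noteq> w" using rot_neq[OF assms(1), of t] by auto
  then show "g (w * cis (2 * pi * t)) * (w * cis (2 * pi * t)) = h (w * cis (2 * pi * t)) * (w * cis (2 * pi * t))"
    using assms(2) rot_circ[OF assms(1)] by simp
qed simp

context
  fixes r e :: real and j :: nat and u v Y :: laurent_pair and w :: complex
  assumes e: "\<bar>e\<bar> \<le> 1" and w: "w \<in> circ" and d: "d \<noteq> 0"
    and v: "nth_pair j v = 1 - r *\<^sub>R (b j *\<^sub>R (eps * (quot (nth_pair j u) * nth_pair j v)))"
    and Y: "nth_pair j Y = (1 / d) *\<^sub>R 1 + r *\<^sub>R ((1 / d) *\<^sub>R (eps * (denom_ser r j u * nth_pair j Y)))"
begin

abbreviation (input) fu where "fu i \<equiv> tail_fun (tail_coeffs e (nth_pair i u))"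
abbreviation (input) fu' where "fu' i \<equiv> tail_deriv (tail_coeffs e (nth_pair i u))"

lemma ad: "\<tau> \<in> circ \<Longrightarrow> admissible e \<tau> w" using e w by (simp add: admissible_def)

text \<open>The equation for \<open>v\<close>, evaluated at \<open>\<tau>\<close> and \<open>w\<close>, makes it the reciprocal of \<open>1 + \<epsilon> b\<^sub>j q\<^sub>j\<close>. The two
  integrands agree except at \<open>\<tau> = w\<close>.\<close>
lemma ev_singular_ser: "ev e 1 w (singular_ser j u v) = singular_int (of_real (r * e) * of_real (b j)) (fu j) (fu' j) w"
proof -
  have "singular_int (of_real (r * e) * of_real (b j)) (fu j) (fu' j) w
     = fint (\<lambda>\<tau>. ev e \<tau> w ((cnj_quot (nth_pair j u) + mon 0 (-1) 0 * mon 0 0 (-1) * quot (nth_pair j u)) * nth_pair j v * (deriv_at_tau (nth_pair j u) - quot (nth_pair j u))))"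
    unfolding singular_int_def
  proof (rule fint_cong_except[OF w])
    fix \<tau> assume \<tau>: "\<tau> \<in> circ" "\<tau> \<noteq> w"
    note a = ad[OF \<tau>(1)]
    define p q V where "p = ev e \<tau> w (cnj_quot (nth_pair j u))" and "q = ev e \<tau> w (quot (nth_pair j u))" and "V = ev e \<tau> w (nth_pair j v)"
    define A where "A = \<tau> - w"
    define E where "E = of_real (r * e) * complex_of_real (b j)"
    have A: "A \<noteq> 0" using \<tau> by (simp add: A_def)
    have B: "fu j \<tau> - fu j w = q * A" "cnj (fu j \<tau> - fu j w) = p * A"
      using ev_quotients[OF a, of "nth_pair j u"] by (simp_all add: p_def q_def A_def)
    have u: "cnj \<tau> * \<tau> = 1" "cnj w * w = 1" using w \<tau> by (simp_all add: complex_norm_square[symmetric] mult.commute)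
    have cA: "cnj A = - (A * (cnj \<tau> * cnj w))"
      using u by (simp add: A_def algebra_simps)
    have N: "A * cnj (fu j \<tau> - fu j w) - cnj A * (fu j \<tau> - fu j w) = A * A * (p + cnj \<tau> * cnj w * q)"
      unfolding B(2) unfolding B(1) cA by (simp add: algebra_simps)
    have D: "A * (A + E * (fu j \<tau> - fu j w)) = A * A * (1 + E * q)"
      unfolding B by (simp add: algebra_simps)
    have "V = 1 - E * q * V"
      using arg_cong[OF v, of "ev e \<tau> w"] by (simp add: ev_simps[OF a] V_def q_def E_def mult_ac)
    then have VE: "V * (1 + E * q) = 1" by (simp add: algebra_simps)
    then have nz: "1 + E * q \<noteq> 0" by auto
    have "V = 1 / (1 + E * q)" using VE nz by (simp add: field_simps)
    moreover have "(A * A * (p + cnj \<tau> * cnj w * q)) / (A * A * (1 + E * q)) = (p + cnj \<tau> * cnj w * q) / (1 + E * q)"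
      using A by simp
    moreover have "(fu j \<tau> - fu j w) / A = q" unfolding B using A by simp
    ultimately have "singular_kernel E A (fu j \<tau> - fu j w) (fu' j \<tau>) = (p + cnj \<tau> * cnj w * q) * V * (fu' j \<tau> - q)"
      unfolding singular_kernel_def N D by (simp add: divide_inverse)
    then show "singular_kernel (of_real (r * e) * of_real (b j)) (\<tau> - w) (fu j \<tau> - fu j w) (fu' j \<tau>)
      = ev e \<tau> w ((cnj_quot (nth_pair j u) + mon 0 (-1) 0 * mon 0 0 (-1) * quot (nth_pair j u)) * nth_pair j v * (deriv_at_tau (nth_pair j u) - quot (nth_pair j u)))"
      by (simp add: A_def[symmetric] E_def[symmetric] ev_simps[OF a] ev_ops[OF a] p_def q_def V_def del: of_real_mult)
  qed
  then show ?thesis unfolding singular_ser_def by (simp add: fint_ev[OF e w])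
qed

text \<open>The equation for Y makes it the reciprocal of the negative denominator. Inserting that equation once in the
  leading term \<open>cnj \<tau> * Y\<close> separates the value at \<open>\<epsilon> = 0\<close> from a multiple of \<open>\<epsilon>\<close>.\<close>
lemma ev_interaction_ser:
  assumes k: "k = 3 - j"
  shows "- (1 / of_real d + of_real (r * e) * ev e 1 w (interaction_ser r j u Y))
    = interaction_int (of_real d) (of_real (r * e) * of_real (b j)) (of_real (r * e) * of_real (b k)) (fu j w) (fu k) (fu' k) w"
proof -
  let ?T = "mon 0 (-1) 0"
  define f where "f = b k *\<^sub>R cnj_at_tau (nth_pair k u)"
  define g where "g = b k *\<^sub>R deriv_at_tau (nth_pair k u)"
  define y where "y = nth_pair j Y"
  define NW where "NW = (?T + r *\<^sub>R (eps * f)) * (1 + r *\<^sub>R (eps * g)) * y"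
  have "NW = ?T * y + r *\<^sub>R (eps * (f * (1 + r *\<^sub>R (eps * g)) * y + ?T * g * y))"
    by (simp add: NW_def algebra_simps)
  also have "?T * y = ?T * ((1 / d) *\<^sub>R 1 + r *\<^sub>R ((1 / d) *\<^sub>R (eps * (denom_ser r j u * y))))"
    using Y by (simp add: y_def)
  also have "\<dots> = (1 / d) *\<^sub>R ?T + r *\<^sub>R (eps * ((1 / d) *\<^sub>R (?T * denom_ser r j u * y)))"
    by (simp add: distrib_left mult_ac)
  finally have "NW = (1 / d) *\<^sub>R ?T + r *\<^sub>R (eps * (f * (1 + r *\<^sub>R (eps * g)) * y + ?T * g * y + (1 / d) *\<^sub>R (?T * denom_ser r j u * y)))"
    by (simp add: algebra_simps)
  moreover have "interaction_ser r j u Y = tau_residue (f * (1 + r *\<^sub>R (eps * g)) * y + ?T * g * y + (1 / d) *\<^sub>R (?T * denom_ser r j u * y))"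
    unfolding interaction_ser_def k[symmetric] f_def g_def y_def by simp
  moreover have "tau_residue ?T = 1" by (simp add: tau_residue_def mon_one)
  ultimately have "tau_residue NW = (1 / d) *\<^sub>R 1 + r *\<^sub>R (eps * interaction_ser r j u Y)"
    by (simp add: linear_simps(1)[OF tau_residue_linear] linear_simps(5)[OF tau_residue_linear] tau_residue_mult_e)
  then have C: "ev e 1 w (tau_residue NW) = 1 / of_real d + of_real (r * e) * ev e 1 w (interaction_ser r j u Y)"
    using ev_simps[OF ad[of 1]] by simp
  have "interaction_int (of_real d) (of_real (r * e) * of_real (b j)) (of_real (r * e) * of_real (b k)) (fu j w) (fu k) (fu' k) w
    = fint (\<lambda>\<tau>. ev e \<tau> w (- NW))"
    unfolding interaction_int_def
  proof (rule fint_cong)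
    fix \<tau> assume \<tau>: "\<tau> \<in> circ"
    note a = ad[OF \<tau>]
    define D where "D = ev e \<tau> w (denom_ser r j u)"
    define V where "V = ev e \<tau> w y"
    have "V = 1 / of_real d + of_real (r * e) / of_real d * (D * V)"
      using arg_cong[OF Y, of "ev e \<tau> w"] by (simp add: ev_simps[OF a] V_def y_def D_def mult_ac)
    then have VD: "V * (of_real d - of_real (r * e) * D) = 1" using d by (simp add: field_simps)
    have De: "D = of_real (b k) * \<tau> + of_real (b j) * w + of_real (r * e) * ((of_real (b k))\<^sup>2 * fu k \<tau> + (of_real (b j))\<^sup>2 * fu j w)"
      unfolding D_def denom_ser_def k[symmetric] by (simp add: ev_simps[OF a] ev_ops[OF a])
    have den: "of_real (r * e) * of_real (b k) * \<tau> + of_real (r * e) * of_real (b j) * w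
         + ((of_real (r * e) * of_real (b k))\<^sup>2 * fu k \<tau> + (of_real (r * e) * of_real (b j))\<^sup>2 * fu j w) - complex_of_real d
       = - (of_real d - of_real (r * e) * D)"
      unfolding De by (simp add: algebra_simps power2_eq_square)
    have nz: "of_real d - of_real (r * e) * D \<noteq> 0" using VD by auto
    have inv: "1 / (of_real d - of_real (r * e) * D) = V" using VD nz by (simp add: field_simps)
    have "ev e \<tau> w (- NW) = - ((cnj \<tau> + of_real (r * e) * of_real (b k) * cnj (fu k \<tau>)) * (1 + of_real (r * e) * of_real (b k) * fu' k \<tau>) * V)"
      unfolding NW_def f_def g_def V_def by (simp add: ev_simps[OF a] ev_ops[OF a] mult_ac)
    moreover have "X / (- (of_real d - of_real (r * e) * D)) = - (X * V)" for X
      unfolding inv[symmetric] minus_divide_right[symmetric] by simp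
    ultimately show "interaction_kernel (of_real d) (of_real (r * e) * of_real (b j)) (of_real (r * e) * of_real (b k)) w (fu j w) \<tau> (fu k \<tau>) (fu' k \<tau>) = ev e \<tau> w (- NW)"
      unfolding interaction_kernel_def den by (simp only:)
  qed
  also have "\<dots> = ev e 1 w (tau_residue (- NW))" by (rule fint_ev[OF e w])
  also have "\<dots> = - ev e 1 w (tau_residue NW)" using ev_simps(3)[OF ad[of 1]] by (simp add: linear_simps(4)[OF tau_residue_linear])
  finally show ?thesis unfolding C ..
qed

lemma ev_remainder_ser:
  assumes k: "k = 3 - j"
  shows "full_expr (of_real (\<gamma> j)) (of_real (\<gamma> k)) (of_real d) (of_real (r * e) * of_real (b j)) (of_real (r * e) * of_real (b k))
       (ev e 1 w Q) (ev e 1 w (linear_ser j P Q)) (fu j) (fu' j) (fu k) (fu' k) w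
     = (ev e 1 w (linear_ser j P Q) + of_real (\<gamma> k) / of_real d) * w - of_real (\<gamma> j) * fu' j w
       + ev e 1 w (r *\<^sub>R (eps * remainder_ser r j P Q u v Y))"
proof -
  note a = ad[of 1, simplified]
  show ?thesis
    unfolding full_expr_def ev_singular_ser[symmetric] ev_interaction_ser[OF k, symmetric] remainder_ser_def k[symmetric] tangent_ser_def
    by (simp add: ev_simps[OF a] ev_ops[OF a] del: of_real_mult) (simp add: algebra_simps)
qed

end

end

section \<open>Zeros of the functional from a fixed point\<close>

lemma full_expr_cong:
  assumes w: "w \<in> circ" and "\<And>\<tau>. \<tau> \<in> circ \<Longrightarrow> fj' \<tau> = gj' \<tau>" "\<And>\<tau>. \<tau> \<in> circ \<Longrightarrow> fk' \<tau> = gk' \<tau>"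
    "\<And>\<tau>. \<tau> \<in> circ \<Longrightarrow> fj \<tau> = gj \<tau>" "\<And>\<tau>. \<tau> \<in> circ \<Longrightarrow> fk \<tau> = gk \<tau>"
  shows "full_expr \<gamma>j \<gamma>k d ej ek Q L fj fj' fk fk' w = full_expr \<gamma>j \<gamma>k d ej ek Q L gj gj' gk gk' w"
proof -
  have "singular_int ej fj fj' w = singular_int ej gj gj' w"
    unfolding singular_int_def by (rule fint_cong) (simp add: assms(2,4) w[simplified] del: mem_sphere_0 add: w)
  moreover have "interaction_int d ej ek (gj w) fk fk' w = interaction_int d ej ek (gj w) gk gk' w"
    unfolding interaction_int_def by (rule fint_cong) (simp only: assms(3,5))
  ultimately show ?thesis unfolding full_expr_def by (simp only: assms(2,4)[OF w])
qed

lemma const_at_one: "const_at e 1 = 1"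
  unfolding mon_one[symmetric] const_at_mon by simp

text \<open>Evaluated on the circle, the equation for \<open>u\<close> removes all modes of order at least 2 from the functional, and the
  equations for P and Q remove the mode 1.\<close>
lemma F_zero_of_fixed_point:
  fixes b \<gamma> :: "nat \<Rightarrow> real" and d :: real
  assumes e: "\<bar>e\<bar> \<le> 1" and d: "d \<noteq> 0" and \<gamma>: "\<gamma> 1 \<noteq> 0" "\<gamma> 2 \<noteq> 0"
    and P: "P = (\<gamma> 2 / d) *\<^sub>R 1 + r *\<^sub>R first_mode (eps * remainder_ser b \<gamma> d r 1 P Q u v Y)"
    and Q: "Q = ((\<gamma> 1 + \<gamma> 2) / d\<^sup>2) *\<^sub>R 1 + r *\<^sub>R ((1 / d) *\<^sub>R (first_mode (eps * remainder_ser b \<gamma> d r 1 P Q u v Y) + first_mode (eps * remainder_ser b \<gamma> d r 2 P Q u v Y)))"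
    and uvY: "\<And>j. j \<in> {1, 2} \<Longrightarrow> nth_pair j u = r *\<^sub>R ((1 / \<gamma> j) *\<^sub>R high_modes (eps * remainder_ser b \<gamma> d r j P Q u v Y))"
      "\<And>j. j \<in> {1, 2} \<Longrightarrow> nth_pair j v = 1 - r *\<^sub>R (b j *\<^sub>R (eps * (quot (nth_pair j u) * nth_pair j v)))"
      "\<And>j. j \<in> {1, 2} \<Longrightarrow> nth_pair j Y = (1 / d) *\<^sub>R 1 + r *\<^sub>R ((1 / d) *\<^sub>R (eps * (denom_ser b r j u * nth_pair j Y)))"
    and \<Omega>: "2 * \<Omega> = const_at e Q" "2 * \<Omega> * Z = const_at e P"
  shows "F_zero b d \<gamma> (r * e) \<Omega> Z (\<lambda>j. tail_fun (tail_coeffs e (nth_pair j u)))"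
  unfolding F_zero_def
proof (intro ballI)
  fix j :: nat and w assume j: "j \<in> {1, 2}" and w: "w \<in> circ"
  define k where "k = 3 - j"
  have a: "admissible e 1 w" using e w by (simp add: admissible_def)
  define X where "X i = eps * remainder_ser b \<gamma> d r i P Q u v Y" for i
  note lR = linear_simps[OF const_at_linear[OF e]]
  have RP: "const_at e P = \<gamma> 2 / d + r * const_at e (first_mode (X 1))"
    using arg_cong[OF P, of "const_at e"] by (simp add: lR const_at_one X_def)
  have RQ: "const_at e Q = (\<gamma> 1 + \<gamma> 2) / d\<^sup>2 + r / d * (const_at e (first_mode (X 1)) + const_at e (first_mode (X 2)))"
    using arg_cong[OF Q, of "const_at e"] by (simp add: lR const_at_one X_def)
  have EP: "ev e 1 w P = of_real (const_at e P)"
    unfolding RP using arg_cong[OF P, of "ev e 1 w"] by (simp add: ev_simps[OF a] ev_first_mode[OF a] X_def)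
  have EQ: "ev e 1 w Q = of_real (const_at e Q)"
    unfolding RQ using arg_cong[OF Q, of "ev e 1 w"] by (simp add: ev_simps[OF a] ev_first_mode[OF a] X_def)
  define l where "l = (-1) ^ j * const_at e P - (of_nat j - 1) * d * const_at e Q"
  have EL: "ev e 1 w (linear_ser d j P Q) = of_real l"
    unfolding linear_ser_def l_def by (simp add: ev_simps[OF a] EP EQ)
  have L0: "l + \<gamma> k / d + r * const_at e (first_mode (X j)) = 0"
    using j d unfolding l_def k_def RP RQ by (auto simp: field_simps power2_eq_square)
  have "F b d \<gamma> (r * e) \<Omega> Z (\<lambda>j. tail_fun (tail_coeffs e (nth_pair j u))) j w
     = Im (full_expr (of_real (\<gamma> j)) (of_real (\<gamma> k)) (of_real d) (of_real (r * e) * of_real (b j)) (of_real (r * e) * of_real (b k))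
         (ev e 1 w Q) (ev e 1 w (linear_ser d j P Q)) (tail_fun (tail_coeffs e (nth_pair j u))) (tail_deriv (tail_coeffs e (nth_pair j u))) (tail_fun (tail_coeffs e (nth_pair k u))) (tail_deriv (tail_coeffs e (nth_pair k u))) w)"
    unfolding F_eq_Im_full_expr[OF j k_def] \<Omega>(2) EQ EL l_def unfolding \<Omega>(1)
    by (rule arg_cong[of _ _ Im], rule full_expr_cong[OF w]) (erule tail_fun_deriv(2), erule tail_fun_deriv(2), rule refl, rule refl)
  also have "\<dots> = Im ((ev e 1 w (linear_ser d j P Q) + of_real (\<gamma> k) / of_real d) * w - of_real (\<gamma> j) * tail_deriv (tail_coeffs e (nth_pair j u)) w
       + ev e 1 w (r *\<^sub>R X j))"
    unfolding X_def by (simp only: ev_remainder_ser[OF e w d uvY(2)[OF j] uvY(3)[OF j] k_def])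
  also have "\<dots> = (l + \<gamma> k / d) * Im w - \<gamma> j * Im (tail_deriv (tail_coeffs e (nth_pair j u)) w) + r * Im (ev e 1 w (X j))"
    unfolding EL by (simp add: ev_simps[OF a] Im_divide_of_real flip: of_real_divide of_real_add)
  also have "Im (tail_deriv (tail_coeffs e (nth_pair j u)) w) = r / \<gamma> j * Im (ev e 1 w (high_modes (X j)))"
  proof -
    have "tail_deriv (tail_coeffs e (nth_pair j u)) w = of_real (r / \<gamma> j) * tail_deriv (tail_coeffs e (high_modes (X j))) w"
      unfolding uvY(1)[OF j] X_def
      by (simp add: linear_simps(5)[OF tail_coeffs_linear[OF e]] linear_simps(5)[OF tail_fun_linear(2)] scaleR_conv_of_real[of _ "_ :: complex"])
    then show ?thesis using Im_split(2)[OF a, of "X j"] by simp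
  qed
  also have "Im (ev e 1 w (X j)) = Im (ev e 1 w (high_modes (X j))) + const_at e (first_mode (X j)) * Im w"
    by (rule Im_split(1)[OF a])
  also have "(l + \<gamma> k / d) * Im w - \<gamma> j * (r / \<gamma> j * Im (ev e 1 w (high_modes (X j)))) + r * (Im (ev e 1 w (high_modes (X j))) + const_at e (first_mode (X j)) * Im w)
     = (l + \<gamma> k / d + r * const_at e (first_mode (X j))) * Im w"
    using j \<gamma> by (auto simp: algebra_simps)
  finally show "F b d \<gamma> (r * e) \<Omega> Z (\<lambda>j. tail_fun (tail_coeffs e (nth_pair j u))) j w = 0" unfolding L0 by simp
qed

text \<open>At \<open>e = 0\<close> only \<open>x\<^sub>0\<close> survives in the fixed-point equation, since all corrections carry the factor \<open>e\<close>.\<close>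
lemma vanish_at_zero:
  "tail_coeffs 0 (high_modes (eps * x)) = 0" "const_at 0 (first_mode (eps * x)) = 0"
proof -
  have 0: "\<bar>0::real\<bar> \<le> 1" by simp
  note S = bounded_linear_compose[OF tail_coeffs_linear[OF 0] bounded_linear_compose[OF high_modes_linear bounded_linear_mult_right]]
  note R = bounded_linear_compose[OF const_at_linear[OF 0] bounded_linear_compose[OF first_mode_linear bounded_linear_mult_right]]
  show "tail_coeffs 0 (high_modes (eps * x)) = 0"
    by (rule laurent_eqI[OF S bounded_linear_zero])
      (simp add: mon_mult high_modes_def eval_eps_def linear_simps(3)[OF tail_coeffs_linear[OF 0], unfolded eval_eps_def] linear_simps(4)[OF tail_coeffs_linear[OF 0], unfolded eval_eps_def])
  show "const_at 0 (first_mode (eps * x)) = 0"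
    by (rule laurent_eqI[OF R bounded_linear_zero])
      (simp add: mon_mult first_mode_def const_at_mon linear_simps(3)[OF const_at_linear[OF 0]] linear_simps(4)[OF const_at_linear[OF 0]])
qed

section \<open>Discs are not solutions\<close>

text \<open>For \<open>f = 0\<close> the self-interaction vanishes and Cauchy's formula evaluates the interaction integral, so that
  \<open>F\<^sub>1\<close> is \<open>L Im w + \<gamma>\<^sub>2 d Im w / |d - ej w|\<^sup>2\<close>. This vanishes identically only if \<open>|d - ej w|\<close> is
  constant on the circle off the real axis, that is for \<open>ej = 0\<close>.\<close>
lemma trivial_not_zero:
  fixes b \<gamma> :: "nat \<Rightarrow> real" and d \<epsilon> :: real
  assumes b: "0 < b 1" "0 < b 2" and d: "d > 2 * (b 1 + b 2)" and \<gamma>: "\<gamma> 2 \<noteq> 0" and \<epsilon>: "\<bar>\<epsilon>\<bar> < 1 / 2" "\<epsilon> \<noteq> 0"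
    and f0: "\<And>j w. j \<in> {1, 2} \<Longrightarrow> w \<in> circ \<Longrightarrow> f j w = 0"
  shows "\<not> F_zero b d \<gamma> \<epsilon> \<Omega> Z f"
proof
  assume z: "F_zero b d \<gamma> \<epsilon> \<Omega> Z f"
  have f0': "circ_deriv (f j) w = 0" if "j \<in> {1, 2}" "w \<in> circ" for j w
  proof -
    have "circ_deriv (f j) w = circ_deriv (\<lambda>_. 0) w" by (rule circ_deriv_cong) (use f0 that in auto)
    also have "\<dots> = 0" by (rule circ_deriv_eq[OF _ that(2)]) simp
    finally show ?thesis .
  qed
  define ej ek where "ej = \<epsilon> * b 1" and "ek = \<epsilon> * b 2"
  have ebd: "\<bar>ej\<bar> \<le> b 1 / 2" "\<bar>ek\<bar> \<le> b 2 / 2"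
    using b \<epsilon> mult_right_mono[of "\<bar>\<epsilon>\<bar>" "1/2" "b 1"] mult_right_mono[of "\<bar>\<epsilon>\<bar>" "1/2" "b 2"] by (auto simp: ej_def ek_def abs_mult)
  define L where "L = - (2 * \<Omega> * Z)"
  have main: "L * Im w + \<gamma> 2 * (d * Im w / (norm (of_real d - of_real ej * w))\<^sup>2) = 0" if w: "w \<in> circ" for w
  proof -
    define c where "c = of_real ej * w - complex_of_real d"
    have w1: "norm w = 1" using w by simp
    have nz: "of_real ek * u + c \<noteq> 0" if "norm u \<le> 1" for u
    proof
      assume "of_real ek * u + c = 0"
      then have "of_real d = of_real ek * u + of_real ej * w" by (simp add: c_def algebra_simps)
      then have "norm (complex_of_real d) \<le> norm (of_real ek * u) + norm (of_real ej * w)" by (metis norm_triangle_ineq)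
      also have "\<dots> \<le> \<bar>ek\<bar> * 1 + \<bar>ej\<bar> * 1" using that w1 by (intro add_mono) (simp_all add: norm_mult mult_left_le)
      finally show False using ebd b d by simp
    qed
    have I: "interaction_int (of_real d) (of_real ej) (of_real ek) 0 (\<lambda>_. 0) (\<lambda>_. 0) w = 1 / c"
    proof -
      have "interaction_int (of_real d) (of_real ej) (of_real ek) 0 (\<lambda>_. 0) (\<lambda>_. 0) w = fint (\<lambda>\<tau>. (1 / (of_real ek * \<tau> + c)) / (\<tau> - 0))"
        unfolding interaction_int_def
      proof (rule fint_cong)
        fix \<tau> :: complex assume "\<tau> \<in> circ"
        then have "cnj \<tau> = 1 / \<tau>" by (rule circ_cnj(2))
        then show "interaction_kernel (of_real d) (of_real ej) (of_real ek) w 0 \<tau> 0 0 = (1 / (of_real ek * \<tau> + c)) / (\<tau> - 0)"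
          by (simp add: interaction_kernel_def c_def algebra_simps)
      qed
      also have "((\<lambda>\<tau>. (1 / (of_real ek * \<tau> + c)) / (\<tau> - 0)) has_contour_integral 2 * of_real pi * \<i> * (1 / (of_real ek * 0 + c))) (circlepath 0 1)"
        by (rule Cauchy_integral_circlepath_simple) (auto intro!: holomorphic_intros dest: nz)
      then have "fint (\<lambda>\<tau>. (1 / (of_real ek * \<tau> + c)) / (\<tau> - 0)) = 1 / c"
        unfolding fint_def by (simp add: contour_integral_unique)
      finally show ?thesis .
    qed
    have S: "singular_int (of_real ej) (\<lambda>_. 0) (\<lambda>_. 0) w = 0"
      by (simp add: singular_int_def singular_kernel_def fint_rot[of 1])
    have "0 = F b d \<gamma> \<epsilon> \<Omega> Z f 1 w" using z w unfolding F_zero_def by simp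
    also have "\<dots> = Im (full_expr (of_real (\<gamma> 1)) (of_real (\<gamma> 2)) (of_real d) (of_real \<epsilon> * of_real (b 1)) (of_real \<epsilon> * of_real (b 2)) (of_real (2 * \<Omega>))
       (of_real ((-1) ^ 1 * (2 * \<Omega> * Z) - (of_nat 1 - 1) * d * (2 * \<Omega>))) (f 1) (circ_deriv (f 1)) (f 2) (circ_deriv (f 2)) w)"
      by (rule F_eq_Im_full_expr) simp_all
    also have "\<dots> = Im (full_expr (of_real (\<gamma> 1)) (of_real (\<gamma> 2)) (of_real d) (of_real ej) (of_real ek) (of_real (2 * \<Omega>))
       (of_real L) (\<lambda>_. 0) (\<lambda>_. 0) (\<lambda>_. 0) (\<lambda>_. 0) w)"
    proof -
      have "complex_of_real \<epsilon> * of_real (b 1) = of_real ej" "complex_of_real \<epsilon> * of_real (b 2) = of_real ek"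
        "(-1) ^ 1 * (2 * \<Omega> * Z) - (of_nat 1 - 1) * d * (2 * \<Omega>) = L" by (simp_all add: ej_def ek_def L_def)
      then show ?thesis by (simp only:) (intro arg_cong[of _ _ Im] full_expr_cong[OF w] f0 f0', simp_all)
    qed
    also have "\<dots> = Im (of_real (2 * \<Omega> * ej) * (cnj w * w) + of_real L * w - of_real (\<gamma> 2) * (w / c))"
      unfolding full_expr_def I S by (simp add: algebra_simps)
    also have "cnj w * w = 1" by (rule circ_cnj(1)[OF w])
    also have "Im (of_real (2 * \<Omega> * ej) * 1 + of_real L * w - of_real (\<gamma> 2) * (w / c)) = L * Im w - \<gamma> 2 * Im (w / c)"
      by (simp del: times_divide_eq_right)
    also have "Im (w / c) = - (d * Im w / (norm (of_real d - of_real ej * w))\<^sup>2)"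
    proof -
      have "Im (w / c) = Im (w * cnj c) / (norm c)\<^sup>2" by (simp add: Im_complex_div_eq_0 complex_div_cnj[of w c] flip: of_real_power)
      also have "Im (w * cnj c) = - (d * Im w)" by (simp add: c_def algebra_simps)
      also have "norm c = norm (of_real d - of_real ej * w)" unfolding c_def by (rule norm_minus_commute)
      finally show ?thesis by simp
    qed
    finally show ?thesis by simp
  qed
  \<comment> \<open>A rational point of the circle off both axes, where \<open>|d - ej w|\<close> differs from its value at \<open>\<i>\<close>.\<close>
  define p where "p = Complex (3/5) (4/5)"
  have pc: "p \<in> circ" "\<i> \<in> circ" by (simp_all add: p_def complex_norm power2_eq_square)
  have n1: "(norm (of_real d - of_real ej * \<i>))\<^sup>2 = d\<^sup>2 + ej\<^sup>2"
    by (simp add: cmod_power2)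
  have n2: "(norm (of_real d - of_real ej * p))\<^sup>2 = d\<^sup>2 + ej\<^sup>2 - 6/5 * d * ej"
    by (simp add: cmod_power2 p_def) (simp add: power2_eq_square algebra_simps)
  have d0: "d > 0" using b d by simp
  have ej0: "ej \<noteq> 0" using b \<epsilon> by (simp add: ej_def)
  have pos: "0 < d\<^sup>2 + ej\<^sup>2" using d0 by (simp add: add_pos_nonneg)
  have "L + \<gamma> 2 * (d / (d\<^sup>2 + ej\<^sup>2)) = 0" using main[OF pc(2)] unfolding n1 by simp
  moreover have "L + \<gamma> 2 * (d / (d\<^sup>2 + ej\<^sup>2 - 6/5 * d * ej)) = 0"
  proof -
    have "L * (4/5) + \<gamma> 2 * (d * (4/5) / (d\<^sup>2 + ej\<^sup>2 - 6/5 * d * ej)) = 0"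
      using main[OF pc(1)] unfolding n2 by (simp add: p_def)
    then have "4/5 * (L + \<gamma> 2 * (d / (d\<^sup>2 + ej\<^sup>2 - 6/5 * d * ej))) = 0" by (simp add: algebra_simps)
    then show ?thesis by simp
  qed
  ultimately have "\<gamma> 2 * (d / (d\<^sup>2 + ej\<^sup>2)) = \<gamma> 2 * (d / (d\<^sup>2 + ej\<^sup>2 - 6/5 * d * ej))" by linarith
  then have eq: "d / (d\<^sup>2 + ej\<^sup>2) = d / (d\<^sup>2 + ej\<^sup>2 - 6/5 * d * ej)" using \<gamma> by simp
  then have "d / (d\<^sup>2 + ej\<^sup>2 - 6/5 * d * ej) \<noteq> 0" using d0 pos by (metis divide_eq_0_iff less_irrefl)
  then have "d\<^sup>2 + ej\<^sup>2 - 6/5 * d * ej \<noteq> 0" by auto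
  then have "d * ej = 0" using eq d0 pos by (simp add: frac_eq_eq)
  then show False using d0 ej0 by simp
qed

section \<open>Continuous differentiability in the parameter\<close>

text \<open>Taylor's formula in \<open>e = t / r\<close>; the difference quotients converge with a linear rate.\<close>
lemma spectral_quotient_bound:
  fixes g :: "int \<Rightarrow> int \<Rightarrow> 'b::banach"
  assumes g: "\<And>i k. norm (g i k) \<le> 1 + \<bar>real_of_int k\<bar>" and r: "0 < r"
    and st: "\<bar>s\<bar> \<le> r / 2" "\<bar>t\<bar> \<le> r / 2" "s \<noteq> t"
  shows "norm ((1 / (s - t)) *\<^sub>R (eval_eps g (s / r) x - eval_eps g (t / r) x) - (1 / r) *\<^sub>R deriv_eps g (t / r) x) \<le> 4 / r\<^sup>2 * norm x * \<bar>s - t\<bar>"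
proof -
  have e: "\<bar>s / r\<bar> \<le> 1/2" "\<bar>t / r\<bar> \<le> 1/2" using st r by (simp_all add: divide_le_eq)
  have "(1 / (s - t)) *\<^sub>R (eval_eps g (s / r) x - eval_eps g (t / r) x) - (1 / r) *\<^sub>R deriv_eps g (t / r) x
     = (1 / (s - t)) *\<^sub>R (eval_eps g (s / r) x - eval_eps g (t / r) x - (s / r - t / r) *\<^sub>R deriv_eps g (t / r) x)"
    using st(3) by (simp add: scaleR_diff_right diff_divide_distrib[symmetric])
  also have "norm \<dots> \<le> \<bar>1 / (s - t)\<bar> * (4 * (s / r - t / r)\<^sup>2 * norm x)"
    unfolding norm_scaleR by (intro mult_left_mono eval_eps_taylor[OF g e]) auto
  also have "\<dots> = 4 / r\<^sup>2 * norm x * \<bar>s - t\<bar>"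
  proof -
    define D where "D = \<bar>s - t\<bar>"
    have "D \<noteq> 0" using st(3) by (simp add: D_def)
    moreover have "(s / r - t / r)\<^sup>2 = D * D / r\<^sup>2"
      by (simp add: D_def diff_divide_distrib[symmetric] power_divide power2_eq_square)
    moreover have "\<bar>1 / (s - t)\<bar> = 1 / D" by (simp add: D_def)
    ultimately show ?thesis unfolding D_def[symmetric] by simp
  qed
  finally show ?thesis .
qed

lemma const_at_C1:
  assumes r: "0 < r" and I: "\<And>t. t \<in> I \<Longrightarrow> \<bar>t\<bar> \<le> r / 2"
  shows "t \<in> I \<Longrightarrow> ((\<lambda>t. const_at (t / r) x) has_real_derivative deriv_eps const_slot (t / r) x / r) (at t within I)"
    and "continuous_on I (\<lambda>t. deriv_eps const_slot (t / r) x / r)"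
proof -
  show "((\<lambda>t. const_at (t / r) x) has_real_derivative deriv_eps const_slot (t / r) x / r) (at t within I)" if t: "t \<in> I" for t
  proof -
    have "((\<lambda>s. (const_at (s / r) x - const_at (t / r) x) / (s - t) - deriv_eps const_slot (t / r) x / r) \<longlongrightarrow> 0) (at t within I)"
    proof (rule Lim_null_comparison)
      have "((\<lambda>s. 4 / r\<^sup>2 * norm x * \<bar>s - t\<bar>) \<longlongrightarrow> 4 / r\<^sup>2 * norm x * \<bar>t - t\<bar>) (at t within I)" by (intro tendsto_intros)
      then show "((\<lambda>s. 4 / r\<^sup>2 * norm x * \<bar>s - t\<bar>) \<longlongrightarrow> 0) (at t within I)" by simp
      have "norm ((const_at (s / r) x - const_at (t / r) x) / (s - t) - deriv_eps const_slot (t / r) x / r) \<le> 4 / r\<^sup>2 * norm x * \<bar>s - t\<bar>" if "s \<noteq> t" "s \<in> I" for s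
        using spectral_quotient_bound[of const_slot r s t x, OF const_slot_norm r I[OF that(2)] I[OF t] that(1)] by simp
      then show "\<forall>\<^sub>F s in at t within I. norm ((const_at (s / r) x - const_at (t / r) x) / (s - t) - deriv_eps const_slot (t / r) x / r) \<le> 4 / r\<^sup>2 * norm x * \<bar>s - t\<bar>"
        unfolding eventually_at_filter by (intro always_eventually allI impI)
    qed
    then show ?thesis unfolding has_field_derivative_iff by (simp add: Lim_null[symmetric])
  qed
  show "continuous_on I (\<lambda>t. deriv_eps const_slot (t / r) x / r)"
    unfolding continuous_on_def
  proof
    fix t assume t: "t \<in> I"
    have "((\<lambda>s. deriv_eps const_slot (s / r) x - deriv_eps const_slot (t / r) x) \<longlongrightarrow> 0) (at t within I)"
    proof (rule Lim_null_comparison)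
      have "((\<lambda>s. 8 * \<bar>s / r - t / r\<bar> * norm x) \<longlongrightarrow> 8 * \<bar>t / r - t / r\<bar> * norm x) (at t within I)" using r by (intro tendsto_intros) auto
      then show "((\<lambda>s. 8 * \<bar>s / r - t / r\<bar> * norm x) \<longlongrightarrow> 0) (at t within I)" by simp
      have "norm (deriv_eps const_slot (s / r) x - deriv_eps const_slot (t / r) x) \<le> 8 * \<bar>s / r - t / r\<bar> * norm x" if "s \<in> I" for s
        by (rule deriv_eps_diff[of const_slot, OF const_slot_norm]) (use I[OF that] I[OF t] r in \<open>simp_all add: divide_le_eq\<close>)
      then show "\<forall>\<^sub>F s in at t within I. norm (deriv_eps const_slot (s / r) x - deriv_eps const_slot (t / r) x) \<le> 8 * \<bar>s / r - t / r\<bar> * norm x"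
        unfolding eventually_at_filter by (intro always_eventually allI impI)
    qed
    then have "((\<lambda>s. deriv_eps const_slot (s / r) x) \<longlongrightarrow> deriv_eps const_slot (t / r) x) (at t within I)" by (simp add: Lim_null[symmetric])
    then show "((\<lambda>t. deriv_eps const_slot (t / r) x / r) \<longlongrightarrow> deriv_eps const_slot (t / r) x / r) (at t within I)"
      using r by (intro tendsto_intros) auto
  qed
qed

lemma tail_fun_curve_C1:
  assumes \<alpha>: "0 < \<alpha>" "\<alpha> < 1" and r: "0 < r" and I: "\<And>t. t \<in> I \<Longrightarrow> \<bar>t\<bar> \<le> r / 2"
  shows "C1_X \<alpha> I (\<lambda>t j. tail_fun (tail_coeffs (t / r) (x j)))"
  unfolding C1_X_def
proof (intro exI ballI conjI)
  let ?v' = "\<lambda>t j. tail_fun ((1 / r) *\<^sub>R deriv_eps tail_slot (t / r) (x j))"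
  define B where "B = norm (x 1) + norm (x 2)"
  have B: "norm (x 1) \<le> B" "norm (x 2) \<le> B" by (simp_all add: B_def)
  fix t assume t: "t \<in> I"
  show "(\<lambda>j. tail_fun (tail_coeffs (t / r) (x j))) \<in> space_X \<alpha>" by (rule tail_fun_space_X[OF \<alpha>])
  show "?v' t \<in> space_X \<alpha>" by (rule tail_fun_space_X[OF \<alpha>])
  note l = linear_simps[OF tail_fun_linear(1)]
  show "((\<lambda>s. norm_X \<alpha> (\<lambda>j w. (tail_fun (tail_coeffs (s / r) (x j)) w - tail_fun (tail_coeffs (t / r) (x j)) w) / of_real (s - t) - ?v' t j w)) \<longlongrightarrow> 0) (at t within I)"
  proof (rule tendsto_sandwich[of "\<lambda>_. 0" _ _ "\<lambda>s. 6 * (4 / r\<^sup>2 * B * \<bar>s - t\<bar>)"])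
    have eq: "(\<lambda>j w. (tail_fun (tail_coeffs (s / r) (x j)) w - tail_fun (tail_coeffs (t / r) (x j)) w) / of_real (s - t) - ?v' t j w)
       = (\<lambda>j. tail_fun ((1 / (s - t)) *\<^sub>R (tail_coeffs (s / r) (x j) - tail_coeffs (t / r) (x j)) - (1 / r) *\<^sub>R deriv_eps tail_slot (t / r) (x j)))" for s
      by (intro ext) (simp add: l scaleR_conv_of_real[where 'a = complex] divide_inverse mult.commute)
    have b: "norm ((1 / (s - t)) *\<^sub>R (tail_coeffs (s / r) (x j) - tail_coeffs (t / r) (x j)) - (1 / r) *\<^sub>R deriv_eps tail_slot (t / r) (x j)) \<le> 4 / r\<^sup>2 * B * \<bar>s - t\<bar>"
      if "s \<noteq> t" "s \<in> I" "norm (x j) \<le> B" for s j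
    proof -
      have "4 / r\<^sup>2 * norm (x j) * \<bar>s - t\<bar> \<le> 4 / r\<^sup>2 * B * \<bar>s - t\<bar>" using that(3) by (intro mult_right_mono mult_left_mono) auto
      then show ?thesis using spectral_quotient_bound[of tail_slot r s t "x j", OF tail_slot_norm r I[OF that(2)] I[OF t] that(1)] by linarith
    qed
    have "0 \<le> norm_X \<alpha> (\<lambda>j w. (tail_fun (tail_coeffs (s / r) (x j)) w - tail_fun (tail_coeffs (t / r) (x j)) w) / of_real (s - t) - ?v' t j w) \<and>
        norm_X \<alpha> (\<lambda>j w. (tail_fun (tail_coeffs (s / r) (x j)) w - tail_fun (tail_coeffs (t / r) (x j)) w) / of_real (s - t) - ?v' t j w) \<le> 6 * (4 / r\<^sup>2 * B * \<bar>s - t\<bar>)"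
      if "s \<noteq> t" "s \<in> I" for s
      unfolding eq using norm_X_tail_fun[OF \<alpha> b[OF that B(1)] b[OF that B(2)]] by blast
    note this[THEN conjunct1] this[THEN conjunct2]
    then show "\<forall>\<^sub>F s in at t within I. 0 \<le> norm_X \<alpha> (\<lambda>j w. (tail_fun (tail_coeffs (s / r) (x j)) w - tail_fun (tail_coeffs (t / r) (x j)) w) / of_real (s - t) - ?v' t j w)"
      "\<forall>\<^sub>F s in at t within I. norm_X \<alpha> (\<lambda>j w. (tail_fun (tail_coeffs (s / r) (x j)) w - tail_fun (tail_coeffs (t / r) (x j)) w) / of_real (s - t) - ?v' t j w) \<le> 6 * (4 / r\<^sup>2 * B * \<bar>s - t\<bar>)"
      unfolding eventually_at_filter by (intro always_eventually allI impI, blast)+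
    have "((\<lambda>s. 6 * (4 / r\<^sup>2 * B * \<bar>s - t\<bar>)) \<longlongrightarrow> 6 * (4 / r\<^sup>2 * B * \<bar>t - t\<bar>)) (at t within I)" by (intro tendsto_intros)
    then show "((\<lambda>s. 6 * (4 / r\<^sup>2 * B * \<bar>s - t\<bar>)) \<longlongrightarrow> 0) (at t within I)" by simp
  qed simp
  show "((\<lambda>s. norm_X \<alpha> (\<lambda>j w. ?v' s j w - ?v' t j w)) \<longlongrightarrow> 0) (at t within I)"
  proof (rule tendsto_sandwich[of "\<lambda>_. 0" _ _ "\<lambda>s. 6 * (8 / r * \<bar>s / r - t / r\<bar> * B)"])
    have eq: "(\<lambda>j w. ?v' s j w - ?v' t j w) = (\<lambda>j. tail_fun ((1 / r) *\<^sub>R (deriv_eps tail_slot (s / r) (x j) - deriv_eps tail_slot (t / r) (x j))))" for s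
      by (intro ext) (simp add: l scaleR_diff_right)
    have b: "norm ((1 / r) *\<^sub>R (deriv_eps tail_slot (s / r) (x j) - deriv_eps tail_slot (t / r) (x j))) \<le> 8 / r * \<bar>s / r - t / r\<bar> * B"
      if "s \<in> I" "norm (x j) \<le> B" for s j
    proof -
      have "norm (deriv_eps tail_slot (s / r) (x j) - deriv_eps tail_slot (t / r) (x j)) \<le> 8 * \<bar>s / r - t / r\<bar> * norm (x j)"
        by (rule deriv_eps_diff[of tail_slot, OF tail_slot_norm]) (use I[OF that(1)] I[OF t] r in \<open>simp_all add: divide_le_eq\<close>)
      also have "\<dots> \<le> 8 * \<bar>s / r - t / r\<bar> * B" using that(2) by (intro mult_left_mono) auto
      finally have "(1 / r) * norm (deriv_eps tail_slot (s / r) (x j) - deriv_eps tail_slot (t / r) (x j)) \<le> (1 / r) * (8 * \<bar>s / r - t / r\<bar> * B)"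
        using r by (intro mult_left_mono) auto
      then show ?thesis using r by simp
    qed
    have "0 \<le> norm_X \<alpha> (\<lambda>j w. ?v' s j w - ?v' t j w) \<and> norm_X \<alpha> (\<lambda>j w. ?v' s j w - ?v' t j w) \<le> 6 * (8 / r * \<bar>s / r - t / r\<bar> * B)" if "s \<in> I" for s
      unfolding eq using norm_X_tail_fun[OF \<alpha> b[OF that B(1)] b[OF that B(2)]] by blast
    then show "\<forall>\<^sub>F s in at t within I. 0 \<le> norm_X \<alpha> (\<lambda>j w. ?v' s j w - ?v' t j w)"
      "\<forall>\<^sub>F s in at t within I. norm_X \<alpha> (\<lambda>j w. ?v' s j w - ?v' t j w) \<le> 6 * (8 / r * \<bar>s / r - t / r\<bar> * B)"
      unfolding eventually_at_filter by (intro always_eventually allI impI, blast)+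
    have "((\<lambda>s. 6 * (8 / r * \<bar>s / r - t / r\<bar> * B)) \<longlongrightarrow> 6 * (8 / r * \<bar>t / r - t / r\<bar> * B)) (at t within I)" using r by (intro tendsto_intros) auto
    then show "((\<lambda>s. 6 * (8 / r * \<bar>s / r - t / r\<bar> * B)) \<longlongrightarrow> 0) (at t within I)" by simp
  qed simp
qed

section \<open>The branch of solutions\<close>

theorem proposition4p1:
  fixes \<alpha> d :: real and b \<gamma> :: "nat \<Rightarrow> real"
  assumes "0 < \<alpha>" and "\<alpha> < 1"
    and "0 < b 1" and "0 < b 2"
    and "d > 2 * (b 1 + b 2)"
    and "\<gamma> 1 + \<gamma> 2 \<noteq> 0"
    and "\<gamma> 1 \<noteq> 0" and "\<gamma> 2 \<noteq> 0"
  shows "\<exists>\<epsilon>\<^sub>0. 0 < \<epsilon>\<^sub>0 \<and> \<epsilon>\<^sub>0 < 1 / 2 \<and>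
    (\<exists>\<Omega> Z f.
      solution_branch \<alpha> b d \<gamma> \<epsilon>\<^sub>0 \<Omega> Z f \<and>
      (\<forall>\<Omega>' Z' f'. solution_branch \<alpha> b d \<gamma> \<epsilon>\<^sub>0 \<Omega>' Z' f' \<longrightarrow>
         (\<forall>\<epsilon>\<in>{-\<epsilon>\<^sub>0..\<epsilon>\<^sub>0}. \<Omega>' \<epsilon> = \<Omega> \<epsilon> \<and> Z' \<epsilon> = Z \<epsilon> \<and>
            (\<forall>j\<in>{1, 2}. \<forall>w\<in>circ. f' \<epsilon> j w = f \<epsilon> j w))) \<and>
      (\<forall>\<epsilon>\<in>{-\<epsilon>\<^sub>0..\<epsilon>\<^sub>0} - {0}. \<not> (\<forall>j\<in>{1, 2}. \<forall>w\<in>circ. f \<epsilon> j w = 0)) \<and>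
      (\<forall>\<epsilon>\<in>{-\<epsilon>\<^sub>0..\<epsilon>\<^sub>0} - {0}. \<forall>j\<in>{1, 2}.
         simple_path (boundary_param b \<epsilon> (f \<epsilon>) j \<circ> circlepath 0 1) \<and>
         strictly_convex_domain (inside (boundary_param b \<epsilon> (f \<epsilon>) j ` circ)))) \<and>
    (\<forall>\<epsilon>\<in>{-1/2<..<1/2}. \<forall>\<Omega> Z. \<forall>f\<in>ball_X \<alpha>. F_zero b d \<gamma> \<epsilon> \<Omega> Z f \<longrightarrow>
       (\<lambda>j w. f j (- w)) \<in> ball_X \<alpha> \<and> F_zero b d \<gamma> (- \<epsilon>) \<Omega> Z (\<lambda>j w. f j (- w)))"
proof -
  note \<alpha> = assms(1,2) and b = assms(3,4) and d = assms(5) and \<gamma>s = assms(6) and \<gamma> = assms(7,8)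
  have d0: "0 < d" using b d by simp
  define c where "c = (\<gamma> 1 + \<gamma> 2) / d\<^sup>2"
  have c0: "c \<noteq> 0" using \<gamma>s d0 by (simp add: c_def)
  \<comment> \<open>The bound 1/16 puts the functions into the unit ball and makes the boundary curves convex; the bound by \<open>c\<close>, the value
    of Q at 0, keeps Q away from zero.\<close>
  define \<rho> where "\<rho> = min (1/16) (\<bar>c\<bar> / 2)"
  have \<rho>: "0 < \<rho>" "\<rho> \<le> 1" "\<rho> \<le> 1/16" "\<rho> < \<bar>c\<bar>" using c0 by (auto simp: \<rho>_def)
  obtain r P Q u v Y where r: "0 < r" "r \<le> 1"
    and P: "P = (\<gamma> 2 / d) *\<^sub>R 1 + r *\<^sub>R first_mode (eps * remainder_ser b \<gamma> d r 1 P Q u v Y)"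
    and Q: "Q = ((\<gamma> 1 + \<gamma> 2) / d\<^sup>2) *\<^sub>R 1 + r *\<^sub>R ((1 / d) *\<^sub>R (first_mode (eps * remainder_ser b \<gamma> d r 1 P Q u v Y) + first_mode (eps * remainder_ser b \<gamma> d r 2 P Q u v Y)))"
    and uvY: "\<And>j. j \<in> {1, 2} \<Longrightarrow> nth_pair j u = r *\<^sub>R ((1 / \<gamma> j) *\<^sub>R high_modes (eps * remainder_ser b \<gamma> d r j P Q u v Y))"
      "\<And>j. j \<in> {1, 2} \<Longrightarrow> nth_pair j v = 1 - r *\<^sub>R (b j *\<^sub>R (eps * (quot (nth_pair j u) * nth_pair j v)))"
      "\<And>j. j \<in> {1, 2} \<Longrightarrow> nth_pair j Y = (1 / d) *\<^sub>R 1 + r *\<^sub>R ((1 / d) *\<^sub>R (eps * (denom_ser b r j u * nth_pair j Y)))"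
    and nQ: "norm (Q - ((\<gamma> 1 + \<gamma> 2) / d\<^sup>2) *\<^sub>R 1) \<le> \<rho>" and nu: "\<And>j. j \<in> {1, 2} \<Longrightarrow> norm (nth_pair j u) \<le> \<rho>"
    using existence_in_algebra[OF \<rho>(1,2), of \<gamma> d b] by blast
  have M: "0 \<le> norm P + norm Q" by simp
  obtain \<epsilon>1 where \<epsilon>1: "0 < \<epsilon>1" and uniq: "\<And>\<epsilon> \<Omega> Z f \<Omega>' Z' f'. \<bar>\<epsilon>\<bar> \<le> \<epsilon>1 \<Longrightarrow> f \<in> ball_X \<alpha> \<Longrightarrow> f' \<in> ball_X \<alpha> \<Longrightarrow>
      F_zero b d \<gamma> \<epsilon> \<Omega> Z f \<Longrightarrow> F_zero b d \<gamma> \<epsilon> \<Omega>' Z' f' \<Longrightarrow> \<bar>2 * \<Omega>'\<bar> \<le> norm P + norm Q \<Longrightarrow> \<bar>2 * \<Omega>' * Z'\<bar> \<le> norm P + norm Q \<Longrightarrow>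
      2 * \<Omega> = 2 * \<Omega>' \<and> 2 * \<Omega> * Z = 2 * \<Omega>' * Z' \<and> (\<forall>j\<in>{1, 2}. \<forall>w\<in>circ. f j w = f' j w)"
    using unique_zero[OF \<alpha>(1) b d0 \<gamma> M] by blast
  \<comment> \<open>The branch is differentiable for \<open>|\<epsilon>| \<le> r / 2\<close>, and \<open>|\<epsilon>| * b j \<le> 1\<close> is used for convexity.\<close>
  define \<epsilon>0 where "\<epsilon>0 = min (r / 2) (min \<epsilon>1 (min (1/4) (1 / (b 1 + b 2))))"
  have \<epsilon>0: "0 < \<epsilon>0" "\<epsilon>0 < 1/2" "\<epsilon>0 \<le> r / 2" "\<epsilon>0 \<le> \<epsilon>1" "\<epsilon>0 \<le> 1 / (b 1 + b 2)"
    using r \<epsilon>1 b by (auto simp: \<epsilon>0_def)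
  define I where "I = {-\<epsilon>0..\<epsilon>0}"
  have I: "\<bar>\<epsilon>\<bar> \<le> \<epsilon>0" if "\<epsilon> \<in> I" for \<epsilon> using that by (auto simp: I_def)
  have Ir: "\<bar>\<epsilon>\<bar> \<le> r / 2" if "\<epsilon> \<in> I" for \<epsilon> using I[OF that] \<epsilon>0 by linarith
  have e1: "\<bar>\<epsilon> / r\<bar> \<le> 1" if "\<epsilon> \<in> I" for \<epsilon> using Ir[OF that] r by (simp add: divide_le_eq)
  define \<Omega> where "\<Omega> \<epsilon> = const_at (\<epsilon> / r) Q / 2" for \<epsilon>
  define Z where "Z \<epsilon> = const_at (\<epsilon> / r) P / const_at (\<epsilon> / r) Q" for \<epsilon>
  define f where "f \<epsilon> j = tail_fun (tail_coeffs (\<epsilon> / r) (nth_pair j u))" for \<epsilon> j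
  have Qne: "const_at (\<epsilon> / r) Q \<noteq> 0" if "\<epsilon> \<in> I" for \<epsilon>
  proof
    assume z: "const_at (\<epsilon> / r) Q = 0"
    have "const_at (\<epsilon> / r) (Q - c *\<^sub>R 1) = - c"
      using z linear_simps(2,5)[OF const_at_linear[OF e1[OF that]]] by (simp add: const_at_one)
    then have "\<bar>c\<bar> \<le> norm (Q - c *\<^sub>R 1)" using eval_eps_bound[of const_slot "\<epsilon> / r" "Q - c *\<^sub>R 1", OF const_slot_norm e1[OF that]] by simp
    then show False using nQ \<rho>(4) by (simp add: c_def)
  qed
  have \<Omega>Z: "2 * \<Omega> \<epsilon> = const_at (\<epsilon> / r) Q" "2 * \<Omega> \<epsilon> * Z \<epsilon> = const_at (\<epsilon> / r) P" if "\<epsilon> \<in> I" for \<epsilon>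
    using Qne[OF that] by (simp_all add: \<Omega>_def Z_def)
  have \<Omega>Zb: "\<bar>2 * \<Omega> \<epsilon>\<bar> \<le> norm P + norm Q" "\<bar>2 * \<Omega> \<epsilon> * Z \<epsilon>\<bar> \<le> norm P + norm Q" if "\<epsilon> \<in> I" for \<epsilon>
  proof -
    have "\<bar>const_at (\<epsilon> / r) X\<bar> \<le> norm X" for X using eval_eps_bound[of const_slot "\<epsilon> / r" X, OF const_slot_norm e1[OF that]] by simp
    from this[of P] this[of Q] show "\<bar>2 * \<Omega> \<epsilon>\<bar> \<le> norm P + norm Q" "\<bar>2 * \<Omega> \<epsilon> * Z \<epsilon>\<bar> \<le> norm P + norm Q"
      unfolding \<Omega>Z(2)[OF that] unfolding \<Omega>Z(1)[OF that] using norm_ge_zero[of P] norm_ge_zero[of Q] by linarith+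
  qed
  have zero: "F_zero b d \<gamma> \<epsilon> (\<Omega> \<epsilon>) (Z \<epsilon>) (f \<epsilon>)" if "\<epsilon> \<in> I" for \<epsilon>
  proof -
    have "F_zero b d \<gamma> (r * (\<epsilon> / r)) (\<Omega> \<epsilon>) (Z \<epsilon>) (\<lambda>j. tail_fun (tail_coeffs (\<epsilon> / r) (nth_pair j u)))"
      using d0 by (intro F_zero_of_fixed_point[OF e1[OF that] _ \<gamma> P Q uvY \<Omega>Z[OF that]]) auto
    then show ?thesis using r by (simp add: f_def[abs_def])
  qed
  have sn: "norm (tail_coeffs (\<epsilon> / r) (nth_pair j u)) \<le> \<rho>" if "\<epsilon> \<in> I" "j \<in> {1, 2}" for \<epsilon> j
    using eval_eps_bound[of tail_slot "\<epsilon> / r" "nth_pair j u", OF tail_slot_norm e1[OF that(1)]] nu[OF that(2)] by linarith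
  have ball: "f \<epsilon> \<in> ball_X \<alpha>" if "\<epsilon> \<in> I" for \<epsilon>
  proof -
    have "norm_X \<alpha> (\<lambda>j. tail_fun (tail_coeffs (\<epsilon> / r) (nth_pair j u))) \<le> 6 * \<rho>"
      by (rule norm_X_tail_fun(1)[OF \<alpha>]; rule sn[OF that]; simp)
    then show ?thesis using tail_fun_space_X[OF \<alpha>, of "\<lambda>j. tail_coeffs (\<epsilon> / r) (nth_pair j u)"] \<rho>(3)
      by (simp add: ball_X_def f_def[abs_def])
  qed
  have branch: "solution_branch \<alpha> b d \<gamma> \<epsilon>0 \<Omega> Z f"
    unfolding solution_branch_def I_def[symmetric]
  proof (intro conjI)
    have D: "((\<lambda>t. const_at (t / r) X) has_real_derivative deriv_eps const_slot (t / r) X / r) (at t within I)" if "t \<in> I" for t X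
      using const_at_C1(1)[OF r(1) Ir that] by blast
    have C: "continuous_on I (\<lambda>t. deriv_eps const_slot (t / r) X / r)" for X
      using const_at_C1(2)[OF r(1) Ir] by blast
    have C0: "continuous_on I (\<lambda>t. const_at (t / r) X)" for X by (rule DERIV_continuous_on[OF D])
    show "C1_real I \<Omega>"
      unfolding C1_real_def \<Omega>_def
      by (rule exI[of _ "\<lambda>t. deriv_eps const_slot (t / r) Q / r / 2"]) (intro conjI ballI DERIV_cdivide D continuous_intros C, simp_all)
    show "C1_real I Z"
      unfolding C1_real_def Z_def
      by (rule exI[of _ "\<lambda>t. (deriv_eps const_slot (t / r) P / r * const_at (t / r) Q - const_at (t / r) P * (deriv_eps const_slot (t / r) Q / r)) / (const_at (t / r) Q * const_at (t / r) Q)"])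
        (intro conjI ballI DERIV_divide D continuous_intros C C0, auto simp: Qne)
    show "C1_X \<alpha> I f"
      unfolding f_def[abs_def] by (rule tail_fun_curve_C1[OF \<alpha> r(1) Ir])
    show "\<forall>\<epsilon>\<in>I. f \<epsilon> \<in> ball_X \<alpha> \<and> F_zero b d \<gamma> \<epsilon> (\<Omega> \<epsilon>) (Z \<epsilon>) (f \<epsilon>)" using ball zero by blast
    have 0: "\<bar>0::real\<bar> \<le> 1" by simp
    note l0 = linear_simps[OF const_at_linear[OF 0]]
    have P0: "const_at 0 P = \<gamma> 2 / d" using arg_cong[OF P, of "const_at 0"] by (simp add: l0 const_at_one vanish_at_zero[simplified])
    have Q0: "const_at 0 Q = (\<gamma> 1 + \<gamma> 2) / d\<^sup>2" using arg_cong[OF Q, of "const_at 0"] by (simp add: l0 const_at_one vanish_at_zero[simplified])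
    show "\<Omega> 0 = (\<gamma> 1 + \<gamma> 2) / (2 * d\<^sup>2)" by (simp add: \<Omega>_def Q0)
    show "Z 0 = d * \<gamma> 2 / (\<gamma> 1 + \<gamma> 2)" using d0 by (simp add: Z_def P0 Q0 power2_eq_square)
    show "\<forall>j\<in>{1, 2}. \<forall>w\<in>circ. f 0 j w = 0"
    proof (intro ballI)
      fix j :: nat and w assume j: "j \<in> {1, 2}" and "w \<in> circ"
      have "tail_coeffs 0 (nth_pair j u) = 0"
        by (subst uvY(1)[OF j]) (simp add: linear_simps(5)[OF tail_coeffs_linear[OF 0]] vanish_at_zero[simplified])
      then show "f 0 j w = 0" by (simp add: f_def linear_simps(3)[OF tail_fun_linear(1)])
    qed
  qed
  have unique: "\<Omega>' \<epsilon> = \<Omega> \<epsilon> \<and> Z' \<epsilon> = Z \<epsilon> \<and> (\<forall>j\<in>{1, 2}. \<forall>w\<in>circ. f' \<epsilon> j w = f \<epsilon> j w)"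
    if br: "solution_branch \<alpha> b d \<gamma> \<epsilon>0 \<Omega>' Z' f'" and e: "\<epsilon> \<in> I" for \<Omega>' Z' f' \<epsilon>
  proof -
    have f': "f' \<epsilon> \<in> ball_X \<alpha>" "F_zero b d \<gamma> \<epsilon> (\<Omega>' \<epsilon>) (Z' \<epsilon>) (f' \<epsilon>)"
      using br e unfolding solution_branch_def I_def by blast+
    have "\<bar>\<epsilon>\<bar> \<le> \<epsilon>1" using I[OF e] \<epsilon>0(4) by linarith
    then have *: "2 * \<Omega>' \<epsilon> = 2 * \<Omega> \<epsilon> \<and> 2 * \<Omega>' \<epsilon> * Z' \<epsilon> = 2 * \<Omega> \<epsilon> * Z \<epsilon> \<and> (\<forall>j\<in>{1, 2}. \<forall>w\<in>circ. f' \<epsilon> j w = f \<epsilon> j w)"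
      by (rule uniq[OF _ f'(1) ball[OF e] f'(2) zero[OF e] \<Omega>Zb[OF e]])
    moreover have "\<Omega> \<epsilon> \<noteq> 0" using Qne[OF e] by (simp add: \<Omega>_def)
    ultimately show ?thesis by auto
  qed
  have nontrivial: "\<not> (\<forall>j\<in>{1, 2}. \<forall>w\<in>circ. f \<epsilon> j w = 0)" if e: "\<epsilon> \<in> I" "\<epsilon> \<noteq> 0" for \<epsilon>
  proof
    assume z: "\<forall>j\<in>{1, 2}. \<forall>w\<in>circ. f \<epsilon> j w = 0"
    have "\<not> F_zero b d \<gamma> \<epsilon> (\<Omega> \<epsilon>) (Z \<epsilon>) (f \<epsilon>)"
    proof (rule trivial_not_zero[of b d \<gamma>, OF b d \<gamma>(2) _ e(2)])
      show "\<bar>\<epsilon>\<bar> < 1 / 2" using I[OF e(1)] \<epsilon>0(2) by linarith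
      show "f \<epsilon> j w = 0" if "j \<in> {1, 2}" "w \<in> circ" for j w by (rule z[rule_format, OF that])
    qed
    then show False using zero[OF e(1)] by blast
  qed
  have convex: "simple_path (boundary_param b \<epsilon> (f \<epsilon>) j \<circ> circlepath 0 1) \<and>
         strictly_convex_domain (inside (boundary_param b \<epsilon> (f \<epsilon>) j ` circ))" if e: "\<epsilon> \<in> I" and j: "j \<in> {1, 2}" for \<epsilon> j
  proof -
    define a where "a = tail_coeffs (\<epsilon> / r) (nth_pair j u)"
    have a: "norm a \<le> 1/16" using sn[OF e j] \<rho>(3) by (simp add: a_def)
    have "\<bar>\<epsilon>\<bar> * b j \<le> 1 / (b 1 + b 2) * (b 1 + b 2)"
      using I[OF e] \<epsilon>0(5) b j by (intro mult_mono) auto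
    then have \<eta>: "norm (complex_of_real \<epsilon> * of_real (b j)) \<le> 1"
      using b j by (auto simp: norm_mult)
    have bp: "boundary_param b \<epsilon> (f \<epsilon>) j = (\<lambda>w. w + of_real \<epsilon> * of_real (b j) * tail_fun a w)"
      by (simp add: boundary_param_def[abs_def] f_def a_def)
    have sm: "norm (of_real \<epsilon> * of_real (b j) * z) \<le> 1/8 * y" if "norm z \<le> norm a * y" "0 \<le> y" for z :: complex and y
    proof -
      have "norm (of_real \<epsilon> * of_real (b j) * z) \<le> 1 * (norm a * y)"
        unfolding norm_mult[of _ z] using \<eta> that by (intro mult_mono) auto
      also have "\<dots> \<le> 1/8 * y" using mult_right_mono[OF a that(2)] that(2) by simp
      finally show ?thesis .
    qed
    have cont: "continuous_on circ (\<lambda>w. w + of_real \<epsilon> * of_real (b j) * tail_fun a w)"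
      by (intro continuous_intros holder1_continuous[OF tail_fun_holder1(1)[OF \<alpha>]])
    have d1: "norm (1 + of_real \<epsilon> * of_real (b j) * tail_deriv a w - 1) \<le> 1/8" for w
      using sm[of "tail_deriv a w" 1] tail_fun_bound(2)[of a w] by simp
    have d2: "norm (\<tau> + of_real \<epsilon> * of_real (b j) * tail_fun a \<tau> - (w + of_real \<epsilon> * of_real (b j) * tail_fun a w)
        - (1 + of_real \<epsilon> * of_real (b j) * tail_deriv a w) * (\<tau> - w)) \<le> 1/8 * (norm (\<tau> - w))\<^sup>2" if "w \<in> circ" "\<tau> \<in> circ" for w \<tau>
    proof -
      have "\<tau> + of_real \<epsilon> * of_real (b j) * tail_fun a \<tau> - (w + of_real \<epsilon> * of_real (b j) * tail_fun a w) - (1 + of_real \<epsilon> * of_real (b j) * tail_deriv a w) * (\<tau> - w)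
         = of_real \<epsilon> * of_real (b j) * (tail_fun a \<tau> - tail_fun a w - tail_deriv a w * (\<tau> - w))" by (simp add: algebra_simps)
      then show ?thesis using sm[OF tail_fun_taylor(1)[OF that]] by simp
    qed
    show ?thesis
      unfolding bp using near_circle_convex[OF cont d1 d2] by blast
  qed
  show ?thesis
  proof (intro exI[of _ \<epsilon>0] conjI)
    show "\<exists>\<Omega> Z f. solution_branch \<alpha> b d \<gamma> \<epsilon>0 \<Omega> Z f \<and>
      (\<forall>\<Omega>' Z' f'. solution_branch \<alpha> b d \<gamma> \<epsilon>0 \<Omega>' Z' f' \<longrightarrow>
         (\<forall>\<epsilon>\<in>{-\<epsilon>0..\<epsilon>0}. \<Omega>' \<epsilon> = \<Omega> \<epsilon> \<and> Z' \<epsilon> = Z \<epsilon> \<and> (\<forall>j\<in>{1, 2}. \<forall>w\<in>circ. f' \<epsilon> j w = f \<epsilon> j w))) \<and>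
      (\<forall>\<epsilon>\<in>{-\<epsilon>0..\<epsilon>0} - {0}. \<not> (\<forall>j\<in>{1, 2}. \<forall>w\<in>circ. f \<epsilon> j w = 0)) \<and>
      (\<forall>\<epsilon>\<in>{-\<epsilon>0..\<epsilon>0} - {0}. \<forall>j\<in>{1, 2}. simple_path (boundary_param b \<epsilon> (f \<epsilon>) j \<circ> circlepath 0 1) \<and>
         strictly_convex_domain (inside (boundary_param b \<epsilon> (f \<epsilon>) j ` circ)))"
      unfolding I_def[symmetric]
      by (intro exI[of _ \<Omega>] exI[of _ Z] exI[of _ f] conjI allI impI ballI branch)
        (use unique nontrivial convex in blast)+
    show "\<forall>\<epsilon>\<in>{-1/2<..<1/2}. \<forall>\<Omega> Z. \<forall>f\<in>ball_X \<alpha>. F_zero b d \<gamma> \<epsilon> \<Omega> Z f \<longrightarrow>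
       (\<lambda>j w. f j (- w)) \<in> ball_X \<alpha> \<and> F_zero b d \<gamma> (- \<epsilon>) \<Omega> Z (\<lambda>j w. f j (- w))"
      using ball_X_reflect F_zero_reflect by blast
  qed (use \<epsilon>0 in auto)
qed

end
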